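(* Assume that the infinite moving average process $X_n=\sum_{i=-\infty}^\infty a_iZ_{n-i}$, $n\in\mathbb{Z}$ (with the noise $(Z_n)$ and its law $F_Z$ as specified in the context) has short memory, that is, $\sum_{n=-\infty}^\infty|a_n|<\infty$ and $\sum_{n=-\infty}^\infty a_n\neq 0$, and that $A=\sum_{n=-\infty}^\infty a_n>0$. Assume, further, that $\left|\int_{\mathbb{R}}e^{\mathrm{i}tz}\,F_Z(dz)\right|<1$ for every real $t\neq0$, where $\mathrm{i}=\sqrt{-1}$. For $\varepsilon$ with $0<\varepsilon/A<s_0$ let $$(D_\varepsilon^-,D_\varepsilon^+)=\left(\sum_{j=-\infty}^{-1}V_j(\varepsilon),\ \sum_{j=1}^\infty V_j(\varepsilon)\right),$$ with $V_j(\varepsilon)$ as defined in the context. Then $D^-_\varepsilon$ and $D^+_\varepsilon$ are a.s. finite for all $\varepsilon>0$ small enough. Further, as $\varepsilon\to0$, $$(\varepsilon^2D_\varepsilon^-,\varepsilon^2D_\varepsilon^+)\Rightarrow\left(A^2\sigma_Z^2\int_0^\infty\mathbf{1}\left(T_0\ge\sqrt2B^-_t+t\right)dt,\ A^2\sigma_Z^2\int_0^\infty\mathbf{1}\left(T_0\ge\sqrt2B^+_t+t\right)dt\right)$$ (weak convergence in $\mathbb{R}^2$), where $\sigma_Z^2=\int_{\mathbb{R}}z^2F_Z(dz)$, $T_0$ is a standard exponential random variable (the same in both components), and $T_0$ is independent of the two independent standard Brownian motions $(B^-_t:t\ge0)$ and $(B^+_t:t\ge0)$.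
   Context: Setting. $(Z_n:n\in\mathbb{Z})$ are i.i.d. non-degenerate real random variables with law $F_Z$ satisfying $\int_{\mathbb{R}}e^{tz}F_Z(dz)<\infty$ for all $t\in\mathbb{R}$ and $\int_{\mathbb{R}}z\,F_Z(dz)=0$. The coefficients $(a_j)_{j\in\mathbb{Z}}$ are real with $\sum_j a_j^2<\infty$, and $X_n=\sum_{i=-\infty}^\infty a_iZ_{n-i}$, $n\in\mathbb{Z}$ (convergence in $L^2$ and a.s.). Notation. $A=\sum_{n=-\infty}^\infty a_n$, $A^-=\sum_{n=-\infty}^{-1}a_n$, $A^+=\sum_{n=0}^\infty a_n$; for $n=0,1,2,\ldots$, $A_n^-=\sum_{j=1}^na_{-j}$ (so $A_0^-=0$) and $A_n^+=\sum_{j=0}^na_j$. $\varphi_Z(t)=\log\int_{\mathbb{R}}e^{tz}F_Z(dz)$. For $\theta\in\mathbb{R}$, $G_\theta$ is the probability measure $G_\theta(dx)=e^{-\varphi_Z(\theta)+\theta x}F_Z(dx)$. $s_0=\sup\{x\in\mathbb{R}:F_Z(x)<1\}\in(0,\infty]$, where $F_Z(x)$ denotes the distribution function, is the right endpoint of the support of the noise. For $0<\varepsilon/A<s_0$, $\tau(\varepsilon)>0$ is the unique solution of $\varphi_Z'(\tau(\varepsilon))=\varepsilon/A$ ($\varphi_Z'$ increases strictly from $0$ at $t=0$ to $s_0$ as $t\to\infty$). For each such $\varepsilon$, $\{Z_j^u:j\in\mathbb{Z},\,u\in\{+,-\}\}$ is a collection of independent random variables (depending on $\varepsilon$) with laws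 $$Z^-_{-j}\sim G_{\tau(\varepsilon)(A^+-A^+_{j-1})/A}\ (j\ge1),\qquad Z^-_j\sim G_{\tau(\varepsilon)(A^++A^-_j)/A}\ (j\ge0),$$ $$Z^+_{-j}\sim G_{\tau(\varepsilon)(A^+_{j-1}+A^-)/A}\ (j\ge1),\qquad Z^+_j\sim G_{\tau(\varepsilon)(A^--A^-_j)/A}\ (j\ge0).$$ $T^*$ is an exponential random variable with parameter (rate) $\tau(\varepsilon)/A$, independent of this family. $U^\pm_n=\sum_{i=-\infty}^\infty a_iZ^\pm_{n-i}$, $n\in\mathbb{Z}$ (the series converge in $L^1$ and a.s.). Finally $$V_j(\varepsilon)=\mathbf{1}\Bigl(T^*\ge\sum_{i=0}^{j-1}(U_i^--U_i^+)\Bigr)\ (j\ge1),\qquad V_j(\varepsilon)=\mathbf{1}\Bigl(T^*\ge\sum_{i=j}^{-1}(U_i^+-U_i^-)\Bigr)\ (j<0).$$ *)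

theory Defs
  imports "HOL-Probability.Probability"
begin

subsection \<open>Independence, weak convergence and Brownian motion\<close>

text \<open>The library constant \<open>indep_var\<close> only covers two random variables with the same value type.\<close>

definition independent_rvs ::
    "'a measure \<Rightarrow> 'b measure \<Rightarrow> ('a \<Rightarrow> 'b) \<Rightarrow> 'c measure \<Rightarrow> ('a \<Rightarrow> 'c) \<Rightarrow> bool" where
  "independent_rvs M S X S' Y \<longleftrightarrow>
     X \<in> measurable M S \<and> Y \<in> measurable M S' \<and>
     prob_space.indep_set M {X -` A \<inter> space M | A. A \<in> sets S}
                            {Y -` A \<inter> space M | A. A \<in> sets S'}"

definition weakly_converges ::
    "('i \<Rightarrow> 'b::topological_space measure) \<Rightarrow> 'b measure \<Rightarrow> 'i filter \<Rightarrow> bool" where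
  "weakly_converges \<mu> \<nu> \<F> \<longleftrightarrow>
     (\<forall>f :: 'b \<Rightarrow> real. continuous_on UNIV f \<longrightarrow> bounded (range f) \<longrightarrow>
        ((\<lambda>i. \<integral>x. f x \<partial>(\<mu> i)) \<longlongrightarrow> (\<integral>x. f x \<partial>\<nu>)) \<F>)"

text \<open>Every path is required to be continuous. With almost surely continuous paths on an
  incomplete space, the occupation times below need not be measurable.\<close>

definition standard_brownian_motion :: "'a measure \<Rightarrow> (real \<Rightarrow> 'a \<Rightarrow> real) \<Rightarrow> bool" where
  "standard_brownian_motion M B \<longleftrightarrow>
     prob_space M \<and>
     (\<forall>t\<ge>0. B t \<in> borel_measurable M) \<and>
     (AE \<omega> in M. B 0 \<omega> = 0) \<and>
     (\<forall>\<omega>\<in>space M. continuous_on {0..} (\<lambda>t. B t \<omega>)) \<and>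
     (\<forall>s t. 0 \<le> s \<longrightarrow> s < t \<longrightarrow>
        distributed M lborel (\<lambda>\<omega>. B t \<omega> - B s \<omega>) (normal_density 0 (sqrt (t - s)))) \<and>
     (\<forall>(n::nat) ts. 0 \<le> ts 0 \<longrightarrow> (\<forall>i<n. ts i < ts (Suc i)) \<longrightarrow>
        prob_space.indep_vars M (\<lambda>_. borel) (\<lambda>i \<omega>. B (ts (Suc i)) \<omega> - B (ts i) \<omega>) {..<n})"

definition sample_path :: "(real \<Rightarrow> 'a \<Rightarrow> real) \<Rightarrow> 'a \<Rightarrow> real \<Rightarrow> real" where
  "sample_path B \<omega> = (\<lambda>t\<in>{0..}. B t \<omega>)"

abbreviation path_space :: "(real \<Rightarrow> real) measure" where
  "path_space \<equiv> \<Pi>\<^sub>M t\<in>{0..}. borel"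

definition occupation_time :: "('a \<Rightarrow> real) \<Rightarrow> (real \<Rightarrow> 'a \<Rightarrow> real) \<Rightarrow> 'a \<Rightarrow> real" where
  "occupation_time T B \<omega> =
     (LINT t:{0..}|lborel. of_bool (T \<omega> \<ge> sqrt 2 * B t \<omega> + t))"

subsection \<open>Noise law and exponential tilting\<close>

definition iid_with_law :: "'a measure \<Rightarrow> (int \<Rightarrow> 'a \<Rightarrow> real) \<Rightarrow> real measure \<Rightarrow> bool" where
  "iid_with_law P Z F \<longleftrightarrow>
     prob_space P \<and> prob_space.indep_vars P (\<lambda>_. borel) Z UNIV \<and>
     (\<forall>n. distr P borel (Z n) = F)"

definition log_mgf :: "real measure \<Rightarrow> real \<Rightarrow> real" where
  "log_mgf F t = ln (\<integral>z. exp (t * z) \<partial>F)"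

definition tilted :: "real measure \<Rightarrow> real \<Rightarrow> real measure" where
  "tilted F \<theta> = density F (\<lambda>x. ennreal (exp (- log_mgf F \<theta> + \<theta> * x)))"

definition right_endpoint :: "real measure \<Rightarrow> ereal" where
  "right_endpoint F = (SUP x\<in>{x. cdf F x < 1}. ereal x)"

subsection \<open>Moving averages\<close>

definition moving_average :: "(int \<Rightarrow> real) \<Rightarrow> (int \<Rightarrow> 'a \<Rightarrow> real) \<Rightarrow> int \<Rightarrow> 'a \<Rightarrow> real" where
  "moving_average a Z n \<omega> = (\<Sum>\<^sub>\<infinity>i\<in>UNIV. a i * Z (n - i) \<omega>)"

definition coeff_sum :: "(int \<Rightarrow> real) \<Rightarrow> real" where
  "coeff_sum a = (\<Sum>\<^sub>\<infinity>n\<in>UNIV. a n)"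

definition coeff_sum_neg :: "(int \<Rightarrow> real) \<Rightarrow> real" where
  "coeff_sum_neg a = (\<Sum>\<^sub>\<infinity>n\<in>{..-1}. a n)"

definition coeff_sum_nonneg :: "(int \<Rightarrow> real) \<Rightarrow> real" where
  "coeff_sum_nonneg a = (\<Sum>\<^sub>\<infinity>n\<in>{0..}. a n)"

definition partial_sum_neg :: "(int \<Rightarrow> real) \<Rightarrow> nat \<Rightarrow> real" where
  "partial_sum_neg a n = (\<Sum>j=1..n. a (- int j))"

definition partial_sum_nonneg :: "(int \<Rightarrow> real) \<Rightarrow> nat \<Rightarrow> real" where
  "partial_sum_nonneg a n = (\<Sum>j=0..n. a (int j))"

definition short_memory :: "(int \<Rightarrow> real) \<Rightarrow> bool" where
  "short_memory a \<longleftrightarrow> (\<lambda>n. \<bar>a n\<bar>) summable_on UNIV \<and> coeff_sum a \<noteq> 0"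

definition tilt :: "real measure \<Rightarrow> (int \<Rightarrow> real) \<Rightarrow> real \<Rightarrow> real" where
  "tilt F a \<epsilon> = (THE t. t > 0 \<and> deriv (log_mgf F) t = \<epsilon> / coeff_sum a)"

subsection \<open>The tilted noise and the cluster\<close>

datatype sign = Minus | Plus

definition tilted_noise ::
    "real measure \<Rightarrow> (int \<Rightarrow> real) \<Rightarrow> real \<Rightarrow> 'a measure \<Rightarrow>
     (sign \<Rightarrow> int \<Rightarrow> 'a \<Rightarrow> real) \<Rightarrow> ('a \<Rightarrow> real) \<Rightarrow> bool" where
  "tilted_noise F a \<epsilon> M Z T \<longleftrightarrow>
     (let \<tau> = tilt F a \<epsilon>; A = coeff_sum a; Aneg = coeff_sum_neg a; Apos = coeff_sum_nonneg a in
      prob_space M \<and>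
      prob_space.indep_vars M (\<lambda>_. borel) (\<lambda>(j, u). Z u j) UNIV \<and>
      (\<forall>j\<ge>1. distr M borel (Z Minus (- int j)) =
                 tilted F (\<tau> * (Apos - partial_sum_nonneg a (j - 1)) / A)) \<and>
      (\<forall>j. distr M borel (Z Minus (int j)) =
                 tilted F (\<tau> * (Apos + partial_sum_neg a j) / A)) \<and>
      (\<forall>j\<ge>1. distr M borel (Z Plus (- int j)) =
                 tilted F (\<tau> * (partial_sum_nonneg a (j - 1) + Aneg) / A)) \<and>
      (\<forall>j. distr M borel (Z Plus (int j)) =
                 tilted F (\<tau> * (Aneg - partial_sum_neg a j) / A)) \<and>
      distributed M lborel T (exponential_density (\<tau> / A)) \<and>
      independent_rvs M borel T
        (\<Pi>\<^sub>M k\<in>(UNIV :: (int \<times> sign) set). borel) (\<lambda>\<omega> (j, u). Z u j \<omega>))"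

text \<open>The index \<open>j = 0\<close> is never used.\<close>

definition cluster_indicator ::
    "(int \<Rightarrow> real) \<Rightarrow> (sign \<Rightarrow> int \<Rightarrow> 'a \<Rightarrow> real) \<Rightarrow> ('a \<Rightarrow> real) \<Rightarrow> int \<Rightarrow> 'a \<Rightarrow> ennreal" where
  "cluster_indicator a Z T j \<omega> =
     (let U = (\<lambda>u n. moving_average a (Z u) n \<omega>) in
      if j \<ge> 1 then of_bool (T \<omega> \<ge> (\<Sum>i\<in>{0..j - 1}. U Minus i - U Plus i))
      else of_bool (T \<omega> \<ge> (\<Sum>i\<in>{j..-1}. U Plus i - U Minus i)))"

definition cluster_size ::
    "(int \<Rightarrow> real) \<Rightarrow> (sign \<Rightarrow> int \<Rightarrow> 'a \<Rightarrow> real) \<Rightarrow> ('a \<Rightarrow> real) \<Rightarrow> sign \<Rightarrow> 'a \<Rightarrow> ennreal" where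
  "cluster_size a Z T u \<omega> =
     (case u of
        Minus \<Rightarrow> (\<Sum>\<^sub>\<infinity>j\<in>{..-1}. cluster_indicator a Z T j \<omega>)
      | Plus \<Rightarrow> (\<Sum>\<^sub>\<infinity>j\<in>{1..}. cluster_indicator a Z T j \<omega>))"

end

theory Submission
  imports Defs "HOL-Real_Asymp.Real_Asymp"
begin

text \<open>
  Put \<open>\<tau> = \<tau>(\<epsilon>)\<close>, so that \<open>\<tau>\<close> is asymptotic to \<open>\<epsilon> / (A \<sigma>\<^sup>2)\<close>, and multiply both \<open>T\<^sup>*\<close> and the two walks
  \<open>\<Sum>i<n. U\<^sup>-\<^sub>i - U\<^sup>+\<^sub>i\<close> by \<open>\<tau> / A\<close>. Then \<open>\<tau> T\<^sup>* / A\<close> is standard exponential. With one step of a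
  walk lasting time \<open>\<epsilon>\<^sup>2 / (A \<sigma>)\<^sup>2\<close>, the rescaled cluster sizes are exactly the amounts of time for
  which the rescaled walks stay below \<open>\<tau> T\<^sup>* / A\<close>.

  By absolute summability of the coefficients, a walk is close in \<open>L\<^sup>1\<close> to \<open>A\<close> times the sum of the
  independent variables \<open>Z\<^sup>-\<^sub>k - Z\<^sup>+\<^sub>k\<close>, \<open>0 \<le> k < n\<close>, and in these the tilting produces means close to
  \<open>\<tau> \<sigma>\<^sup>2\<close> and variances close to \<open>2 \<sigma>\<^sup>2\<close>. Hence the increments of the rescaled walks converge jointly to
  those of \<open>\<surd>2 B\<^sub>t + t\<close>, by the central limit theorem for triangular arrays. Since the exponential
  variable has a bounded density, the probabilities that both walks lie below it at finitely many
  prescribed times converge as well.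

  By Fubini, mixed moments of the occupation times of \<open>[0, K]\<close> are integrals of such probabilities,
  so they converge, and the Stone--Weierstrass theorem gives weak convergence for the truncated
  occupation times. A Chernoff bound shows that the walks lie below the exponential variable at
  time \<open>t\<close> with probability at most \<open>C exp (- c t)\<close> uniformly in \<open>\<epsilon>\<close>; this gives finiteness and
  removes the truncation.
\<close>

section \<open>Exponentially tilted laws\<close>

text \<open>The coefficients are only summable, so no rate controls the dependence between steps,
  and the noise before time 0 and after time n enters n steps with an error that need not stay
  bounded. It is o(n), however: at most \<open>e * n + C\<close> for every \<open>e > 0\<close>.
  This is just enough, because the errors are weighted by \<tau>^2, and \<tau>^2 n stays bounded on
  the time scale of the limit. Bounds of the form \<open>e * n + C\<close> therefore recur for
  coefficients and means. The unit of time is what makes the drift 1: a step adds mean \<tau>^2 s2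
  and variance 2 \<tau>^2 s2 to a rescaled walk, up to smaller terms, and \<tau>^2 s2 is asymptotic
  to the duration of a step. An occupation time is not a continuous functional of the path, but its
  moments involve only finitely many times, so finite-dimensional convergence suffices. As every
  \<epsilon> has its own probability space, constants are fixed before the space, and limits are
  taken along sequences of laws.\<close>

lemma abs_exp_diff_le: "\<bar>exp x - 1 - x\<bar> \<le> x\<^sup>2 * exp \<bar>x :: real\<bar>"
proof -
  \<comment> \<open>Both halves rest on \<open>1 + y \<le> exp y\<close>: at \<open>y = - x\<close>
    it gives this bound, at \<open>y = x\<close> the next one. Together they squeeze
    \<open>exp x - 1\<close> between \<open>x\<close> and \<open>x * exp x\<close>.\<close>
  have 1: "exp x - 1 \<le> x * exp x"
  proof -
    have "(1 - x) * exp x \<le> exp (- x) * exp x"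
      using exp_ge_add_one_self[of "- x"] by (intro mult_right_mono) auto
    then show ?thesis by (simp add: exp_minus field_simps)
  qed
  have 2: "1 + x \<le> exp x" by (rule exp_ge_add_one_self)
  have "exp x - 1 - x \<le> x\<^sup>2 * exp \<bar>x\<bar>"
  proof (cases "x \<ge> 0")
    case True
    have "exp x - 1 - x \<le> x * (exp x - 1)" using 1 by (simp add: algebra_simps)
    also have "\<dots> \<le> x * (x * exp x)" using 1 True by (intro mult_left_mono) auto
    finally show ?thesis using True by (simp add: power2_eq_square mult_ac)
  next
    case False
    have "exp x - 1 - x \<le> (- x) * (1 - exp x)" using 1 by (simp add: algebra_simps)
    also have "\<dots> \<le> (- x) * (- x)" using 2 False by (intro mult_left_mono; linarith)
    also have "\<dots> \<le> x\<^sup>2 * exp \<bar>x\<bar>"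
      using mult_left_mono[of 1 "exp \<bar>x\<bar>" "x\<^sup>2"] by (simp add: power2_eq_square)
    finally show ?thesis .
  qed
  then show ?thesis using 2 by linarith
qed

text \<open>A single term of the exponential series is at most its sum. This trades any power for an
  exponential at the cost of a constant.\<close>

lemma power_le_fact_exp: "x \<ge> 0 \<Longrightarrow> x ^ p \<le> fact p * exp (x :: real)"
proof -
  assume x: "x \<ge> 0"
  have "(\<Sum>n\<in>{p}. x ^ n /\<^sub>R fact n) \<le> (\<Sum>n. x ^ n /\<^sub>R fact n)"
    using x by (intro sum_le_suminf summable_exp_generic) auto
  then show ?thesis by (simp add: exp_def field_simps)
qed

locale noise_law = real_distribution F for F +
  assumes exp_moments: "\<And>t. integrable F (\<lambda>z. exp (t * z))"
    and mean_zero: "(\<integral>z. z \<partial>F) = 0"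
    and nondegenerate: "\<And>c. F \<noteq> return borel c"
begin

lemma integrable_exp_abs: "integrable F (\<lambda>z. exp (r * \<bar>z\<bar>))"
proof (rule Bochner_Integration.integrable_bound)
  show "integrable F (\<lambda>z. exp (r * z) + exp ((- r) * z))"
    using exp_moments by (intro Bochner_Integration.integrable_add)
  show "AE z in F. norm (exp (r * \<bar>z\<bar>)) \<le> norm (exp (r * z) + exp ((- r) * z))"
  proof (intro AE_I2)
    fix z :: real
    have "exp (r * \<bar>z\<bar>) \<le> exp (r * z) + exp ((- r) * z)"
      by (cases "z \<ge> 0") (simp_all add: add_increasing add_increasing2)
    then show "norm (exp (r * \<bar>z\<bar>)) \<le> norm (exp (r * z) + exp ((- r) * z))"
      using abs_ge_self[of "exp (r * z) + exp ((- r) * z)"] by simp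
  qed
qed measurable

lemma integrable_abs_power_exp: "integrable F (\<lambda>z. \<bar>z\<bar> ^ p * exp (r * \<bar>z\<bar>))"
proof (rule Bochner_Integration.integrable_bound)
  show "integrable F (\<lambda>z. fact p * exp ((r + 1) * \<bar>z\<bar>))"
    by (intro integrable_mult_right integrable_exp_abs)
  show "AE z in F. norm (\<bar>z\<bar> ^ p * exp (r * \<bar>z\<bar>)) \<le> norm (fact p * exp ((r + 1) * \<bar>z\<bar>))"
  proof (intro AE_I2)
    fix z :: real
    have "\<bar>z\<bar> ^ p * exp (r * \<bar>z\<bar>) \<le> fact p * exp \<bar>z\<bar> * exp (r * \<bar>z\<bar>)"
      by (intro mult_right_mono power_le_fact_exp) auto
    also have "\<dots> = fact p * exp ((r + 1) * \<bar>z\<bar>)" by (simp add: exp_add distrib_right)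
    finally show "norm (\<bar>z\<bar> ^ p * exp (r * \<bar>z\<bar>)) \<le> norm (fact p * exp ((r + 1) * \<bar>z\<bar>))" by simp
  qed
qed measurable

text \<open>By \<open>mom_deriv\<close> this is the p-th derivative of the moment generating
  function \<open>mom 0\<close>.\<close>

definition mom :: "nat \<Rightarrow> real \<Rightarrow> real" where
  "mom p t = (\<integral>z. z ^ p * exp (t * z) \<partial>F)"

lemma integrable_mom: "integrable F (\<lambda>z. z ^ p * exp (t * z))"
proof (rule Bochner_Integration.integrable_bound[OF integrable_abs_power_exp[of p "\<bar>t\<bar>"]])
  show "AE z in F. norm (z ^ p * exp (t * z)) \<le> norm (\<bar>z\<bar> ^ p * exp (\<bar>t\<bar> * \<bar>z\<bar>))"
  proof (intro AE_I2)
    fix z :: real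
    have "t * z \<le> \<bar>t\<bar> * \<bar>z\<bar>" using abs_ge_self[of "t * z"] by (simp only: abs_mult)
    then have "\<bar>z ^ p\<bar> * exp (t * z) \<le> \<bar>z ^ p\<bar> * exp (\<bar>t\<bar> * \<bar>z\<bar>)"
      by (intro mult_left_mono) auto
    then show "norm (z ^ p * exp (t * z)) \<le> norm (\<bar>z\<bar> ^ p * exp (\<bar>t\<bar> * \<bar>z\<bar>))"
      by (simp add: abs_mult power_abs)
  qed
qed measurable

text \<open>Differentiation under the integral with a rate: for \<bar>h\<bar> < 1 the second-order
  remainder is at most h^2 times one integrable function, so the difference quotient misses its
  limit by at most \<open>C * \<bar>h\<bar>\<close>.\<close>

lemma mom_deriv: "(mom p has_real_derivative mom (Suc p) t) (at t)"
proof -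
  define C where "C = (\<integral>z. \<bar>z\<bar> ^ (p + 2) * exp ((\<bar>t\<bar> + 1) * \<bar>z\<bar>) \<partial>F)"
  have bound: "\<bar>(mom p (t + h) - mom p t) / h - mom (Suc p) t\<bar> \<le> C * \<bar>h\<bar>" if h: "h \<noteq> 0" "\<bar>h\<bar> < 1" for h
  proof -
    have "\<bar>mom p (t + h) - mom p t - h * mom (Suc p) t\<bar>
       = \<bar>\<integral>z. z ^ p * exp ((t + h) * z) - z ^ p * exp (t * z) - h * (z ^ Suc p * exp (t * z)) \<partial>F\<bar>"
      unfolding mom_def using integrable_mom by (simp del: power_Suc)
    also have "\<dots> \<le> (\<integral>z. \<bar>z ^ p * exp ((t + h) * z) - z ^ p * exp (t * z) - h * (z ^ Suc p * exp (t * z))\<bar> \<partial>F)"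
      by (rule integral_abs_bound)
    also have "\<dots> \<le> (\<integral>z. h\<^sup>2 * (\<bar>z\<bar> ^ (p + 2) * exp ((\<bar>t\<bar> + 1) * \<bar>z\<bar>)) \<partial>F)"
    proof (intro integral_mono)
      fix z :: real
      have "z ^ p * exp ((t + h) * z) - z ^ p * exp (t * z) - h * (z ^ Suc p * exp (t * z))
          = z ^ p * exp (t * z) * (exp (h * z) - 1 - h * z)"
        by (simp add: exp_add algebra_simps)
      then have "\<bar>z ^ p * exp ((t + h) * z) - z ^ p * exp (t * z) - h * (z ^ Suc p * exp (t * z))\<bar>
          = \<bar>z\<bar> ^ p * exp (t * z) * \<bar>exp (h * z) - 1 - h * z\<bar>"
        by (simp only: abs_mult power_abs abs_exp_cancel)
      also have "\<dots> \<le> \<bar>z\<bar> ^ p * exp (\<bar>t\<bar> * \<bar>z\<bar>) * ((h * z)\<^sup>2 * exp (1 * \<bar>z\<bar>))"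
      proof (intro mult_mono mult_left_mono)
        have "\<bar>exp (h * z) - 1 - h * z\<bar> \<le> (h * z)\<^sup>2 * exp \<bar>h * z\<bar>" by (rule abs_exp_diff_le)
        also have "\<dots> \<le> (h * z)\<^sup>2 * exp (1 * \<bar>z\<bar>)"
          using h by (intro mult_left_mono) (auto simp: abs_mult intro!: mult_right_mono mult_left_le_one_le)
        finally show "\<bar>exp (h * z) - 1 - h * z\<bar> \<le> (h * z)\<^sup>2 * exp (1 * \<bar>z\<bar>)" .
        show "exp (t * z) \<le> exp (\<bar>t\<bar> * \<bar>z\<bar>)" using abs_ge_self[of "t * z"] by (simp only: abs_mult exp_le_cancel_iff)
      qed auto
      also have "\<dots> = h\<^sup>2 * (\<bar>z\<bar> ^ (p + 2) * exp ((\<bar>t\<bar> + 1) * \<bar>z\<bar>))"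
      proof -
        have "exp ((\<bar>t\<bar> + 1) * \<bar>z\<bar>) = exp (\<bar>t\<bar> * \<bar>z\<bar>) * exp (1 * \<bar>z\<bar>)"
          by (simp only: exp_add distrib_right)
        moreover have "\<bar>z\<bar> ^ (p + 2) = \<bar>z\<bar> ^ p * z\<^sup>2" by (simp only: power_add power2_abs)
        ultimately show ?thesis by (simp only: power_mult_distrib mult_ac)
      qed
      finally show "\<bar>z ^ p * exp ((t + h) * z) - z ^ p * exp (t * z) - h * (z ^ Suc p * exp (t * z))\<bar>
          \<le> h\<^sup>2 * (\<bar>z\<bar> ^ (p + 2) * exp ((\<bar>t\<bar> + 1) * \<bar>z\<bar>))" .
    qed (intro integrable_mom integrable_abs_power_exp Bochner_Integration.integrable_diff
           integrable_mult_right integrable_abs)+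
    also have "\<dots> = h\<^sup>2 * C" by (simp add: C_def)
    finally have "\<bar>mom p (t + h) - mom p t - h * mom (Suc p) t\<bar> / \<bar>h\<bar> \<le> h\<^sup>2 * C / \<bar>h\<bar>"
      by (intro divide_right_mono) auto
    also have "h\<^sup>2 * C / \<bar>h\<bar> = C * \<bar>h\<bar>"
    proof -
      have "x * x * C / x = C * x" if "x \<noteq> 0" for x :: real using that by simp
      from this[of "\<bar>h\<bar>"] show ?thesis using h by (simp add: power2_eq_square)
    qed
    also have "\<bar>mom p (t + h) - mom p t - h * mom (Suc p) t\<bar> / \<bar>h\<bar> = \<bar>(mom p (t + h) - mom p t) / h - mom (Suc p) t\<bar>"
      unfolding abs_divide[symmetric] using h by (simp add: diff_divide_distrib)
    finally show ?thesis .
  qed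
  have "((\<lambda>h. (mom p (t + h) - mom p t) / h) \<longlongrightarrow> mom (Suc p) t) (at 0)"
  proof (rule LIM_zero_cancel, rule Lim_null_comparison)
    show "\<forall>\<^sub>F h in at 0. norm ((mom p (t + h) - mom p t) / h - mom (Suc p) t) \<le> C * \<bar>h\<bar>"
      using bound by (auto simp: eventually_at intro!: exI[of _ 1])
    show "((\<lambda>h. C * \<bar>h\<bar>) \<longlongrightarrow> 0) (at 0)"
      by (auto intro!: tendsto_eq_intros)
  qed
  then show ?thesis by (simp add: DERIV_def)
qed

lemma mom_cont [continuous_intros]: "continuous_on S (mom p)"
  by (meson DERIV_continuous_on mom_deriv has_field_derivative_at_within)

lemma mom_0_0 [simp]: "mom 0 0 = 1" using prob_space by (simp add: mom_def)
lemma mom_1_0 [simp]: "mom (Suc 0) 0 = 0" by (simp add: mom_def mean_zero)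

text \<open>Integrate \<open>1 + t * z \<le> exp (t * z)\<close> and use the vanishing mean.
  Dividing a nonnegative bound by \<open>mom 0 t\<close> therefore never enlarges it.\<close>

lemma mom_0_ge_1: "mom 0 t \<ge> 1"
proof -
  have iz: "integrable F (\<lambda>z. z)" using integrable_mom[of 1 0] by simp
  have "1 = (\<integral>z. 1 + t * z \<partial>F)" using iz prob_space by (simp add: mean_zero)
  also have "\<dots> \<le> (\<integral>z. exp (t * z) \<partial>F)"
    using iz exp_moments by (intro integral_mono) auto
  finally show ?thesis by (simp add: mom_def)
qed

lemma mom_0_pos [simp]: "mom 0 t > 0" using mom_0_ge_1[of t] by linarith

lemma mom_0_nonzero [simp]: "mom 0 t \<noteq> 0" using mom_0_pos[of t] by linarith

text \<open>Mean and variance of \<open>tilted F t\<close>, and at the same time the first two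
  derivatives of \<open>log_mgf F\<close>; see \<open>tilted_mean\<close>,
  \<open>tilted_square\<close>, \<open>log_mgf_deriv\<close> and \<open>tmean_deriv\<close>.\<close>

definition tmean :: "real \<Rightarrow> real" where "tmean t = mom 1 t / mom 0 t"
definition tvar :: "real \<Rightarrow> real" where "tvar t = mom 2 t / mom 0 t - (tmean t)\<^sup>2"

lemma tilted_density: "exp (- log_mgf F \<theta> + \<theta> * x) = exp (\<theta> * x) / mom 0 \<theta>"
proof -
  have "log_mgf F \<theta> = ln (mom 0 \<theta>)" by (simp add: log_mgf_def mom_def)
  then show ?thesis by (simp add: exp_diff)
qed

lemma integrable_tilted_iff:
  "g \<in> borel_measurable borel \<Longrightarrow>
   integrable (tilted F \<theta>) g \<longleftrightarrow> integrable F (\<lambda>x. exp (\<theta> * x) / mom 0 \<theta> * g x :: real)"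
  unfolding tilted_def tilted_density
  by (subst integrable_density) (auto intro!: less_imp_le divide_pos_pos)

lemma integral_tilted:
  assumes "g \<in> borel_measurable borel"
  shows "(\<integral>x. g x \<partial>tilted F \<theta>) = (\<integral>x. exp (\<theta> * x) * g x \<partial>F) / mom 0 \<theta>"
proof -
  have "(\<integral>x. g x \<partial>tilted F \<theta>) = (\<integral>x. exp (\<theta> * x) / mom 0 \<theta> * g x \<partial>F)"
    unfolding tilted_def tilted_density using assms
    by (subst integral_density) (auto intro!: less_imp_le divide_pos_pos)
  then show ?thesis by simp
qed

lemma tilted_mean: "(\<integral>x. x \<partial>tilted F \<theta>) = tmean \<theta>"
  by (subst integral_tilted) (auto simp: tmean_def mom_def mult.commute)

lemma tilted_square: "(\<integral>x. x\<^sup>2 \<partial>tilted F \<theta>) = tvar \<theta> + (tmean \<theta>)\<^sup>2"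
  by (subst integral_tilted) (auto simp: tvar_def mom_def mult.commute)

text \<open>The exponent 3 splits as 2 + 1: the moments of the tilted laws are taken at exponent 2,
  and a tilt of size at most 1 costs the remaining 1.\<close>

definition exp_bound :: real where "exp_bound = (\<integral>z. exp (3 * \<bar>z\<bar>) \<partial>F)"

lemma tilted_exp_abs:
  assumes \<theta>: "\<bar>\<theta>\<bar> \<le> 1"
  shows "integrable (tilted F \<theta>) (\<lambda>x. exp (2 * \<bar>x\<bar>))"
    and "(\<integral>x. exp (2 * \<bar>x\<bar>) \<partial>tilted F \<theta>) \<le> exp_bound"
proof -
  have le: "exp (\<theta> * x) * exp (2 * \<bar>x\<bar>) \<le> exp (3 * \<bar>x\<bar>)" for x :: real
  proof -
    have "\<theta> * x \<le> \<bar>\<theta>\<bar> * \<bar>x\<bar>" by (simp add: abs_mult[symmetric])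
    also have "\<dots> \<le> 1 * \<bar>x\<bar>" using \<theta> by (intro mult_right_mono) auto
    finally show ?thesis by (simp add: exp_add[symmetric])
  qed
  have i: "integrable F (\<lambda>x. exp (\<theta> * x) * exp (2 * \<bar>x\<bar>))"
    by (rule Bochner_Integration.integrable_bound[OF integrable_exp_abs[of 3]]) (use le in auto)
  show "integrable (tilted F \<theta>) (\<lambda>x. exp (2 * \<bar>x\<bar>))"
    using i by (subst integrable_tilted_iff) auto
  have "(\<integral>x. exp (\<theta> * x) * exp (2 * \<bar>x\<bar>) \<partial>F) \<le> exp_bound"
    unfolding exp_bound_def using le i integrable_exp_abs by (intro integral_mono) auto
  moreover have "0 \<le> exp_bound" unfolding exp_bound_def by simp
  ultimately have "(\<integral>x. exp (\<theta> * x) * exp (2 * \<bar>x\<bar>) \<partial>F) / mom 0 \<theta> \<le> exp_bound / 1"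
    using mom_0_ge_1[of \<theta>] by (intro frac_le) auto
  then show "(\<integral>x. exp (2 * \<bar>x\<bar>) \<partial>tilted F \<theta>) \<le> exp_bound"
    by (subst integral_tilted) auto
qed

lemma log_mgf_deriv: "(log_mgf F has_real_derivative tmean t) (at t)"
proof -
  have "log_mgf F = (\<lambda>t. ln (mom 0 t))" by (simp add: log_mgf_def mom_def fun_eq_iff)
  moreover have "((\<lambda>t. ln (mom 0 t)) has_real_derivative tmean t) (at t)"
    by (rule derivative_eq_intros mom_deriv | simp add: tmean_def)+
  ultimately show ?thesis by simp
qed

lemma tmean_deriv: "(tmean has_real_derivative tvar t) (at t)"
proof -
  have "((\<lambda>t. mom 1 t / mom 0 t) has_real_derivative
      (mom (Suc 1) t * mom 0 t - mom 1 t * mom (Suc 0) t) / (mom 0 t * mom 0 t)) (at t)"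
    by (rule DERIV_divide mom_deriv mom_0_nonzero)+
  moreover have "(mom (Suc 1) t * mom 0 t - mom 1 t * mom (Suc 0) t) / (mom 0 t * mom 0 t) = tvar t"
    by (simp add: tvar_def tmean_def diff_divide_distrib power2_eq_square numeral_2_eq_2)
  ultimately show ?thesis by (simp add: tmean_def[abs_def])
qed

lemma AE_const_false: "\<not> (AE z in F. z = c)"
proof
  assume ae: "AE z in F. z = c"
  have "F = return borel c"
  proof (rule measure_eqI)
    fix A assume A: "A \<in> sets F"
    have "emeasure F A = emeasure F (if c \<in> A then space F else {})"
      using ae A by (intro emeasure_eq_AE) (auto elim!: eventually_mono)
    also have "\<dots> = indicator A c" by (simp add: emeasure_space_1 del: space_eq_univ)
    finally show "emeasure F A = emeasure (return borel c) A" using A by simp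
  qed simp
  then show False using nondegenerate by blast
qed

text \<open>Up to normalisation \<open>tvar t\<close> is the integral of
  \<open>(z - m)\<^sup>2 * exp (t * z)\<close>, with \<open>m\<close> the tilted mean. It could
  vanish only if F were the point mass at \<open>m\<close>.\<close>

lemma tvar_pos: "tvar t > 0"
proof -
  define m where "m = tmean t"
  have sq: "(\<lambda>z. (z - m)\<^sup>2 * exp (t * z))
      = (\<lambda>z. z\<^sup>2 * exp (t * z) - 2 * m * (z * exp (t * z)) + m\<^sup>2 * exp (t * z))"
    by (auto simp: power2_eq_square algebra_simps)
  have i: "integrable F (\<lambda>z. z\<^sup>2 * exp (t * z))" "integrable F (\<lambda>z. z * exp (t * z))"
    using integrable_mom[of 2 t] integrable_mom[of 1 t] by simp_all
  have int: "integrable F (\<lambda>z. (z - m)\<^sup>2 * exp (t * z))"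
    unfolding sq using i exp_moments by simp
  have "(\<integral>z. (z - m)\<^sup>2 * exp (t * z) \<partial>F) = mom 2 t - 2 * m * mom 1 t + m\<^sup>2 * mom 0 t"
    unfolding sq mom_def using i exp_moments by simp
  also have "mom 1 t = m * mom 0 t" by (simp add: m_def tmean_def)
  finally have eq: "tvar t = (\<integral>z. (z - m)\<^sup>2 * exp (t * z) \<partial>F) / mom 0 t"
    by (simp add: tvar_def m_def[symmetric] add_divide_distrib diff_divide_distrib power2_eq_square)
  have "(\<integral>z. (z - m)\<^sup>2 * exp (t * z) \<partial>F) \<noteq> 0"
  proof
    assume "(\<integral>z. (z - m)\<^sup>2 * exp (t * z) \<partial>F) = 0"
    then have "AE z in F. (z - m)\<^sup>2 * exp (t * z) = 0"
      using integral_nonneg_eq_0_iff_AE[OF int] by auto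
    then have "AE z in F. z = m" by eventually_elim auto
    then show False using AE_const_false by blast
  qed
  moreover have "(\<integral>z. (z - m)\<^sup>2 * exp (t * z) \<partial>F) \<ge> 0" by (intro integral_nonneg_AE) auto
  ultimately have "(\<integral>z. (z - m)\<^sup>2 * exp (t * z) \<partial>F) > 0" by linarith
  then show ?thesis unfolding eq by (rule divide_pos_pos) simp
qed

lemma tmean_strict_mono: "s < t \<Longrightarrow> tmean s < tmean t"
  by (rule DERIV_pos_imp_increasing[of s t tmean]) (use tmean_deriv tvar_pos in blast)+

lemma tmean_0 [simp]: "tmean 0 = 0" by (simp add: tmean_def)

definition s2 :: real where "s2 = (\<integral>z. z\<^sup>2 \<partial>F)"

lemma tvar_0: "tvar 0 = s2"
proof -
  have "mom 2 0 = s2" by (simp add: mom_def s2_def)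
  then show ?thesis by (simp add: tvar_def)
qed

lemma s2_pos: "s2 > 0" using tvar_pos[of 0] by (simp add: tvar_0)

lemma tvar_tendsto: "(tvar \<longlongrightarrow> s2) (nhds 0)"
proof -
  have "isCont tvar 0"
  proof -
    have "continuous_on UNIV tvar" unfolding tvar_def tmean_def
      by (intro continuous_intros) (use mom_0_pos in \<open>auto simp: less_le\<close>)
    then show ?thesis by (simp add: continuous_on_eq_continuous_at)
  qed
  then show ?thesis by (simp add: continuous_at tvar_0 tendsto_at_iff_tendsto_nhds flip: tvar_0)
qed

text \<open>Differentiability at 0, rewritten without a quotient so that it includes t = 0 and
  applies to all tilts \<open>\<tau> * q k\<close> with one radius.\<close>

lemma tmean_linear:
  assumes d: "d > 0"
  shows "\<exists>r>0. \<forall>t. \<bar>t\<bar> \<le> r \<longrightarrow> \<bar>tmean t - s2 * t\<bar> \<le> d * \<bar>t\<bar>"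
proof -
  have "((\<lambda>h. tmean h / h) \<longlongrightarrow> s2) (at 0)"
    using tmean_deriv[of 0] by (simp add: DERIV_def tvar_0)
  then have "eventually (\<lambda>h. dist (tmean h / h) s2 < d) (at 0)" using d by (rule tendstoD)
  then obtain r where r: "r > 0" "\<And>h. h \<noteq> 0 \<Longrightarrow> \<bar>h\<bar> < r \<Longrightarrow> \<bar>tmean h / h - s2\<bar> < d"
    by (auto simp: eventually_at dist_real_def)
  have "\<bar>tmean t - s2 * t\<bar> \<le> d * \<bar>t\<bar>" if "\<bar>t\<bar> \<le> r / 2" for t
  proof (cases "t = 0")
    case False
    then have "\<bar>tmean t / t - s2\<bar> * \<bar>t\<bar> \<le> d * \<bar>t\<bar>"
      using r that by (intro mult_right_mono less_imp_le[OF r(2)]) auto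
    moreover have "tmean t - s2 * t = (tmean t / t - s2) * t" using False by (simp add: field_simps)
    ultimately show ?thesis by (simp only: abs_mult)
  qed simp
  then show ?thesis using r(1) by (intro exI[of _ "r / 2"]) auto
qed

text \<open>If F had no mass beyond 0, then -z would be nonnegative with integral 0, hence almost
  surely 0, and F would be degenerate. It follows that all small \<epsilon> are admissible.\<close>

lemma right_endpoint_pos: "\<exists>x>0. ereal x \<le> right_endpoint F"
proof -
  have "\<exists>x>0. cdf F x < 1"
  proof (rule ccontr)
    assume "\<not> (\<exists>x>0. cdf F x < 1)"
    then have c: "cdf F x = 1" if "x > 0" for x
      using that cdf_bounded_prob[of x] by (metis linorder_not_less order_le_less)
    have "AE z in F. z \<le> inverse (real (Suc n))" for n
    proof -
      have "prob {..inverse (real (Suc n))} = 1"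
        using c[of "inverse (real (Suc n))"] by (simp add: cdf_def)
      then have "AE z in F. z \<in> {..inverse (real (Suc n))}" by (rule AE_prob_1)
      then show ?thesis by simp
    qed
    then have "AE z in F. \<forall>n. z \<le> inverse (real (Suc n))" by (simp add: AE_all_countable)
    then have le: "AE z in F. 0 \<le> - z"
    proof eventually_elim
      case (elim z)
      show ?case
      proof (rule ccontr)
        assume "\<not> 0 \<le> - z"
        then obtain n where "inverse (real (Suc n)) < z" using reals_Archimedean[of z] by auto
        then show False using elim[rule_format, of n] by linarith
      qed
    qed
    have int: "integrable F (\<lambda>z. - z)" using integrable_mom[of 1 0] by simp
    have "AE z in F. - z = 0"
      using integral_nonneg_eq_0_iff_AE[OF int le] mean_zero by simp
    then have "AE z in F. z = 0" by eventually_elim simp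
    then show False using AE_const_false by blast
  qed
  then obtain x where "x > 0" "cdf F x < 1" by blast
  then show ?thesis unfolding right_endpoint_def by (intro exI[of _ x]) (auto intro!: SUP_upper)
qed

text \<open>The intermediate value theorem on \<open>{0..r}\<close> gives a solution and strict
  monotonicity makes it the only one. The bracket \<open>r\<close> stays in the conclusion because
  it is what shows that the tilt becomes small.\<close>

lemma tilt_eq:
  assumes A: "coeff_sum a > 0" and e: "\<epsilon> > 0" "\<epsilon> / coeff_sum a < tmean r" and r: "r > 0"
  shows "0 < tilt F a \<epsilon>" "tilt F a \<epsilon> < r" "tmean (tilt F a \<epsilon>) = \<epsilon> / coeff_sum a"
proof -
  let ?y = "\<epsilon> / coeff_sum a"
  have y: "?y > 0" using A e by simp
  have "continuous_on {0..r} tmean"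
    by (meson DERIV_continuous_on tmean_deriv has_field_derivative_at_within)
  then obtain t where t: "0 \<le> t" "t \<le> r" "tmean t = ?y"
    using IVT'[of tmean 0 ?y r] y e r by auto
  have "t \<noteq> 0" "t \<noteq> r" using t y e by auto
  then have t': "0 < t" "t < r" using t by auto
  have d: "deriv (log_mgf F) u = tmean u" for u using log_mgf_deriv by (rule DERIV_imp_deriv)
  have "tilt F a \<epsilon> = t" unfolding tilt_def d
  proof (rule the_equality)
    fix u assume "0 < u \<and> tmean u = ?y"
    then show "u = t" using tmean_strict_mono[of u t] tmean_strict_mono[of t u] t by (cases u t rule: linorder_cases) auto
  qed (use t t' in auto)
  then show "0 < tilt F a \<epsilon>" "tilt F a \<epsilon> < r" "tmean (tilt F a \<epsilon>) = ?y" using t t' by auto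
qed

lemma eventually_tilt:
  assumes A: "coeff_sum a > 0" and r: "r > 0"
  shows "\<forall>\<^sub>F \<epsilon> in at_right 0. 0 < tilt F a \<epsilon> \<and> tilt F a \<epsilon> < r \<and> tmean (tilt F a \<epsilon>) = \<epsilon> / coeff_sum a"
proof -
  have "0 < coeff_sum a * tmean r" using A tmean_strict_mono[OF r] by simp
  then have "\<forall>\<^sub>F \<epsilon> in at_right 0. 0 < \<epsilon> \<and> \<epsilon> < coeff_sum a * tmean r"
    by (auto simp: eventually_at_right_field)
  then show ?thesis
  proof eventually_elim
    case (elim \<epsilon>)
    then have "\<epsilon> / coeff_sum a < tmean r" using A by (simp add: field_simps)
    then show ?case using tilt_eq[OF A _ _ r] elim by auto
  qed
qed

lemma tilt_tendsto:
  assumes A: "coeff_sum a > 0"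
  shows "filterlim (tilt F a) (at_right 0) (at_right 0)"
  unfolding filterlim_at
proof
  show "\<forall>\<^sub>F \<epsilon> in at_right 0. tilt F a \<epsilon> \<in> {0<..} \<and> tilt F a \<epsilon> \<noteq> 0"
    using eventually_tilt[OF A, of 1] by (auto elim: eventually_mono)
  show "(tilt F a \<longlongrightarrow> 0) (at_right 0)"
  proof (rule tendstoI)
    fix r :: real assume "r > 0"
    then show "\<forall>\<^sub>F \<epsilon> in at_right 0. dist (tilt F a \<epsilon>) 0 < r"
      using eventually_tilt[OF A, of r] by (auto elim: eventually_mono)
  qed
qed

text \<open>Along \<tau> = \<tau>(\<epsilon>) the quotient \<open>tmean \<tau> / \<tau>\<close>,
  which tends to s2, equals \<epsilon> / (A \<tau>). Inverting it gives the rate at which \<tau>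
  vanishes.\<close>

lemma tilt_ratio:
  assumes A: "coeff_sum a > 0"
  shows "((\<lambda>\<epsilon>. tilt F a \<epsilon> / \<epsilon>) \<longlongrightarrow> 1 / (coeff_sum a * s2)) (at_right 0)"
proof -
  have "((\<lambda>h. tmean h / h) \<longlongrightarrow> s2) (at_right 0)"
    using tmean_deriv[of 0] by (auto simp: DERIV_def tvar_0 intro: tendsto_within_subset)
  from filterlim_compose[OF this tilt_tendsto[OF A]]
  have "((\<lambda>\<epsilon>. 1 / (coeff_sum a * (tmean (tilt F a \<epsilon>) / tilt F a \<epsilon>))) \<longlongrightarrow> 1 / (coeff_sum a * s2)) (at_right 0)"
    using A s2_pos by (intro tendsto_intros) auto
  moreover have "\<forall>\<^sub>F \<epsilon> in at_right 0. 1 / (coeff_sum a * (tmean (tilt F a \<epsilon>) / tilt F a \<epsilon>)) = tilt F a \<epsilon> / \<epsilon>"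
    using eventually_tilt[OF A zero_less_one] by eventually_elim (use A in auto)
  ultimately show ?thesis by (rule Lim_transform_eventually)
qed

end

section \<open>The coefficients of the moving average\<close>

lemma abs_summable_tail:
  fixes a :: "'i \<Rightarrow> real"
  assumes a: "(\<lambda>i. \<bar>a i\<bar>) summable_on UNIV" and e: "e > 0"
  shows "\<exists>E. finite E \<and> (\<Sum>\<^sub>\<infinity>i\<in>-E. \<bar>a i\<bar>) < e"
proof -
  have "((\<lambda>i. \<bar>a i\<bar>) has_sum (\<Sum>\<^sub>\<infinity>i. \<bar>a i\<bar>)) UNIV" using a by simp
  then have "(sum (\<lambda>i. \<bar>a i\<bar>) \<longlongrightarrow> (\<Sum>\<^sub>\<infinity>i. \<bar>a i\<bar>)) (finite_subsets_at_top UNIV)"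
    by (simp add: has_sum_def)
  from tendstoD[OF this e] obtain E where E: "finite E" "dist (\<Sum>i\<in>E. \<bar>a i\<bar>) (\<Sum>\<^sub>\<infinity>i. \<bar>a i\<bar>) < e"
    unfolding eventually_finite_subsets_at_top by blast
  have "(\<Sum>\<^sub>\<infinity>i\<in>UNIV - E. \<bar>a i\<bar>) = (\<Sum>\<^sub>\<infinity>i. \<bar>a i\<bar>) - (\<Sum>\<^sub>\<infinity>i\<in>E. \<bar>a i\<bar>)"
    by (rule infsum_Diff) (use a summable_on_finite[OF E(1)] in auto)
  then have "(\<Sum>\<^sub>\<infinity>i\<in>-E. \<bar>a i\<bar>) = (\<Sum>\<^sub>\<infinity>i. \<bar>a i\<bar>) - (\<Sum>i\<in>E. \<bar>a i\<bar>)"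
    using E by (simp add: Compl_eq_Diff_UNIV)
  then show ?thesis using E by (intro exI[of _ E]) (auto simp: dist_real_def)
qed

lemma has_sum_finite_sum:
  fixes f :: "'i \<Rightarrow> 'j \<Rightarrow> real"
  assumes "finite K" "\<And>k. k \<in> K \<Longrightarrow> (f k has_sum s k) S"
  shows "((\<lambda>x. \<Sum>k\<in>K. f k x) has_sum (\<Sum>k\<in>K. s k)) S"
  using assms by (induction K rule: finite_induct) (auto intro!: has_sum_add has_sum_0)

locale tilted_coeffs = noise_law +
  fixes a :: "int \<Rightarrow> real"
  assumes abs_summable: "(\<lambda>i. \<bar>a i\<bar>) summable_on UNIV"
    and A_pos: "coeff_sum a > 0"
begin

abbreviation A :: real where "A \<equiv> coeff_sum a"

definition \<alpha> :: real where "\<alpha> = (\<Sum>\<^sub>\<infinity>i. \<bar>a i\<bar>)"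

lemma abs_summable_on: "(\<lambda>i. \<bar>a i\<bar>) summable_on S"
  using abs_summable by (rule summable_on_subset_banach) simp

lemma summable_a: "a summable_on S"
  by (rule abs_summable_summable) (use abs_summable_on[of S] in simp)

lemma abs_infsum_le: "\<bar>infsum a S\<bar> \<le> (\<Sum>\<^sub>\<infinity>i\<in>S. \<bar>a i\<bar>)"
  using norm_infsum_bound[of a S] abs_summable_on[of S] by simp

lemma infsum_abs_mono: "S \<subseteq> S' \<Longrightarrow> (\<Sum>\<^sub>\<infinity>i\<in>S. \<bar>a i\<bar>) \<le> (\<Sum>\<^sub>\<infinity>i\<in>S'. \<bar>a i\<bar>)"
  by (rule infsum_mono2) (use abs_summable_on in auto)

lemma abs_infsum_le_\<alpha>: "\<bar>infsum a S\<bar> \<le> \<alpha>"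
  using abs_infsum_le[of S] infsum_abs_mono[of S UNIV] by (simp add: \<alpha>_def)

lemma A_le_\<alpha>: "A \<le> \<alpha>" using abs_infsum_le_\<alpha>[of UNIV] by (simp add: coeff_sum_def)

lemma \<alpha>_pos: "\<alpha> > 0" using A_le_\<alpha> A_pos by linarith

text \<open>The noise at time \<open>k\<close> is tilted by \<open>\<tau> * q k\<close> in the family with superscript minus and by
  \<open>\<tau> * (1 - q k)\<close> in the family with superscript plus.\<close>

definition q :: "int \<Rightarrow> real" where "q k = infsum a {-k..} / A"

lemma infsum_split: "S \<inter> S' = {} \<Longrightarrow> infsum a (S \<union> S') = infsum a S + infsum a S'"
  by (rule infsum_Un_disjoint) (use summable_a in auto)

lemma q_compl: "A * (1 - q k) = infsum a {..<-k}"
proof -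
  have "A = infsum a ({..<-k} \<union> {-k..})" by (auto simp: coeff_sum_def intro!: arg_cong[where f="infsum a"])
  also have "\<dots> = infsum a {..<-k} + infsum a {-k..}" by (rule infsum_split) auto
  finally show ?thesis using A_pos by (simp add: q_def field_simps)
qed

text \<open>Bounds both \<bar>q k\<bar> and \<bar>1 - q k\<bar>. Once
  \<open>\<tau> * \<rho> \<le> 1\<close>, all tilts lie in the range [-1, 1] of
  \<open>tilted_exp_abs\<close>.\<close>

definition \<rho> :: real where "\<rho> = \<alpha> / A"

lemma \<rho>_pos: "\<rho> > 0" using \<alpha>_pos A_pos by (simp add: \<rho>_def)

lemma q_bounds: "\<bar>q k\<bar> \<le> \<rho>" "\<bar>1 - q k\<bar> \<le> \<rho>"
proof -
  show "\<bar>q k\<bar> \<le> \<rho>" using abs_infsum_le_\<alpha>[of "{-k..}"] A_pos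
    by (simp add: q_def \<rho>_def abs_divide divide_right_mono)
  have "1 - q k = infsum a {..<-k} / A" using q_compl[of k] A_pos by (simp add: field_simps)
  then show "\<bar>1 - q k\<bar> \<le> \<rho>" using abs_infsum_le_\<alpha>[of "{..<-k}"] A_pos
    by (simp add: \<rho>_def abs_divide divide_right_mono)
qed

text \<open>\<open>1 - q k\<close> is the sum of the coefficients below -k, divided by A, hence a
  tail. So at late times the minus family carries nearly the full tilt \<tau> and the plus family
  nearly none; this asymmetry is the source of the drift.\<close>

lemma q_tendsto:
  assumes e: "e > 0"
  shows "\<exists>k0::nat. \<forall>k\<ge>k0. \<bar>1 - q (int k)\<bar> \<le> e"
proof -
  have "e * A > 0" using e A_pos by simp
  from abs_summable_tail[OF abs_summable this]
  obtain E where E: "finite E" "(\<Sum>\<^sub>\<infinity>i\<in>-E. \<bar>a i\<bar>) < e * A" by blast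
  have "bdd_below E" using E by simp
  then obtain m where m: "\<And>x. x \<in> E \<Longrightarrow> m \<le> x" unfolding bdd_below_def by auto
  show ?thesis
  proof (intro exI[of _ "nat (- m)"] allI impI)
    fix k assume "nat (- m) \<le> k"
    then have sub: "{..<- int k} \<subseteq> - E" using m by force
    have "\<bar>A * (1 - q (int k))\<bar> \<le> (\<Sum>\<^sub>\<infinity>i\<in>-E. \<bar>a i\<bar>)"
      unfolding q_compl using abs_infsum_le infsum_abs_mono[OF sub] by (rule order_trans)
    also have "\<dots> \<le> A * e" using E(2) by (simp add: mult.commute)
    finally show "\<bar>1 - q (int k)\<bar> \<le> e" using A_pos by (simp add: abs_mult)
  qed
qed

text \<open>The coefficient of the noise at time k in the sum of the moving averages at times 0,
  ..., n - 1. It sums a window of n consecutive coefficients: close to A for k well inside [0, n),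
  close to 0 far outside.\<close>

definition b :: "nat \<Rightarrow> int \<Rightarrow> real" where "b n k = (\<Sum>i<n. a (int i - k))"

text \<open>The error in the coefficient of the noise at time k when n steps of the walk are
  replaced by A times the sum of the noise at times 0, ..., n - 1.\<close>

definition d :: "nat \<Rightarrow> int \<Rightarrow> real" where "d n k = b n k - A * of_bool (0 \<le> k \<and> k < int n)"

lemma b_eq_sum: "b n k = sum a {-k..<int n - k}"
proof -
  have "(\<Sum>i<n. a (int i - k)) = (\<Sum>m\<in>(\<lambda>i. int i - k) ` {..<n}. a m)"
    by (subst sum.reindex) (auto simp: inj_on_def)
  also have "(\<lambda>i. int i - k) ` {..<n} = {-k..<int n - k}"
  proof safe
    fix x assume x: "x \<in> {-k..<int n - k}"
    then have "x = int (nat (x + k)) - k" "nat (x + k) < n" by auto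
    then show "x \<in> (\<lambda>i. int i - k) ` {..<n}" by blast
  qed auto
  finally show ?thesis by (simp add: b_def)
qed

lemma b_eq_infsum: "b n k = (\<Sum>\<^sub>\<infinity>m. a m * of_bool (0 \<le> m + k \<and> m + k < int n))"
proof -
  have "(\<Sum>\<^sub>\<infinity>m. a m * of_bool (0 \<le> m + k \<and> m + k < int n)) = infsum a {-k..<int n - k}"
    by (rule infsum_cong_neutral) auto
  then show ?thesis by (simp add: b_eq_sum)
qed

lemma abs_b_le: "\<bar>b n k\<bar> \<le> \<alpha>"
proof -
  have "b n k = infsum a {-k..<int n - k}" by (simp add: b_eq_sum)
  then show ?thesis by (simp only: abs_infsum_le_\<alpha>)
qed

lemma abs_d_le: "\<bar>d n k\<bar> \<le> 2 * \<alpha>"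
  using abs_b_le[of n k] A_le_\<alpha> A_pos by (auto simp: d_def)

text \<open>Exchange the sums. The coefficient \<open>a m\<close> is counted once for each element
  of the symmetric difference of the windows [-m, n - m) and [0, n), which has at most
  \<open>2 * min n \<bar>m\<bar>\<close> elements. Finitely many m with the bound 2 \<bar>m\<bar>
  make up the constant C; on the rest, where the absolute coefficients sum to less than e / 2, the
  bound 2 n gives e n.\<close>

lemma sum_abs_d:
  assumes e: "e > 0"
  shows "\<exists>C\<ge>0. \<forall>n K. finite K \<longrightarrow> (\<Sum>k\<in>K. \<bar>d n k\<bar>) \<le> e * real n + C"
proof -
  obtain E where E: "finite E" "(\<Sum>\<^sub>\<infinity>i\<in>-E. \<bar>a i\<bar>) < e / 2"
    using abs_summable_tail[OF abs_summable, of "e / 2"] e by auto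
  define C where "C = (\<Sum>m\<in>E. \<bar>a m\<bar> * (2 * \<bar>real_of_int m\<bar>))"
  have C: "C \<ge> 0" unfolding C_def by (intro sum_nonneg) auto
  have "(\<Sum>k\<in>K. \<bar>d n k\<bar>) \<le> e * real n + C" if K: "finite K" for n K
  proof -
    \<comment> \<open>\<open>P m\<close> is the set of times k at which \<open>a m\<close> enters
      \<open>b n k\<close>, and \<open>P 0\<close> is the ideal window. As A is the sum of all
      \<open>a m\<close>, the error \<open>d n k\<close> is the sum of \<open>a m * w m k\<close>
      over m.\<close>
    define P where "P m = {m'. 0 \<le> m + m' \<and> m + m' < int n}" for m :: int
    define w where "w m k = (of_bool (k \<in> P m) - of_bool (k \<in> P 0) :: real)" for m k
    have dk: "\<bar>d n k\<bar> \<le> (\<Sum>\<^sub>\<infinity>m. \<bar>a m\<bar> * \<bar>w m k\<bar>)" and sk: "(\<lambda>m. \<bar>a m\<bar> * \<bar>w m k\<bar>) summable_on UNIV" for k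
    proof -
      have s1: "(\<lambda>m. a m * of_bool (k \<in> P m)) summable_on UNIV"
        by (rule abs_summable_summable, rule summable_on_comparison_test[OF abs_summable])
           (auto simp: abs_mult)
      have s2: "(\<lambda>m. a m * of_bool (k \<in> P 0)) summable_on UNIV"
        by (intro summable_on_cmult_left summable_a)
      have s3: "(\<lambda>m. \<bar>a m * w m k\<bar>) summable_on UNIV"
        by (rule summable_on_comparison_test[OF abs_summable]) (auto simp: abs_mult w_def)
      then show "(\<lambda>m. \<bar>a m\<bar> * \<bar>w m k\<bar>) summable_on UNIV" by (simp add: abs_mult)
      have "d n k = (\<Sum>\<^sub>\<infinity>m. a m * of_bool (k \<in> P m)) - (\<Sum>\<^sub>\<infinity>m. a m * of_bool (k \<in> P 0))"
        unfolding d_def b_eq_infsum by (simp add: P_def infsum_cmult_left coeff_sum_def summable_a)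
      also have "\<dots> = (\<Sum>\<^sub>\<infinity>m. a m * w m k)"
        using infsum_add[OF s1 s2[THEN summable_on_uminus[THEN iffD2]]]
        by (simp add: w_def right_diff_distrib infsum_uminus)
      finally have "d n k = (\<Sum>\<^sub>\<infinity>m. a m * w m k)" .
      then show "\<bar>d n k\<bar> \<le> (\<Sum>\<^sub>\<infinity>m. \<bar>a m\<bar> * \<bar>w m k\<bar>)"
        using norm_infsum_bound[of "\<lambda>m. a m * w m k" UNIV] s3 by (simp add: abs_mult)
    qed
    have cP: "P m = {-m..<int n - m}" for m by (auto simp: P_def)
    have W: "(\<Sum>k\<in>K. \<bar>w m k\<bar>) \<le> 2 * min (real n) \<bar>real_of_int m\<bar>" for m
    proof -
      have c1: "card (P m - P 0) \<le> nat (min (int n) \<bar>m\<bar>)"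
      proof (rule order_trans[OF card_mono])
        show "P m - P 0 \<subseteq> (if \<bar>m\<bar> \<le> int n then if m \<ge> 0 then {-m..<0} else {int n..<int n - m} else {-m..<int n - m})"
          by (auto simp: P_def)
      qed auto
      have c2: "card (P 0 - P m) \<le> nat (min (int n) \<bar>m\<bar>)"
      proof (rule order_trans[OF card_mono])
        show "P 0 - P m \<subseteq> (if \<bar>m\<bar> \<le> int n then if m \<ge> 0 then {int n - m..<int n} else {0..<-m} else {0..<int n})"
          by (auto simp: P_def)
      qed auto
      have "(\<Sum>k\<in>K. \<bar>w m k\<bar>) = (\<Sum>k\<in>K. indicator (P m - P 0) k + indicator (P 0 - P m) k)"
        by (intro sum.cong) (auto simp: w_def indicator_def)
      also have "\<dots> = real (card (K \<inter> (P m - P 0))) + real (card (K \<inter> (P 0 - P m)))"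
        using K by (simp add: sum.distrib indicator_def sum_of_bool_eq set_diff_eq)
      also have "\<dots> \<le> real (card (P m - P 0)) + real (card (P 0 - P m))"
        by (intro add_mono of_nat_mono card_mono) (auto simp: cP)
      also have "\<dots> \<le> real (nat (min (int n) \<bar>m\<bar>)) + real (nat (min (int n) \<bar>m\<bar>))"
        using c1 c2 by (intro add_mono of_nat_mono)
      also have "\<dots> = 2 * min (real n) \<bar>real_of_int m\<bar>" by (auto simp: min_def)
      finally show ?thesis .
    qed
    have hs: "((\<lambda>m. \<Sum>k\<in>K. \<bar>a m\<bar> * \<bar>w m k\<bar>) has_sum (\<Sum>k\<in>K. \<Sum>\<^sub>\<infinity>m. \<bar>a m\<bar> * \<bar>w m k\<bar>)) UNIV"
      using K sk by (intro has_sum_finite_sum) auto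
    have "(\<Sum>k\<in>K. \<bar>d n k\<bar>) \<le> (\<Sum>k\<in>K. \<Sum>\<^sub>\<infinity>m. \<bar>a m\<bar> * \<bar>w m k\<bar>)"
      by (intro sum_mono dk)
    also have "\<dots> = (\<Sum>\<^sub>\<infinity>m. \<Sum>k\<in>K. \<bar>a m\<bar> * \<bar>w m k\<bar>)"
      using hs by (simp add: infsumI)
    also have "\<dots> = (\<Sum>\<^sub>\<infinity>m. \<bar>a m\<bar> * (\<Sum>k\<in>K. \<bar>w m k\<bar>))" by (simp add: sum_distrib_left)
    also have "\<dots> \<le> (\<Sum>\<^sub>\<infinity>m. \<bar>a m\<bar> * (if m \<in> E then 2 * \<bar>real_of_int m\<bar> else 2 * real n))"
    proof (rule infsum_mono)
      show "(\<lambda>m. \<bar>a m\<bar> * (\<Sum>k\<in>K. \<bar>w m k\<bar>)) summable_on UNIV"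
        unfolding sum_distrib_left using hs by (rule has_sum_imp_summable)
      show "(\<lambda>m. \<bar>a m\<bar> * (if m \<in> E then 2 * \<bar>real_of_int m\<bar> else 2 * real n)) summable_on UNIV"
      proof -
        have "(\<lambda>m. \<bar>a m\<bar> * (if m \<in> E then 2 * \<bar>real_of_int m\<bar> else 2 * real n)) summable_on (E \<union> - E)"
        proof (rule summable_on_Un_disjoint)
          show "(\<lambda>m. \<bar>a m\<bar> * (if m \<in> E then 2 * \<bar>real_of_int m\<bar> else 2 * real n)) summable_on - E"
            using summable_on_cmult_left[OF abs_summable_on[of "- E"], of "2 * real n"]
            by (rule summable_on_cong[THEN iffD1, rotated]) auto
        qed (use E in auto)
        then show ?thesis by simp
      qed
      show "\<bar>a m\<bar> * (\<Sum>k\<in>K. \<bar>w m k\<bar>) \<le> \<bar>a m\<bar> * (if m \<in> E then 2 * \<bar>real_of_int m\<bar> else 2 * real n)" for m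
        using W[of m] by (intro mult_left_mono) auto
    qed
    also have "\<dots> = C + (\<Sum>\<^sub>\<infinity>m\<in>-E. \<bar>a m\<bar> * (2 * real n))"
    proof -
      let ?f = "\<lambda>m. \<bar>a m\<bar> * (if m \<in> E then 2 * \<bar>real_of_int m\<bar> else 2 * real n)"
      have s: "?f summable_on - E"
        using summable_on_cmult_left[OF abs_summable_on[of "- E"], of "2 * real n"]
        by (rule summable_on_cong[THEN iffD1, rotated]) auto
      have "infsum ?f (E \<union> - E) = infsum ?f E + infsum ?f (- E)"
        by (rule infsum_Un_disjoint) (use E s in auto)
      moreover have "infsum ?f E = C" using E by (simp add: C_def)
      moreover have "infsum ?f (- E) = (\<Sum>\<^sub>\<infinity>m\<in>-E. \<bar>a m\<bar> * (2 * real n))"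
        by (rule infsum_cong) auto
      ultimately show ?thesis by simp
    qed
    also have "(\<Sum>\<^sub>\<infinity>m\<in>-E. \<bar>a m\<bar> * (2 * real n)) = (\<Sum>\<^sub>\<infinity>m\<in>-E. \<bar>a m\<bar>) * (2 * real n)"
      by (rule infsum_cmult_left) (use abs_summable_on in auto)
    also have "\<dots> \<le> e / 2 * (2 * real n)" using E(2) by (intro mult_right_mono) auto
    finally show ?thesis by simp
  qed
  then show ?thesis using C by blast
qed

subsection \<open>Means and variances of the tilted increments\<close>

text \<open>The mean of the difference of the two noise families at time k; \<open>svar\<close> is
  its variance, by independence a sum.\<close>

definition smean :: "real \<Rightarrow> int \<Rightarrow> real" where
  "smean \<tau> k = tmean (\<tau> * q k) - tmean (\<tau> * (1 - q k))"

definition svar :: "real \<Rightarrow> int \<Rightarrow> real" where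
  "svar \<tau> k = tvar (\<tau> * q k) + tvar (\<tau> * (1 - q k))"

lemma tilt_small: "0 < \<tau> \<Longrightarrow> \<tau> * (\<rho>) \<le> r \<Longrightarrow> \<bar>\<tau> * q k\<bar> \<le> r \<and> \<bar>\<tau> * (1 - q k)\<bar> \<le> r"
proof -
  assume \<tau>: "0 < \<tau>" "\<tau> * \<rho> \<le> r"
  then have "\<bar>\<tau> * q k\<bar> \<le> \<tau> * \<rho>" "\<bar>\<tau> * (1 - q k)\<bar> \<le> \<tau> * \<rho>"
    using q_bounds[of k] by (auto simp: abs_mult intro: mult_left_mono)
  then show ?thesis using \<tau>(2) by linarith
qed

text \<open>Linearising \<open>tmean\<close> at both tilts gives s2 \<tau> (q - (1 - q)). It is
  written in terms of \<open>1 - q k\<close>, the quantity that vanishes for late k. One radius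
  serves all k, as the tilts are at most \<tau> \<rho> in absolute value.\<close>

lemma smean_approx:
  assumes e: "e > 0"
  shows "\<exists>r>0. \<forall>\<tau> k. 0 < \<tau> \<longrightarrow> \<tau> \<le> r \<longrightarrow> \<bar>smean \<tau> k - s2 * \<tau> * (1 - 2 * (1 - q k))\<bar> \<le> e * \<tau>"
proof -
  let ?R = "\<rho>"
  have R: "?R > 0" using \<rho>_pos by simp
  \<comment> \<open>Each of the two linearisations costs at most
    \<open>\<delta> * (\<tau> * \<rho>)\<close>; together they cost
    \<open>e * \<tau>\<close>.\<close>
  define \<delta> where "\<delta> = e / (2 * ?R)"
  have \<delta>: "\<delta> > 0" "2 * \<delta> * ?R = e" using e R by (auto simp: \<delta>_def)
  from tmean_linear[OF \<delta>(1)] obtain r where r: "r > 0"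
    "\<And>t. \<bar>t\<bar> \<le> r \<Longrightarrow> \<bar>tmean t - s2 * t\<bar> \<le> \<delta> * \<bar>t\<bar>" by blast
  show ?thesis
  proof (intro exI[of _ "r / ?R"] conjI allI impI)
    show "r / ?R > 0" using r R by simp
    fix \<tau> k assume \<tau>: "0 < \<tau>" "\<tau> \<le> r / ?R"
    then have "\<tau> * ?R \<le> r" using R by (simp add: pos_le_divide_eq)
    from tilt_small[OF \<tau>(1) this, of k]
    have b: "\<bar>\<tau> * q k\<bar> \<le> r" "\<bar>\<tau> * (1 - q k)\<bar> \<le> r" by auto
    have "\<bar>tmean (\<tau> * q k) - s2 * (\<tau> * q k)\<bar> \<le> \<delta> * (\<tau> * ?R)"
      by (rule order_trans[OF r(2)[OF b(1)] mult_left_mono])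
         (use tilt_small[OF \<tau>(1) order_refl, of k] \<delta> in auto)
    moreover have "\<bar>tmean (\<tau> * (1 - q k)) - s2 * (\<tau> * (1 - q k))\<bar> \<le> \<delta> * (\<tau> * ?R)"
      by (rule order_trans[OF r(2)[OF b(2)] mult_left_mono])
         (use tilt_small[OF \<tau>(1) order_refl, of k] \<delta> in auto)
    moreover have "\<delta> * (\<tau> * ?R) + \<delta> * (\<tau> * ?R) = e * \<tau>"
      unfolding \<delta>(2)[symmetric] by (simp add: algebra_simps)
    moreover have "smean \<tau> k - s2 * \<tau> * (1 - 2 * (1 - q k))
        = (tmean (\<tau> * q k) - s2 * (\<tau> * q k)) - (tmean (\<tau> * (1 - q k)) - s2 * (\<tau> * (1 - q k)))"
      by (simp add: smean_def algebra_simps)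
    ultimately show "\<bar>smean \<tau> k - s2 * \<tau> * (1 - 2 * (1 - q k))\<bar> \<le> e * \<tau>" by linarith
  qed
qed

lemma smean_bound: "\<exists>C\<ge>0. \<exists>r>0. \<forall>\<tau> k. 0 < \<tau> \<longrightarrow> \<tau> \<le> r \<longrightarrow> \<bar>smean \<tau> k\<bar> \<le> C * \<tau>"
proof -
  from smean_approx[OF zero_less_one] obtain r where r: "r > 0"
    "\<And>\<tau> k. 0 < \<tau> \<Longrightarrow> \<tau> \<le> r \<Longrightarrow> \<bar>smean \<tau> k - s2 * \<tau> * (1 - 2 * (1 - q k))\<bar> \<le> 1 * \<tau>" by blast
  have "\<bar>smean \<tau> k\<bar> \<le> (1 + s2 * (1 + 2 * (\<rho>))) * \<tau>" if \<tau>: "0 < \<tau>" "\<tau> \<le> r" for \<tau> k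
  proof -
    have "\<bar>1 - 2 * (1 - q k)\<bar> \<le> \<bar>1\<bar> + \<bar>2 * (1 - q k)\<bar>" by (rule abs_triangle_ineq4)
    then have "\<bar>1 - 2 * (1 - q k)\<bar> \<le> 1 + 2 * \<rho>" using q_bounds(2)[of k] by (simp add: abs_mult)
    then have "\<bar>s2 * \<tau> * (1 - 2 * (1 - q k))\<bar> \<le> s2 * \<tau> * (1 + 2 * (\<rho>))"
      using \<tau> s2_pos unfolding abs_mult by (intro mult_mono) auto
    also have "\<dots> = s2 * (1 + 2 * (\<rho>)) * \<tau>" by simp
    finally show ?thesis using r(2)[OF \<tau>, of k] unfolding distrib_right by linarith
  qed
  moreover have "0 \<le> 1 + s2 * (1 + 2 * (\<rho>))"
    using s2_pos \<rho>_pos by (intro add_nonneg_nonneg mult_nonneg_nonneg) auto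
  ultimately show ?thesis using r(1) by blast
qed

text \<open>From index k0 on, \<open>1 - q k\<close> is so small that each mean is within e \<tau>
  of s2 \<tau>. Each of the first k0 terms costs a further fixed multiple of \<tau>, whatever n is;
  they form C.\<close>

lemma sum_smean:
  assumes e: "e > 0"
  shows "\<exists>C\<ge>0. \<exists>r>0. \<forall>\<tau> n. 0 < \<tau> \<longrightarrow> \<tau> \<le> r \<longrightarrow>
    \<bar>(\<Sum>k<n. smean \<tau> (int k)) - s2 * \<tau> * real n\<bar> \<le> \<tau> * (e * real n + C)"
proof -
  from smean_approx[of "e / 2"] e obtain r where r: "r > 0"
    "\<And>\<tau> k. 0 < \<tau> \<Longrightarrow> \<tau> \<le> r \<Longrightarrow> \<bar>smean \<tau> k - s2 * \<tau> * (1 - 2 * (1 - q k))\<bar> \<le> e / 2 * \<tau>" by auto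
  \<comment> \<open>Chosen so that \<open>2 * s2 * \<tau> * \<bar>1 - q k\<bar>\<close> is at most e
    \<tau> / 2; the other half is spent on the linearisation.\<close>
  have "e / (4 * s2) > 0" using e s2_pos by simp
  from q_tendsto[OF this] obtain k0 where k0: "\<And>k. k \<ge> k0 \<Longrightarrow> \<bar>1 - q (int k)\<bar> \<le> e / (4 * s2)" by blast
  define C where "C = real k0 * (2 * s2 * (\<rho>))"
  have C: "C \<ge> 0" using s2_pos \<rho>_pos by (simp add: C_def)
  have "\<bar>(\<Sum>k<n. smean \<tau> (int k)) - s2 * \<tau> * real n\<bar> \<le> \<tau> * (e * real n + C)" if \<tau>: "0 < \<tau>" "\<tau> \<le> r" for \<tau> n
  proof -
    have bound: "\<bar>smean \<tau> (int k) - s2 * \<tau>\<bar> \<le> e * \<tau> + of_bool (k < k0) * (2 * s2 * (\<rho>) * \<tau>)" for k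
    proof -
      have t1: "\<bar>smean \<tau> (int k) - s2 * \<tau>\<bar> \<le> e / 2 * \<tau> + 2 * s2 * \<tau> * \<bar>1 - q (int k)\<bar>"
      proof -
        have "smean \<tau> (int k) - s2 * \<tau> = (smean \<tau> (int k) - s2 * \<tau> * (1 - 2 * (1 - q (int k)))) - 2 * s2 * \<tau> * (1 - q (int k))"
          by (simp add: algebra_simps)
        moreover have "\<bar>2 * s2 * \<tau> * (1 - q (int k))\<bar> = 2 * s2 * \<tau> * \<bar>1 - q (int k)\<bar>"
          using s2_pos \<tau> by (simp add: abs_mult)
        ultimately show ?thesis using r(2)[OF \<tau>, of "int k"] by linarith
      qed
      show ?thesis
      proof (cases "k < k0")
        case True
        have "2 * s2 * \<tau> * \<bar>1 - q (int k)\<bar> \<le> 2 * s2 * \<tau> * (\<rho>)"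
          using q_bounds(2) s2_pos \<tau> by (intro mult_left_mono) auto
        also have "\<dots> = 2 * s2 * (\<rho>) * \<tau>" by simp
        finally have "2 * s2 * \<tau> * \<bar>1 - q (int k)\<bar> \<le> 2 * s2 * (\<rho>) * \<tau>" .
        moreover have "e / 2 * \<tau> \<le> e * \<tau>" using e \<tau> by simp
        ultimately show ?thesis using t1 True by (simp del: times_divide_eq_right times_divide_eq_left) 
      next
        case False
        then have "2 * s2 * \<tau> * \<bar>1 - q (int k)\<bar> \<le> 2 * s2 * \<tau> * (e / (4 * s2))"
          using k0[of k] s2_pos \<tau> by (intro mult_left_mono) auto
        also have "\<dots> = e / 2 * \<tau>" using s2_pos by simp
        finally show ?thesis using t1 False by simp
      qed
    qed
    have "\<bar>(\<Sum>k<n. smean \<tau> (int k)) - s2 * \<tau> * real n\<bar> = \<bar>\<Sum>k<n. smean \<tau> (int k) - s2 * \<tau>\<bar>"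
      by (simp add: sum_subtractf mult.commute)
    also have "\<dots> \<le> (\<Sum>k<n. e * \<tau> + of_bool (k < k0) * (2 * s2 * (\<rho>) * \<tau>))"
      by (rule order_trans[OF sum_abs sum_mono[OF bound]])
    also have "\<dots> = real n * (e * \<tau>) + (\<Sum>k<n. of_bool (k < k0)) * (2 * s2 * (\<rho>) * \<tau>)"
      by (simp add: sum.distrib sum_distrib_right)
    also have "(\<Sum>k<n. of_bool (k < k0)) \<le> real k0"
    proof -
      have "(\<Sum>k<n. of_bool (k < k0) :: real) = real (card {k\<in>{..<n}. k < k0})" 
        by (simp add: sum_of_bool_eq Int_def)
      also have "\<dots> \<le> real (card {..<k0})" by (intro of_nat_mono card_mono) auto
      finally show ?thesis by simp
    qed
    then have "real n * (e * \<tau>) + (\<Sum>k<n. of_bool (k < k0)) * (2 * s2 * (\<rho>) * \<tau>)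
        \<le> real n * (e * \<tau>) + real k0 * (2 * s2 * (\<rho>) * \<tau>)"
      using s2_pos \<rho>_pos \<tau> by (intro add_left_mono mult_right_mono) auto
    also have "\<dots> = \<tau> * (e * real n + C)" by (simp add: C_def algebra_simps)
    finally show ?thesis .
  qed
  then show ?thesis using C r(1) by blast
qed

text \<open>In contrast to the means, no initial stretch has to be split off: both tilts tend to 0
  uniformly in k, and \<open>tvar\<close> is continuous at 0 with value s2.\<close>

lemma svar_approx:
  assumes e: "e > 0"
  shows "\<exists>r>0. \<forall>\<tau> k. 0 < \<tau> \<longrightarrow> \<tau> \<le> r \<longrightarrow> \<bar>svar \<tau> k - 2 * s2\<bar> \<le> e"
proof -
  have "eventually (\<lambda>t. dist (tvar t) s2 < e / 2) (nhds 0)"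
    using tendstoD[OF tvar_tendsto, of "e / 2"] e by simp
  then obtain r where r: "r > 0" "\<And>t. \<bar>t\<bar> < r \<Longrightarrow> \<bar>tvar t - s2\<bar> < e / 2"
    by (auto simp: eventually_nhds_metric dist_real_def)
  let ?R = "\<rho>"
  have R: "?R > 0" using \<rho>_pos by simp
  show ?thesis
  proof (intro exI[of _ "(r / 2) / ?R"] conjI allI impI)
    show "(r / 2) / ?R > 0" using r R by simp
    fix \<tau> k assume \<tau>: "0 < \<tau>" "\<tau> \<le> (r / 2) / ?R"
    then have "\<tau> * ?R \<le> r / 2" using R by (simp add: pos_le_divide_eq)
    from tilt_small[OF \<tau>(1) this, of k]
    have "\<bar>\<tau> * q k\<bar> < r" "\<bar>\<tau> * (1 - q k)\<bar> < r" using r(1) by auto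
    from this[THEN r(2)] show "\<bar>svar \<tau> k - 2 * s2\<bar> \<le> e" unfolding svar_def by linarith
  qed
qed

end

section \<open>Sums of independent variables with exponential moments\<close>

lemma square_exp_le: "y\<^sup>2 * exp \<bar>y\<bar> \<le> 2 * exp (2 * \<bar>y :: real\<bar>)"
proof -
  have "\<bar>y\<bar> ^ 2 * exp \<bar>y\<bar> \<le> fact 2 * exp \<bar>y\<bar> * exp \<bar>y\<bar>"
    by (intro mult_right_mono power_le_fact_exp) auto
  also have "\<dots> = 2 * exp (2 * \<bar>y\<bar>)"
    by (simp add: fact_numeral exp_add[symmetric])
  finally show ?thesis by simp
qed

context prob_space
begin

context
  fixes Y :: "'a \<Rightarrow> real" and C :: real
  assumes Y [measurable]: "Y \<in> borel_measurable M"
    and int: "integrable M (\<lambda>\<omega>. exp (2 * \<bar>Y \<omega>\<bar>))"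
    and C: "expectation (\<lambda>\<omega>. exp (2 * \<bar>Y \<omega>\<bar>)) \<le> C"
begin

lemma exp_moment_power: "integrable M (\<lambda>\<omega>. \<bar>Y \<omega>\<bar> ^ p)" "expectation (\<lambda>\<omega>. \<bar>Y \<omega>\<bar> ^ p) \<le> fact p * C"
proof -
  have le: "\<bar>Y \<omega>\<bar> ^ p \<le> fact p * exp (2 * \<bar>Y \<omega>\<bar>)" for \<omega>
  proof -
    have "\<bar>Y \<omega>\<bar> ^ p \<le> fact p * exp \<bar>Y \<omega>\<bar>" by (rule power_le_fact_exp) simp
    also have "\<dots> \<le> fact p * exp (2 * \<bar>Y \<omega>\<bar>)" by simp
    finally show ?thesis .
  qed
  have i: "integrable M (\<lambda>\<omega>. fact p * exp (2 * \<bar>Y \<omega>\<bar>))" using int by simp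
  show i2: "integrable M (\<lambda>\<omega>. \<bar>Y \<omega>\<bar> ^ p)"
    by (rule Bochner_Integration.integrable_bound[OF i]) (use le in auto)
  have "expectation (\<lambda>\<omega>. \<bar>Y \<omega>\<bar> ^ p) \<le> expectation (\<lambda>\<omega>. fact p * exp (2 * \<bar>Y \<omega>\<bar>))"
    using i i2 le by (intro integral_mono) auto
  also have "\<dots> \<le> fact p * C" using C by simp
  finally show "expectation (\<lambda>\<omega>. \<bar>Y \<omega>\<bar> ^ p) \<le> fact p * C" .
qed

lemma exp_moment_integrable: "integrable M Y" "integrable M (\<lambda>\<omega>. (Y \<omega>)\<^sup>2)"
  using exp_moment_power(1)[of 1] exp_moment_power(1)[of 2] by (auto simp: integrable_abs_iff)

lemma exp_moment_abs_mean: "expectation (\<lambda>\<omega>. \<bar>Y \<omega>\<bar>) \<le> C" "\<bar>expectation Y\<bar> \<le> C"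
proof -
  show 1: "expectation (\<lambda>\<omega>. \<bar>Y \<omega>\<bar>) \<le> C" using exp_moment_power(2)[of 1] by simp
  show "\<bar>expectation Y\<bar> \<le> C" using integral_abs_bound[of M Y] 1 by linarith
qed

lemma exp_moment_C: "C \<ge> 1"
proof -
  have "1 \<le> expectation (\<lambda>\<omega>. exp (2 * \<bar>Y \<omega>\<bar>))"
    using int by (intro integral_ge_const) auto
  then show ?thesis using C by linarith
qed

lemma exp_moment_variance: "variance Y \<le> 2 * C"
  using exp_moment_power(2)[of 2] exp_moment_integrable
  by (subst variance_eq) (auto simp: fact_numeral intro: order_trans[rotated])

text \<open>A bound with quadratic exponent for \<bar>c\<bar> \<le> 1. The second-order remainder is
  at most c^2 Y^2 exp \<bar>Y\<bar>, hence at most 2 c^2 exp (2 \<bar>Y\<bar>); this is where the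
  exponent 2 in the moment assumption comes from.\<close>

lemma exp_moment_mgf:
  assumes c: "\<bar>c\<bar> \<le> 1"
  shows "(\<integral>\<^sup>+\<omega>. exp (c * Y \<omega>) \<partial>M) \<le> ennreal (exp (c * expectation Y + 2 * C * c\<^sup>2))"
proof -
  have le: "exp (c * Y \<omega>) \<le> 1 + c * Y \<omega> + c\<^sup>2 * (2 * exp (2 * \<bar>Y \<omega>\<bar>))" for \<omega>
  proof -
    have "exp (c * Y \<omega>) \<le> 1 + c * Y \<omega> + (c * Y \<omega>)\<^sup>2 * exp \<bar>c * Y \<omega>\<bar>"
      using abs_exp_diff_le[of "c * Y \<omega>"] by linarith
    also have "(c * Y \<omega>)\<^sup>2 * exp \<bar>c * Y \<omega>\<bar> \<le> (c * Y \<omega>)\<^sup>2 * exp \<bar>Y \<omega>\<bar>"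
      using c mult_right_mono[of "\<bar>c\<bar>" 1 "\<bar>Y \<omega>\<bar>"] by (intro mult_left_mono) (auto simp: abs_mult)
    also have "\<dots> = c\<^sup>2 * ((Y \<omega>)\<^sup>2 * exp \<bar>Y \<omega>\<bar>)" by (simp add: power_mult_distrib)
    also have "\<dots> \<le> c\<^sup>2 * (2 * exp (2 * \<bar>Y \<omega>\<bar>))" by (intro mult_left_mono square_exp_le) auto
    finally show ?thesis by simp
  qed
  have i: "integrable M (\<lambda>\<omega>. 1 + c * Y \<omega> + c\<^sup>2 * (2 * exp (2 * \<bar>Y \<omega>\<bar>)))"
    using int exp_moment_integrable by simp
  have "(\<integral>\<^sup>+\<omega>. exp (c * Y \<omega>) \<partial>M) \<le> (\<integral>\<^sup>+\<omega>. ennreal (1 + c * Y \<omega> + c\<^sup>2 * (2 * exp (2 * \<bar>Y \<omega>\<bar>))) \<partial>M)"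
    by (intro nn_integral_mono ennreal_leI le)
  also have "\<dots> = ennreal (expectation (\<lambda>\<omega>. 1 + c * Y \<omega> + c\<^sup>2 * (2 * exp (2 * \<bar>Y \<omega>\<bar>))))"
    by (intro nn_integral_eq_integral i AE_I2) (use le in \<open>auto intro: order_trans[OF less_imp_le[OF exp_gt_zero]]\<close>)
  also have "expectation (\<lambda>\<omega>. 1 + c * Y \<omega> + c\<^sup>2 * (2 * exp (2 * \<bar>Y \<omega>\<bar>)))
      = 1 + (c * expectation Y + 2 * expectation (\<lambda>\<omega>. exp (2 * \<bar>Y \<omega>\<bar>)) * c\<^sup>2)"
    using int exp_moment_integrable by (simp add: prob_space)
  also have "\<dots> \<le> 1 + (c * expectation Y + 2 * C * c\<^sup>2)"
    using C by (intro add_left_mono mult_right_mono mult_left_mono) auto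
  also have "\<dots> \<le> exp (c * expectation Y + 2 * C * c\<^sup>2)" by (rule exp_ge_add_one_self)
  finally show ?thesis by (simp add: ennreal_leI)
qed

end

lemma indep_sum_mgf:
  fixes Y :: "'i \<Rightarrow> 'a \<Rightarrow> real"
  assumes indep: "indep_vars (\<lambda>_. borel) Y I" and J: "finite J" "J \<subseteq> I"
    and int: "\<And>i. i \<in> I \<Longrightarrow> integrable M (\<lambda>\<omega>. exp (2 * \<bar>Y i \<omega>\<bar>))"
    and C: "\<And>i. i \<in> I \<Longrightarrow> expectation (\<lambda>\<omega>. exp (2 * \<bar>Y i \<omega>\<bar>)) \<le> C"
    and c: "\<And>i. i \<in> I \<Longrightarrow> \<bar>c i\<bar> \<le> 1"
  shows "(\<integral>\<^sup>+\<omega>. exp (\<Sum>i\<in>J. c i * Y i \<omega>) \<partial>M)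
     \<le> ennreal (exp (\<Sum>i\<in>J. c i * expectation (Y i) + 2 * C * (c i)\<^sup>2))"
proof -
  have [measurable]: "i \<in> I \<Longrightarrow> Y i \<in> borel_measurable M" for i
    using indep by (auto simp: indep_vars_def)
  have "indep_vars (\<lambda>_. borel) (\<lambda>i \<omega>. ennreal (exp (c i * Y i \<omega>))) J"
    using indep_vars_subset[OF indep J(2)] by (rule indep_vars_compose2) auto
  have "(\<integral>\<^sup>+\<omega>. exp (\<Sum>i\<in>J. c i * Y i \<omega>) \<partial>M) = (\<integral>\<^sup>+\<omega>. (\<Prod>i\<in>J. ennreal (exp (c i * Y i \<omega>))) \<partial>M)"
    using J by (simp add: exp_sum prod_ennreal)
  also have "\<dots> = (\<Prod>i\<in>J. \<integral>\<^sup>+\<omega>. ennreal (exp (c i * Y i \<omega>)) \<partial>M)"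
    by (rule indep_vars_nn_integral) (use J \<open>indep_vars _ _ J\<close> in auto)
  also have "\<dots> \<le> (\<Prod>i\<in>J. ennreal (exp (c i * expectation (Y i) + 2 * C * (c i)\<^sup>2)))"
    using J int C c by (intro prod_mono_ennreal exp_moment_mgf) auto
  also have "\<dots> = ennreal (exp (\<Sum>i\<in>J. c i * expectation (Y i) + 2 * C * (c i)\<^sup>2))"
    using J by (simp add: exp_sum prod_ennreal)
  finally show ?thesis .
qed

text \<open>The series converges only almost surely, so its exponential moment is bounded through
  those of the partial sums, by Fatou's lemma. The bound B is asked only eventually, when the
  partial sums already contain the main terms.\<close>

lemma indep_series_mgf:
  fixes Y :: "'i \<Rightarrow> 'a \<Rightarrow> real" and X :: "'a \<Rightarrow> real"
  assumes indep: "indep_vars (\<lambda>_. borel) Y I" and J: "\<And>n::nat. finite (J n)" "\<And>n. J n \<subseteq> I"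
    and int: "\<And>i. i \<in> I \<Longrightarrow> integrable M (\<lambda>\<omega>. exp (2 * \<bar>Y i \<omega>\<bar>))"
    and C: "\<And>i. i \<in> I \<Longrightarrow> expectation (\<lambda>\<omega>. exp (2 * \<bar>Y i \<omega>\<bar>)) \<le> C"
    and c: "\<And>i. i \<in> I \<Longrightarrow> \<bar>c i\<bar> \<le> 1"
    and X: "AE \<omega> in M. (\<lambda>n. \<Sum>i\<in>J n. c i * Y i \<omega>) \<longlonglongrightarrow> X \<omega>"
    and B: "\<forall>\<^sub>F n in sequentially. (\<Sum>i\<in>J n. c i * expectation (Y i) + 2 * C * (c i)\<^sup>2) \<le> B"
  shows "(\<integral>\<^sup>+\<omega>. exp (X \<omega>) \<partial>M) \<le> ennreal (exp B)"
proof -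
  have [measurable]: "i \<in> I \<Longrightarrow> Y i \<in> borel_measurable M" for i
    using indep by (auto simp: indep_vars_def)
  have [measurable]: "(\<lambda>\<omega>. \<Sum>i\<in>J n. c i * Y i \<omega>) \<in> borel_measurable M" for n
    using J(2)[of n] by (intro borel_measurable_sum borel_measurable_times borel_measurable_const) auto
  have "(\<integral>\<^sup>+\<omega>. exp (X \<omega>) \<partial>M) = (\<integral>\<^sup>+\<omega>. liminf (\<lambda>n. ennreal (exp (\<Sum>i\<in>J n. c i * Y i \<omega>))) \<partial>M)"
  proof (rule nn_integral_cong_AE)
    show "AE \<omega> in M. ennreal (exp (X \<omega>)) = liminf (\<lambda>n. ennreal (exp (\<Sum>i\<in>J n. c i * Y i \<omega>)))"
      using X
    proof eventually_elim
      case (elim \<omega>)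
      then have "(\<lambda>n. ennreal (exp (\<Sum>i\<in>J n. c i * Y i \<omega>))) \<longlonglongrightarrow> ennreal (exp (X \<omega>))"
        by (intro tendsto_intros)
      then show ?case by (rule lim_imp_Liminf[symmetric, rotated]) simp
    qed
  qed
  also have "\<dots> \<le> liminf (\<lambda>n. \<integral>\<^sup>+\<omega>. ennreal (exp (\<Sum>i\<in>J n. c i * Y i \<omega>)) \<partial>M)"
    by (rule nn_integral_liminf) measurable
  also have "\<dots> \<le> ennreal (exp B)"
  proof (rule Liminf_le)
    show "\<forall>\<^sub>F n in sequentially. (\<integral>\<^sup>+\<omega>. ennreal (exp (\<Sum>i\<in>J n. c i * Y i \<omega>)) \<partial>M) \<le> ennreal (exp B)"
      using B
    proof eventually_elim
      case (elim n)
      have "(\<integral>\<^sup>+\<omega>. ennreal (exp (\<Sum>i\<in>J n. c i * Y i \<omega>)) \<partial>M)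
          \<le> ennreal (exp (\<Sum>i\<in>J n. c i * expectation (Y i) + 2 * C * (c i)\<^sup>2))"
        using indep J int C c by (rule indep_sum_mgf)
      also have "\<dots> \<le> ennreal (exp B)" using elim by (intro ennreal_leI) simp
      finally show ?case .
    qed
  qed simp
  finally show ?thesis .
qed

end

section \<open>Central limit theorem for triangular arrays\<close>

lemma char_affine:
  assumes "prob_space M" and [measurable]: "X \<in> borel_measurable M"
  shows "char (distr M borel (\<lambda>\<omega>. a + b * X \<omega> :: real)) t = iexp (t * a) * char (distr M borel X) (b * t)"
  unfolding char_def by (simp add: integral_distr exp_add distrib_left mult_ac)

lemma char_normal:
  assumes s: "\<sigma> > 0"
  shows "char (density lborel (normal_density \<mu> \<sigma>)) t = iexp (t * \<mu>) * exp (- ((\<sigma> * t)\<^sup>2) / 2)"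
proof -
  interpret N: real_distribution std_normal_distribution by (rule real_dist_normal_dist)
  have "distributed std_normal_distribution lborel (\<lambda>x. x) (normal_density 0 1)"
    unfolding distributed_def by (auto simp: distr_id2)
  from N.normal_density_affine[OF this, of \<sigma> \<mu>] s
  have "distr std_normal_distribution lborel (\<lambda>x. \<mu> + \<sigma> * x) = density lborel (normal_density \<mu> \<sigma>)"
    by (simp add: distributed_def)
  moreover have "distr std_normal_distribution lborel (\<lambda>x. \<mu> + \<sigma> * x) = distr std_normal_distribution borel (\<lambda>x. \<mu> + \<sigma> * x)"
    by (rule distr_cong) auto
  ultimately have "density lborel (normal_density \<mu> \<sigma>) = distr std_normal_distribution borel (\<lambda>x. \<mu> + \<sigma> * x)" by simp
  then show ?thesis
    by (simp add: char_affine[OF N.prob_space_axioms, of "\<lambda>x. x"] distr_id2 char_std_normal_distribution)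
qed

text \<open>Levy's continuity theorem with an expansion of each factor. Uniform exponential moments
  control the third absolute moments, so a factor errs by O(\<bar>\<tau> t\<bar>^3); as the number
  of factors times \<tau>^2 is at most B, the total error vanishes. The probability spaces may
  change with k.\<close>

lemma triangular_clt:
  fixes M :: "nat \<Rightarrow> 'a measure" and Y :: "nat \<Rightarrow> 'i \<Rightarrow> 'a \<Rightarrow> real" and \<tau> :: "nat \<Rightarrow> real"
  assumes M: "\<And>k. prob_space (M k)"
    and indep: "\<And>k. prob_space.indep_vars (M k) (\<lambda>_. borel) (Y k) (J k)" and J: "\<And>k. finite (J k)"
    and int: "\<And>k i. i \<in> J k \<Longrightarrow> integrable (M k) (\<lambda>\<omega>. exp (2 * \<bar>Y k i \<omega>\<bar>))"
    and C: "\<And>k i. i \<in> J k \<Longrightarrow> (\<integral>\<omega>. exp (2 * \<bar>Y k i \<omega>\<bar>) \<partial>M k) \<le> C" and C0: "C \<ge> 0"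
    and \<tau>: "\<tau> \<longlonglongrightarrow> 0" and card: "\<And>k. card (J k) * (\<tau> k)\<^sup>2 \<le> B"
    and mean: "(\<lambda>k. \<tau> k * (\<Sum>i\<in>J k. (\<integral>\<omega>. Y k i \<omega> \<partial>M k))) \<longlonglongrightarrow> \<mu>"
    and var: "(\<lambda>k. (\<tau> k)\<^sup>2 * (\<Sum>i\<in>J k. prob_space.variance (M k) (Y k i))) \<longlonglongrightarrow> v" and v: "v > 0"
  shows "weak_conv_m (\<lambda>k. distr (M k) borel (\<lambda>\<omega>. \<tau> k * (\<Sum>i\<in>J k. Y k i \<omega>)))
     (density lborel (normal_density \<mu> (sqrt v)))"
proof (rule levy_continuity)
  interpret M: prob_space "M k" for k by (rule M)
  have meas [measurable]: "i \<in> J k \<Longrightarrow> Y k i \<in> borel_measurable (M k)" for i k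
    using indep[of k] by (auto simp: M.indep_vars_def)
  have sm [measurable]: "(\<lambda>\<omega>. \<Sum>i\<in>J k. Y k i \<omega>) \<in> borel_measurable (M k)" for k
    by (intro borel_measurable_sum) auto
  show "real_distribution (distr (M k) borel (\<lambda>\<omega>. \<tau> k * (\<Sum>i\<in>J k. Y k i \<omega>)))" for k
    by (rule M.real_distribution_distr) measurable
  show "real_distribution (density lborel (normal_density \<mu> (sqrt v)))"
    using v prob_space_normal_density[of "sqrt v" \<mu>]
    by (auto simp: real_distribution_def real_distribution_axioms_def)
  fix t
  define m where "m k i = (\<integral>\<omega>. Y k i \<omega> \<partial>M k)" for k i
  define w where "w k i = M.variance k (Y k i)" for k i
  define \<phi> where "\<phi> k i = char (distr (M k) borel (\<lambda>\<omega>. Y k i \<omega> - m k i)) (\<tau> k * t)" for k i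
  define s where "s k = \<bar>\<tau> k * t\<bar>" for k
  have eq: "char (distr (M k) borel (\<lambda>\<omega>. \<tau> k * (\<Sum>i\<in>J k. Y k i \<omega>))) t
      = iexp (t * (\<tau> k * (\<Sum>i\<in>J k. m k i))) * (\<Prod>i\<in>J k. \<phi> k i)" for k
  proof -
    have "(\<lambda>\<omega>. \<tau> k * (\<Sum>i\<in>J k. Y k i \<omega>))
        = (\<lambda>\<omega>. \<tau> k * (\<Sum>i\<in>J k. m k i) + \<tau> k * (\<Sum>i\<in>J k. Y k i \<omega> - m k i))"
      by (simp add: sum_subtractf algebra_simps)
    then have "char (distr (M k) borel (\<lambda>\<omega>. \<tau> k * (\<Sum>i\<in>J k. Y k i \<omega>))) t
        = iexp (t * (\<tau> k * (\<Sum>i\<in>J k. m k i))) * char (distr (M k) borel (\<lambda>\<omega>. \<Sum>i\<in>J k. Y k i \<omega> - m k i)) (\<tau> k * t)"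
      by (subst char_affine[OF M, symmetric]) auto
    also have "char (distr (M k) borel (\<lambda>\<omega>. \<Sum>i\<in>J k. Y k i \<omega> - m k i)) (\<tau> k * t) = (\<Prod>i\<in>J k. \<phi> k i)"
      unfolding \<phi>_def
      by (intro M.char_distr_sum M.indep_vars_compose2[OF indep]) auto
    finally show ?thesis .
  qed
  have w: "0 \<le> w k i" "w k i \<le> 2 * C" if i: "i \<in> J k" for k i
    unfolding w_def using i M.exp_moment_variance[OF meas int C] by (auto simp: M.variance_positive)
  \<comment> \<open>Two comparisons are chained: the characteristic function with its quadratic
    Taylor polynomial, then this polynomial with an exponential, which multiplies well over
    i.\<close>
  have approx: "cmod (\<phi> k i - exp (- ((s k)\<^sup>2 * w k i / 2))) \<le> (s k)^3 * (C * exp C) + (s k)^4 * (C\<^sup>2 * exp ((s k)\<^sup>2 * C))"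
    if i: "i \<in> J k" for k i
  proof -
    note em = M.exp_moment_integrable[OF meas[OF i] int[OF i] C[OF i]]
    have im: "integrable (M k) (\<lambda>\<omega>. (Y k i \<omega> - m k i)\<^sup>2)"
      using em by (auto simp: power2_diff)
    have "cmod (\<phi> k i - (1 - (\<tau> k * t)\<^sup>2 * w k i / 2))
        \<le> (\<tau> k * t)\<^sup>2 / 6 * (\<integral>\<omega>. min (6 * (Y k i \<omega> - m k i)\<^sup>2) (\<bar>\<tau> k * t\<bar> * \<bar>Y k i \<omega> - m k i\<bar> ^ 3) \<partial>M k)"
      unfolding \<phi>_def
      by (rule M.char_approx3') (use em im i in \<open>auto simp: m_def w_def M.prob_space\<close>)
    also have "\<dots> \<le> (\<tau> k * t)\<^sup>2 / 6 * (\<integral>\<omega>. \<bar>\<tau> k * t\<bar> * (6 * (exp C * exp (2 * \<bar>Y k i \<omega>\<bar>))) \<partial>M k)"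
    proof (intro mult_left_mono integral_mono)
      fix \<omega>
      have "\<bar>Y k i \<omega> - m k i\<bar> ^ 3 \<le> fact 3 * exp \<bar>Y k i \<omega> - m k i\<bar>"
        by (rule power_le_fact_exp) simp
      also have "\<dots> \<le> fact 3 * exp (C + 2 * \<bar>Y k i \<omega>\<bar>)"
        using M.exp_moment_abs_mean(2)[OF meas[OF i] int[OF i] C[OF i]] unfolding m_def
        by (intro mult_left_mono) auto
      also have "\<dots> = 6 * (exp C * exp (2 * \<bar>Y k i \<omega>\<bar>))" by (simp add: fact_numeral exp_add)
      finally have "\<bar>\<tau> k * t\<bar> * \<bar>Y k i \<omega> - m k i\<bar> ^ 3 \<le> \<bar>\<tau> k * t\<bar> * (6 * (exp C * exp (2 * \<bar>Y k i \<omega>\<bar>)))"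
        by (rule mult_left_mono) simp
      then show "min (6 * (Y k i \<omega> - m k i)\<^sup>2) (\<bar>\<tau> k * t\<bar> * \<bar>Y k i \<omega> - m k i\<bar> ^ 3)
          \<le> \<bar>\<tau> k * t\<bar> * (6 * (exp C * exp (2 * \<bar>Y k i \<omega>\<bar>)))" by (rule min.coboundedI2)
    next
      show "integrable (M k) (\<lambda>\<omega>. min (6 * (Y k i \<omega> - m k i)\<^sup>2) (\<bar>\<tau> k * t\<bar> * \<bar>Y k i \<omega> - m k i\<bar> ^ 3))"
        by (rule Bochner_Integration.integrable_bound[where f="\<lambda>\<omega>. 6 * (Y k i \<omega> - m k i)\<^sup>2"])
           (use im i in auto)
    qed (use int i in auto)
    also have "\<dots> = (s k)\<^sup>2 * s k * (exp C * (\<integral>\<omega>. exp (2 * \<bar>Y k i \<omega>\<bar>) \<partial>M k))"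
      by (simp add: s_def)
    also have "\<dots> \<le> (s k)\<^sup>2 * s k * (exp C * C)"
      using C[OF i] by (intro mult_left_mono) (auto simp: s_def)
    also have "\<dots> = (s k)^3 * (C * exp C)" by (simp add: power_numeral_reduce)
    finally have 1: "cmod (\<phi> k i - (1 - (\<tau> k * t)\<^sup>2 * w k i / 2)) \<le> (s k)^3 * (C * exp C)" .
    define x where "x = (s k)\<^sup>2 * w k i / 2"
    have x: "0 \<le> x" "x \<le> (s k)\<^sup>2 * C"
      using w[OF i] mult_left_mono[of "w k i" "2 * C" "(s k)\<^sup>2"] by (auto simp: x_def)
    have "\<bar>exp (- x) - 1 - (- x)\<bar> \<le> (- x)\<^sup>2 * exp \<bar>- x\<bar>" by (rule abs_exp_diff_le)
    also have "\<dots> \<le> ((s k)\<^sup>2 * C)\<^sup>2 * exp ((s k)\<^sup>2 * C)"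
      using x by (intro mult_mono) (auto intro!: power_mono)
    also have "\<dots> = (s k)^4 * (C\<^sup>2 * exp ((s k)\<^sup>2 * C))" by (simp add: power_mult_distrib flip: power_mult)
    finally have "\<bar>(1 - x) - exp (- x)\<bar> \<le> (s k)^4 * (C\<^sup>2 * exp ((s k)\<^sup>2 * C))" by linarith
    then have 2: "cmod (complex_of_real ((1 - x) - exp (- x))) \<le> (s k)^4 * (C\<^sup>2 * exp ((s k)\<^sup>2 * C))"
      by (simp only: norm_of_real)
    have "(\<tau> k * t)\<^sup>2 = (s k)\<^sup>2" by (simp add: s_def)
    then have "\<phi> k i - complex_of_real (exp (- ((s k)\<^sup>2 * w k i / 2)))
       = (\<phi> k i - complex_of_real (1 - (\<tau> k * t)\<^sup>2 * w k i / 2)) + complex_of_real ((1 - x) - exp (- x))"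
      by (simp only: x_def of_real_diff of_real_1) simp
    then show ?thesis using norm_triangle_mono[OF 1 2] by (simp only:)
  qed
  \<comment> \<open>A factor \<tau>^2 t^2 is taken out of both error terms, so that
    \<open>card (J k) * (\<tau> k)\<^sup>2 \<le> B\<close> absorbs the number of summands. What is
    left still contains a factor \<open>s k\<close>, which tends to 0.\<close>
  define G where "G k = t^2 * B * (s k * (C * exp C) + (s k)^2 * (C\<^sup>2 * exp ((s k)\<^sup>2 * C)))" for k
  have prod: "cmod ((\<Prod>i\<in>J k. \<phi> k i) - exp (- ((\<Sum>i\<in>J k. (s k)\<^sup>2 * w k i) / 2))) \<le> G k" for k
  proof -
    have "exp (- ((\<Sum>i\<in>J k. (s k)\<^sup>2 * w k i) / 2)) = (\<Prod>i\<in>J k. exp (- ((s k)\<^sup>2 * w k i / 2)))"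
      using J by (simp add: exp_sum[symmetric] sum_negf sum_divide_distrib)
    then have "cmod ((\<Prod>i\<in>J k. \<phi> k i) - exp (- ((\<Sum>i\<in>J k. (s k)\<^sup>2 * w k i) / 2)))
      = cmod ((\<Prod>i\<in>J k. \<phi> k i) - (\<Prod>i\<in>J k. complex_of_real (exp (- ((s k)\<^sup>2 * w k i / 2)))))"
      by (simp only: of_real_prod)
    also have "\<dots> \<le> (\<Sum>i\<in>J k. cmod (\<phi> k i - complex_of_real (exp (- ((s k)\<^sup>2 * w k i / 2)))))"
    proof (rule norm_prod_diff)
      fix i assume i: "i \<in> J k"
      have "real_distribution (distr (M k) borel (\<lambda>\<omega>. Y k i \<omega> - m k i))"
        using i by (intro M.real_distribution_distr) measurable
      then show "cmod (\<phi> k i) \<le> 1" unfolding \<phi>_def by (rule real_distribution.cmod_char_le_1)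
      show "cmod (complex_of_real (exp (- ((s k)\<^sup>2 * w k i / 2)))) \<le> 1"
        using w[OF i] by (simp only: norm_of_real) simp
    qed
    also have "\<dots> \<le> (\<Sum>i\<in>J k. (s k)^3 * (C * exp C) + (s k)^4 * (C\<^sup>2 * exp ((s k)\<^sup>2 * C)))"
      by (intro sum_mono) (use approx in \<open>simp add: exp_of_real\<close>)
    also have "\<dots> = (card (J k) * (\<tau> k)\<^sup>2) * (t\<^sup>2 * (s k * (C * exp C) + (s k)^2 * (C\<^sup>2 * exp ((s k)\<^sup>2 * C))))"
    proof -
      have s2: "(s k)\<^sup>2 = (\<tau> k)\<^sup>2 * t\<^sup>2" by (simp add: s_def power_mult_distrib)
      have "(s k)^3 = (\<tau> k)\<^sup>2 * t\<^sup>2 * s k" "(s k)^4 = (\<tau> k)\<^sup>2 * t\<^sup>2 * (s k)\<^sup>2"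
        unfolding s2[symmetric] by (simp_all add: power_numeral_reduce)
      then show ?thesis by (simp add: algebra_simps del: power_mult_distrib)
    qed
    also have "\<dots> \<le> B * (t\<^sup>2 * (s k * (C * exp C) + (s k)^2 * (C\<^sup>2 * exp ((s k)\<^sup>2 * C))))"
      using card[of k] C0 by (intro mult_right_mono) (auto simp: s_def)
    also have "\<dots> = G k" by (simp add: G_def)
    finally show ?thesis .
  qed
  have s0: "s \<longlonglongrightarrow> 0" unfolding s_def using \<tau> by (auto intro!: tendsto_eq_intros)
  have G0: "G \<longlonglongrightarrow> 0" unfolding G_def by (rule tendsto_eq_intros s0 | simp)+
  have ws: "(\<lambda>k. \<Sum>i\<in>J k. (s k)\<^sup>2 * w k i) \<longlonglongrightarrow> t\<^sup>2 * v"
  proof -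
    have "(\<lambda>k. t\<^sup>2 * ((\<tau> k)\<^sup>2 * (\<Sum>i\<in>J k. w k i))) \<longlonglongrightarrow> t\<^sup>2 * v"
      using var unfolding w_def by (rule tendsto_mult_left)
    moreover have "(\<Sum>i\<in>J k. (s k)\<^sup>2 * w k i) = t\<^sup>2 * ((\<tau> k)\<^sup>2 * (\<Sum>i\<in>J k. w k i))" for k
      unfolding sum_distrib_left[symmetric] by (simp add: s_def power_mult_distrib)
    ultimately show ?thesis by simp
  qed
  have "(\<lambda>k. complex_of_real (exp (- ((\<Sum>i\<in>J k. (s k)\<^sup>2 * w k i) / 2)))) \<longlonglongrightarrow> complex_of_real (exp (- (t\<^sup>2 * v / 2)))"
    by (intro tendsto_intros ws) auto
  moreover have "(\<lambda>k. (\<Prod>i\<in>J k. \<phi> k i) - complex_of_real (exp (- ((\<Sum>i\<in>J k. (s k)\<^sup>2 * w k i) / 2)))) \<longlonglongrightarrow> 0"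
    by (rule Lim_null_comparison[OF _ G0]) (use prod in \<open>simp add: exp_of_real\<close>)
  ultimately have "(\<lambda>k. \<Prod>i\<in>J k. \<phi> k i) \<longlonglongrightarrow> complex_of_real (exp (- (t\<^sup>2 * v / 2)))"
    using tendsto_add by fastforce
  moreover have "(\<lambda>k. iexp (t * (\<tau> k * (\<Sum>i\<in>J k. m k i)))) \<longlonglongrightarrow> iexp (t * \<mu>)"
    using mean unfolding m_def by (intro tendsto_intros)
  ultimately have "(\<lambda>k. char (distr (M k) borel (\<lambda>\<omega>. \<tau> k * (\<Sum>i\<in>J k. Y k i \<omega>))) t)
      \<longlonglongrightarrow> iexp (t * \<mu>) * complex_of_real (exp (- (t\<^sup>2 * v / 2)))"
    unfolding eq by (intro tendsto_mult)
  then show "(\<lambda>k. char (distr (M k) borel (\<lambda>\<omega>. \<tau> k * (\<Sum>i\<in>J k. Y k i \<omega>))) t)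
      \<longlonglongrightarrow> char (density lborel (normal_density \<mu> (sqrt v))) t"
    using v by (simp add: char_normal power_mult_distrib mult_ac)
qed

section \<open>Weak convergence of occupation times\<close>

definition occ :: "('a \<Rightarrow> real) \<Rightarrow> (sign \<Rightarrow> real \<Rightarrow> 'a \<Rightarrow> real) \<Rightarrow> real set \<Rightarrow> sign \<Rightarrow> 'a \<Rightarrow> real" where
  "occ T W I u \<omega> = (LINT t:I|lborel. of_bool (T \<omega> \<ge> W u t \<omega>))"

text \<open>What the rescaled walks and the limit have in common. The constants C and c are
  parameters, because removing the truncation uniformly requires one pair of constants for a whole
  sequence and its limit.\<close>

locale occupation = prob_space M for M :: "'a measure" +
  fixes T :: "'a \<Rightarrow> real" and W :: "sign \<Rightarrow> real \<Rightarrow> 'a \<Rightarrow> real" and C c :: real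
  assumes T_meas [measurable]: "T \<in> borel_measurable M"
    and W_joint: "\<And>u. (\<lambda>x. W u (fst x) (snd x)) \<in> borel_measurable (borel \<Otimes>\<^sub>M M)"
    and c_pos: "c > 0"
    and tail: "\<And>u t. t \<ge> 0 \<Longrightarrow> prob {\<omega>\<in>space M. T \<omega> \<ge> W u t \<omega>} \<le> C * exp (- c * t)"
begin

lemma W_measurable [measurable (raw)]:
  assumes f: "f \<in> borel_measurable N" and g: "g \<in> measurable N M"
  shows "(\<lambda>x. W u (f x) (g x)) \<in> borel_measurable N"
  using measurable_compose[OF measurable_Pair[OF f g] W_joint] by simp

lemma C_nonneg: "C \<ge> 0"
proof -
  have "0 \<le> prob {\<omega>\<in>space M. T \<omega> \<ge> W Plus 0 \<omega>}" by simp
  also have "\<dots> \<le> C" using tail[of 0 Plus] by simp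
  finally show ?thesis .
qed

lemma occ_measurable [measurable]:
  assumes [measurable]: "I \<in> sets borel"
  shows "occ T W I u \<in> borel_measurable M"
  unfolding occ_def set_lebesgue_integral_def by measurable

text \<open>This includes infinite occupation times: then both sides are 0, the left by the
  convention for non-integrable functions, the right because \<open>enn2real\<close> sends infinity
  to 0.\<close>

lemma occ_eq_nn:
  assumes [measurable]: "I \<in> sets borel" "\<omega> \<in> space M"
  shows "occ T W I u \<omega> = enn2real (\<integral>\<^sup>+t. indicator I t * of_bool (T \<omega> \<ge> W u t \<omega>) \<partial>lborel)"
proof -
  have "(\<lambda>t. indicator I t *\<^sub>R of_bool (T \<omega> \<ge> W u t \<omega>) :: real) \<in> borel_measurable lborel"
    by measurable
  then show ?thesis unfolding occ_def set_lebesgue_integral_def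
    by (subst integral_eq_nn_integral)
       (auto intro!: arg_cong[where f=enn2real] nn_integral_cong simp: indicator_def)
qed

lemma occ_nonneg: "0 \<le> occ T W I u \<omega>"
  unfolding occ_def set_lebesgue_integral_def by (intro integral_nonneg_AE) auto

lemma nn_exp_tail: "K \<ge> 0 \<Longrightarrow>
  (\<integral>\<^sup>+t. indicator {K..} t * ennreal (C * exp (- c * t)) \<partial>lborel) = ennreal (C / c * exp (- c * K))"
proof -
  assume "K \<ge> 0"
  have "((\<lambda>t. - (C / c) * exp (- c * t)) \<longlongrightarrow> 0) at_top"
    using c_pos by real_asymp
  then have "(\<integral>\<^sup>+t. ennreal (C * exp (- c * t)) * indicator {K..} t \<partial>lborel)
       = ennreal (0 - (- (C / c) * exp (- c * K)))"
    using c_pos C_nonneg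
    by (intro nn_integral_FTC_atLeast) (auto intro!: derivative_eq_intros)
  then show ?thesis by (simp add: mult.commute)
qed

text \<open>By Tonelli's theorem the expected occupation time after K is the integral of the
  exceedance probabilities, to which the tail bound applies.\<close>

lemma nn_occ_tail:
  assumes "K \<ge> 0"
  shows "(\<integral>\<^sup>+\<omega>. (\<integral>\<^sup>+t. indicator {K..} t * of_bool (T \<omega> \<ge> W u t \<omega>) \<partial>lborel) \<partial>M)
      \<le> ennreal (C / c * exp (- c * K))"
proof -
  interpret pair_sigma_finite M "lborel :: real measure" ..
  have "(\<integral>\<^sup>+\<omega>. (\<integral>\<^sup>+t. indicator {K..} t * of_bool (T \<omega> \<ge> W u t \<omega>) \<partial>lborel) \<partial>M)
      = (\<integral>\<^sup>+t. (\<integral>\<^sup>+\<omega>. indicator {K..} t * of_bool (T \<omega> \<ge> W u t \<omega>) \<partial>M) \<partial>lborel)"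
    by (rule Fubini'[symmetric]) measurable
  also have "\<dots> \<le> (\<integral>\<^sup>+t. indicator {K..} t * ennreal (C * exp (- c * t)) \<partial>lborel)"
  proof (rule nn_integral_mono)
    fix t :: real
    have "(\<integral>\<^sup>+\<omega>. of_bool (T \<omega> \<ge> W u t \<omega>) \<partial>M)
        = (\<integral>\<^sup>+\<omega>. indicator {\<omega>\<in>space M. T \<omega> \<ge> W u t \<omega>} \<omega> \<partial>M)"
      by (intro nn_integral_cong) (auto simp: indicator_def)
    also have "\<dots> = emeasure M {\<omega>\<in>space M. T \<omega> \<ge> W u t \<omega>}" by simp
    finally have "(\<integral>\<^sup>+\<omega>. of_bool (T \<omega> \<ge> W u t \<omega>) \<partial>M) = emeasure M {\<omega>\<in>space M. T \<omega> \<ge> W u t \<omega>}" .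
    moreover have "t \<ge> K \<Longrightarrow> emeasure M {\<omega>\<in>space M. T \<omega> \<ge> W u t \<omega>} \<le> ennreal (C * exp (- c * t))"
      using tail[of t u] assms by (auto simp: emeasure_eq_measure intro!: ennreal_leI)
    ultimately show "(\<integral>\<^sup>+\<omega>. indicator {K..} t * of_bool (T \<omega> \<ge> W u t \<omega>) \<partial>M)
        \<le> indicator {K..} t * ennreal (C * exp (- c * t))"
      by (auto simp: indicator_def)
  qed
  also have "\<dots> = ennreal (C / c * exp (- c * K))" by (rule nn_exp_tail) fact
  finally show ?thesis .
qed

lemma AE_occ_finite:
  "AE \<omega> in M. (\<integral>\<^sup>+t. indicator {0..} t * of_bool (T \<omega> \<ge> W u t \<omega>) \<partial>lborel) < \<infinity>"
proof -
  have "(\<integral>\<^sup>+\<omega>. (\<integral>\<^sup>+t. indicator {0..} t * of_bool (T \<omega> \<ge> W u t \<omega>) \<partial>lborel) \<partial>M) < \<infinity>"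
    using nn_occ_tail[of 0 u] by (auto simp: less_top[symmetric] top_unique)
  then have "AE \<omega> in M. (\<integral>\<^sup>+t. indicator {0..} t * of_bool (T \<omega> \<ge> W u t \<omega>) \<partial>lborel) \<noteq> \<infinity>"
    by (intro nn_integral_PInf_AE) auto
  then show ?thesis by (simp add: less_top)
qed

lemma occ_diff:
  assumes K: "K \<ge> 0"
  shows "integrable M (\<lambda>\<omega>. occ T W {0..} u \<omega>)" "integrable M (\<lambda>\<omega>. occ T W {0..K} u \<omega>)"
    and "expectation (\<lambda>\<omega>. occ T W {0..} u \<omega>) \<le> C / c"
    and "expectation (\<lambda>\<omega>. \<bar>occ T W {0..} u \<omega> - occ T W {0..K} u \<omega>\<bar>) \<le> C / c * exp (- c * K)"
proof -
  define G where "G I \<omega> = (\<integral>\<^sup>+t. indicator I t * of_bool (T \<omega> \<ge> W u t \<omega>) \<partial>lborel)" for I \<omega>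
  have [measurable]: "G I \<in> borel_measurable M" if [measurable]: "I \<in> sets borel" for I
    unfolding G_def by measurable
  have fin: "AE \<omega> in M. G {0..} \<omega> < \<infinity>" using AE_occ_finite[of u] by (simp add: G_def)
  have mono: "I \<subseteq> J \<Longrightarrow> G I \<omega> \<le> G J \<omega>" for I J \<omega>
    unfolding G_def by (intro nn_integral_mono) (auto simp: indicator_def)
  have split: "G {0..} \<omega> \<le> G {0..K} \<omega> + G {K..} \<omega>" if [measurable]: "\<omega> \<in> space M" for \<omega>
    unfolding G_def by (subst nn_integral_add[symmetric])
      (measurable, auto intro!: nn_integral_mono simp: indicator_def)
  have occ_G: "\<omega> \<in> space M \<Longrightarrow> I \<in> sets borel \<Longrightarrow> occ T W I u \<omega> = enn2real (G I \<omega>)" for I \<omega>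
    unfolding G_def by (rule occ_eq_nn)
  have e1: "(\<integral>\<^sup>+\<omega>. ennreal (occ T W {0..} u \<omega>) \<partial>M) \<le> ennreal (C / c)"
  proof -
    have "(\<integral>\<^sup>+\<omega>. ennreal (occ T W {0..} u \<omega>) \<partial>M) \<le> (\<integral>\<^sup>+\<omega>. G {0..} \<omega> \<partial>M)"
      by (intro nn_integral_mono) (auto simp: occ_G ennreal_enn2real_if)
    also have "\<dots> \<le> ennreal (C / c)" using nn_occ_tail[of 0 u] by (simp add: G_def)
    finally show ?thesis .
  qed
  have e1': "(\<integral>\<^sup>+\<omega>. ennreal (occ T W {0..K} u \<omega>) \<partial>M) \<le> ennreal (C / c)"
  proof -
    have "(\<integral>\<^sup>+\<omega>. ennreal (occ T W {0..K} u \<omega>) \<partial>M) \<le> (\<integral>\<^sup>+\<omega>. G {0..} \<omega> \<partial>M)"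
    proof (intro nn_integral_mono)
      fix \<omega> assume "\<omega> \<in> space M"
      then have "ennreal (occ T W {0..K} u \<omega>) \<le> G {0..K} \<omega>"
        by (simp add: occ_G ennreal_enn2real_if)
      also have "\<dots> \<le> G {0..} \<omega>" by (rule mono) auto
      finally show "ennreal (occ T W {0..K} u \<omega>) \<le> G {0..} \<omega>" .
    qed
    also have "\<dots> \<le> ennreal (C / c)" using nn_occ_tail[of 0 u] by (simp add: G_def)
    finally show ?thesis .
  qed
  show i1: "integrable M (\<lambda>\<omega>. occ T W {0..} u \<omega>)" 
    by (rule integrableI_nonneg) (use e1 in \<open>auto simp: occ_nonneg intro: le_less_trans\<close>)
  show i2: "integrable M (\<lambda>\<omega>. occ T W {0..K} u \<omega>)"
    by (rule integrableI_nonneg) (use e1' in \<open>auto simp: occ_nonneg intro: le_less_trans\<close>)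
  have Cc: "0 \<le> C / c" using C_nonneg c_pos by simp
  show "expectation (\<lambda>\<omega>. occ T W {0..} u \<omega>) \<le> C / c"
    using e1 nn_integral_eq_integral[OF i1] Cc by (simp add: occ_nonneg)
  have "(\<integral>\<^sup>+\<omega>. ennreal \<bar>occ T W {0..} u \<omega> - occ T W {0..K} u \<omega>\<bar> \<partial>M) \<le> (\<integral>\<^sup>+\<omega>. G {K..} \<omega> \<partial>M)"
  proof (intro nn_integral_mono_AE)
    have AEM: "AE \<omega> in M. \<omega> \<in> space M" by simp
      show "AE \<omega> in M. ennreal \<bar>occ T W {0..} u \<omega> - occ T W {0..K} u \<omega>\<bar> \<le> G {K..} \<omega>"
      using fin AEM
    proof (eventually_elim, goal_cases)
      case (1 \<omega>)
      then have \<omega>: "\<omega> \<in> space M" by simp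
      have a: "G {0..K} \<omega> < \<infinity>" "G {K..} \<omega> < \<infinity>"
        using 1 mono[of "{0..K}" "{0..}" \<omega>] mono[of "{K..}" "{0..}" \<omega>] K by (auto intro: le_less_trans)
      have "enn2real (G {0..K} \<omega>) \<le> enn2real (G {0..} \<omega>)"
        using 1 mono[of "{0..K}" "{0..}" \<omega>] by (intro enn2real_mono) auto
      moreover have "enn2real (G {0..} \<omega>) \<le> enn2real (G {0..K} \<omega>) + enn2real (G {K..} \<omega>)"
        using enn2real_mono[OF split[OF \<omega>]] a by (simp add: enn2real_plus)
      ultimately have "\<bar>occ T W {0..} u \<omega> - occ T W {0..K} u \<omega>\<bar> \<le> enn2real (G {K..} \<omega>)"
        using \<omega> by (simp add: occ_G)
      then show ?case using a(2) by (metis ennreal_enn2real ennreal_leI infinity_ennreal_def)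
    qed
  qed
  also have "\<dots> \<le> ennreal (C / c * exp (- c * K))" using nn_occ_tail[OF K, of u] by (simp add: G_def)
  finally have "(\<integral>\<^sup>+\<omega>. ennreal \<bar>occ T W {0..} u \<omega> - occ T W {0..K} u \<omega>\<bar> \<partial>M) \<le> ennreal (C / c * exp (- c * K))" .
  then show "expectation (\<lambda>\<omega>. \<bar>occ T W {0..} u \<omega> - occ T W {0..K} u \<omega>\<bar>) \<le> C / c * exp (- c * K)"
    using nn_integral_eq_integral[of M "\<lambda>\<omega>. \<bar>occ T W {0..} u \<omega> - occ T W {0..K} u \<omega>\<bar>"] i1 i2
      ennreal_le_iff[of "C / c * exp (- c * K)"] mult_nonneg_nonneg[OF Cc, of "exp (- c * K)"]
    by (simp del: times_divide_eq_left)
qed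

lemma occ_le: "K \<ge> 0 \<Longrightarrow> \<omega> \<in> space M \<Longrightarrow> occ T W {0..K} u \<omega> \<le> K"
proof -
  assume K: "K \<ge> 0" and [measurable]: "\<omega> \<in> space M"
  have "occ T W {0..K} u \<omega> \<le> (LINT t:{0..K}|lborel. 1)"
    unfolding occ_def set_lebesgue_integral_def
    by (intro integral_mono integrable_real_mult_indicator) 
       (auto simp: indicator_def emeasure_lborel_Icc_eq intro!: integrable_real_indicator Bochner_Integration.integrable_bound[where f="indicator {0..K} :: real \<Rightarrow> real"])
  also have "\<dots> = K" using K by (simp add: set_lebesgue_integral_def)
  finally show ?thesis .
qed

end

section \<open>Mixed moments of truncated occupation times\<close>

abbreviation box_measure :: "nat \<Rightarrow> real \<Rightarrow> (nat \<Rightarrow> real) measure" where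
  "box_measure n K \<equiv> \<Pi>\<^sub>M i\<in>{..<n}. restrict_space lborel {0..K}"

lemma finite_restrict_Icc: "finite_measure (restrict_space lborel {0..K::real})"
  by (rule finite_measureI) (auto simp: emeasure_restrict_space space_restrict_space emeasure_lborel_Icc_eq)

lemma finite_box_measure: "finite_measure (box_measure n K)"
proof -
  let ?L = "restrict_space lborel {0..K} :: real measure"
  interpret L: product_sigma_finite "\<lambda>i::nat. ?L"
    unfolding product_sigma_finite_def using finite_restrict_Icc by (simp add: finite_measure.axioms)
  have "emeasure (box_measure n K) (space (box_measure n K)) = (\<Prod>i<n. emeasure ?L (space ?L))"
    unfolding space_PiM by (rule L.emeasure_PiM) (simp_all only: finite_lessThan sets.top)
  also have "\<dots> \<noteq> \<infinity>"
    using finite_measure.emeasure_finite[OF finite_restrict_Icc[of K]]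
    by (simp add: ennreal_prod_eq_top power_eq_top_ennreal)
  finally show ?thesis by (rule finite_measureI)
qed

lemma measurable_box_component [measurable (raw)]:
  "i < n \<Longrightarrow> (\<lambda>x. x i) \<in> borel_measurable (box_measure n K)"
  using measurable_compose[OF measurable_component_singleton[of i "{..<n}" "\<lambda>i. restrict_space lborel {0..K}"],
      of "\<lambda>x. x" borel]
  by (simp add: measurable_restrict_space1)

context occupation
begin

lemma joint_indicator_measurable:
  "(\<lambda>(\<omega>, t). \<Prod>i<n. of_bool (T \<omega> \<ge> W (s i) (t i) \<omega>) :: real)
     \<in> borel_measurable (M \<Otimes>\<^sub>M box_measure n K)"
  unfolding split_beta'
proof (rule borel_measurable_prod)
  fix i assume i: "i \<in> {..<n}"
  have [measurable]: "(\<lambda>x. snd x i) \<in> borel_measurable (M \<Otimes>\<^sub>M box_measure n K)"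
    using measurable_compose[OF measurable_snd measurable_box_component[of i n K]] i by simp
  show "(\<lambda>x. of_bool (W (s i) (snd x i) (fst x) \<le> T (fst x)) :: real)
      \<in> borel_measurable (M \<Otimes>\<^sub>M box_measure n K)"
    by measurable
qed

lemma expectation_joint_indicator:
  "expectation (\<lambda>\<omega>. \<Prod>i<n. of_bool (T \<omega> \<ge> W (s i) (t i) \<omega>) :: real)
     = prob {\<omega>\<in>space M. \<forall>i<n. T \<omega> \<ge> W (s i) (t i) \<omega>}" for n :: nat
proof -
  have "expectation (\<lambda>\<omega>. \<Prod>i<n. of_bool (T \<omega> \<ge> W (s i) (t i) \<omega>) :: real)
      = expectation (\<lambda>\<omega>. indicator {\<omega>\<in>space M. \<forall>i<n. T \<omega> \<ge> W (s i) (t i) \<omega>} \<omega>)"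
  proof (rule Bochner_Integration.integral_cong[OF refl])
    fix \<omega> assume "\<omega> \<in> space M"
    moreover have "(\<Prod>i<n. of_bool (P i)) = (of_bool (\<forall>i<n. P i) :: real)" for P
      by (induction n) (auto simp: less_Suc_eq)
    ultimately show "(\<Prod>i<n. of_bool (T \<omega> \<ge> W (s i) (t i) \<omega>) :: real)
        = (indicator {\<omega>\<in>space M. \<forall>i<n. T \<omega> \<ge> W (s i) (t i) \<omega>} \<omega> :: real)"
      by (simp add: indicator_def)
  qed
  then show ?thesis by simp
qed

lemma prob_joint_measurable:
  "(\<lambda>t. prob {\<omega>\<in>space M. \<forall>i<n. T \<omega> \<ge> W (s i) (t i) \<omega>}) \<in> borel_measurable (box_measure n K)"
proof -
  have "(\<lambda>(t, \<omega>). \<Prod>i<n. of_bool (T \<omega> \<ge> W (s i) (t i) \<omega>) :: real)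
      \<in> borel_measurable (box_measure n K \<Otimes>\<^sub>M M)"
    using measurable_compose[OF measurable_pair_swap' joint_indicator_measurable[where n=n and s=s and K=K]]
    by (simp add: split_beta')
  from borel_measurable_lebesgue_integral[OF this] show ?thesis
    by (simp only: expectation_joint_indicator)
qed

text \<open>A product of n integrals over [0, K] is one integral over the box, with a separate time
  variable for each factor. After exchanging it with the expectation, only joint probabilities at n
  fixed times remain.\<close>

lemma occ_moment:
  fixes s :: "nat \<Rightarrow> sign"
  shows "expectation (\<lambda>\<omega>. \<Prod>i<n. occ T W {0..K} (s i) \<omega>)
       = (\<integral>t. prob {\<omega>\<in>space M. \<forall>i<n. T \<omega> \<ge> W (s i) (t i) \<omega>} \<partial>box_measure n K)"
proof -
  let ?L = "restrict_space lborel {0..K} :: real measure"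
  interpret L: product_sigma_finite "\<lambda>i::nat. ?L"
    unfolding product_sigma_finite_def using finite_restrict_Icc by (simp add: finite_measure.axioms)
  interpret P: finite_measure "box_measure n K" by (rule finite_box_measure)
  interpret PP: pair_sigma_finite M "box_measure n K" ..
  have int: "integrable (M \<Otimes>\<^sub>M box_measure n K)
      (\<lambda>(\<omega>, t). \<Prod>i<n. of_bool (T \<omega> \<ge> W (s i) (t i) \<omega>) :: real)"
  proof (rule finite_measure.integrable_const_bound[where B=1])
    show "finite_measure (M \<Otimes>\<^sub>M box_measure n K)"
      by (intro finite_measure_pair_measure finite_box_measure) unfold_locales
  qed (use joint_indicator_measurable in \<open>auto intro!: AE_I2 prod_le_1 simp: abs_prod\<close>)
  have "expectation (\<lambda>\<omega>. \<Prod>i<n. occ T W {0..K} (s i) \<omega>)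
      = expectation (\<lambda>\<omega>. \<integral>t. (\<Prod>i<n. of_bool (T \<omega> \<ge> W (s i) (t i) \<omega>)) \<partial>box_measure n K)"
  proof (rule Bochner_Integration.integral_cong[OF refl])
    fix \<omega> assume [measurable]: "\<omega> \<in> space M"
    have "(\<Prod>i<n. occ T W {0..K} (s i) \<omega>) = (\<Prod>i<n. \<integral>t. of_bool (T \<omega> \<ge> W (s i) t \<omega>) \<partial>?L)"
      unfolding occ_def set_lebesgue_integral_def by (subst integral_restrict_space) auto
    also have "\<dots> = (\<integral>t. (\<Prod>i<n. of_bool (T \<omega> \<ge> W (s i) (t i) \<omega>)) \<partial>box_measure n K)"
    proof (rule L.product_integral_prod[symmetric])
      show "integrable ?L (\<lambda>t. of_bool (T \<omega> \<ge> W (s i) t \<omega>) :: real)" for i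
        by (rule finite_measure.integrable_const_bound[OF finite_restrict_Icc, where B=1])
           (auto intro!: measurable_restrict_space1)
    qed simp
    finally show "(\<Prod>i<n. occ T W {0..K} (s i) \<omega>)
        = (\<integral>t. (\<Prod>i<n. of_bool (T \<omega> \<ge> W (s i) (t i) \<omega>)) \<partial>box_measure n K)" .
  qed
  also have "\<dots> = (\<integral>t. expectation (\<lambda>\<omega>. \<Prod>i<n. of_bool (T \<omega> \<ge> W (s i) (t i) \<omega>)) \<partial>box_measure n K)"
    by (rule PP.Fubini_integral[OF int, symmetric])
  finally show ?thesis by (simp add: expectation_joint_indicator)
qed

end

section \<open>Polynomials in two variables and truncation of test functions\<close>

definition coord :: "sign \<Rightarrow> real \<times> real \<Rightarrow> real" where
  "coord u p = (case u of Minus \<Rightarrow> fst p | Plus \<Rightarrow> snd p)"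

text \<open>Polynomials generated by monomials that are words in the two coordinates. A word lists
  which occupation time each factor is, which is the form that \<open>occ_moment\<close>
  evaluates.\<close>

inductive bipoly :: "(real \<times> real \<Rightarrow> real) \<Rightarrow> bool" where
  mono: "bipoly (\<lambda>p. c * (\<Prod>u\<leftarrow>us. coord u p))"
| add: "bipoly f \<Longrightarrow> bipoly g \<Longrightarrow> bipoly (\<lambda>p. f p + g p)"

lemma bipoly_mult: "bipoly f \<Longrightarrow> bipoly g \<Longrightarrow> bipoly (\<lambda>p. f p * g p)"
proof (induction f rule: bipoly.induct)
  case (mono c us)
  from mono show ?case
  proof (induction g rule: bipoly.induct)
    case (mono d vs)
    then show ?case using bipoly.mono[of "c * d" "us @ vs"] by (simp add: mult_ac)
  next
    case (add f g)
    then show ?case using bipoly.add by (simp add: distrib_left)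
  qed
next
  case (add f1 f2)
  then show ?case using bipoly.add by (simp add: distrib_right)
qed

lemma coord_continuous [continuous_intros]: "continuous_on S (coord u)"
  unfolding coord_def by (cases u) (auto intro!: continuous_intros)

lemma bipoly_continuous: "bipoly f \<Longrightarrow> continuous_on S f"
proof (induction rule: bipoly.induct)
  case (mono c us)
  then show ?case
    by (induction us) (auto intro!: continuous_intros simp: mult.left_commute[of c])
qed (auto intro!: continuous_intros)

lemma bipoly_dense:
  fixes f :: "real \<times> real \<Rightarrow> real"
  assumes "compact S" "continuous_on S f" "e > 0"
  shows "\<exists>g. bipoly g \<and> (\<forall>x\<in>S. \<bar>f x - g x\<bar> < e)"
proof (rule Stone_Weierstrass_HOL[where P=bipoly])
  fix x y :: "real \<times> real" assume "x \<in> S \<and> y \<in> S \<and> x \<noteq> y"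
  then have "coord Minus x \<noteq> coord Minus y \<or> coord Plus x \<noteq> coord Plus y"
    by (auto simp: coord_def prod_eq_iff)
  moreover have "bipoly (coord u)" for u
    using bipoly.mono[of 1 "[u]"] by simp
  ultimately show "\<exists>f. bipoly f \<and> f x \<noteq> f y" by blast
next
  show "bipoly (\<lambda>x. c)" for c using bipoly.mono[of c "[]"] by simp
qed (use assms bipoly_continuous bipoly_mult bipoly.add in auto)

text \<open>The error terms are linear so that first moments control their expectations.\<close>

lemma clamp_approx:
  fixes f :: "real \<times> real \<Rightarrow> real"
  assumes cont: "continuous_on UNIV f" and B: "\<And>x. \<bar>f x\<bar> \<le> B" and e: "e > 0"
  shows "\<exists>g Q. continuous_on UNIV g \<and> (\<forall>x. \<bar>g x\<bar> \<le> B) \<and> Q \<ge> 0 \<and>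
    (\<forall>x y x' y'. 0 \<le> x \<longrightarrow> 0 \<le> y \<longrightarrow> 0 \<le> x' \<longrightarrow> 0 \<le> y' \<longrightarrow>
      \<bar>f (x, y) - g (x', y')\<bar> \<le> e * (1 + x + y) + Q * (\<bar>x - x'\<bar> + \<bar>y - y'\<bar>))"
proof -
  have B0: "B \<ge> 0" using B[of 0] by linarith
  \<comment> \<open>Outside the square [0, R]^2 the sum x + y is at least R, and then
    \<open>e * (x + y)\<close> covers 2 B, the largest possible difference of two values.\<close>
  define R where "R = 2 * B / e + 1"
  have R: "R > 0" using B0 e by (simp add: R_def add_nonneg_pos)
  define k :: "real \<Rightarrow> real" where "k x = max 0 (min x R)" for x
  have k: "k x \<in> {0..R}" "\<bar>k x - k y\<bar> \<le> \<bar>x - y\<bar>" for x y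
    using R by (auto simp: k_def)
  define g where "g p = f (k (fst p), k (snd p))" for p
  have gc: "continuous_on UNIV g"
    unfolding g_def k_def
    by (intro continuous_on_compose2[OF cont]) (auto intro!: continuous_intros)
  have "uniformly_continuous_on ({0..R} \<times> {0..R}) f"
    by (intro compact_uniformly_continuous continuous_on_subset[OF cont] compact_Times) auto
  then obtain d where d: "d > 0" and dd: "\<And>p q. p \<in> {0..R} \<times> {0..R} \<Longrightarrow> q \<in> {0..R} \<times> {0..R} \<Longrightarrow>
      dist q p < d \<Longrightarrow> dist (f q) (f p) < e"
    using e unfolding uniformly_continuous_on_def by metis
  \<comment> \<open>For arguments at distance at least d the difference is bounded trivially by 2 B;
    this slope makes the linear term cover it.\<close>
  define Q where "Q = 2 * B / d"
  have Q: "Q \<ge> 0" using B0 d by (simp add: Q_def)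
  have 1: "\<bar>g (x, y) - g (x', y')\<bar> \<le> e + Q * (\<bar>x - x'\<bar> + \<bar>y - y'\<bar>)" for x y x' y'
  proof (cases "\<bar>x - x'\<bar> + \<bar>y - y'\<bar> < d")
    case True
    have "dist (k x, k y) (k x', k y') \<le> \<bar>k x - k x'\<bar> + \<bar>k y - k y'\<bar>"
      using norm_Pair_le[of "k x - k x'" "k y - k y'"] by (simp add: dist_norm)
    also have "\<dots> < d" using True k(2)[of x x'] k(2)[of y y'] by linarith
    finally have "dist (f (k x, k y)) (f (k x', k y')) < e"
      using k by (intro dd) auto
    moreover have "0 \<le> Q * (\<bar>x - x'\<bar> + \<bar>y - y'\<bar>)" using Q by simp
    ultimately show ?thesis by (simp add: g_def dist_real_def)
  next
    case False
    then have "2 * B \<le> Q * (\<bar>x - x'\<bar> + \<bar>y - y'\<bar>)"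
      using mult_left_mono[of d "\<bar>x - x'\<bar> + \<bar>y - y'\<bar>" Q] Q d by (simp add: Q_def)
    moreover have "\<bar>g (x, y) - g (x', y')\<bar> \<le> 2 * B"
      using B[of "(k x, k y)"] B[of "(k x', k y')"] by (simp add: g_def)
    ultimately show ?thesis using e by linarith
  qed
  have 2: "\<bar>f (x, y) - g (x, y)\<bar> \<le> e * (x + y)" if "0 \<le> x" "0 \<le> y" for x y
  proof (cases "x \<le> R \<and> y \<le> R")
    case True
    then show ?thesis using that e by (simp add: g_def k_def)
  next
    case False
    then have "R \<le> x + y" using that by auto
    then have "e * R \<le> e * (x + y)" using e by simp
    moreover have "2 * B \<le> e * R" using e by (simp add: R_def field_simps)
    moreover have "\<bar>f (x, y) - g (x, y)\<bar> \<le> 2 * B"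
      using B[of "(k x, k y)"] B[of "(x, y)"] by (simp add: g_def)
    ultimately show ?thesis by linarith
  qed
  show ?thesis
  proof (intro exI[of _ g] exI[of _ Q] conjI allI impI)
    fix x y x' y' :: real assume "0 \<le> x" "0 \<le> y"
    then show "\<bar>f (x, y) - g (x', y')\<bar> \<le> e * (1 + x + y) + Q * (\<bar>x - x'\<bar> + \<bar>y - y'\<bar>)"
      using 1[of x y x' y'] 2[of x y] by (simp add: distrib_left)
  qed (use gc Q B in \<open>auto simp: g_def\<close>)
qed

definition occ_pair :: "('a \<Rightarrow> real) \<Rightarrow> (sign \<Rightarrow> real \<Rightarrow> 'a \<Rightarrow> real) \<Rightarrow> real set \<Rightarrow> 'a \<Rightarrow> real \<times> real" where
  "occ_pair T W I \<omega> = (occ T W I Minus \<omega>, occ T W I Plus \<omega>)"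

lemma coord_occ_pair [simp]: "coord u (occ_pair T W I \<omega>) = occ T W I u \<omega>"
  by (cases u) (auto simp: coord_def occ_pair_def)

context occupation
begin

lemma occ_pair_measurable [measurable]:
  assumes [measurable]: "I \<in> sets borel"
  shows "occ_pair T W I \<in> borel_measurable M"
  unfolding occ_pair_def by measurable

lemma integrable_cont_occ_pair:
  assumes "continuous_on UNIV f" "\<And>x. \<bar>f x\<bar> \<le> (B::real)" "I \<in> sets borel"
  shows "integrable M (\<lambda>\<omega>. f (occ_pair T W I \<omega>))"
  using assms measurable_compose[OF occ_pair_measurable borel_measurable_continuous_onI]
  by (intro integrable_const_bound[where B=B]) auto

lemma integrable_cont_occ_pair_box:
  fixes f :: "real \<times> real \<Rightarrow> real"
  assumes f: "continuous_on UNIV f" and K: "K \<ge> 0"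
  shows "integrable M (\<lambda>\<omega>. f (occ_pair T W {0..K} \<omega>))"
proof -
  have "bounded (f ` ({0..K} \<times> {0..K}))"
    by (intro compact_imp_bounded compact_continuous_image compact_Times continuous_on_subset[OF f]) auto
  then obtain B where B: "\<And>x. x \<in> {0..K} \<times> {0..K} \<Longrightarrow> \<bar>f x\<bar> \<le> B"
    unfolding bounded_iff by auto
  show ?thesis
    using measurable_compose[OF occ_pair_measurable borel_measurable_continuous_onI[OF f]] K
    by (intro integrable_const_bound[where B=B])
       (auto intro!: B simp: occ_pair_def occ_nonneg occ_le)
qed

lemma clamp_approx_expectation:
  assumes fc: "continuous_on UNIV f" and fB: "\<And>x. \<bar>f x\<bar> \<le> B"
    and gc: "continuous_on UNIV g" and gB: "\<And>x. \<bar>g x\<bar> \<le> B"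
    and fg: "\<forall>x y x' y'. 0 \<le> x \<longrightarrow> 0 \<le> y \<longrightarrow> 0 \<le> x' \<longrightarrow> 0 \<le> y' \<longrightarrow>
      \<bar>f (x, y) - g (x', y')\<bar> \<le> e * (1 + x + y) + Q * (\<bar>x - x'\<bar> + \<bar>y - y'\<bar>)"
    and e: "e > 0" and Q: "Q \<ge> 0" and K: "K \<ge> 0"
  shows "\<bar>expectation (\<lambda>\<omega>. f (occ_pair T W {0..} \<omega>)) - expectation (\<lambda>\<omega>. g (occ_pair T W {0..K} \<omega>))\<bar>
     \<le> e * (1 + 2 * (C / c)) + Q * (2 * (C / c * exp (- c * K)))"
proof -
  let ?O = "\<lambda>u \<omega>. occ T W {0..} u \<omega>" and ?D = "\<lambda>u \<omega>. \<bar>occ T W {0..} u \<omega> - occ T W {0..K} u \<omega>\<bar>"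
  note [intro, simp] = occ_diff(1)[OF K] occ_diff(2)[OF K]
  have i1: "integrable M (\<lambda>\<omega>. f (occ_pair T W {0..} \<omega>))" by (rule integrable_cont_occ_pair[OF fc fB]) simp
  have i2: "integrable M (\<lambda>\<omega>. g (occ_pair T W {0..K} \<omega>))" by (rule integrable_cont_occ_pair[OF gc gB]) simp
  have "\<bar>expectation (\<lambda>\<omega>. f (occ_pair T W {0..} \<omega>)) - expectation (\<lambda>\<omega>. g (occ_pair T W {0..K} \<omega>))\<bar>
      = \<bar>expectation (\<lambda>\<omega>. f (occ_pair T W {0..} \<omega>) - g (occ_pair T W {0..K} \<omega>))\<bar>"
    using i1 i2 by simp
  also have "\<dots> \<le> expectation (\<lambda>\<omega>. \<bar>f (occ_pair T W {0..} \<omega>) - g (occ_pair T W {0..K} \<omega>)\<bar>)"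
    by (rule integral_abs_bound)
  also have "\<dots> \<le> expectation (\<lambda>\<omega>. e * (1 + ?O Minus \<omega> + ?O Plus \<omega>) + Q * (?D Minus \<omega> + ?D Plus \<omega>))"
    using i1 i2 by (intro integral_mono) (auto simp: occ_pair_def occ_nonneg intro!: fg[rule_format])
  also have "\<dots> = e * (1 + expectation (?O Minus) + expectation (?O Plus))
       + Q * (expectation (?D Minus) + expectation (?D Plus))"
    by (simp add: prob_space)
  also have "\<dots> \<le> e * (1 + 2 * (C / c)) + Q * (2 * (C / c * exp (- c * K)))"
  proof (rule add_mono; rule mult_left_mono)
    show "1 + expectation (?O Minus) + expectation (?O Plus) \<le> 1 + 2 * (C / c)"
      using occ_diff(3)[OF K, of Minus] occ_diff(3)[OF K, of Plus] by linarith
    show "expectation (?D Minus) + expectation (?D Plus) \<le> 2 * (C / c * exp (- c * K))"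
      using occ_diff(4)[OF K, of Minus] occ_diff(4)[OF K, of Plus] by linarith
  qed (use e Q in auto)
  finally show ?thesis .
qed

end

text \<open>Polynomials are handled only for truncated times, on which they are bounded, and the
  Stone-Weierstrass theorem extends the convergence to continuous functions on the square [0, K]^2.
  \<open>clamp_approx\<close> then compares a bounded continuous function of the full times with one
  of the truncated times.\<close>

lemma occ_weak_limit:
  fixes M :: "nat \<Rightarrow> 'm measure" and N :: "'n measure" and f :: "real \<times> real \<Rightarrow> real"
  assumes pre: "\<And>k. occupation (M k) (T k) (W k) C c" and lim: "occupation N T' W' C c"
    and conv: "\<And>n (s :: nat \<Rightarrow> sign) t. (\<And>i. i < n \<Longrightarrow> t i \<ge> 0) \<Longrightarrow>
      (\<lambda>k. measure (M k) {\<omega>\<in>space (M k). \<forall>i<n. T k \<omega> \<ge> W k (s i) (t i) \<omega>})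
        \<longlonglongrightarrow> measure N {\<omega>\<in>space N. \<forall>i<n. T' \<omega> \<ge> W' (s i) (t i) \<omega>}"
    and f: "continuous_on UNIV f" and fB: "\<And>x. \<bar>f x\<bar> \<le> B"
  shows "(\<lambda>k. \<integral>\<omega>. f (occ_pair (T k) (W k) {0..} \<omega>) \<partial>M k)
     \<longlonglongrightarrow> (\<integral>\<omega>. f (occ_pair T' W' {0..} \<omega>) \<partial>N)"
proof -
  interpret pre: occupation "M k" "T k" "W k" C c for k by (rule pre)
  interpret lim: occupation N T' W' C c by (rule lim)
  have poly: "bipoly g \<Longrightarrow> (\<lambda>k. \<integral>\<omega>. g (occ_pair (T k) (W k) {0..K} \<omega>) \<partial>M k)
      \<longlonglongrightarrow> (\<integral>\<omega>. g (occ_pair T' W' {0..K} \<omega>) \<partial>N)" if K: "K \<ge> 0" for g K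
  proof (induction g rule: bipoly.induct)
    case (mono a us)
    let ?n = "length us" and ?s = "\<lambda>i. us ! i"
    have e: "(\<Prod>u\<leftarrow>us. h u) = (\<Prod>i<?n. h (?s i))" for h :: "sign \<Rightarrow> real"
      by (simp add: prod.list_conv_set_nth atLeast0LessThan)
    interpret P: finite_measure "box_measure ?n K" by (rule finite_box_measure)
    have "(\<lambda>k. \<integral>t. measure (M k) {\<omega>\<in>space (M k). \<forall>i<?n. T k \<omega> \<ge> W k (?s i) (t i) \<omega>} \<partial>box_measure ?n K)
        \<longlonglongrightarrow> (\<integral>t. measure N {\<omega>\<in>space N. \<forall>i<?n. T' \<omega> \<ge> W' (?s i) (t i) \<omega>} \<partial>box_measure ?n K)"
    proof (rule integral_dominated_convergence[where w="\<lambda>_. 1"])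
      show "AE t in box_measure ?n K. (\<lambda>k. measure (M k) {\<omega>\<in>space (M k). \<forall>i<?n. T k \<omega> \<ge> W k (?s i) (t i) \<omega>})
          \<longlonglongrightarrow> measure N {\<omega>\<in>space N. \<forall>i<?n. T' \<omega> \<ge> W' (?s i) (t i) \<omega>}"
        by (intro AE_I2 conv) (auto simp: space_PiM PiE_iff space_restrict_space)
      show "integrable (box_measure ?n K) (\<lambda>_. 1 :: real)" by simp
      show "AE t in box_measure ?n K.
          norm (measure (M k) {\<omega>\<in>space (M k). \<forall>i<?n. T k \<omega> \<ge> W k (?s i) (t i) \<omega>}) \<le> 1" for k
        by (intro AE_I2) (simp add: pre.prob_le_1)
    qed (fact pre.prob_joint_measurable lim.prob_joint_measurable)+
    then show ?case
      by (auto simp: e pre.occ_moment lim.occ_moment intro!: tendsto_mult_left)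
  next
    case (add g h)
    have ig: "integrable (M k) (\<lambda>\<omega>. f (occ_pair (T k) (W k) {0..K} \<omega>))"
      "integrable N (\<lambda>\<omega>. f (occ_pair T' W' {0..K} \<omega>))" if "bipoly f" for f k
      by (rule pre.integrable_cont_occ_pair_box lim.integrable_cont_occ_pair_box;
          use bipoly_continuous[OF that] K in simp)+
    show ?case using add by (auto simp: ig intro!: tendsto_add)
  qed
  have trunc: "(\<lambda>k. \<integral>\<omega>. g (occ_pair (T k) (W k) {0..K} \<omega>) \<partial>M k)
      \<longlonglongrightarrow> (\<integral>\<omega>. g (occ_pair T' W' {0..K} \<omega>) \<partial>N)"
    if K: "K \<ge> 0" and g: "continuous_on UNIV g" for g :: "real \<times> real \<Rightarrow> real" and K
  proof (rule tendstoI)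
    fix e :: real assume e: "e > 0"
    have cont: "continuous_on ({0..K} \<times> {0..K}) g" by (rule continuous_on_subset[OF g]) simp
    obtain h where h: "bipoly h" and hb: "\<And>x. x \<in> {0..K} \<times> {0..K} \<Longrightarrow> \<bar>g x - h x\<bar> < e / 3"
      using bipoly_dense[OF _ cont, of "e / 3"] e by (auto simp: compact_Times)
    note hc = bipoly_continuous[OF h, of UNIV]
    have close: "\<bar>(\<integral>\<omega>. g (occ_pair Tx Wx {0..K} \<omega>) \<partial>L) - (\<integral>\<omega>. h (occ_pair Tx Wx {0..K} \<omega>) \<partial>L)\<bar> \<le> e / 3"
      if "occupation L Tx Wx C c" for L :: "'z measure" and Tx Wx
    proof -
      interpret L: occupation L Tx Wx C c by fact
      note i = L.integrable_cont_occ_pair_box[OF g K] L.integrable_cont_occ_pair_box[OF hc K]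
      have "\<bar>(\<integral>\<omega>. g (occ_pair Tx Wx {0..K} \<omega>) \<partial>L) - (\<integral>\<omega>. h (occ_pair Tx Wx {0..K} \<omega>) \<partial>L)\<bar>
          = \<bar>\<integral>\<omega>. g (occ_pair Tx Wx {0..K} \<omega>) - h (occ_pair Tx Wx {0..K} \<omega>) \<partial>L\<bar>"
        using i by simp
      also have "\<dots> \<le> (\<integral>\<omega>. \<bar>g (occ_pair Tx Wx {0..K} \<omega>) - h (occ_pair Tx Wx {0..K} \<omega>)\<bar> \<partial>L)"
        by (rule integral_abs_bound)
      also have "\<dots> \<le> (\<integral>\<omega>. e / 3 \<partial>L)"
      proof (intro integral_mono)
        fix \<omega> assume "\<omega> \<in> space L"
        then have "occ_pair Tx Wx {0..K} \<omega> \<in> {0..K} \<times> {0..K}"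
          using K by (auto simp: occ_pair_def L.occ_nonneg L.occ_le)
        from hb[OF this] show "\<bar>g (occ_pair Tx Wx {0..K} \<omega>) - h (occ_pair Tx Wx {0..K} \<omega>)\<bar> \<le> e / 3"
          by (rule less_imp_le)
      qed (use i in auto)
      finally show ?thesis by (simp add: L.prob_space)
    qed
    have "eventually (\<lambda>k. dist (\<integral>\<omega>. h (occ_pair (T k) (W k) {0..K} \<omega>) \<partial>M k)
       (\<integral>\<omega>. h (occ_pair T' W' {0..K} \<omega>) \<partial>N) < e / 3) sequentially"
      using tendstoD[OF poly[OF K h], of "e / 3"] e by simp
    then show "eventually (\<lambda>k. dist (\<integral>\<omega>. g (occ_pair (T k) (W k) {0..K} \<omega>) \<partial>M k)
       (\<integral>\<omega>. g (occ_pair T' W' {0..K} \<omega>) \<partial>N) < e) sequentially"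
    proof eventually_elim
      case (elim k)
      then show ?case using close[OF pre, of k] close[OF lim] unfolding dist_real_def by linarith
    qed
  qed
  show ?thesis
  proof (rule tendstoI)
    fix e :: real assume e: "e > 0"
    have Cc: "C / c \<ge> 0" using lim.C_nonneg lim.c_pos by simp
    define D where "D = 1 + 2 * (C / c)"
    \<comment> \<open>\<open>D\<close> bounds 1 plus the two mean occupation times, so the error
      term that is linear in them is at most e / 8.\<close>
    define e' where "e' = e / (8 * D)"
    have "D > 0" using Cc unfolding D_def by linarith
    then have "e' > 0" "e' * D = e / 8" using e by (simp_all add: e'_def)
    then have e': "e' > 0" "e' * (1 + 2 * (C / c)) = e / 8" unfolding D_def by auto
    obtain g Q where g: "continuous_on UNIV g" "\<And>x. \<bar>g x\<bar> \<le> B" and Q: "Q \<ge> 0"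
      and fg: "\<forall>x y x' y'. 0 \<le> x \<longrightarrow> 0 \<le> y \<longrightarrow> 0 \<le> x' \<longrightarrow> 0 \<le> y' \<longrightarrow>
      \<bar>f (x, y) - g (x', y')\<bar> \<le> e' * (1 + x + y) + Q * (\<bar>x - x'\<bar> + \<bar>y - y'\<bar>)"
      using clamp_approx[OF f fB e'(1)] by metis
    \<comment> \<open>\<open>g\<close> and \<open>Q\<close> are fixed before K, because the
      truncation error is multiplied by \<open>Q\<close>.\<close>
    have "((\<lambda>K. Q * (2 * (C / c * exp (- c * K)))) \<longlongrightarrow> 0) at_top"
      using lim.c_pos by real_asymp
    then have "eventually (\<lambda>K. Q * (2 * (C / c * exp (- c * K))) < e / 8 \<and> K \<ge> 0) at_top"
      using e by (intro eventually_conj order_tendstoD(2)[of _ 0] eventually_ge_at_top) auto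
    then obtain K where K: "Q * (2 * (C / c * exp (- c * K))) < e / 8" "K \<ge> 0"
      by (auto simp: eventually_at_top_linorder)
    have close: "\<bar>(\<integral>\<omega>. f (occ_pair (T k) (W k) {0..} \<omega>) \<partial>M k) - (\<integral>\<omega>. g (occ_pair (T k) (W k) {0..K} \<omega>) \<partial>M k)\<bar> \<le> e / 4" for k
      using order_trans[OF pre.clamp_approx_expectation[OF f fB g fg e'(1) Q K(2), of k]
          add_mono[OF eq_refl[OF e'(2)] less_imp_le[OF K(1)]]] by simp
    have closeN: "\<bar>(\<integral>\<omega>. f (occ_pair T' W' {0..} \<omega>) \<partial>N) - (\<integral>\<omega>. g (occ_pair T' W' {0..K} \<omega>) \<partial>N)\<bar> \<le> e / 4"
      using order_trans[OF lim.clamp_approx_expectation[OF f fB g fg e'(1) Q K(2)]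
          add_mono[OF eq_refl[OF e'(2)] less_imp_le[OF K(1)]]] by simp
    have "eventually (\<lambda>k. dist (\<integral>\<omega>. g (occ_pair (T k) (W k) {0..K} \<omega>) \<partial>M k)
       (\<integral>\<omega>. g (occ_pair T' W' {0..K} \<omega>) \<partial>N) < e / 4) sequentially"
      using tendstoD[OF trunc[OF K(2) g(1)], of "e / 4"] e by simp
    then show "eventually (\<lambda>k. dist (\<integral>\<omega>. f (occ_pair (T k) (W k) {0..} \<omega>) \<partial>M k)
       (\<integral>\<omega>. f (occ_pair T' W' {0..} \<omega>) \<partial>N) < e) sequentially"
    proof eventually_elim
      case (elim k)
      then show ?case using close[of k] closeN e unfolding dist_real_def by linarith
    qed
  qed
qed

section \<open>Large deviations and approximation by independent sums\<close>

context tilted_coeffs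
begin

lemma sum_b_split:
  assumes J: "finite J" "{0..<int n} \<subseteq> J"
  shows "(\<Sum>k\<in>J. b n k * h k) = (\<Sum>k\<in>J. d n k * h k) + A * (\<Sum>k<n. h (int k))"
proof -
  have "(\<Sum>k\<in>J. b n k * h k) = (\<Sum>k\<in>J. d n k * h k) + (\<Sum>k\<in>J. A * (of_bool (0 \<le> k \<and> k < int n) * h k))"
    by (simp add: d_def sum.distrib[symmetric] algebra_simps)
  also have "(\<Sum>k\<in>J. A * (of_bool (0 \<le> k \<and> k < int n) * h k)) = A * (\<Sum>k\<in>J. of_bool (0 \<le> k \<and> k < int n) * h k)"
    by (simp add: sum_distrib_left)
  also have "(\<Sum>k\<in>J. of_bool (0 \<le> k \<and> k < int n) * h k) = (\<Sum>k\<in>{0..<int n}. h k)"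
    using J by (intro sum.mono_neutral_cong_right) auto
  also have "\<dots> = (\<Sum>k<n. h (int k))"
    by (rule sum.reindex_bij_witness[of _ int nat]) auto
  finally show ?thesis .
qed

lemma abs_sum_d_le:
  assumes J: "finite J" and h: "\<And>k. \<bar>h k\<bar> \<le> H"
    and d: "(\<Sum>k\<in>J. \<bar>d n k\<bar>) \<le> D"
  shows "\<bar>\<Sum>k\<in>J. d n k * h k\<bar> \<le> D * H"
proof -
  have "H \<ge> 0" using h[of 0] by linarith
  have "\<bar>\<Sum>k\<in>J. d n k * h k\<bar> \<le> (\<Sum>k\<in>J. \<bar>d n k\<bar> * H)"
    by (rule order_trans[OF sum_abs sum_mono]) (auto simp: abs_mult intro: mult_left_mono h)
  also have "\<dots> = (\<Sum>k\<in>J. \<bar>d n k\<bar>) * H" by (simp add: sum_distrib_right)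
  also have "\<dots> \<le> D * H" using d \<open>H \<ge> 0\<close> by (rule mult_right_mono)
  finally show ?thesis .
qed

text \<open>In the exponent the linear term is at most a negative multiple of \<eta> \<tau>^2 n, and
  the quadratic one at most a constant times \<eta>^2 \<tau>^2 n, so a small \<eta> lets the drift
  win. The estimate is needed for all finite J containing \<open>{0..<int n}\<close>, since the walk
  is the limit of such finite sums.\<close>

lemma chernoff_exponent:
  assumes C: "C \<ge> 0"
  shows "\<exists>\<eta> c n0 r. 0 < \<eta> \<and> \<eta> \<le> 1 \<and> 0 < c \<and> 0 < r \<and> (\<forall>\<tau> n J. 0 < \<tau> \<longrightarrow> \<tau> \<le> r \<longrightarrow> n0 \<le> n \<longrightarrow>
      finite J \<longrightarrow> {0..<int n} \<subseteq> J \<longrightarrow>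
      (\<forall>k. \<bar>- (\<eta> * (\<tau> / A) * b n k)\<bar> \<le> 1) \<and>
      (\<Sum>k\<in>J. - (\<eta> * (\<tau> / A) * b n k) * smean \<tau> k + 2 * C * (- (\<eta> * (\<tau> / A) * b n k))\<^sup>2) \<le> - (c * \<tau>\<^sup>2 * real n))"
proof -
  obtain C0 r0 where C0: "C0 \<ge> 0" "r0 > 0" "\<And>\<tau> k. 0 < \<tau> \<Longrightarrow> \<tau> \<le> r0 \<Longrightarrow> \<bar>smean \<tau> k\<bar> \<le> C0 * \<tau>"
    using smean_bound by blast
  obtain C2 r2 where C2: "C2 \<ge> 0" "r2 > 0" "\<And>\<tau> n. 0 < \<tau> \<Longrightarrow> \<tau> \<le> r2 \<Longrightarrow>
      \<bar>(\<Sum>k<n. smean \<tau> (int k)) - s2 * \<tau> * real n\<bar> \<le> \<tau> * (s2 / 4 * real n + C2)"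
    using sum_smean[of "s2 / 4"] s2_pos by auto
  \<comment> \<open>The boundary coefficients may use up a quarter of the drift
    \<open>A * s2\<close>. The error s2 / 4 allowed in the sum of the means uses up a second
    quarter, and \<open>n0\<close> is so large that the constants use up at most a third.\<close>
  define e1 where "e1 = A * s2 / (4 * (C0 + 1))"
  have e1: "e1 > 0" "C0 * e1 \<le> A * s2 / 4"
    using C0(1) A_pos s2_pos by (auto simp: e1_def field_simps)
  obtain C1 where C1: "C1 \<ge> 0" "\<And>n K. finite K \<Longrightarrow> (\<Sum>k\<in>K. \<bar>d n k\<bar>) \<le> e1 * real n + C1"
    using sum_abs_d[OF e1(1)] by blast
  \<comment> \<open>A bound for the sum of \<open>(b n k)\<^sup>2\<close> per unit of n: one factor
    is at most \<alpha>, and the sum of \<bar>b n k\<bar> is at most (e1 + C1 + A) n once n \<ge>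
    1.\<close>
  define K where "K = \<alpha> * (e1 + C1 + A)"
  have K: "K > 0" using \<alpha>_pos e1 C1(1) A_pos by (auto simp: K_def intro!: mult_pos_pos)
  \<comment> \<open>Makes the quadratic term at most half of the linear one that is left, s2 / 8
    against s2 / 4.\<close>
  define \<eta> where "\<eta> = min 1 (s2 * A\<^sup>2 / (16 * (C + 1) * K))"
  have \<eta>: "0 < \<eta>" "\<eta> \<le> 1" using s2_pos A_pos K C by (auto simp: \<eta>_def)
  have \<eta>2: "2 * C * \<eta> * K / A\<^sup>2 \<le> s2 / 8"
  proof -
    have "\<eta> \<le> s2 * A\<^sup>2 / (16 * (C + 1) * K)" by (simp add: \<eta>_def)
    then have "\<eta> * (16 * (C + 1) * K) \<le> s2 * A\<^sup>2"
      using K C by (subst (asm) pos_le_divide_eq) (auto intro!: mult_pos_pos)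
    moreover have "\<eta> * (16 * C * K) \<le> \<eta> * (16 * (C + 1) * K)" using \<eta> K C by (intro mult_left_mono) auto
    ultimately have "16 * (C * \<eta> * K) \<le> s2 * A\<^sup>2" by (simp add: mult_ac)
    then show ?thesis using A_pos by (simp add: field_simps)
  qed
  define n0 where "n0 = nat \<lceil>4 * (A * C2 + C0 * C1) / (A * s2)\<rceil> + 1"
  \<comment> \<open>The bound \<open>A / \<alpha>\<close> keeps the coefficients
    \<open>\<eta> * (\<tau> / A) * b n k\<close> within [-1, 1], as \<bar>b n k\<bar> \<le>
    \<alpha>.\<close>
  define r where "r = min (min r0 r2) (A / \<alpha>)"
  have r: "r > 0" using C0 C2 A_pos \<alpha>_pos by (auto simp: r_def)
  show ?thesis
  proof (rule exI[of _ \<eta>], rule exI[of _ "\<eta> * s2 / 8"], rule exI[of _ n0], rule exI[of _ r],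
      intro conjI allI impI)
    show "\<eta> * s2 / 8 > 0" using \<eta> s2_pos by simp
    fix \<tau> n and J :: "int set"
    assume \<tau>: "0 < \<tau>" "\<tau> \<le> r" and n: "n0 \<le> n" and J: "finite J" "{0..<int n} \<subseteq> J"
    have \<tau>A: "\<tau> * \<alpha> \<le> A" using \<tau> \<alpha>_pos by (simp add: r_def field_simps)
    show "\<bar>- (\<eta> * (\<tau> / A) * b n k)\<bar> \<le> 1" for k
    proof -
      have "\<bar>\<eta> * (\<tau> / A) * b n k\<bar> = \<eta> * (\<tau> / A) * \<bar>b n k\<bar>"
        using \<eta> \<tau> A_pos by (simp add: abs_mult)
      also have "\<dots> \<le> 1 * (\<tau> / A) * \<alpha>"
        using \<eta> \<tau> A_pos abs_b_le by (intro mult_mono) auto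
      also have "\<dots> \<le> 1" using \<tau>A A_pos by (simp add: field_simps)
      finally show ?thesis by simp
    qed
    have n1: "real n \<ge> 1" using n by (simp add: n0_def)
    have d1: "(\<Sum>k\<in>J. \<bar>d n k\<bar>) \<le> e1 * real n + C1" using C1(2)[OF J(1)] .
    have m1: "\<bar>\<Sum>k\<in>J. d n k * smean \<tau> k\<bar> \<le> (e1 * real n + C1) * (C0 * \<tau>)"
      using C0(3) \<tau> by (intro abs_sum_d_le J d1) (auto simp: r_def)
    have m2: "(\<Sum>k<n. smean \<tau> (int k)) \<ge> s2 * \<tau> * real n - \<tau> * (s2 / 4 * real n + C2)"
      using C2(3)[of \<tau> n] \<tau> by (auto simp: r_def)
    have mean: "(\<Sum>k\<in>J. b n k * smean \<tau> k) \<ge> \<tau> * (A * s2 * real n / 4)"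
    proof -
      have "A * (s2 * \<tau> * real n - \<tau> * (s2 / 4 * real n + C2)) - (e1 * real n + C1) * (C0 * \<tau>) \<le> (\<Sum>k\<in>J. b n k * smean \<tau> k)"
        unfolding sum_b_split[OF J] using m1 mult_left_mono[OF m2, of A] A_pos by linarith
      moreover have "A * (s2 * \<tau> * real n - \<tau> * (s2 / 4 * real n + C2)) - (e1 * real n + C1) * (C0 * \<tau>)
          = \<tau> * (3/4 * (A * s2 * real n) - C0 * e1 * real n - (A * C2 + C0 * C1))"
        by (simp add: algebra_simps)
      moreover have "A * s2 * real n / 4 \<le> 3/4 * (A * s2 * real n) - C0 * e1 * real n - (A * C2 + C0 * C1)"
      proof -
        have "C0 * e1 * real n \<le> A * s2 / 4 * real n" using e1(2) by (rule mult_right_mono) simp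
        moreover have "4 * (A * C2 + C0 * C1) / (A * s2) \<le> real n"
          using n unfolding n0_def by linarith
        then have "4 * (A * C2 + C0 * C1) \<le> real n * (A * s2)"
          using A_pos s2_pos by (simp add: pos_divide_le_eq)
        ultimately show ?thesis by (simp add: algebra_simps)
      qed
      then have "\<tau> * (A * s2 * real n / 4) \<le> \<tau> * (3/4 * (A * s2 * real n) - C0 * e1 * real n - (A * C2 + C0 * C1))"
        using \<tau> by (intro mult_left_mono) auto
      ultimately show ?thesis by linarith
    qed
    have sq: "(\<Sum>k\<in>J. (b n k)\<^sup>2) \<le> K * real n"
    proof -
      have "(\<Sum>k\<in>J. (b n k)\<^sup>2) \<le> (\<Sum>k\<in>J. \<alpha> * \<bar>b n k\<bar>)"
      proof (intro sum_mono)
        fix k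
        have "(b n k)\<^sup>2 = \<bar>b n k\<bar> * \<bar>b n k\<bar>" by (simp add: power2_eq_square)
        also have "\<dots> \<le> \<alpha> * \<bar>b n k\<bar>" using abs_b_le by (intro mult_right_mono) auto
        finally show "(b n k)\<^sup>2 \<le> \<alpha> * \<bar>b n k\<bar>" .
      qed
      also have "\<dots> = \<alpha> * (\<Sum>k\<in>J. \<bar>b n k\<bar>)" by (simp add: sum_distrib_left)
      also have "(\<Sum>k\<in>J. \<bar>b n k\<bar>) \<le> (\<Sum>k\<in>J. \<bar>d n k\<bar> + A * of_bool (0 \<le> k \<and> k < int n))"
        using A_pos by (intro sum_mono) (auto simp: d_def)
      also have "\<dots> = (\<Sum>k\<in>J. \<bar>d n k\<bar>) + A * real n"
      proof -
        have "J \<inter> {k. 0 \<le> k \<and> k < int n} = {0..<int n}" using J by auto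
        then have "(\<Sum>k\<in>J. of_bool (0 \<le> k \<and> k < int n) :: real) = real (card {0..<int n})"
          using J by (simp add: sum_of_bool_eq)
        then show ?thesis by (simp add: sum.distrib sum_distrib_left[symmetric])
      qed
      also have "\<dots> \<le> (e1 + C1 + A) * real n"
        using d1 mult_left_mono[OF n1 C1(1)] by (simp add: algebra_simps)
      finally show ?thesis using \<alpha>_pos by (simp add: K_def mult_left_mono mult.assoc)
    qed
    have "(\<Sum>k\<in>J. - (\<eta> * (\<tau> / A) * b n k) * smean \<tau> k + 2 * C * (- (\<eta> * (\<tau> / A) * b n k))\<^sup>2)
        = - (\<eta> * (\<tau> / A)) * (\<Sum>k\<in>J. b n k * smean \<tau> k) + 2 * C * (\<eta> * (\<tau> / A))\<^sup>2 * (\<Sum>k\<in>J. (b n k)\<^sup>2)"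
    proof -
      have "- (\<eta> * (\<tau> / A) * b n k) * smean \<tau> k + 2 * C * (- (\<eta> * (\<tau> / A) * b n k))\<^sup>2
          = - (\<eta> * (\<tau> / A)) * (b n k * smean \<tau> k) + 2 * C * (\<eta> * (\<tau> / A))\<^sup>2 * (b n k)\<^sup>2" for k
        unfolding power2_minus power_mult_distrib[of _ "b n k"] by simp
      then show ?thesis by (simp only: sum.distrib sum_distrib_left)
    qed
    also have "\<dots> \<le> - (\<eta> * (\<tau> / A)) * (\<tau> * (A * s2 * real n / 4)) + 2 * C * (\<eta> * (\<tau> / A))\<^sup>2 * (K * real n)"
      using mean sq \<eta> \<tau> A_pos C by (intro add_mono mult_left_mono mult_left_mono_neg) auto
    also have "\<dots> = \<eta> * \<tau>\<^sup>2 * real n * (2 * C * \<eta> * K / A\<^sup>2 - s2 / 4)"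
      using A_pos by (simp add: power2_eq_square field_simps)
    also have "\<dots> \<le> \<eta> * \<tau>\<^sup>2 * real n * (s2 / 8 - s2 / 4)"
      using \<eta>2 \<eta> by (intro mult_left_mono) auto
    also have "\<dots> = - (\<eta> * s2 / 8 * \<tau>\<^sup>2 * real n)" by (simp add: algebra_simps)
    finally show "(\<Sum>k\<in>J. - (\<eta> * (\<tau> / A) * b n k) * smean \<tau> k + 2 * C * (- (\<eta> * (\<tau> / A) * b n k))\<^sup>2)
        \<le> - (\<eta> * s2 / 8 * \<tau>\<^sup>2 * real n)" .
  qed (use \<eta> r in auto)
qed

text \<open>The same exponent for the boundary coefficients, with both signs. Linear and quadratic
  terms are bounded by constants times \<tau>^2 (e1 n + C1), which is small because \<tau>^2 n stays
  bounded and e1 is at our disposal.\<close>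

lemma approx_exponent:
  assumes C: "C \<ge> 0" and e: "e > 0" and R: "R \<ge> 0"
  shows "\<exists>r>0. \<forall>\<tau> n J s. 0 < \<tau> \<longrightarrow> \<tau> \<le> r \<longrightarrow> real n * \<tau>\<^sup>2 \<le> R \<longrightarrow> finite J \<longrightarrow> \<bar>s\<bar> = 1 \<longrightarrow>
      (\<forall>k. \<bar>s * (\<tau> / A * d n k)\<bar> \<le> 1) \<and>
      (\<Sum>k\<in>J. s * (\<tau> / A * d n k) * smean \<tau> k + 2 * C * (s * (\<tau> / A * d n k))\<^sup>2) \<le> e"
proof -
  obtain C0 r0 where C0: "C0 \<ge> 0" "r0 > 0" "\<And>\<tau> k. 0 < \<tau> \<Longrightarrow> \<tau> \<le> r0 \<Longrightarrow> \<bar>smean \<tau> k\<bar> \<le> C0 * \<tau>"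
    using smean_bound by blast
  define K where "K = C0 / A + 4 * C * \<alpha> / A\<^sup>2 + 1"
  have K: "K > 0" using C0 A_pos \<alpha>_pos C by (auto simp: K_def intro!: add_nonneg_pos)
  \<comment> \<open>\<open>e1\<close> handles the part proportional to n, through
    \<open>real n * \<tau>\<^sup>2 \<le> R\<close>; the square root in \<open>r\<close> handles the
    constant C1. Each gets e / 2.\<close>
  define e1 where "e1 = e / 2 / K / (R + 1)"
  have e1: "e1 > 0" using e K R by (auto simp: e1_def intro!: divide_pos_pos)
  have e1R: "K * (e1 * R) \<le> e / 2"
  proof -
    have "K * (e1 * R) \<le> K * (e1 * (R + 1))" using K e1 by (intro mult_left_mono) auto
    also have "\<dots> = e / 2" using K R by (simp add: e1_def del: divide_divide_eq_left)
    finally show ?thesis .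
  qed
  obtain C1 where C1: "C1 \<ge> 0" "\<And>n K. finite K \<Longrightarrow> (\<Sum>k\<in>K. \<bar>d n k\<bar>) \<le> e1 * real n + C1"
    using sum_abs_d[OF e1] by blast
  define r where "r = min (min r0 (A / (2 * \<alpha>))) (sqrt (e / (2 * K * (C1 + 1))))"
  have r: "r > 0" using C0 A_pos \<alpha>_pos e K C1 by (auto simp: r_def)
  show ?thesis
  proof (intro exI[of _ r] conjI allI impI r)
    fix \<tau> s :: real and n and J :: "int set"
    assume \<tau>: "0 < \<tau>" "\<tau> \<le> r" and n: "real n * \<tau>\<^sup>2 \<le> R" and J: "finite J" and s: "\<bar>s\<bar> = 1"
    have "\<tau> \<le> A / (2 * \<alpha>)" using \<tau> by (simp add: r_def)
    then have \<tau>A: "\<tau> * (2 * \<alpha>) \<le> A" using \<alpha>_pos by (simp add: field_simps)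
    show "\<bar>s * (\<tau> / A * d n k)\<bar> \<le> 1" for k
    proof -
      have "\<bar>s * (\<tau> / A * d n k)\<bar> = \<tau> / A * \<bar>d n k\<bar>" using s \<tau> A_pos by (simp add: abs_mult)
      also have "\<dots> \<le> \<tau> / A * (2 * \<alpha>)" using \<tau> A_pos abs_d_le by (intro mult_left_mono) auto
      also have "\<dots> \<le> 1" using \<tau>A A_pos by (simp add: field_simps)
      finally show ?thesis .
    qed
    let ?D = "e1 * real n + C1"
    have d1: "(\<Sum>k\<in>J. \<bar>d n k\<bar>) \<le> ?D" using C1(2)[OF J] .
    have D0: "?D \<ge> 0" using e1 C1 by simp
    have s2: "s\<^sup>2 = 1" using s by (metis power2_abs power_one)
    have m1: "\<bar>\<Sum>k\<in>J. d n k * smean \<tau> k\<bar> \<le> ?D * (C0 * \<tau>)"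
      using C0(3) \<tau> by (intro abs_sum_d_le J d1) (auto simp: r_def)
    have sq: "(\<Sum>k\<in>J. (d n k)\<^sup>2) \<le> 2 * \<alpha> * ?D"
    proof -
      have "(\<Sum>k\<in>J. (d n k)\<^sup>2) \<le> (\<Sum>k\<in>J. 2 * \<alpha> * \<bar>d n k\<bar>)"
      proof (intro sum_mono)
        fix k
        have "(d n k)\<^sup>2 = \<bar>d n k\<bar> * \<bar>d n k\<bar>" by (simp add: power2_eq_square)
        also have "\<dots> \<le> 2 * \<alpha> * \<bar>d n k\<bar>" using abs_d_le by (intro mult_right_mono) auto
        finally show "(d n k)\<^sup>2 \<le> 2 * \<alpha> * \<bar>d n k\<bar>" .
      qed
      also have "\<dots> = 2 * \<alpha> * (\<Sum>k\<in>J. \<bar>d n k\<bar>)" by (simp add: sum_distrib_left)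
      also have "\<dots> \<le> 2 * \<alpha> * ?D" using d1 \<alpha>_pos by (intro mult_left_mono) auto
      finally show ?thesis .
    qed
    have "(\<Sum>k\<in>J. s * (\<tau> / A * d n k) * smean \<tau> k + 2 * C * (s * (\<tau> / A * d n k))\<^sup>2)
        = \<tau> / A * (s * (\<Sum>k\<in>J. d n k * smean \<tau> k)) + 2 * C * (\<tau> / A)\<^sup>2 * (\<Sum>k\<in>J. (d n k)\<^sup>2)"
    proof -
      have "s * (\<tau> / A * d n k) * smean \<tau> k + 2 * C * (s * (\<tau> / A * d n k))\<^sup>2
          = \<tau> / A * (s * (d n k * smean \<tau> k)) + 2 * C * (\<tau> / A)\<^sup>2 * (d n k)\<^sup>2" for k
        unfolding power_mult_distrib s2 by simp
      then show ?thesis by (simp only: sum.distrib sum_distrib_left)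
    qed
    also have "s * (\<Sum>k\<in>J. d n k * smean \<tau> k) \<le> ?D * (C0 * \<tau>)"
    proof -
      have "s * (\<Sum>k\<in>J. d n k * smean \<tau> k) \<le> \<bar>s * (\<Sum>k\<in>J. d n k * smean \<tau> k)\<bar>" by simp
      also have "\<dots> \<le> ?D * (C0 * \<tau>)" using m1 s by (simp add: abs_mult)
      finally show ?thesis .
    qed
    then have "\<tau> / A * (s * (\<Sum>k\<in>J. d n k * smean \<tau> k)) + 2 * C * (\<tau> / A)\<^sup>2 * (\<Sum>k\<in>J. (d n k)\<^sup>2)
       \<le> \<tau> / A * (?D * (C0 * \<tau>)) + 2 * C * (\<tau> / A)\<^sup>2 * (2 * \<alpha> * ?D)"
      using sq \<tau> A_pos C by (intro add_mono mult_left_mono) auto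
    also have "\<dots> = (C0 / A + 4 * C * \<alpha> / A\<^sup>2) * (\<tau>\<^sup>2 * ?D)"
      by (simp add: power_divide power2_eq_square[of \<tau>] distrib_right distrib_left add_divide_distrib mult_ac)
    also have "\<dots> \<le> K * (\<tau>\<^sup>2 * ?D)" using D0 by (intro mult_right_mono) (auto simp: K_def)
    also have "\<dots> = K * (e1 * (real n * \<tau>\<^sup>2)) + K * (\<tau>\<^sup>2 * C1)" by (simp add: algebra_simps)
    also have "\<dots> \<le> K * (e1 * R) + e / 2"
    proof (intro add_mono mult_left_mono)
      have "\<tau>\<^sup>2 \<le> (sqrt (e / (2 * K * (C1 + 1))))\<^sup>2" using \<tau> by (intro power_mono) (auto simp: r_def)
      also have "\<dots> = e / (2 * K * (C1 + 1))" using e K C1 by simp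
      finally have "\<tau>\<^sup>2 * (2 * K * (C1 + 1)) \<le> e" using K C1 by (simp add: pos_le_divide_eq)
      moreover have "0 \<le> \<tau>\<^sup>2 * (2 * K)" using K by simp
      ultimately show "K * (\<tau>\<^sup>2 * C1) \<le> e / 2" by (simp add: algebra_simps)
    qed (use n e1 K in auto)
    also have "\<dots> \<le> e" using e1R by simp
    finally show "(\<Sum>k\<in>J. s * (\<tau> / A * d n k) * smean \<tau> k + 2 * C * (s * (\<tau> / A * d n k))\<^sup>2) \<le> e" .
  qed
qed

end

section \<open>Walks driven by independent noise\<close>

lemma has_sum_int_tendsto:
  fixes f :: "int \<Rightarrow> real"
  assumes "(f has_sum S) UNIV"
  shows "(\<lambda>n. \<Sum>k\<in>{- int n..int n}. f k) \<longlonglongrightarrow> S"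
proof -
  have "filterlim (\<lambda>n. {- int n..int n}) (finite_subsets_at_top UNIV) sequentially"
    unfolding filterlim_finite_subsets_at_top
  proof (intro allI impI)
    fix X :: "int set" assume "finite X \<and> X \<subseteq> UNIV"
    then have "finite X" by simp
    then obtain m where m: "\<And>x. x \<in> X \<Longrightarrow> \<bar>x\<bar> \<le> m"
      by (metis finite_imageI Max_ge finite_surj imageI subset_UNIV rev_image_eqI)
    have "eventually (\<lambda>n. nat m \<le> n) sequentially" by (rule eventually_ge_at_top)
    then show "\<forall>\<^sub>F n in sequentially. finite {- int n..int n} \<and> X \<subseteq> {- int n..int n} \<and> {- int n..int n} \<subseteq> UNIV"
      by eventually_elim (use m in force)
  qed
  from filterlim_compose[OF assms[unfolded has_sum_def] this] show ?thesis by simp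
qed

text \<open>\<open>S n\<close> is a random walk whose steps form a moving average of the independent variables \<open>Y k\<close>.\<close>

locale tilted_walk = tilted_coeffs F a + M: prob_space M
  for F :: "real measure" and a :: "int \<Rightarrow> real" and M :: "'m measure" +
  fixes \<tau> :: real and Y :: "int \<Rightarrow> 'm \<Rightarrow> real" and S :: "nat \<Rightarrow> 'm \<Rightarrow> real"
  assumes \<tau>_pos: "\<tau> > 0"
    and Y_indep: "M.indep_vars (\<lambda>_. borel) Y UNIV"
    and Y_exp: "\<And>k. integrable M (\<lambda>\<omega>. exp (2 * \<bar>Y k \<omega>\<bar>))"
    and Y_exp_le: "\<And>k. (\<integral>\<omega>. exp (2 * \<bar>Y k \<omega>\<bar>) \<partial>M) \<le> exp_bound\<^sup>2"
    and Y_mean: "\<And>k. (\<integral>\<omega>. Y k \<omega> \<partial>M) = smean \<tau> k"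
    and Y_var: "\<And>k. prob_space.variance M (Y k) = svar \<tau> k"
    and S_measurable [measurable]: "\<And>n. S n \<in> borel_measurable M"
    and S_sum: "\<And>n. AE \<omega> in M. ((\<lambda>k. b n k * Y k \<omega>) has_sum S n \<omega>) UNIV"
begin

lemma Y_measurable [measurable]: "Y k \<in> borel_measurable M"
  using Y_indep by (auto simp: M.indep_vars_def)

text \<open>The bound is asked only for J containing \<open>{0..<int n}\<close>, where the drift
  sits; the symmetric windows along which the series is summed eventually contain this set.\<close>

lemma series_mgf:
  assumes X: "AE \<omega> in M. ((\<lambda>k. c k * Y k \<omega>) has_sum X \<omega>) UNIV" and c: "\<And>k. \<bar>c k\<bar> \<le> 1"
    and B: "\<And>J. finite J \<Longrightarrow> {0..<int n} \<subseteq> J \<Longrightarrow> (\<Sum>k\<in>J. c k * smean \<tau> k + 2 * exp_bound\<^sup>2 * (c k)\<^sup>2) \<le> B"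
  shows "(\<integral>\<^sup>+\<omega>. exp (X \<omega>) \<partial>M) \<le> ennreal (exp B)"
proof (rule M.indep_series_mgf[where J="\<lambda>n. {- int n..int n}"])
  show "M.indep_vars (\<lambda>_. borel) Y UNIV" by (rule Y_indep)
  show "AE \<omega> in M. (\<lambda>n. \<Sum>k\<in>{- int n..int n}. c k * Y k \<omega>) \<longlonglongrightarrow> X \<omega>"
    using X by eventually_elim (rule has_sum_int_tendsto)
  show "\<forall>\<^sub>F m in sequentially. (\<Sum>k\<in>{- int m..int m}. c k * M.expectation (Y k) + 2 * exp_bound\<^sup>2 * (c k)\<^sup>2) \<le> B"
    using eventually_ge_at_top[of n] by eventually_elim (auto simp: Y_mean intro!: B)
qed (use Y_exp Y_exp_le c in auto)

definition Sa :: "nat \<Rightarrow> 'm \<Rightarrow> real" where "Sa n \<omega> = (\<Sum>k<n. Y (int k) \<omega>)"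

lemma Sa_measurable [measurable]: "Sa n \<in> borel_measurable M"
  unfolding Sa_def[abs_def] by measurable

lemma S_diff_sum: "AE \<omega> in M. ((\<lambda>k. d n k * Y k \<omega>) has_sum S n \<omega> - A * Sa n \<omega>) UNIV"
  using S_sum[of n]
proof eventually_elim
  case (elim \<omega>)
  have "((\<lambda>k. A * of_bool (0 \<le> k \<and> k < int n) * Y k \<omega>) has_sum (\<Sum>k\<in>{0..<int n}. A * Y k \<omega>)) UNIV"
    by (rule has_sum_cong_neutral[THEN iffD1, OF _ _ _ has_sum_finite]) auto
  also have "(\<Sum>k\<in>{0..<int n}. A * Y k \<omega>) = A * Sa n \<omega>"
    unfolding Sa_def sum_distrib_left by (rule sum.reindex_bij_witness[of _ int nat]) auto
  finally have "((\<lambda>k. - (A * of_bool (0 \<le> k \<and> k < int n) * Y k \<omega>)) has_sum - (A * Sa n \<omega>)) UNIV"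
    by (simp add: has_sum_uminus)
  from has_sum_add[OF elim this] show ?case by (simp add: d_def left_diff_distrib)
qed

end

lemma (in tilted_coeffs) exp_bound_sq_nonneg: "exp_bound\<^sup>2 \<ge> 0" by simp

text \<open>The constants come before the quantifiers over M, Y and S: each \<epsilon> has its own
  probability space, and the bound has to be uniform over all of them.\<close>

lemma (in tilted_coeffs) walk_tail:
  "\<exists>\<eta> c n0 r. 0 < \<eta> \<and> \<eta> \<le> 1 \<and> 0 < c \<and> 0 < r \<and> (\<forall>\<tau> (M :: 'm measure) Y S n. \<tau> \<le> r \<longrightarrow> n0 \<le> n \<longrightarrow>
     tilted_walk F a M \<tau> Y S \<longrightarrow>
     (\<integral>\<^sup>+\<omega>. exp (- (\<eta> * (\<tau> / A * S n \<omega>))) \<partial>M) \<le> ennreal (exp (- (c * \<tau>\<^sup>2 * real n))))"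
proof -
  obtain \<eta> c n0 r where *: "0 < \<eta>" "\<eta> \<le> 1" "0 < c" "0 < r"
    and le': "\<forall>\<tau> n J. 0 < \<tau> \<longrightarrow> \<tau> \<le> r \<longrightarrow> n0 \<le> n \<longrightarrow> finite J \<longrightarrow> {0..<int n} \<subseteq> J \<longrightarrow>
      (\<forall>k. \<bar>- (\<eta> * (\<tau> / A) * b n k)\<bar> \<le> 1) \<and>
      (\<Sum>k\<in>J. - (\<eta> * (\<tau> / A) * b n k) * smean \<tau> k + 2 * exp_bound\<^sup>2 * (- (\<eta> * (\<tau> / A) * b n k))\<^sup>2) \<le> - (c * \<tau>\<^sup>2 * real n)"
    using chernoff_exponent[OF exp_bound_sq_nonneg] by (elim exE conjE) (rule that)
  note le = le'[rule_format]
  have main: "(\<integral>\<^sup>+\<omega>. exp (- (\<eta> * (\<tau> / A * S n \<omega>))) \<partial>M) \<le> ennreal (exp (- (c * \<tau>\<^sup>2 * real n)))"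
    if \<tau>: "\<tau> \<le> r" and n: "n0 \<le> n" and walk: "tilted_walk F a M \<tau> Y S" for \<tau> and M :: "'m measure" and Y S n
  proof -
    interpret tilted_walk F a M \<tau> Y S by (rule walk)
    show ?thesis
    proof (rule series_mgf)
      show "AE \<omega> in M. ((\<lambda>k. - (\<eta> * (\<tau> / A) * b n k) * Y k \<omega>) has_sum - (\<eta> * (\<tau> / A * S n \<omega>))) UNIV"
        using S_sum[of n]
      proof eventually_elim
        case (elim \<omega>)
        from has_sum_cmult_right[OF this, of "- (\<eta> * (\<tau> / A))"] show ?case by (simp add: mult_ac)
      qed
    qed (use le[OF \<tau>_pos \<tau> n] le[OF \<tau>_pos \<tau> n, of "{0..<int n}"] in auto)
  qed
  show ?thesis
  proof (rule exI[of _ \<eta>], rule exI[of _ c], rule exI[of _ n0], rule exI[of _ r], intro conjI allI impI)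
    fix \<tau> and M :: "'m measure" and Y S n
    assume "\<tau> \<le> r" "n0 \<le> n" "tilted_walk F a M \<tau> Y S"
    then show "(\<integral>\<^sup>+\<omega>. exp (- (\<eta> * (\<tau> / A * S n \<omega>))) \<partial>M) \<le> ennreal (exp (- (c * \<tau>\<^sup>2 * real n)))"
      by (rule main)
  qed (fact *)+
qed

text \<open>An estimate in L1 from exponential moments at 1 and -1. If both are at most 1 + f^2,
  then X is small, since exp x + exp (-x) - 2 dominates x^2 / 2 and therefore 2 f \<bar>x\<bar> - 2
  f^2.\<close>

lemma (in tilted_coeffs) walk_approx:
  assumes e: "e > 0" and R: "R \<ge> 0"
  shows "\<exists>r>0. \<forall>\<tau> (M :: 'm measure) Y S n. \<tau> \<le> r \<longrightarrow> real n * \<tau>\<^sup>2 \<le> R \<longrightarrow> tilted_walk F a M \<tau> Y S \<longrightarrow>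
    (\<integral>\<^sup>+\<omega>. ennreal \<bar>\<tau> / A * S n \<omega> - \<tau> * (\<Sum>k<n. Y (int k) \<omega>)\<bar> \<partial>M) \<le> ennreal e"
proof -
  define f where "f = e / 2"
  have f: "f > 0" using e by (simp add: f_def)
  \<comment> \<open>With exp v = 1 + f^2, the two exponential moments and the correction 2 f^2 - 2
    add up to at most 4 f^2 = 2 f e.\<close>
  define v where "v = ln (1 + f\<^sup>2)"
  have v: "v > 0" "exp v = 1 + f\<^sup>2"
    using f by (auto simp: v_def intro!: ln_gt_zero exp_ln add_pos_pos)
  obtain r where r: "r > 0" and le: "\<And>\<tau> n J s. 0 < \<tau> \<Longrightarrow> \<tau> \<le> r \<Longrightarrow> real n * \<tau>\<^sup>2 \<le> R \<Longrightarrow> finite J \<Longrightarrow> \<bar>s\<bar> = 1 \<Longrightarrow>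
      (\<forall>k. \<bar>s * (\<tau> / A * d n k)\<bar> \<le> 1) \<and>
      (\<Sum>k\<in>J. s * (\<tau> / A * d n k) * smean \<tau> k + 2 * exp_bound\<^sup>2 * (s * (\<tau> / A * d n k))\<^sup>2) \<le> v"
    using approx_exponent[OF exp_bound_sq_nonneg v(1) R] by blast
  have "(\<integral>\<^sup>+\<omega>. ennreal \<bar>\<tau> / A * S n \<omega> - \<tau> * (\<Sum>k<n. Y (int k) \<omega>)\<bar> \<partial>M) \<le> ennreal e"
    if \<tau>: "\<tau> \<le> r" and n: "real n * \<tau>\<^sup>2 \<le> R" and walk: "tilted_walk F a M \<tau> Y S" for \<tau> and M :: "'m measure" and Y S n
  proof -
    interpret tilted_walk F a M \<tau> Y S by (rule walk)
    define X where "X \<omega> = \<tau> / A * (S n \<omega> - A * Sa n \<omega>)" for \<omega>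
    have [measurable]: "X \<in> borel_measurable M" unfolding X_def[abs_def] by measurable
    have mgf: "(\<integral>\<^sup>+\<omega>. exp (s * X \<omega>) \<partial>M) \<le> ennreal (exp v)" if s: "\<bar>s\<bar> = 1" for s :: real
    proof (rule series_mgf)
      show "AE \<omega> in M. ((\<lambda>k. s * (\<tau> / A * d n k) * Y k \<omega>) has_sum s * X \<omega>) UNIV"
        using S_diff_sum[of n]
      proof eventually_elim
        case (elim \<omega>)
        from has_sum_cmult_right[OF this, of "s * (\<tau> / A)"] show ?case by (simp add: X_def mult_ac)
      qed
    qed (use le[OF \<tau>_pos \<tau> n _ s] le[OF \<tau>_pos \<tau> n _ s, of "{}"] in auto)
    have cosh: "2 * f * \<bar>x\<bar> \<le> exp (1 * x) + exp (- 1 * x) + (2 * f\<^sup>2 - 2)" for x :: real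
    proof -
      have "1 + \<bar>x\<bar> + \<bar>x\<bar>\<^sup>2 / 2 \<le> exp \<bar>x\<bar>" by (rule exp_lower_Taylor_quadratic) simp
      moreover have "1 + (- \<bar>x\<bar>) \<le> exp (- \<bar>x\<bar>)" by (rule exp_ge_add_one_self)
      moreover have "exp (1 * x) + exp (- 1 * x) = exp \<bar>x\<bar> + exp (- \<bar>x\<bar>)" by (cases "x \<ge> 0") auto
      moreover have "2 * (2 * f) * \<bar>x\<bar> \<le> (2 * f)\<^sup>2 + \<bar>x\<bar>\<^sup>2" by (rule sum_squares_bound)
      ultimately show ?thesis by (simp add: power_mult_distrib)
    qed
    have fin: "integrable M (\<lambda>\<omega>. exp (s * X \<omega>))" "M.expectation (\<lambda>\<omega>. exp (s * X \<omega>)) \<le> exp v"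
      if s: "\<bar>s\<bar> = 1" for s :: real
    proof -
      show i: "integrable M (\<lambda>\<omega>. exp (s * X \<omega>))"
        using mgf[OF s] by (intro integrableI_nonneg) (auto intro: le_less_trans)
      show "M.expectation (\<lambda>\<omega>. exp (s * X \<omega>)) \<le> exp v"
        using mgf[OF s] by (subst (asm) nn_integral_eq_integral[OF i]) auto
    qed
    note fin1 = fin[of 1] fin[of "- 1"]
    have i: "integrable M (\<lambda>\<omega>. exp (1 * X \<omega>) + exp (- 1 * X \<omega>) + (2 * f\<^sup>2 - 2))"
      using fin1 by simp
    have iX: "integrable M (\<lambda>\<omega>. 2 * f * \<bar>X \<omega>\<bar>)"
      by (rule Bochner_Integration.integrable_bound[OF i])
         (use order_trans[OF cosh abs_ge_self] f in \<open>auto intro!: AE_I2 simp: abs_mult\<close>)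
    have "2 * f * M.expectation (\<lambda>\<omega>. \<bar>X \<omega>\<bar>) = M.expectation (\<lambda>\<omega>. 2 * f * \<bar>X \<omega>\<bar>)" by simp
    also have "\<dots> \<le> M.expectation (\<lambda>\<omega>. exp (1 * X \<omega>) + exp (- 1 * X \<omega>) + (2 * f\<^sup>2 - 2))"
      using cosh by (intro integral_mono i iX)
    also have "\<dots> = M.expectation (\<lambda>\<omega>. exp (1 * X \<omega>)) + M.expectation (\<lambda>\<omega>. exp (- 1 * X \<omega>)) + (2 * f\<^sup>2 - 2)"
      using fin1 by (simp add: M.prob_space)
    also have "\<dots> \<le> exp v + exp v + (2 * f\<^sup>2 - 2)" using fin1 by simp
    also have "\<dots> = 2 * f * e" unfolding v(2) by (simp add: f_def power2_eq_square)
    finally have "M.expectation (\<lambda>\<omega>. \<bar>X \<omega>\<bar>) \<le> e" using f by simp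
    moreover have "(\<integral>\<^sup>+\<omega>. ennreal \<bar>X \<omega>\<bar> \<partial>M) = ennreal (M.expectation (\<lambda>\<omega>. \<bar>X \<omega>\<bar>))"
      by (rule nn_integral_eq_integral) (use iX f in auto)
    moreover have "X \<omega> = \<tau> / A * S n \<omega> - \<tau> * (\<Sum>k<n. Y (int k) \<omega>)" for \<omega>
      using A_pos by (simp add: X_def Sa_def right_diff_distrib)
    ultimately show ?thesis by (simp add: ennreal_leI)
  qed
  then show ?thesis using r by blast
qed

section \<open>Independence and product laws\<close>

lemma distr_PiM_components:
  fixes f :: "'i \<Rightarrow> 'a \<Rightarrow> 'b"
  assumes I: "finite I" and M: "\<And>i. i \<in> I \<Longrightarrow> prob_space (M i)"
    and f: "\<And>i. i \<in> I \<Longrightarrow> f i \<in> measurable (M i) (N i)"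
  shows "distr (PiM I M) (PiM I N) (\<lambda>x. \<lambda>i\<in>I. f i (x i)) = (\<Pi>\<^sub>M i\<in>I. distr (M i) (N i) (f i))"
proof -
  \<comment> \<open>Outside I the families are extended by a point mass, because the product
    construction asks for a probability measure at every index.\<close>
  define M' where "M' i = (if i \<in> I then M i else return (count_space UNIV) undefined)" for i
  define D where "D i = (if i \<in> I then distr (M i) (N i) (f i) else return (count_space UNIV) undefined)" for i
  have ps: "prob_space (M' i)" "prob_space (D i)" for i
    using M f by (auto simp: M'_def D_def intro!: prob_space_return prob_space.prob_space_distr)
  have [simp]: "PiM I M' = PiM I M" "(\<Pi>\<^sub>M i\<in>I. distr (M i) (N i) (f i)) = PiM I D"
    by (auto intro!: PiM_cong simp: M'_def D_def)
  interpret M': product_prob_space M' I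
    using ps by (intro product_prob_spaceI)
  interpret D: product_prob_space D I
    using ps by (intro product_prob_spaceI)
  have meas: "(\<lambda>x. \<lambda>i\<in>I. f i (x i)) \<in> measurable (PiM I M) (PiM I N)"
    using f by (intro measurable_restrict) (auto intro!: measurable_compose[OF measurable_component_singleton])
  have "distr (PiM I M) (PiM I N) (\<lambda>x. \<lambda>i\<in>I. f i (x i)) = PiM I D"
  proof (rule D.PiM_eqI[OF I])
    show "sets (distr (PiM I M) (PiM I N) (\<lambda>x. \<lambda>i\<in>I. f i (x i))) = sets (PiM I D)"
      by (simp add: D_def cong: sets_PiM_cong)
    fix A assume A: "\<And>i. i \<in> I \<Longrightarrow> A i \<in> sets (D i)"
    then have A': "\<And>i. i \<in> I \<Longrightarrow> A i \<in> sets (N i)" by (simp add: D_def)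
    have "emeasure (distr (PiM I M) (PiM I N) (\<lambda>x. \<lambda>i\<in>I. f i (x i))) (Pi\<^sub>E I A)
        = emeasure (PiM I M) ((\<lambda>x. \<lambda>i\<in>I. f i (x i)) -` Pi\<^sub>E I A \<inter> space (PiM I M))"
      using A' I by (intro emeasure_distr meas sets_PiM_I_finite)
    also have "(\<lambda>x. \<lambda>i\<in>I. f i (x i)) -` Pi\<^sub>E I A \<inter> space (PiM I M) = (\<Pi>\<^sub>E i\<in>I. f i -` A i \<inter> space (M i))"
      by (auto simp: space_PiM PiE_iff)
    also have "emeasure (PiM I M) (\<Pi>\<^sub>E i\<in>I. f i -` A i \<inter> space (M i)) = emeasure (PiM I M') (\<Pi>\<^sub>E i\<in>I. f i -` A i \<inter> space (M i))"
      by simp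
    also have "\<dots> = (\<Prod>i\<in>I. emeasure (M' i) (f i -` A i \<inter> space (M i)))"
      using I A' f by (intro M'.emeasure_PiM) (auto simp: M'_def intro: measurable_sets)
    also have "\<dots> = (\<Prod>i\<in>I. emeasure (D i) (A i))"
      using A' f by (intro prod.cong) (auto simp: M'_def D_def emeasure_distr)
    finally show "emeasure (distr (PiM I M) (PiM I N) (\<lambda>x. \<lambda>i\<in>I. f i (x i))) (Pi\<^sub>E I A) = (\<Prod>i\<in>I. emeasure (D i) (A i))" .
  qed
  then show ?thesis by simp
qed

text \<open>Skorohod's theorem represents the weak convergence in each coordinate as pointwise
  convergence on some space. On the product of these spaces all coordinates converge at once, and
  bounded convergence applies to \<Phi>.\<close>

lemma weak_conv_PiM:
  fixes \<mu> :: "nat \<Rightarrow> 'i \<Rightarrow> real measure" and \<Phi> :: "('i \<Rightarrow> real) \<Rightarrow> real"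
  assumes I: "finite I"
    and \<mu>: "\<And>k i. i \<in> I \<Longrightarrow> real_distribution (\<mu> k i)" and \<nu>: "\<And>i. i \<in> I \<Longrightarrow> real_distribution (\<nu> i)"
    and conv: "\<And>i. i \<in> I \<Longrightarrow> weak_conv_m (\<lambda>k. \<mu> k i) (\<nu> i)"
    and \<Phi> [measurable]: "\<Phi> \<in> borel_measurable (PiM I (\<lambda>_. borel))" and B: "\<And>x. \<bar>\<Phi> x\<bar> \<le> B"
    and cont: "\<And>X x. (\<And>i. i \<in> I \<Longrightarrow> (\<lambda>k. X k i) \<longlonglongrightarrow> x i) \<Longrightarrow> (\<lambda>k. \<Phi> (X k)) \<longlonglongrightarrow> \<Phi> x"
  shows "(\<lambda>k. \<integral>x. \<Phi> x \<partial>PiM I (\<mu> k)) \<longlonglongrightarrow> (\<integral>x. \<Phi> x \<partial>PiM I \<nu>)"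
proof -
  have "\<forall>i\<in>I. \<exists>(\<Omega> :: real measure) Ys Y. prob_space \<Omega> \<and> (\<forall>k. Ys k \<in> borel_measurable \<Omega>) \<and>
      (\<forall>k. distr \<Omega> borel (Ys k) = \<mu> k i) \<and> Y \<in> measurable \<Omega> lborel \<and> distr \<Omega> borel Y = \<nu> i \<and>
      (\<forall>x\<in>space \<Omega>. (\<lambda>k. Ys k x) \<longlonglongrightarrow> Y x)"
    using Skorohod[OF \<mu> \<nu> conv] by blast
  from this[THEN bchoice] obtain \<Omega> :: "'i \<Rightarrow> real measure" where
    "\<forall>i\<in>I. \<exists>Ys Y. prob_space (\<Omega> i) \<and> (\<forall>k. Ys k \<in> borel_measurable (\<Omega> i)) \<and>
      (\<forall>k. distr (\<Omega> i) borel (Ys k) = \<mu> k i) \<and> Y \<in> measurable (\<Omega> i) lborel \<and> distr (\<Omega> i) borel Y = \<nu> i \<and>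
      (\<forall>x\<in>space (\<Omega> i). (\<lambda>k. Ys k x) \<longlonglongrightarrow> Y x)" by blast
  from this[THEN bchoice] obtain Ys where
    "\<forall>i\<in>I. \<exists>Y. prob_space (\<Omega> i) \<and> (\<forall>k. Ys i k \<in> borel_measurable (\<Omega> i)) \<and>
      (\<forall>k. distr (\<Omega> i) borel (Ys i k) = \<mu> k i) \<and> Y \<in> measurable (\<Omega> i) lborel \<and> distr (\<Omega> i) borel Y = \<nu> i \<and>
      (\<forall>x\<in>space (\<Omega> i). (\<lambda>k. Ys i k x) \<longlonglongrightarrow> Y x)" by blast
  from this[THEN bchoice] obtain Y where Y:
    "\<forall>i\<in>I. prob_space (\<Omega> i) \<and> (\<forall>k. Ys i k \<in> borel_measurable (\<Omega> i)) \<and>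
      (\<forall>k. distr (\<Omega> i) borel (Ys i k) = \<mu> k i) \<and> Y i \<in> measurable (\<Omega> i) lborel \<and> distr (\<Omega> i) borel (Y i) = \<nu> i \<and>
      (\<forall>x\<in>space (\<Omega> i). (\<lambda>k. Ys i k x) \<longlonglongrightarrow> Y i x)" by blast
  have
    *: "\<And>i. i \<in> I \<Longrightarrow> prob_space (\<Omega> i)" "\<And>i k. i \<in> I \<Longrightarrow> Ys i k \<in> borel_measurable (\<Omega> i)"
      "\<And>i k. i \<in> I \<Longrightarrow> distr (\<Omega> i) borel (Ys i k) = \<mu> k i" "\<And>i. i \<in> I \<Longrightarrow> Y i \<in> borel_measurable (\<Omega> i)"
      "\<And>i. i \<in> I \<Longrightarrow> distr (\<Omega> i) borel (Y i) = \<nu> i"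
      "\<And>i x. i \<in> I \<Longrightarrow> x \<in> space (\<Omega> i) \<Longrightarrow> (\<lambda>k. Ys i k x) \<longlonglongrightarrow> Y i x"
    using Y by auto
  let ?P = "PiM I \<Omega>"
  interpret P: prob_space ?P by (rule prob_space_PiM) (rule *)
  have m1: "(\<lambda>x. \<lambda>i\<in>I. Ys i k (x i)) \<in> measurable ?P (PiM I (\<lambda>_. borel))" for k
    using *(2) by (intro measurable_restrict) (auto intro!: measurable_compose[OF measurable_component_singleton])
  have m2: "(\<lambda>x. \<lambda>i\<in>I. Y i (x i)) \<in> measurable ?P (PiM I (\<lambda>_. borel))"
    using *(4) by (intro measurable_restrict) (auto intro!: measurable_compose[OF measurable_component_singleton])
  have e1: "PiM I (\<mu> k) = distr ?P (PiM I (\<lambda>_. borel)) (\<lambda>x. \<lambda>i\<in>I. Ys i k (x i))" for k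
    using I * by (subst distr_PiM_components) (auto intro!: PiM_cong)
  have e2: "PiM I \<nu> = distr ?P (PiM I (\<lambda>_. borel)) (\<lambda>x. \<lambda>i\<in>I. Y i (x i))"
    using I * by (subst distr_PiM_components) (auto intro!: PiM_cong)
  have "(\<lambda>k. \<integral>x. \<Phi> (\<lambda>i\<in>I. Ys i k (x i)) \<partial>?P) \<longlonglongrightarrow> (\<integral>x. \<Phi> (\<lambda>i\<in>I. Y i (x i)) \<partial>?P)"
  proof (rule integral_dominated_convergence[where w="\<lambda>_. B"])
    show "AE x in ?P. (\<lambda>k. \<Phi> (\<lambda>i\<in>I. Ys i k (x i))) \<longlonglongrightarrow> \<Phi> (\<lambda>i\<in>I. Y i (x i))"
      by (intro AE_I2 cont) (auto simp: space_PiM intro!: *(6))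
    show "AE x in ?P. norm (\<Phi> (\<lambda>i\<in>I. Ys i k (x i))) \<le> B" for k using B by simp
  qed (use measurable_compose[OF m1 \<Phi>] measurable_compose[OF m2 \<Phi>] in auto)
  then show ?thesis unfolding e1 e2 using m1 m2 by (simp add: integral_distr)
qed

lemma (in prob_space) expectation_indep_vars:
  fixes X :: "'i \<Rightarrow> 'a \<Rightarrow> real" and \<Phi> :: "('i \<Rightarrow> real) \<Rightarrow> real"
  assumes X: "indep_vars (\<lambda>_. borel) X I" and I: "I \<noteq> {}"
    and \<Phi>: "\<Phi> \<in> borel_measurable (PiM I (\<lambda>_. borel))"
  shows "expectation (\<lambda>\<omega>. \<Phi> (\<lambda>i\<in>I. X i \<omega>)) = (\<integral>x. \<Phi> x \<partial>(\<Pi>\<^sub>M i\<in>I. distr M borel (X i)))"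
proof -
  have rv: "\<And>i. i \<in> I \<Longrightarrow> X i \<in> borel_measurable M" using X by (auto simp: indep_vars_def)
  have "distr M (\<Pi>\<^sub>M i\<in>I. borel) (\<lambda>x. \<lambda>i\<in>I. X i x) = (\<Pi>\<^sub>M i\<in>I. distr M borel (X i))"
    using X I rv by (subst (asm) indep_vars_iff_distr_eq_PiM') auto
  moreover have "(\<integral>x. \<Phi> x \<partial>distr M (\<Pi>\<^sub>M i\<in>I. borel) (\<lambda>x. \<lambda>i\<in>I. X i x)) = expectation (\<lambda>\<omega>. \<Phi> (\<lambda>i\<in>I. X i \<omega>))"
    using rv by (intro integral_distr \<Phi> measurable_restrict)
  ultimately show ?thesis by simp
qed

context prob_space
begin

lemma independent_rvs_prob:
  assumes "independent_rvs M S X S' Y" "A \<in> sets S" "B \<in> sets S'"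
  shows "prob ((X -` A \<inter> space M) \<inter> (Y -` B \<inter> space M)) = prob (X -` A \<inter> space M) * prob (Y -` B \<inter> space M)"
  using assms unfolding independent_rvs_def by (intro indep_setD) auto

lemma independent_rvs_distr:
  assumes ind: "independent_rvs M S X S' Y"
  shows "distr M (S \<Otimes>\<^sub>M S') (\<lambda>x. (X x, Y x)) = distr M S X \<Otimes>\<^sub>M distr M S' Y"
proof -
  have X: "X \<in> measurable M S" and Y: "Y \<in> measurable M S'" using ind by (auto simp: independent_rvs_def)
  have XY: "(\<lambda>x. (X x, Y x)) \<in> measurable M (S \<Otimes>\<^sub>M S')" using X Y by (rule measurable_Pair)
  interpret X: prob_space "distr M S X" by (rule prob_space_distr) fact
  interpret Y: prob_space "distr M S' Y" by (rule prob_space_distr) fact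
  show ?thesis
  proof (rule pair_measure_eqI[symmetric])
    fix A B assume "A \<in> sets (distr M S X)" "B \<in> sets (distr M S' Y)"
    then have A: "A \<in> sets S" and B: "B \<in> sets S'" by auto
    have "(\<lambda>x. (X x, Y x)) -` (A \<times> B) \<inter> space M = (X -` A \<inter> space M) \<inter> (Y -` B \<inter> space M)" by auto
    then show "emeasure (distr M S X) A * emeasure (distr M S' Y) B = emeasure (distr M (S \<Otimes>\<^sub>M S') (\<lambda>x. (X x, Y x))) (A \<times> B)"
      using A B X Y XY independent_rvs_prob[OF ind A B]
      by (simp add: emeasure_distr emeasure_eq_measure ennreal_mult)
  qed (simp_all add: X.sigma_finite_measure_axioms Y.sigma_finite_measure_axioms)
qed

lemma independent_rvs_compose:
  assumes ind: "independent_rvs M S X S' Y" and f: "f \<in> measurable S N" and g: "g \<in> measurable S' N'"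
  shows "independent_rvs M N (\<lambda>\<omega>. f (X \<omega>)) N' (\<lambda>\<omega>. g (Y \<omega>))"
proof -
  have X: "X \<in> measurable M S" and Y: "Y \<in> measurable M S'" using ind by (auto simp: independent_rvs_def)
  have "prob ((\<lambda>\<omega>. f (X \<omega>)) -` A \<inter> space M \<inter> ((\<lambda>\<omega>. g (Y \<omega>)) -` B \<inter> space M))
      = prob ((\<lambda>\<omega>. f (X \<omega>)) -` A \<inter> space M) * prob ((\<lambda>\<omega>. g (Y \<omega>)) -` B \<inter> space M)"
    if A: "A \<in> sets N" and B: "B \<in> sets N'" for A B
  proof -
    have "(\<lambda>\<omega>. f (X \<omega>)) -` A \<inter> space M = X -` (f -` A \<inter> space S) \<inter> space M"
      "(\<lambda>\<omega>. g (Y \<omega>)) -` B \<inter> space M = Y -` (g -` B \<inter> space S') \<inter> space M"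
      using measurable_space[OF X] measurable_space[OF Y] by auto
    then show ?thesis
      using independent_rvs_prob[OF ind measurable_sets[OF f A] measurable_sets[OF g B]] by simp
  qed
  moreover have "(\<lambda>\<omega>. f (X \<omega>)) \<in> measurable M N" "(\<lambda>\<omega>. g (Y \<omega>)) \<in> measurable M N'"
    using measurable_compose[OF X f] measurable_compose[OF Y g] by auto
  ultimately show ?thesis unfolding independent_rvs_def
    by (auto intro!: indep_setI measurable_sets)
qed

text \<open>A finite intersection of events splits into its parts over I and J. Each part is the
  preimage of a cylinder under one family, so independence between the families separates the parts,
  and independence within each family does the rest.\<close>

lemma independent_rvs_imp_indep_vars:
  fixes X :: "'i \<Rightarrow> 'a \<Rightarrow> 'b"
  assumes X: "indep_vars (\<lambda>_. N) X I" and Y: "indep_vars (\<lambda>_. N) X J" and IJ: "I \<inter> J = {}"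
    and ind: "independent_rvs M (PiM I (\<lambda>_. N)) (\<lambda>\<omega>. \<lambda>i\<in>I. X i \<omega>) (PiM J (\<lambda>_. N)) (\<lambda>\<omega>. \<lambda>i\<in>J. X i \<omega>)"
  shows "indep_vars (\<lambda>_. N) X (I \<union> J)"
  unfolding indep_vars_def2
proof (intro conjI ballI indep_setsI)
  fix i assume "i \<in> I \<union> J"
  then show "random_variable N (X i)" using X Y by (auto simp: indep_vars_def2)
  then show "{X i -` A \<inter> space M |A. A \<in> sets N} \<subseteq> events" by (auto intro: measurable_sets)
next
  fix A K assume K: "K \<noteq> {}" "K \<subseteq> I \<union> J" "finite K" and A: "\<forall>j\<in>K. A j \<in> {X j -` A \<inter> space M |A. A \<in> sets N}"
  then obtain B where B: "\<And>j. j \<in> K \<Longrightarrow> B j \<in> sets N" "\<And>j. j \<in> K \<Longrightarrow> A j = X j -` B j \<inter> space M"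
    by (simp add: Bex_def) metis
  \<comment> \<open>The intersection with the whole space gives the empty index set probability 1; K
    may lie entirely in I or in J.\<close>
  define G where "G K' = (\<Inter>j\<in>K'. A j) \<inter> space M" for K'
  have *: "prob (G K') = (\<Prod>j\<in>K'. prob (A j))" if K': "K' \<subseteq> K" "K' \<subseteq> L" and L: "indep_vars (\<lambda>_. N) X L" for K' L
  proof (cases "K' = {}")
    case True
    then show ?thesis by (simp add: G_def prob_space)
  next
    case False
    have AB: "\<And>j. j \<in> K' \<Longrightarrow> A j = X j -` B j \<inter> space M" "\<And>j. j \<in> K' \<Longrightarrow> B j \<in> sets N"
      using B K'(1) by blast+
    have "G K' = (\<Inter>j\<in>K'. X j -` B j \<inter> space M)"
      using False unfolding G_def by (simp add: AB(1) cong: INF_cong_simp)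
    also have "prob \<dots> = (\<Prod>j\<in>K'. prob (X j -` B j \<inter> space M))"
      using indep_varsD[OF L False _ K'(2), of B] finite_subset[OF K'(1) K(3)] AB(2) by blast
    also have "\<dots> = (\<Prod>j\<in>K'. prob (A j))" by (intro prod.cong) (simp_all add: AB(1))
    finally show ?thesis .
  qed
  have vimage: "G (K \<inter> L) = (\<lambda>\<omega>. \<lambda>i\<in>L. X i \<omega>) -` (prod_emb L (\<lambda>_. N) (K \<inter> L) (\<Pi>\<^sub>E j\<in>K \<inter> L. B j)) \<inter> space M"
    if L: "indep_vars (\<lambda>_. N) X L" for L
  proof -
    have "X i \<omega> \<in> space N" if "i \<in> L" "\<omega> \<in> space M" for i \<omega>
      using L that by (auto simp: indep_vars_def2 dest: measurable_space)
    moreover have "(\<Inter>j\<in>K \<inter> L. A j) = (\<Inter>j\<in>K \<inter> L. X j -` B j \<inter> space M)"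
      using B(2) by (intro INF_cong) auto
    ultimately show ?thesis by (auto simp: G_def prod_emb_def PiE_iff fun_eq_iff)
  qed
  have "(\<Inter>j\<in>K. A j) = G (K \<inter> I) \<inter> G (K \<inter> J)"
  proof -
    have "A j \<subseteq> space M" if "j \<in> K" for j using B(2)[OF that] by auto
    then show ?thesis using K(1,2) unfolding G_def by blast
  qed
  also have "prob \<dots> = prob (G (K \<inter> I)) * prob (G (K \<inter> J))"
    unfolding vimage[OF X] vimage[OF Y]
    by (intro independent_rvs_prob[OF ind] sets_PiM_I) (use K B in auto)
  also have "\<dots> = (\<Prod>j\<in>K \<inter> I. prob (A j)) * (\<Prod>j\<in>K \<inter> J. prob (A j))"
    using *[OF _ _ X] *[OF _ _ Y] by simp
  also have "\<dots> = (\<Prod>j\<in>(K \<inter> I) \<union> (K \<inter> J). prob (A j))"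
    using K IJ by (subst prod.union_disjoint) auto
  also have "(K \<inter> I) \<union> (K \<inter> J) = K" using K by auto
  finally show "prob (\<Inter>j\<in>K. A j) = (\<Prod>j\<in>K. prob (A j))" .
qed

section \<open>Comparison with an independent exponential variable\<close>

context
  fixes T X :: "'a \<Rightarrow> real"
  assumes T: "distributed M lborel T (exponential_density 1)" and ind: "independent_rvs M borel T borel X"
begin

lemma T_meas: "T \<in> borel_measurable M" using T by (simp add: distributed_def)
lemma X_meas: "X \<in> borel_measurable M" using ind by (simp add: independent_rvs_def)

text \<open>Fubini's theorem for the product law of T and X: T is averaged over a fresh sample point
  \<omega>' while X is held fixed at \<omega>.\<close>

lemma prob_exponential_pair:
  assumes P: "{p \<in> space (borel \<Otimes>\<^sub>M borel). P (fst p) (snd p)} \<in> sets (borel \<Otimes>\<^sub>M borel)"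
  shows "emeasure M {\<omega>\<in>space M. P (T \<omega>) (X \<omega>)} = (\<integral>\<^sup>+\<omega>. emeasure M {\<omega>'\<in>space M. P (T \<omega>') (X \<omega>)} \<partial>M)"
proof -
  note [measurable] = T_meas X_meas
  let ?A = "{p \<in> space (borel \<Otimes>\<^sub>M borel). P (fst p) (snd p)} :: (real \<times> real) set"
  interpret X: prob_space "distr M borel X" by (rule prob_space_distr) measurable
  interpret T: prob_space "distr M borel T" by (rule prob_space_distr) measurable
  interpret TX: pair_sigma_finite "distr M borel T" "distr M borel X" ..
  have A: "?A \<in> sets (distr M borel T \<Otimes>\<^sub>M distr M borel X)" using P by (simp cong: sets_pair_measure_cong)
  have "emeasure M {\<omega>\<in>space M. P (T \<omega>) (X \<omega>)} = emeasure (distr M (borel \<Otimes>\<^sub>M borel) (\<lambda>x. (T x, X x))) ?A"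
    using P by (subst emeasure_distr) (auto simp: space_pair_measure intro!: arg_cong[where f="emeasure M"])
  also have "\<dots> = emeasure (distr M borel T \<Otimes>\<^sub>M distr M borel X) ?A"
    by (simp add: independent_rvs_distr[OF ind])
  also have "\<dots> = (\<integral>\<^sup>+x. emeasure (distr M borel T) ((\<lambda>t. (t, x)) -` ?A) \<partial>distr M borel X)"
    by (rule TX.emeasure_pair_measure_alt2[OF A])
  also have "\<dots> = (\<integral>\<^sup>+\<omega>. emeasure (distr M borel T) ((\<lambda>t. (t, X \<omega>)) -` ?A) \<partial>M)"
    by (intro nn_integral_distr) (use TX.measurable_emeasure_Pair2[OF A] in auto)
  also have "\<dots> = (\<integral>\<^sup>+\<omega>. emeasure M {\<omega>'\<in>space M. P (T \<omega>') (X \<omega>)} \<partial>M)"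
  proof (rule nn_integral_cong)
    fix \<omega>
    have "(\<lambda>t. (t, X \<omega>)) -` ?A \<in> sets borel" using sets_Pair2[OF A, of "X \<omega>"] by simp
    then show "emeasure (distr M borel T) ((\<lambda>t. (t, X \<omega>)) -` ?A) = emeasure M {\<omega>'\<in>space M. P (T \<omega>') (X \<omega>)}"
      by (subst emeasure_distr) (auto simp: space_pair_measure intro!: arg_cong[where f="emeasure M"])
  qed
  finally show ?thesis .
qed

lemma exponential_interval:
  assumes "\<delta> \<ge> 0"
  shows "emeasure M {\<omega>\<in>space M. - \<delta> \<le> T \<omega> - x \<and> T \<omega> - x < 0} \<le> ennreal \<delta>"
proof -
  have "emeasure M {\<omega>\<in>space M. - \<delta> \<le> T \<omega> - x \<and> T \<omega> - x < 0} = emeasure M (T -` {x - \<delta>..<x} \<inter> space M)"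
    by (intro arg_cong[where f="emeasure M"]) auto
  also have "\<dots> = (\<integral>\<^sup>+t. ennreal (exponential_density 1 t) * indicator {x - \<delta>..<x} t \<partial>lborel)"
    by (rule distributed_emeasure[OF T]) simp
  also have "\<dots> \<le> (\<integral>\<^sup>+t. indicator {x - \<delta>..<x} t \<partial>lborel)"
    by (intro nn_integral_mono) (auto simp: exponential_density_def indicator_def ennreal_le_1)
  also have "\<dots> = ennreal \<delta>" using assms by simp
  finally show ?thesis .
qed

text \<open>The density of T is at most 1, so T hits an interval of length \<delta> with probability
  at most \<delta>. After conditioning on X this holds for a random interval too, whatever the law
  of X.\<close>

lemma prob_exponential_near:
  assumes \<delta>: "\<delta> \<ge> 0"
  shows "prob {\<omega>\<in>space M. - \<delta> \<le> T \<omega> - X \<omega> \<and> T \<omega> - X \<omega> < 0} \<le> \<delta>"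
proof -
  have "emeasure M {\<omega>\<in>space M. - \<delta> \<le> T \<omega> - X \<omega> \<and> T \<omega> - X \<omega> < 0}
      = (\<integral>\<^sup>+\<omega>. emeasure M {\<omega>'\<in>space M. - \<delta> \<le> T \<omega>' - X \<omega> \<and> T \<omega>' - X \<omega> < 0} \<partial>M)"
    by (rule prob_exponential_pair) measurable
  also have "\<dots> \<le> (\<integral>\<^sup>+\<omega>. ennreal \<delta> \<partial>M)"
    by (intro nn_integral_mono exponential_interval \<delta>)
  also have "\<dots> = ennreal \<delta>" by (simp add: emeasure_space_1)
  finally show ?thesis using \<delta> by (simp add: emeasure_eq_measure)
qed

text \<open>For x \<ge> 0 the exponential tail is exp (-x), and lowering the rate to \<eta> only
  increases it; for x < 0 the bound exceeds 1. The rate is left free because the Chernoff bound for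
  the walks chooses a small \<eta>.\<close>

lemma prob_exponential_ge:
  assumes \<eta>: "0 < \<eta>" "\<eta> \<le> 1"
  shows "emeasure M {\<omega>\<in>space M. T \<omega> \<ge> X \<omega>} \<le> (\<integral>\<^sup>+\<omega>. exp (- (\<eta> * X \<omega>)) \<partial>M)"
proof -
  note [measurable] = T_meas X_meas
  have "emeasure M {\<omega>\<in>space M. T \<omega> \<ge> X \<omega>} = (\<integral>\<^sup>+\<omega>. emeasure M {\<omega>'\<in>space M. T \<omega>' \<ge> X \<omega>} \<partial>M)"
    by (rule prob_exponential_pair[where P="\<lambda>t x. x \<le> t"]) measurable
  also have "\<dots> \<le> (\<integral>\<^sup>+\<omega>. exp (- (\<eta> * X \<omega>)) \<partial>M)"
  proof (rule nn_integral_mono)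
    fix \<omega>
    show "emeasure M {\<omega>'\<in>space M. T \<omega>' \<ge> X \<omega>} \<le> ennreal (exp (- (\<eta> * X \<omega>)))"
    proof (cases "X \<omega> \<ge> 0")
      case True
      have "emeasure M {\<omega>'\<in>space M. T \<omega>' \<ge> X \<omega>} = emeasure M (T -` {X \<omega>..} \<inter> space M)"
        by (intro arg_cong[where f="emeasure M"]) auto
      also have "\<dots> = (\<integral>\<^sup>+t. ennreal (exponential_density 1 t) * indicator {X \<omega>..} t \<partial>lborel)"
        by (rule distributed_emeasure[OF T]) simp
      also have "\<dots> = (\<integral>\<^sup>+t. ennreal (exp (- t)) * indicator {X \<omega>..} t \<partial>lborel)"
        using True by (intro nn_integral_cong) (auto simp: exponential_density_def indicator_def)
      also have "\<dots> = ennreal (0 - (- exp (- X \<omega>)))"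
      proof (rule nn_integral_FTC_atLeast)
        show "((\<lambda>t. - exp (- t)) \<longlongrightarrow> (0 :: real)) at_top" by real_asymp
      qed (auto intro!: derivative_eq_intros)
      also have "\<dots> \<le> ennreal (exp (- (\<eta> * X \<omega>)))"
        using True \<eta> mult_right_mono[of \<eta> 1 "X \<omega>"] by (intro ennreal_leI) auto
      finally show ?thesis .
    next
      case False
      then have "1 \<le> exp (- (\<eta> * X \<omega>))" using \<eta> by (simp add: mult_nonneg_nonpos)
      then have "1 \<le> ennreal (exp (- (\<eta> * X \<omega>)))" using ennreal_leI by fastforce
      moreover have "emeasure M {\<omega>'\<in>space M. T \<omega>' \<ge> X \<omega>} \<le> 1" by (rule emeasure_le_1)
      ultimately show ?thesis by (rule order_trans[rotated])
    qed
  qed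
  finally show ?thesis .
qed

end

end

section \<open>Convergence of joint exceedance probabilities\<close>

text \<open>A continuous version of the indicator of x \<ge> 0: for \<delta> > 0 it rises linearly
  from 0 at -\<delta> to 1 at 0.\<close>

definition ramp :: "real \<Rightarrow> real \<Rightarrow> real" where "ramp \<delta> x = max 0 (min 1 (1 + x / \<delta>))"

lemma ramp_bounds: "0 \<le> ramp \<delta> x" "ramp \<delta> x \<le> 1" by (auto simp: ramp_def)

lemma ramp_cont: "isCont (ramp \<delta>) x" unfolding ramp_def divide_inverse by (intro continuous_intros)

lemma ramp_measurable [measurable]: "ramp \<delta> \<in> borel_measurable borel"
  unfolding ramp_def by measurable

lemma ramp_lipschitz: "\<delta> > 0 \<Longrightarrow> \<bar>ramp \<delta> x - ramp \<delta> y\<bar> \<le> \<bar>x - y\<bar> / \<delta>"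
proof -
  assume "\<delta> > 0"
  then have "\<bar>x - y\<bar> / \<delta> = \<bar>x / \<delta> - y / \<delta>\<bar>" by (simp add: abs_divide diff_divide_distrib[symmetric])
  then show ?thesis by (auto simp: ramp_def)
qed

lemma ramp_indicator: "\<delta> > 0 \<Longrightarrow> \<bar>of_bool (0 \<le> x) - ramp \<delta> x\<bar> \<le> of_bool (- \<delta> \<le> x \<and> x < 0)"
  by (auto simp: ramp_def field_simps min_def max_def)

context prob_space
begin

text \<open>Each of the n events costs twice: \<delta> for smoothing the indicator, which matters
  only when T lies within \<delta> below W, and e / \<delta> for replacing W by V, through the
  Lipschitz constant of the ramp.\<close>

lemma exceedance_ramp:
  fixes W V :: "nat \<Rightarrow> 'a \<Rightarrow> real"
  assumes T: "distributed M lborel T (exponential_density 1)" and ind: "\<And>i. i < n \<Longrightarrow> independent_rvs M borel T borel (W i)"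
    and V: "\<And>i. i < n \<Longrightarrow> V i \<in> borel_measurable M" and \<delta>: "\<delta> > 0"
    and e: "\<And>i. i < n \<Longrightarrow> (\<integral>\<^sup>+\<omega>. ennreal \<bar>W i \<omega> - V i \<omega>\<bar> \<partial>M) \<le> ennreal e" and e0: "e \<ge> 0"
  shows "\<bar>prob {\<omega>\<in>space M. \<forall>i<n. T \<omega> \<ge> W i \<omega>} - expectation (\<lambda>\<omega>. \<Prod>i<n. ramp \<delta> (T \<omega> - V i \<omega>))\<bar>
      \<le> n * \<delta> + n * (e / \<delta>)"
proof -
  have [measurable]: "T \<in> borel_measurable M" using T by (simp add: distributed_def)
  have W [measurable]: "i < n \<Longrightarrow> W i \<in> borel_measurable M" for i using ind by (simp add: independent_rvs_def)
  note V [measurable]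
  define N where "N i = {\<omega>\<in>space M. - \<delta> \<le> T \<omega> - W i \<omega> \<and> T \<omega> - W i \<omega> < 0}" for i
  have Nm [measurable]: "i < n \<Longrightarrow> N i \<in> sets M" for i unfolding N_def by measurable
  have iWV: "integrable M (\<lambda>\<omega>. \<bar>W i \<omega> - V i \<omega>\<bar>)" and eWV: "expectation (\<lambda>\<omega>. \<bar>W i \<omega> - V i \<omega>\<bar>) \<le> e" if i: "i < n" for i
  proof -
    show i1: "integrable M (\<lambda>\<omega>. \<bar>W i \<omega> - V i \<omega>\<bar>)"
      using e[OF i] i by (intro integrableI_nonneg) (auto intro: le_less_trans)
    show "expectation (\<lambda>\<omega>. \<bar>W i \<omega> - V i \<omega>\<bar>) \<le> e"
      using e[OF i] e0 by (subst (asm) nn_integral_eq_integral[OF i1]) auto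
  qed
  have pm: "(\<lambda>\<omega>. \<Prod>i<n. of_bool (T \<omega> \<ge> W i \<omega>) :: real) \<in> borel_measurable M"
    "(\<lambda>\<omega>. \<Prod>i<n. ramp \<delta> (T \<omega> - V i \<omega>)) \<in> borel_measurable M"
    by (intro borel_measurable_prod; simp)+
  have i1: "integrable M (\<lambda>\<omega>. \<Prod>i<n. of_bool (T \<omega> \<ge> W i \<omega>) :: real)"
    by (rule integrable_const_bound[where B=1]) (use pm in \<open>auto simp: abs_prod intro!: prod_le_1 AE_I2\<close>)
  have i2: "integrable M (\<lambda>\<omega>. \<Prod>i<n. ramp \<delta> (T \<omega> - V i \<omega>))"
    by (rule integrable_const_bound[where B=1])
       (use pm ramp_bounds in \<open>auto simp: abs_prod intro!: prod_le_1 AE_I2\<close>)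
  have eq: "prob {\<omega>\<in>space M. \<forall>i<n. T \<omega> \<ge> W i \<omega>} = expectation (\<lambda>\<omega>. \<Prod>i<n. of_bool (T \<omega> \<ge> W i \<omega>))"
  proof -
    have "expectation (\<lambda>\<omega>. \<Prod>i<n. of_bool (T \<omega> \<ge> W i \<omega>) :: real)
        = expectation (\<lambda>\<omega>. indicator {\<omega>\<in>space M. \<forall>i<n. T \<omega> \<ge> W i \<omega>} \<omega>)"
    proof (rule Bochner_Integration.integral_cong[OF refl])
      fix \<omega> assume "\<omega> \<in> space M"
      moreover have "(\<Prod>i<n. of_bool (P i)) = (of_bool (\<forall>i<n. P i) :: real)" for P
        by (induction n) (auto simp: less_Suc_eq)
      ultimately show "(\<Prod>i<n. of_bool (T \<omega> \<ge> W i \<omega>) :: real)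
          = (indicator {\<omega>\<in>space M. \<forall>i<n. T \<omega> \<ge> W i \<omega>} \<omega> :: real)"
        by (simp add: indicator_def)
    qed
    then show ?thesis by simp
  qed
  have pt: "\<bar>(\<Prod>i<n. of_bool (T \<omega> \<ge> W i \<omega>)) - (\<Prod>i<n. ramp \<delta> (T \<omega> - V i \<omega>))\<bar>
      \<le> (\<Sum>i<n. indicator (N i) \<omega> + \<bar>W i \<omega> - V i \<omega>\<bar> / \<delta>)" if "\<omega> \<in> space M" for \<omega>
  proof -
    have "norm ((\<Prod>i<n. of_bool (T \<omega> \<ge> W i \<omega>)) - (\<Prod>i<n. ramp \<delta> (T \<omega> - V i \<omega>)))
        \<le> (\<Sum>i<n. norm (of_bool (T \<omega> \<ge> W i \<omega>) - ramp \<delta> (T \<omega> - V i \<omega>)))"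
      by (rule norm_prod_diff) (use ramp_bounds in auto)
    also have "\<dots> \<le> (\<Sum>i<n. indicator (N i) \<omega> + \<bar>W i \<omega> - V i \<omega>\<bar> / \<delta>)"
    proof (rule sum_mono)
      fix i
      have "\<bar>of_bool (0 \<le> T \<omega> - W i \<omega>) - ramp \<delta> (T \<omega> - W i \<omega>)\<bar> \<le> indicator (N i) \<omega>"
        using ramp_indicator[OF \<delta>, of "T \<omega> - W i \<omega>"] that by (simp add: N_def indicator_def)
      moreover have "\<bar>ramp \<delta> (T \<omega> - W i \<omega>) - ramp \<delta> (T \<omega> - V i \<omega>)\<bar> \<le> \<bar>W i \<omega> - V i \<omega>\<bar> / \<delta>"
        using ramp_lipschitz[OF \<delta>, of "T \<omega> - W i \<omega>" "T \<omega> - V i \<omega>"] by (simp add: abs_minus_commute)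
      ultimately show "norm (of_bool (T \<omega> \<ge> W i \<omega>) - ramp \<delta> (T \<omega> - V i \<omega>))
          \<le> indicator (N i) \<omega> + \<bar>W i \<omega> - V i \<omega>\<bar> / \<delta>" by simp
    qed
    finally show ?thesis by simp
  qed
  have "\<bar>prob {\<omega>\<in>space M. \<forall>i<n. T \<omega> \<ge> W i \<omega>} - expectation (\<lambda>\<omega>. \<Prod>i<n. ramp \<delta> (T \<omega> - V i \<omega>))\<bar>
      = \<bar>expectation (\<lambda>\<omega>. (\<Prod>i<n. of_bool (T \<omega> \<ge> W i \<omega>)) - (\<Prod>i<n. ramp \<delta> (T \<omega> - V i \<omega>)))\<bar>"
    unfolding eq using i1 i2 by simp
  also have "\<dots> \<le> expectation (\<lambda>\<omega>. \<bar>(\<Prod>i<n. of_bool (T \<omega> \<ge> W i \<omega>)) - (\<Prod>i<n. ramp \<delta> (T \<omega> - V i \<omega>))\<bar>)"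
    by (rule integral_abs_bound)
  also have "\<dots> \<le> expectation (\<lambda>\<omega>. \<Sum>i<n. indicator (N i) \<omega> + \<bar>W i \<omega> - V i \<omega>\<bar> / \<delta>)"
    using i1 i2 iWV by (intro integral_mono pt) (auto simp: emeasure_eq_measure)
  also have "\<dots> = (\<Sum>i<n. prob (N i) + expectation (\<lambda>\<omega>. \<bar>W i \<omega> - V i \<omega>\<bar>) / \<delta>)"
    using iWV by (subst Bochner_Integration.integral_sum) (auto simp: emeasure_eq_measure)
  also have "\<dots> \<le> (\<Sum>i<n. \<delta> + e / \<delta>)"
  proof (intro sum_mono add_mono divide_right_mono)
    fix i assume i: "i \<in> {..<n}"
    show "prob (N i) \<le> \<delta>" unfolding N_def using i \<delta> by (intro prob_exponential_near[OF T ind]) auto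
    show "expectation (\<lambda>\<omega>. \<bar>W i \<omega> - V i \<omega>\<bar>) \<le> e" using i by (intro eWV) auto
  qed (use \<delta> in auto)
  also have "\<dots> = n * \<delta> + n * (e / \<delta>)" by (simp add: distrib_left)
  finally show ?thesis .
qed

end

text \<open>The index \<open>None\<close> carries the exponential variable, the indices \<open>Some j\<close> the increments.\<close>

lemma exceedance_limit:
  fixes M :: "nat \<Rightarrow> 'm measure" and N :: "'n measure" and W :: "nat \<Rightarrow> nat \<Rightarrow> 'm \<Rightarrow> real" and W' :: "nat \<Rightarrow> 'n \<Rightarrow> real"
    and V :: "nat \<Rightarrow> 'j option \<Rightarrow> 'm \<Rightarrow> real" and V' :: "'j option \<Rightarrow> 'n \<Rightarrow> real"
  assumes M: "\<And>k. prob_space (M k)" and N: "prob_space N" and I: "finite I" "None \<in> I"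
    and T: "\<And>k. distributed (M k) lborel (V k None) (exponential_density 1)"
    and T': "distributed N lborel (V' None) (exponential_density 1)"
    and ind: "\<And>k i. i < n \<Longrightarrow> independent_rvs (M k) borel (V k None) borel (W k i)"
    and ind': "\<And>i. i < n \<Longrightarrow> independent_rvs N borel (V' None) borel (W' i)"
    and V: "\<And>k. prob_space.indep_vars (M k) (\<lambda>_. borel) (V k) I"
    and V': "prob_space.indep_vars N (\<lambda>_. borel) V' I"
    and K: "\<And>i. i < n \<Longrightarrow> Some ` K i \<subseteq> I" "\<And>i. finite (K i)"
    and conv: "\<And>j. Some j \<in> I \<Longrightarrow> weak_conv_m (\<lambda>k. distr (M k) borel (V k (Some j))) (distr N borel (V' (Some j)))"
    and approx: "\<And>i e. i < n \<Longrightarrow> e > 0 \<Longrightarrow> \<forall>\<^sub>F k in sequentially.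
      (\<integral>\<^sup>+\<omega>. ennreal \<bar>W k i \<omega> - (\<Sum>j\<in>K i. V k (Some j) \<omega>)\<bar> \<partial>M k) \<le> ennreal e"
    and approx': "\<And>i. i < n \<Longrightarrow> AE \<omega> in N. W' i \<omega> = (\<Sum>j\<in>K i. V' (Some j) \<omega>)"
  shows "(\<lambda>k. measure (M k) {\<omega>\<in>space (M k). \<forall>i<n. V k None \<omega> \<ge> W k i \<omega>})
     \<longlonglongrightarrow> measure N {\<omega>\<in>space N. \<forall>i<n. V' None \<omega> \<ge> W' i \<omega>}"
proof (rule tendstoI)
  interpret M: prob_space "M k" for k by (rule M)
  interpret N: prob_space N by (rule N)
  fix e :: real assume e: "e > 0"
  \<comment> \<open>Smoothing width and L1 error are balanced: with
    \<open>f = \<delta>\<^sup>2\<close> both costs are n \<delta>, and their sum is at most e /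
    4.\<close>
  define \<delta> where "\<delta> = e / (8 * (real n + 1))"
  define f where "f = \<delta>\<^sup>2"
  have \<delta>: "\<delta> > 0" "real n * \<delta> \<le> e / 8" using e by (auto simp: \<delta>_def field_simps)
  have f: "f > 0" "f / \<delta> = \<delta>" using \<delta> by (auto simp: f_def power2_eq_square)
  have nf: "real n * \<delta> + real n * (f / \<delta>) \<le> e / 4" unfolding f(2) using \<delta>(2) by linarith
  have Vm: "i \<in> I \<Longrightarrow> V k i \<in> borel_measurable (M k)" for k i using V[of k] by (auto simp: M.indep_vars_def)
  have V'm: "i \<in> I \<Longrightarrow> V' i \<in> borel_measurable N" for i using V' by (auto simp: N.indep_vars_def)
  have Km: "i < n \<Longrightarrow> (\<lambda>\<omega>. \<Sum>j\<in>K i. V k (Some j) \<omega>) \<in> borel_measurable (M k)"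
    "i < n \<Longrightarrow> (\<lambda>\<omega>. \<Sum>j\<in>K i. V' (Some j) \<omega>) \<in> borel_measurable N" for i k
    using K by (auto intro!: borel_measurable_sum Vm V'm)
  define \<Phi> where "\<Phi> x = (\<Prod>i<n. ramp \<delta> (x None - (\<Sum>j\<in>K i. x (Some j))))" for x :: "'j option \<Rightarrow> real"
  have \<Phi>m: "\<Phi> \<in> borel_measurable (PiM I (\<lambda>_. borel))"
  proof -
    have c: "(\<lambda>x. x i) \<in> borel_measurable (PiM I (\<lambda>_. borel))" if "i \<in> I" for i :: "'j option"
      using measurable_component_singleton[OF that, of "\<lambda>_. borel"] by simp
    have K': "Some j \<in> I" if "i < n" "j \<in> K i" for i j using K that by blast
    show ?thesis unfolding \<Phi>_def using I K'
      by (intro borel_measurable_prod measurable_compose[OF _ ramp_measurable] borel_measurable_diff borel_measurable_sum c) auto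
  qed
  have \<Phi>r: "\<Phi> (\<lambda>i\<in>I. x i) = \<Phi> x" for x
  proof -
    have "restrict x I (Some j) = x (Some j)" if "i < n" "j \<in> K i" for i j using K that by auto
    then show ?thesis unfolding \<Phi>_def using I by (intro prod.cong refl) simp
  qed
  \<comment> \<open>The coordinate \<open>None\<close> has the same exponential law for every k, so
    only the increments need a limit theorem.\<close>
  have wc: "weak_conv_m (\<lambda>k. distr (M k) borel (V k i)) (distr N borel (V' i))" if i: "i \<in> I" for i
  proof (cases i)
    case None
    have "distr (M k) borel (V k None) = distr N borel (V' None)" for k
    proof -
      have "distr (M k) borel (V k None) = density lborel (exponential_density 1)"
        using T[of k] by (simp add: distributed_def cong: distr_cong)
      moreover have "distr N borel (V' None) = density lborel (exponential_density 1)"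
        using T' by (simp add: distributed_def cong: distr_cong)
      ultimately show ?thesis by simp
    qed
    then show ?thesis using None by (simp add: weak_conv_m_def weak_conv_def)
  qed (use conv i in auto)
  have "(\<lambda>k. \<integral>x. \<Phi> x \<partial>(\<Pi>\<^sub>M i\<in>I. distr (M k) borel (V k i))) \<longlonglongrightarrow> (\<integral>x. \<Phi> x \<partial>(\<Pi>\<^sub>M i\<in>I. distr N borel (V' i)))"
  proof (rule weak_conv_PiM[where B=1])
    show "\<bar>\<Phi> x\<bar> \<le> 1" for x
      unfolding \<Phi>_def abs_prod by (intro prod_le_1) (auto simp: ramp_bounds abs_of_nonneg)
    show "(\<lambda>k. \<Phi> (X k)) \<longlonglongrightarrow> \<Phi> x" if "\<And>i. i \<in> I \<Longrightarrow> (\<lambda>k. X k i) \<longlonglongrightarrow> x i" for X x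
      unfolding \<Phi>_def using I K
      by (intro tendsto_prod isCont_tendsto_compose[OF ramp_cont] tendsto_diff tendsto_sum that) auto
  qed (use I wc \<Phi>m Vm V'm in \<open>auto intro!: M.real_distribution_distr N.real_distribution_distr\<close>)
  then have lim: "(\<lambda>k. \<integral>\<omega>. \<Phi> (\<lambda>i. V k i \<omega>) \<partial>M k) \<longlonglongrightarrow> (\<integral>\<omega>. \<Phi> (\<lambda>i. V' i \<omega>) \<partial>N)"
  proof -
    have "I \<noteq> {}" using I by auto
    from M.expectation_indep_vars[OF V this \<Phi>m] N.expectation_indep_vars[OF V' this \<Phi>m]
    show ?thesis using \<open>(\<lambda>k. \<integral>x. \<Phi> x \<partial>_ k) \<longlonglongrightarrow> _\<close> by (simp add: \<Phi>r)
  qed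
  have closeN: "\<bar>measure N {\<omega>\<in>space N. \<forall>i<n. V' None \<omega> \<ge> W' i \<omega>} - (\<integral>\<omega>. \<Phi> (\<lambda>i. V' i \<omega>) \<partial>N)\<bar> \<le> e / 4"
  proof -
    have *: "(\<integral>\<^sup>+\<omega>. ennreal \<bar>W' i \<omega> - (\<Sum>j\<in>K i. V' (Some j) \<omega>)\<bar> \<partial>N) \<le> ennreal f" if "i < n" for i
    proof -
      have "(\<integral>\<^sup>+\<omega>. ennreal \<bar>W' i \<omega> - (\<Sum>j\<in>K i. V' (Some j) \<omega>)\<bar> \<partial>N) = (\<integral>\<^sup>+\<omega>. 0 \<partial>N)"
        using approx'[OF that] by (intro nn_integral_cong_AE) (auto elim: eventually_mono)
      then show ?thesis by simp
    qed
    show ?thesis unfolding \<Phi>_def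
      using order_trans[OF N.exceedance_ramp[where n=n and W=W' and e=f, OF T' ind' Km(2) \<delta>(1) *] nf] f(1) by simp
  qed
  have "\<forall>\<^sub>F k in sequentially. \<forall>i\<in>{..<n}. (\<integral>\<^sup>+\<omega>. ennreal \<bar>W k i \<omega> - (\<Sum>j\<in>K i. V k (Some j) \<omega>)\<bar> \<partial>M k) \<le> ennreal f"
    using approx f by (intro eventually_ball_finite) auto
  moreover have "\<forall>\<^sub>F k in sequentially. dist (\<integral>\<omega>. \<Phi> (\<lambda>i. V k i \<omega>) \<partial>M k) (\<integral>\<omega>. \<Phi> (\<lambda>i. V' i \<omega>) \<partial>N) < e / 4"
    using tendstoD[OF lim, of "e / 4"] e by simp
  ultimately show "\<forall>\<^sub>F k in sequentially. dist (measure (M k) {\<omega>\<in>space (M k). \<forall>i<n. V k None \<omega> \<ge> W k i \<omega>})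
      (measure N {\<omega>\<in>space N. \<forall>i<n. V' None \<omega> \<ge> W' i \<omega>}) < e"
  proof eventually_elim
    case (elim k)
    have "\<bar>measure (M k) {\<omega>\<in>space (M k). \<forall>i<n. V k None \<omega> \<ge> W k i \<omega>} - (\<integral>\<omega>. \<Phi> (\<lambda>i. V k i \<omega>) \<partial>M k)\<bar> \<le> e / 4"
      unfolding \<Phi>_def
      using order_trans[OF M.exceedance_ramp[where n=n and W="W k" and e=f and V="\<lambda>i \<omega>. \<Sum>j\<in>K i. V k (Some j) \<omega>",
          OF T ind Km(1) \<delta>(1)] nf] elim(1) f(1) by simp
    then show ?case using closeN elim(2) e unfolding dist_real_def by linarith
  qed
qed

section \<open>The tilted noise as a pair of random walks\<close>

text \<open>Enumerating the integers turns the unordered sum into an ordinary series, and for real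
  terms summability means absolute summability. Where it fails, \<open>infsum\<close> has the value
  0. Measurability is read off from this explicit case distinction.\<close>

lemma moving_average_eq:
  "moving_average a Z n \<omega> =
    (if summable (\<lambda>m. \<bar>a (int_decode m) * Z (n - int_decode m) \<omega>\<bar>)
     then (\<Sum>m. a (int_decode m) * Z (n - int_decode m) \<omega>) else 0)"
proof -
  let ?f = "\<lambda>m. a (int_decode m) * Z (n - int_decode m) \<omega>"
  have "moving_average a Z n \<omega> = infsum ?f UNIV"
    unfolding moving_average_def
    by (rule infsum_reindex_bij_betw[OF bij_int_decode, symmetric])
  also have "\<dots> = (if summable (\<lambda>m. \<bar>?f m\<bar>) then suminf ?f else 0)"
  proof (cases "summable (\<lambda>m. \<bar>?f m\<bar>)")
    case True
    then have "(?f has_sum suminf ?f) UNIV"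
      using summable_rabs_cancel by (intro norm_summable_imp_has_sum) (auto simp: summable_sums)
    then show ?thesis using True by (simp add: infsumI)
  next
    case False
    then have "\<not> ?f summable_on UNIV"
      using summable_on_iff_abs_summable_on_real[of ?f UNIV] summable_on_UNIV_nonneg_real_iff[of "\<lambda>m. \<bar>?f m\<bar>"] by auto
    then show ?thesis using False by (simp add: infsum_not_exists)
  qed
  finally show ?thesis .
qed

lemma moving_average_measurable [measurable]:
  assumes [measurable]: "\<And>k. Z k \<in> borel_measurable M"
  shows "moving_average a Z n \<in> borel_measurable M"
proof -
  have "(\<lambda>\<omega>. if (\<Sum>m. ennreal \<bar>a (int_decode m) * Z (n - int_decode m) \<omega>\<bar>) < \<infinity>
      then (\<Sum>m. a (int_decode m) * Z (n - int_decode m) \<omega>) else 0) \<in> borel_measurable M"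
    by measurable
  moreover have "summable (\<lambda>m. \<bar>f m\<bar>) \<longleftrightarrow> (\<Sum>m. ennreal \<bar>f m\<bar>) < \<infinity>" for f :: "nat \<Rightarrow> real"
  proof
    assume "summable (\<lambda>m. \<bar>f m\<bar>)"
    then have "(\<Sum>m. ennreal \<bar>f m\<bar>) = ennreal (\<Sum>m. \<bar>f m\<bar>)" by (intro suminf_ennreal2) auto
    then show "(\<Sum>m. ennreal \<bar>f m\<bar>) < \<infinity>" by simp
  next
    assume "(\<Sum>m. ennreal \<bar>f m\<bar>) < \<infinity>"
    then show "summable (\<lambda>m. \<bar>f m\<bar>)" by (intro summable_suminf_not_top) auto
  qed
  ultimately show ?thesis unfolding moving_average_eq[abs_def] by (simp only:)
qed

text \<open>The expected sum of the absolute terms is at most C times the sum of \<bar>a i\<bar>,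
  hence finite, and the series converges absolutely almost surely. The summation index is changed to
  that of the noise, so that several moving averages can be added term by term.\<close>

lemma (in prob_space) AE_moving_average:
  fixes Z :: "int \<Rightarrow> 'a \<Rightarrow> real"
  assumes a: "(\<lambda>i. \<bar>a i\<bar>) summable_on UNIV" and Z [measurable]: "\<And>k. Z k \<in> borel_measurable M"
    and int: "\<And>k. integrable M (\<lambda>\<omega>. exp (2 * \<bar>Z k \<omega>\<bar>))" and C: "\<And>k. expectation (\<lambda>\<omega>. exp (2 * \<bar>Z k \<omega>\<bar>)) \<le> C"
  shows "AE \<omega> in M. ((\<lambda>k. a (n - k) * Z k \<omega>) has_sum moving_average a Z n \<omega>) UNIV"
proof -
  let ?f = "\<lambda>\<omega> m. a (int_decode m) * Z (n - int_decode m) \<omega>"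
  have sa: "summable (\<lambda>m. \<bar>a (int_decode m)\<bar>)"
    using a summable_on_reindex_bij_betw[OF bij_int_decode, of "\<lambda>i. \<bar>a i\<bar>"]
    by (simp add: summable_on_UNIV_nonneg_real_iff)
  have C0: "C \<ge> 0" using exp_moment_C[OF Z int C] by simp
  have "(\<integral>\<^sup>+\<omega>. (\<Sum>m. ennreal \<bar>?f \<omega> m\<bar>) \<partial>M) = (\<Sum>m. \<integral>\<^sup>+\<omega>. ennreal \<bar>?f \<omega> m\<bar> \<partial>M)"
    by (intro nn_integral_suminf) measurable
  also have "\<dots> \<le> (\<Sum>m. ennreal (\<bar>a (int_decode m)\<bar> * C))"
  proof (intro suminf_le)
    fix m
    note em = exp_moment_integrable(1)[OF Z int C] exp_moment_abs_mean(1)[OF Z int C]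
    have "(\<integral>\<^sup>+\<omega>. ennreal \<bar>?f \<omega> m\<bar> \<partial>M) = ennreal (expectation (\<lambda>\<omega>. \<bar>?f \<omega> m\<bar>))"
      using em by (intro nn_integral_eq_integral) auto
    also have "\<dots> \<le> ennreal (\<bar>a (int_decode m)\<bar> * C)"
      using em by (intro ennreal_leI) (auto simp: abs_mult intro: mult_left_mono)
    finally show "(\<integral>\<^sup>+\<omega>. ennreal \<bar>?f \<omega> m\<bar> \<partial>M) \<le> ennreal (\<bar>a (int_decode m)\<bar> * C)" .
  qed auto
  also have "\<dots> = ennreal (\<Sum>m. \<bar>a (int_decode m)\<bar> * C)"
    using sa C0 by (intro suminf_ennreal2 summable_mult2) auto
  also have "\<dots> < \<infinity>" by simp
  finally have "AE \<omega> in M. (\<Sum>m. ennreal \<bar>?f \<omega> m\<bar>) \<noteq> \<infinity>"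
    by (intro nn_integral_PInf_AE) auto
  then show ?thesis
  proof eventually_elim
    case (elim \<omega>)
    then have s: "summable (\<lambda>m. \<bar>?f \<omega> m\<bar>)" using summable_suminf_not_top[of "\<lambda>m. \<bar>?f \<omega> m\<bar>"] by auto
    then have "(?f \<omega> has_sum moving_average a Z n \<omega>) UNIV"
      using summable_rabs_cancel[OF s] unfolding moving_average_eq
      by (simp add: norm_summable_imp_has_sum summable_sums)
    then have "((\<lambda>i. a i * Z (n - i) \<omega>) has_sum moving_average a Z n \<omega>) UNIV"
      by (subst (asm) has_sum_reindex_bij_betw[OF bij_int_decode])
    moreover have "bij_betw (\<lambda>k::int. n - k) UNIV UNIV"
      by (rule bij_betwI[where g="\<lambda>k. n - k"]) auto
    ultimately show ?case
      by (subst (asm) has_sum_reindex_bij_betw[of "\<lambda>k. n - k" UNIV UNIV, symmetric]) auto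
  qed
qed

context tilted_coeffs
begin

text \<open>The two moving averages in a step share their coefficients, so a step is a moving
  average of the differences \<open>Z Minus k - Z Plus k\<close>. Grouping the noise in pairs makes
  these differences independent over k.\<close>

lemma tilted_walkI:
  fixes M :: "'m measure" and Z :: "sign \<Rightarrow> int \<Rightarrow> 'm \<Rightarrow> real"
  assumes M: "prob_space M" and indep: "prob_space.indep_vars M (\<lambda>_. borel) (\<lambda>(k, u). Z u k) UNIV"
    and law_m: "\<And>k. distr M borel (Z Minus k) = tilted F (\<tau> * q k)"
    and law_p: "\<And>k. distr M borel (Z Plus k) = tilted F (\<tau> * (1 - q k))"
    and \<tau>: "0 < \<tau>" "\<tau> * \<rho> \<le> 1"
  shows "tilted_walk F a M \<tau> (\<lambda>k \<omega>. Z Minus k \<omega> - Z Plus k \<omega>)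
     (\<lambda>n \<omega>. \<Sum>i<n. moving_average a (Z Minus) (int i) \<omega> - moving_average a (Z Plus) (int i) \<omega>)"
proof -
  interpret M: prob_space M by (rule M)
  let ?X = "\<lambda>(k, u). Z u k"
  have Zm [measurable]: "Z u k \<in> borel_measurable M" for u k
    using indep unfolding M.indep_vars_def by auto
  define \<theta> where "\<theta> u k = (case u of Minus \<Rightarrow> \<tau> * q k | Plus \<Rightarrow> \<tau> * (1 - q k))" for u k
  have law: "distr M borel (Z u k) = tilted F (\<theta> u k)" for u k
    using law_m law_p by (cases u) (auto simp: \<theta>_def)
  have \<theta>: "\<bar>\<theta> u k\<bar> \<le> 1" for u k using tilt_small[OF \<tau>, of k] by (cases u) (auto simp: \<theta>_def)
  have Z_exp: "integrable M (\<lambda>\<omega>. exp (2 * \<bar>Z u k \<omega>\<bar>))"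
    and Z_exp_le: "M.expectation (\<lambda>\<omega>. exp (2 * \<bar>Z u k \<omega>\<bar>)) \<le> exp_bound" for u k
    using tilted_exp_abs[OF \<theta>, of u k] unfolding law[symmetric]
    by (simp_all add: integrable_distr_eq integral_distr)
  have Z_mean: "M.expectation (Z u k) = tmean (\<theta> u k)" for u k
    using tilted_mean[of "\<theta> u k"] unfolding law[symmetric] by (simp add: integral_distr)
  have Z_sq: "M.expectation (\<lambda>\<omega>. (Z u k \<omega>)\<^sup>2) = tvar (\<theta> u k) + (tmean (\<theta> u k))\<^sup>2" for u k
    using tilted_square[of "\<theta> u k"] unfolding law[symmetric] by (simp add: integral_distr)
  note Z_int = M.exp_moment_integrable[OF Zm Z_exp Z_exp_le]
  define J where "J k = {(k, Minus), (k, Plus)}" for k :: int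
  have indJ: "M.indep_vars (\<lambda>_. borel) ?X (J k)" for k
    by (rule M.indep_vars_subset[OF indep]) simp
  \<comment> \<open>Applied to \<open>exp (2 * \<bar>x\<bar>)\<close> this yields the bound
    \<open>exp_bound\<^sup>2\<close>; applied to the identity it makes the covariance of the two
    families vanish.\<close>
  have prod_exp: "integrable M (\<lambda>\<omega>. g (Z Minus k \<omega>) * g (Z Plus k \<omega>))"
    "M.expectation (\<lambda>\<omega>. g (Z Minus k \<omega>) * g (Z Plus k \<omega>)) = M.expectation (\<lambda>\<omega>. g (Z Minus k \<omega>)) * M.expectation (\<lambda>\<omega>. g (Z Plus k \<omega>))"
    if g [measurable]: "g \<in> borel_measurable borel" and gi: "\<And>u. integrable M (\<lambda>\<omega>. g (Z u k \<omega>))" for g :: "real \<Rightarrow> real" and k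
  proof -
    have i: "M.indep_vars (\<lambda>_. borel) (\<lambda>i \<omega>. g (?X i \<omega>)) (J k)"
      by (rule M.indep_vars_compose2[OF indJ]) simp
    have "integrable M (\<lambda>\<omega>. \<Prod>i\<in>J k. g (?X i \<omega>))"
      by (rule M.indep_vars_integrable[OF _ i]) (auto simp: J_def gi)
    then show "integrable M (\<lambda>\<omega>. g (Z Minus k \<omega>) * g (Z Plus k \<omega>))" by (simp add: J_def)
    have "M.expectation (\<lambda>\<omega>. \<Prod>i\<in>J k. g (?X i \<omega>)) = (\<Prod>i\<in>J k. M.expectation (\<lambda>\<omega>. g (?X i \<omega>)))"
      by (rule M.indep_vars_lebesgue_integral[OF _ i]) (auto simp: J_def gi)
    then show "M.expectation (\<lambda>\<omega>. g (Z Minus k \<omega>) * g (Z Plus k \<omega>)) = M.expectation (\<lambda>\<omega>. g (Z Minus k \<omega>)) * M.expectation (\<lambda>\<omega>. g (Z Plus k \<omega>))"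
      by (simp add: J_def)
  qed
  show ?thesis
  proof (unfold_locales, fact \<tau>(1))
    have "M.indep_vars (\<lambda>k. PiM (J k) (\<lambda>_. borel)) (\<lambda>k \<omega>. restrict (\<lambda>i. ?X i \<omega>) (J k)) UNIV"
      by (rule M.indep_vars_restrict[OF indep]) (auto simp: J_def disjoint_family_on_def)
    then have "M.indep_vars (\<lambda>_. borel) (\<lambda>k \<omega>. (\<lambda>x. x (k, Minus) - x (k, Plus)) (restrict (\<lambda>i. ?X i \<omega>) (J k))) UNIV"
    proof (rule M.indep_vars_compose2)
      fix k :: int
      have "(\<lambda>x. x i) \<in> borel_measurable (PiM (J k) (\<lambda>_. borel))" if "i \<in> J k" for i
        using measurable_component_singleton[OF that, of "\<lambda>_. borel"] by simp
      then show "(\<lambda>x. x (k, Minus) - x (k, Plus) :: real) \<in> borel_measurable (PiM (J k) (\<lambda>_. borel))"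
        by (intro borel_measurable_diff) (auto simp: J_def)
    qed
    then show "M.indep_vars (\<lambda>_. borel) (\<lambda>k \<omega>. Z Minus k \<omega> - Z Plus k \<omega>) UNIV"
      by (simp add: J_def)
    fix k
    have le: "exp (2 * \<bar>Z Minus k \<omega> - Z Plus k \<omega>\<bar>) \<le> exp (2 * \<bar>Z Minus k \<omega>\<bar>) * exp (2 * \<bar>Z Plus k \<omega>\<bar>)" for \<omega>
      unfolding exp_add[symmetric] using abs_triangle_ineq4[of "Z Minus k \<omega>" "Z Plus k \<omega>"] by simp
    note pe = prod_exp[of "\<lambda>x. exp (2 * \<bar>x\<bar>)", OF _ Z_exp, simplified]
    show i: "integrable M (\<lambda>\<omega>. exp (2 * \<bar>Z Minus k \<omega> - Z Plus k \<omega>\<bar>))"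
      by (rule Bochner_Integration.integrable_bound[OF pe(1)[of k]]) (use le in \<open>auto simp: abs_mult\<close>)
    have "M.expectation (\<lambda>\<omega>. exp (2 * \<bar>Z Minus k \<omega> - Z Plus k \<omega>\<bar>)) \<le> M.expectation (\<lambda>\<omega>. exp (2 * \<bar>Z Minus k \<omega>\<bar>) * exp (2 * \<bar>Z Plus k \<omega>\<bar>))"
      by (intro integral_mono i pe le)
    also have "\<dots> \<le> exp_bound * exp_bound"
      unfolding pe(2) by (intro mult_mono Z_exp_le) (auto intro!: order_trans[OF _ Z_exp_le] integral_nonneg_AE)
    finally show "M.expectation (\<lambda>\<omega>. exp (2 * \<bar>Z Minus k \<omega> - Z Plus k \<omega>\<bar>)) \<le> exp_bound\<^sup>2"
      by (simp add: power2_eq_square)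
    show mean: "M.expectation (\<lambda>\<omega>. Z Minus k \<omega> - Z Plus k \<omega>) = smean \<tau> k"
      using Z_int by (simp add: Z_mean smean_def \<theta>_def)
    note pz = prod_exp[of "\<lambda>x. x", OF _ Z_int(1), simplified]
    have sqi: "integrable M (\<lambda>\<omega>. (Z Minus k \<omega> - Z Plus k \<omega>)\<^sup>2)"
      using Z_int pz(1)[of k] by (simp add: power2_diff mult.assoc)
    have "M.expectation (\<lambda>\<omega>. (Z Minus k \<omega> - Z Plus k \<omega>)\<^sup>2)
        = M.expectation (\<lambda>\<omega>. (Z Minus k \<omega>)\<^sup>2) + M.expectation (\<lambda>\<omega>. (Z Plus k \<omega>)\<^sup>2) - 2 * (M.expectation (Z Minus k) * M.expectation (Z Plus k))"
      using Z_int pz(1)[of k] by (simp add: power2_diff mult.assoc pz(2))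
    also have "\<dots> = svar \<tau> k + (smean \<tau> k)\<^sup>2"
      unfolding Z_sq Z_mean by (simp add: \<theta>_def svar_def smean_def power2_diff)
    finally show "M.variance (\<lambda>\<omega>. Z Minus k \<omega> - Z Plus k \<omega>) = svar \<tau> k"
      using Z_int sqi by (subst M.variance_eq) (auto simp: mean[simplified])
  next
    fix n :: nat
    show "(\<lambda>\<omega>. \<Sum>i<n. moving_average a (Z Minus) (int i) \<omega> - moving_average a (Z Plus) (int i) \<omega>) \<in> borel_measurable M"
      by measurable
    have "AE \<omega> in M. \<forall>i. ((\<lambda>k. a (int i - k) * Z u k \<omega>) has_sum moving_average a (Z u) (int i) \<omega>) UNIV" for u
      unfolding AE_all_countable
      by (intro allI M.AE_moving_average abs_summable Zm Z_exp) (rule Z_exp_le)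
    from this[of Minus] this[of Plus]
    show "AE \<omega> in M. ((\<lambda>k. b n k * (Z Minus k \<omega> - Z Plus k \<omega>)) has_sum
        (\<Sum>i<n. moving_average a (Z Minus) (int i) \<omega> - moving_average a (Z Plus) (int i) \<omega>)) UNIV"
    proof eventually_elim
      case (elim \<omega>)
      have "((\<lambda>k. a (int i - k) * (Z Minus k \<omega> - Z Plus k \<omega>)) has_sum
          (moving_average a (Z Minus) (int i) \<omega> - moving_average a (Z Plus) (int i) \<omega>)) UNIV" for i
      proof -
        have "((\<lambda>k. - (a (int i - k) * Z Plus k \<omega>)) has_sum - moving_average a (Z Plus) (int i) \<omega>) UNIV"
          using elim(2)[rule_format, of i] by (simp add: has_sum_uminus)
        from has_sum_add[OF elim(1)[rule_format, of i] this] show ?thesis by (simp add: right_diff_distrib)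
      qed
      from has_sum_finite_sum[OF finite_lessThan this, of "\<lambda>i. i" n]
      show ?case by (simp add: b_def sum_distrib_right)
    qed
  qed
qed

end

lemma (in prob_space) indep_vars_reindex:
  assumes X: "indep_vars (\<lambda>_. N) X I" and h: "inj_on h J" "h ` J \<subseteq> I"
  shows "indep_vars (\<lambda>_. N) (\<lambda>j. X (h j)) J"
proof -
  have "indep_vars (\<lambda>j. PiM {h j} (\<lambda>_. N)) (\<lambda>j \<omega>. restrict (\<lambda>i. X i \<omega>) {h j}) J"
    by (rule indep_vars_restrict[OF X]) (use h in \<open>auto simp: disjoint_family_on_def inj_on_def\<close>)
  then have "indep_vars (\<lambda>_. N) (\<lambda>j \<omega>. (\<lambda>x. x (h j)) (restrict (\<lambda>i. X i \<omega>) {h j})) J"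
  proof (rule indep_vars_compose2)
    fix j show "(\<lambda>x. x (h j)) \<in> measurable (PiM {h j} (\<lambda>_. N)) N"
      by (rule measurable_component_singleton) simp
  qed
  then show ?thesis by simp
qed

section \<open>Reflection of the left side of the cluster\<close>

definition flip :: "sign \<Rightarrow> sign" where "flip u = (case u of Minus \<Rightarrow> Plus | Plus \<Rightarrow> Minus)"

lemma flip_simps [simp]: "flip Minus = Plus" "flip Plus = Minus" "flip (flip u) = u"
  by (cases u; simp add: flip_def)+

text \<open>Reflecting time, \<open>i \<mapsto> -1 - i\<close>, turns the left side of the cluster into a right side
  for the reflected coefficients, with the two families of noise variables exchanged.\<close>

definition side_coeff :: "(int \<Rightarrow> real) \<Rightarrow> sign \<Rightarrow> int \<Rightarrow> real" where
  "side_coeff a u = (case u of Plus \<Rightarrow> a | Minus \<Rightarrow> (\<lambda>i. a (- i)))"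

definition side_noise :: "(sign \<Rightarrow> int \<Rightarrow> 'a \<Rightarrow> real) \<Rightarrow> sign \<Rightarrow> sign \<Rightarrow> int \<Rightarrow> 'a \<Rightarrow> real" where
  "side_noise Z u = (case u of Plus \<Rightarrow> Z | Minus \<Rightarrow> (\<lambda>v k. Z (flip v) (-1 - k)))"

definition side_step :: "(sign \<Rightarrow> int \<Rightarrow> 'a \<Rightarrow> real) \<Rightarrow> sign \<Rightarrow> int \<Rightarrow> 'a \<Rightarrow> real" where
  "side_step Z u k \<omega> = side_noise Z u Minus k \<omega> - side_noise Z u Plus k \<omega>"

definition side_walk :: "(int \<Rightarrow> real) \<Rightarrow> (sign \<Rightarrow> int \<Rightarrow> 'a \<Rightarrow> real) \<Rightarrow> sign \<Rightarrow> nat \<Rightarrow> 'a \<Rightarrow> real" where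
  "side_walk a Z u n \<omega> = (\<Sum>i<n. moving_average (side_coeff a u) (side_noise Z u Minus) (int i) \<omega>
      - moving_average (side_coeff a u) (side_noise Z u Plus) (int i) \<omega>)"

lemma moving_average_reflect:
  "moving_average (\<lambda>i. a (- i)) (\<lambda>k. Z (-1 - k)) n \<omega> = moving_average a Z (-1 - n) \<omega>"
proof -
  have "moving_average a Z (-1 - n) \<omega> = (\<Sum>\<^sub>\<infinity>i. a (- i) * Z (-1 - n - (- i)) \<omega>)"
    unfolding moving_average_def
    by (rule infsum_reindex_bij_betw[OF bij_uminus, symmetric])
  also have "\<dots> = (\<Sum>\<^sub>\<infinity>i. a (- i) * Z (-1 - (n - i)) \<omega>)"
    by (intro infsum_cong) (simp add: algebra_simps)
  finally show ?thesis by (simp add: moving_average_def)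
qed

lemma side_walk_Plus:
  "side_walk a Z Plus n \<omega> = (\<Sum>i\<in>{0..int n - 1}. moving_average a (Z Minus) i \<omega> - moving_average a (Z Plus) i \<omega>)"
  unfolding side_walk_def side_coeff_def side_noise_def sign.case
  by (rule sum.reindex_bij_witness[of _ nat int]) auto

lemma side_walk_Minus:
  "side_walk a Z Minus n \<omega> = (\<Sum>i\<in>{- int n..-1}. moving_average a (Z Plus) i \<omega> - moving_average a (Z Minus) i \<omega>)"
  unfolding side_walk_def side_coeff_def side_noise_def sign.case flip_simps moving_average_reflect
  by (rule sum.reindex_bij_witness[of _ "\<lambda>i. nat (-1 - i)" "\<lambda>i. -1 - int i"]) auto

lemma side_noise_measurable [measurable]:
  "(\<And>v k. Z v k \<in> borel_measurable M) \<Longrightarrow> side_noise Z u v k \<in> borel_measurable M"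
  by (cases u) (auto simp: side_noise_def)

lemma side_walk_measurable [measurable]:
  assumes [measurable]: "\<And>v k. Z v k \<in> borel_measurable M"
  shows "side_walk a Z u n \<in> borel_measurable M"
  unfolding side_walk_def by measurable

lemma side_step_measurable [measurable]:
  assumes [measurable]: "\<And>v k. Z v k \<in> borel_measurable M"
  shows "side_step Z u k \<in> borel_measurable M"
  unfolding side_step_def by measurable

context tilted_coeffs
begin

lemma coeff_sum_side: "coeff_sum (side_coeff a u) = A"
  using infsum_reindex_bij_betw[OF bij_uminus, of a] by (cases u) (simp_all add: side_coeff_def coeff_sum_def)

lemma tilted_coeffs_side: "tilted_coeffs F (side_coeff a u)"
proof unfold_locales
  show "coeff_sum (side_coeff a u) > 0" using A_pos by (simp add: coeff_sum_side)
  show "(\<lambda>i. \<bar>side_coeff a u i\<bar>) summable_on UNIV"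
    using abs_summable summable_on_reindex_bij_betw[OF bij_uminus, of "\<lambda>i. \<bar>a i\<bar>"]
    by (cases u) (simp_all add: side_coeff_def)
qed

text \<open>Under reflection the sum of a over an upper ray becomes one over a lower ray, so q and 1
  - q change places. \<open>side_noise\<close> exchanges the two families accordingly, and the left
  side meets the hypotheses of \<open>tilted_walkI\<close> with the same \<tau>.\<close>

lemma q_side: "tilted_coeffs.q (side_coeff a Minus) k = 1 - q (-1 - k)"
proof -
  interpret R: tilted_coeffs F "side_coeff a Minus" by (rule tilted_coeffs_side)
  have "bij_betw uminus {-k..} {..k}" by (rule bij_betwI[where g=uminus]) auto
  from infsum_reindex_bij_betw[OF this, of a]
  have "R.q k = infsum a {..k} / A" by (simp add: R.q_def coeff_sum_side) (simp add: side_coeff_def)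
  also have "{..k} = {..<- (-1 - k)}" by auto
  also have "infsum a \<dots> / A = 1 - q (-1 - k)" using q_compl[of "-1 - k"] A_pos by (simp add: field_simps)
  finally show ?thesis .
qed

text \<open>The cases for k \<ge> 0 and for k < 0 are one formula: the tilt of the minus family is
  \<tau> / A times the sum of a over \<open>{-k..}\<close>, and that of the plus family \<tau> / A
  times the sum over the complement.\<close>

lemma tilted_noise_laws:
  assumes tn: "tilted_noise F a \<epsilon> M Z T"
  shows "distr M borel (Z Minus k) = tilted F (tilt F a \<epsilon> * q k)"
    and "distr M borel (Z Plus k) = tilted F (tilt F a \<epsilon> * (1 - q k))"
proof -
  define \<tau> where "\<tau> = tilt F a \<epsilon>"
  note l = tn[unfolded tilted_noise_def Let_def, folded \<tau>_def]
  have nn: "partial_sum_neg a n = infsum a {- int n..-1}" for n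
    unfolding partial_sum_neg_def
    by (simp, rule sum.reindex_bij_witness[of _ "\<lambda>i. nat (- i)" "\<lambda>j. - int j"]) auto
  \<comment> \<open>The shift by one matters: \<open>partial_sum_nonneg a (n - 1)\<close> starts at
    index 0 and so has exactly n terms.\<close>
  have np: "partial_sum_nonneg a (n - 1) = infsum a {0..<int n}" if "n \<ge> 1" for n
    unfolding partial_sum_nonneg_def using that
    by (simp, intro sum.reindex_bij_witness[of _ nat int]) auto
  have AA: "A = infsum a {..-1} + infsum a {0..}"
    unfolding coeff_sum_def by (subst infsum_split[symmetric]) (auto intro!: arg_cong[where f="infsum a"])
  have q1: "q (int j) = (coeff_sum_nonneg a + partial_sum_neg a j) / A" for j
    unfolding q_def nn coeff_sum_nonneg_def
    by (subst infsum_split[symmetric]) (auto intro!: arg_cong[where f="infsum a"])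
  have q2: "q (- int j) = (coeff_sum_nonneg a - partial_sum_nonneg a (j - 1)) / A" if "j \<ge> 1" for j
  proof -
    have "infsum a {0..} = infsum a {0..<int j} + infsum a {int j..}"
      by (subst infsum_split[symmetric]) (auto intro!: arg_cong[where f="infsum a"])
    then show ?thesis unfolding q_def np[OF that] coeff_sum_nonneg_def by simp
  qed
  have q3: "1 - q (int j) = (coeff_sum_neg a - partial_sum_neg a j) / A" for j
    unfolding q1 using AA A_pos by (simp add: field_simps coeff_sum_neg_def coeff_sum_nonneg_def)
  have q4: "1 - q (- int j) = (partial_sum_nonneg a (j - 1) + coeff_sum_neg a) / A" if "j \<ge> 1" for j
    unfolding q2[OF that] using AA A_pos by (simp add: field_simps coeff_sum_neg_def coeff_sum_nonneg_def)
  have k: "(\<exists>j. k = int j) \<or> (\<exists>j\<ge>1. k = - int j)"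
    by (cases "k \<ge> 0") (auto intro: exI[of _ "nat k"] exI[of _ "nat (- k)"])
  then show "distr M borel (Z Minus k) = tilted F (tilt F a \<epsilon> * q k)"
    using l by (auto simp: q1 q2 \<tau>_def[symmetric])
  show "distr M borel (Z Plus k) = tilted F (tilt F a \<epsilon> * (1 - q k))"
    using k l by (auto simp: q3 q4 \<tau>_def[symmetric])
qed

lemma tilted_noise_basic:
  assumes tn: "tilted_noise F a \<epsilon> M Z T"
  shows "prob_space M" "prob_space.indep_vars M (\<lambda>_. borel) (\<lambda>(k, u). Z u k) UNIV"
    "Z u k \<in> borel_measurable M"
    "distributed M lborel T (exponential_density (tilt F a \<epsilon> / A))"
    "independent_rvs M borel T (\<Pi>\<^sub>M k\<in>(UNIV :: (int \<times> sign) set). borel) (\<lambda>\<omega> (j, u). Z u j \<omega>)"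
proof -
  show p: "prob_space M" and i: "prob_space.indep_vars M (\<lambda>_. borel) (\<lambda>(k, u). Z u k) UNIV"
    and "distributed M lborel T (exponential_density (tilt F a \<epsilon> / A))"
    "independent_rvs M borel T (\<Pi>\<^sub>M k\<in>(UNIV :: (int \<times> sign) set). borel) (\<lambda>\<omega> (j, u). Z u j \<omega>)"
    using tn unfolding tilted_noise_def Let_def by auto
  show "Z u k \<in> borel_measurable M"
    using i unfolding prob_space.indep_vars_def[OF p] by auto
qed

lemma tilted_walk_side:
  assumes tn: "tilted_noise F a \<epsilon> M Z T" and \<tau>: "0 < tilt F a \<epsilon>"
    and small: "tilt F a \<epsilon> * tilted_coeffs.\<rho> (side_coeff a u) \<le> 1"
  shows "tilted_walk F (side_coeff a u) M (tilt F a \<epsilon>) (side_step Z u) (side_walk a Z u)"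
proof -
  interpret S: tilted_coeffs F "side_coeff a u" by (rule tilted_coeffs_side)
  note b = tilted_noise_basic[OF tn]
  interpret M: prob_space M by (rule b(1))
  have ind: "M.indep_vars (\<lambda>_. borel) (\<lambda>(k, v). side_noise Z u v k) UNIV"
  proof (cases u)
    case Plus
    then show ?thesis using b(2) by (simp add: side_noise_def)
  next
    case Minus
    have "M.indep_vars (\<lambda>_. borel) (\<lambda>j. (\<lambda>(k, u). Z u k) ((\<lambda>(k, v). (-1 - k, flip v)) j)) UNIV"
    proof (rule M.indep_vars_reindex[OF b(2)])
      show "inj (\<lambda>(k, v). (-1 - k :: int, flip v))"
        by (rule inj_on_inverseI[where g="\<lambda>(k, v). (-1 - k, flip v)"]) auto
    qed simp
    then show ?thesis using Minus by (simp add: side_noise_def case_prod_beta')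
  qed
  have "tilted_walk F (side_coeff a u) M (tilt F a \<epsilon>) (\<lambda>k \<omega>. side_noise Z u Minus k \<omega> - side_noise Z u Plus k \<omega>)
     (\<lambda>n \<omega>. \<Sum>i<n. moving_average (side_coeff a u) (side_noise Z u Minus) (int i) \<omega>
        - moving_average (side_coeff a u) (side_noise Z u Plus) (int i) \<omega>)"
  proof (rule S.tilted_walkI[OF b(1) ind _ _ \<tau> small])
    fix k
    show "distr M borel (side_noise Z u Minus k) = tilted F (tilt F a \<epsilon> * S.q k)"
      using tilted_noise_laws[OF tn] q_side
      by (cases u) (simp_all add: side_noise_def, simp add: side_coeff_def)
    show "distr M borel (side_noise Z u Plus k) = tilted F (tilt F a \<epsilon> * (1 - S.q k))"
      using tilted_noise_laws[OF tn] q_side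
      by (cases u) (simp_all add: side_noise_def, simp add: side_coeff_def)
  qed
  then show ?thesis by (simp add: side_step_def[abs_def] side_walk_def[abs_def])
qed

text \<open>T is assumed independent of the noise as a whole; this passes to every quantity that is
  written as a measurable function \<open>g\<close> of the noise configuration.\<close>

lemma indep_T_noise_fun:
  assumes tn: "tilted_noise F a \<epsilon> M Z T"
    and f: "f \<in> measurable borel N'" and g: "g \<in> measurable (PiM UNIV (\<lambda>_. borel)) N"
    and G: "\<And>\<omega>. G \<omega> = g (\<lambda>(j, u). Z u j \<omega>)"
  shows "independent_rvs M N' (\<lambda>\<omega>. f (T \<omega>)) N G"
proof -
  note b = tilted_noise_basic[OF tn]
  interpret M: prob_space M by (rule b(1))
  have "G = (\<lambda>\<omega>. g (\<lambda>(j, u). Z u j \<omega>))" using G by (rule ext)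
  then show ?thesis using M.independent_rvs_compose[OF b(5) f g] by simp
qed

end

lemma exponential_scale:
  assumes M: "prob_space M" and T: "distributed M lborel T (exponential_density l)" and l: "l > 0"
  shows "distributed M lborel (\<lambda>\<omega>. l * T \<omega>) (exponential_density 1)"
proof -
  interpret prob_space M by (rule M)
  have [measurable]: "T \<in> borel_measurable M" using T by (simp add: distributed_def)
  have "prob {\<omega>\<in>space M. l * T \<omega> \<le> x} = 1 - exp (- x)" if "x \<ge> 0" for x
  proof -
    have "{\<omega>\<in>space M. l * T \<omega> \<le> x} = {\<omega>\<in>space M. T \<omega> \<le> x / l}"
      using l by (auto simp: field_simps)
    then show ?thesis using exponential_distributedD_le[OF T, of "x / l"] that l by simp
  qed
  then show ?thesis using exponential_distributed_iff[of 1 "\<lambda>\<omega>. l * T \<omega>"] by simp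
qed

section \<open>Rescaled walks\<close>

context tilted_coeffs
begin

text \<open>The constant in front of the limiting occupation times. It also sets the time scale: one
  step lasts \<epsilon>^2 / c0.\<close>

definition c0 :: real where "c0 = A\<^sup>2 * s2"

lemma c0_pos: "c0 > 0" using A_pos s2_pos by (simp add: c0_def)

text \<open>Rounded up, not down: between n and n + 1 step durations, the left end excluded, the
  walk has taken n + 1 steps. As the cluster sums start at index 1, the occupation time then equals
  the rescaled cluster size without an error term.\<close>

definition steps :: "real \<Rightarrow> real \<Rightarrow> nat" where "steps \<epsilon> t = nat \<lceil>t * c0 / \<epsilon>\<^sup>2\<rceil>"

definition scaled_T :: "real \<Rightarrow> ('a \<Rightarrow> real) \<Rightarrow> 'a \<Rightarrow> real" where
  "scaled_T \<epsilon> T \<omega> = tilt F a \<epsilon> / A * T \<omega>"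

definition scaled_walk :: "real \<Rightarrow> (sign \<Rightarrow> int \<Rightarrow> 'a \<Rightarrow> real) \<Rightarrow> sign \<Rightarrow> real \<Rightarrow> 'a \<Rightarrow> real" where
  "scaled_walk \<epsilon> Z u t \<omega> = tilt F a \<epsilon> / A * side_walk a Z u (steps \<epsilon> t) \<omega>"

lemma scaled_T_exponential:
  assumes tn: "tilted_noise F a \<epsilon> M Z T" and \<tau>: "0 < tilt F a \<epsilon>"
  shows "distributed M lborel (scaled_T \<epsilon> T) (exponential_density 1)"
  unfolding scaled_T_def[abs_def] using \<tau> A_pos
  by (intro exponential_scale tilted_noise_basic(1,4)[OF tn]) auto

text \<open>Writes the walk as one fixed function of the noise configuration, with the coordinate
  \<open>x (k, u)\<close> in place of the noise variable, which is the form that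
  \<open>indep_T_noise_fun\<close> asks for.\<close>

lemma side_walk_natural:
  "side_walk a Z u n \<omega> = side_walk a (\<lambda>u k x. x (k, u)) u n (\<lambda>(j, u). Z u j \<omega>)"
  by (cases u) (simp_all add: side_walk_def side_noise_def moving_average_def)

lemma noise_component_measurable: "(\<lambda>x. x (k, u)) \<in> borel_measurable (PiM UNIV (\<lambda>_. borel))"
  using measurable_component_singleton[of "(k, u)" UNIV "\<lambda>_. borel"] by simp

lemma indep_T_walk:
  assumes tn: "tilted_noise F a \<epsilon> M Z T"
  shows "independent_rvs M borel (scaled_T \<epsilon> T) borel (scaled_walk \<epsilon> Z u t)"
proof -
  have 1: "(\<lambda>x. tilt F a \<epsilon> / A * x) \<in> borel_measurable borel" by measurable
  have 2: "(\<lambda>x. tilt F a \<epsilon> / A * side_walk a (\<lambda>u k x. x (k, u)) u (steps \<epsilon> t) x) \<in> borel_measurable (PiM UNIV (\<lambda>_. borel))"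
    by (intro borel_measurable_times borel_measurable_const side_walk_measurable noise_component_measurable)
  have "independent_rvs M borel (\<lambda>\<omega>. (\<lambda>x. tilt F a \<epsilon> / A * x) (T \<omega>)) borel (scaled_walk \<epsilon> Z u t)"
    by (rule indep_T_noise_fun[OF tn 1 2]) (simp add: scaled_walk_def side_walk_natural[symmetric])
  then show ?thesis by (simp add: scaled_T_def[abs_def])
qed

lemma steps_bounds:
  assumes "\<epsilon> > 0" "t \<ge> 0"
  shows "t * c0 / \<epsilon>\<^sup>2 \<le> real (steps \<epsilon> t)" "real (steps \<epsilon> t) \<le> t * c0 / \<epsilon>\<^sup>2 + 1"
proof -
  have "t * c0 / \<epsilon>\<^sup>2 \<ge> 0" using assms c0_pos by simp
  then show "t * c0 / \<epsilon>\<^sup>2 \<le> real (steps \<epsilon> t)" "real (steps \<epsilon> t) \<le> t * c0 / \<epsilon>\<^sup>2 + 1"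
    unfolding steps_def by linarith+
qed

lemma scaled_walk_joint:
  assumes Z: "\<And>u k. Z u k \<in> borel_measurable M"
  shows "(\<lambda>x. scaled_walk \<epsilon> Z u (fst x) (snd x)) \<in> borel_measurable (borel \<Otimes>\<^sub>M M)"
proof -
  have "(\<lambda>x. side_walk a Z u (steps \<epsilon> (fst x)) (snd x)) \<in> borel_measurable (borel \<Otimes>\<^sub>M M)"
  proof (rule measurable_compose_countable[where f="\<lambda>n x. side_walk a Z u n (snd x)" and g="\<lambda>x. steps \<epsilon> (fst x)"])
    show "(\<lambda>x. side_walk a Z u n (snd x)) \<in> borel_measurable (borel \<Otimes>\<^sub>M M)" for n
      using side_walk_measurable[OF Z] by measurable
    show "(\<lambda>x. steps \<epsilon> (fst x)) \<in> measurable (borel \<Otimes>\<^sub>M M) (count_space UNIV)"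
      unfolding steps_def by measurable
  qed
  then show ?thesis unfolding scaled_walk_def by measurable
qed

text \<open>Half of the limit in \<open>tilt_ratio\<close> serves as a lower bound for \<tau> /
  \<epsilon>. It converts tail estimates in \<tau>^2 n into estimates in t.\<close>

lemma eventually_tilt_le:
  assumes r: "r > 0"
  shows "\<forall>\<^sub>F \<epsilon> in at_right 0. 0 < \<epsilon> \<and> \<epsilon> < r \<and> 0 < tilt F a \<epsilon> \<and> tilt F a \<epsilon> \<le> r \<and> \<epsilon> / (2 * A * s2) \<le> tilt F a \<epsilon>"
proof -
  have "1 / (2 * (A * s2)) < 1 / (A * s2)" using A_pos s2_pos by (simp add: field_simps)
  from order_tendstoD(1)[OF tilt_ratio[OF A_pos] this]
  have "\<forall>\<^sub>F \<epsilon> in at_right 0. 1 / (2 * (A * s2)) < tilt F a \<epsilon> / \<epsilon>" .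
  moreover have "\<forall>\<^sub>F \<epsilon> in at_right 0. 0 < \<epsilon> \<and> \<epsilon> < r"
    using r by (auto simp: eventually_at_right_field)
  ultimately show ?thesis using eventually_tilt[OF A_pos r]
  proof eventually_elim
    case (elim \<epsilon>)
    then have "1 / (2 * (A * s2)) * \<epsilon> \<le> tilt F a \<epsilon>" by (simp add: pos_less_divide_eq)
    then show ?case using elim by (simp add: mult.assoc)
  qed
qed

lemma scaled_walk_tail:
  "\<exists>C c. c > 0 \<and> (\<forall>\<^sub>F \<epsilon> in at_right 0. \<forall>(M :: 'm measure) Z T t. tilted_noise F a \<epsilon> M Z T \<longrightarrow> t \<ge> 0 \<longrightarrow>
     measure M {\<omega>\<in>space M. scaled_T \<epsilon> T \<omega> \<ge> scaled_walk \<epsilon> Z u t \<omega>} \<le> C * exp (- c * t))"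
proof -
  interpret S: tilted_coeffs F "side_coeff a u" by (rule tilted_coeffs_side)
  obtain \<eta> c n0 r where *: "0 < \<eta>" "\<eta> \<le> 1" "0 < c" "0 < r"
    and tail: "\<forall>\<tau> (M :: 'm measure) Y S n. \<tau> \<le> r \<longrightarrow> n0 \<le> n \<longrightarrow> tilted_walk F (side_coeff a u) M \<tau> Y S \<longrightarrow>
     (\<integral>\<^sup>+\<omega>. exp (- (\<eta> * (\<tau> / coeff_sum (side_coeff a u) * S n \<omega>))) \<partial>M) \<le> ennreal (exp (- (c * \<tau>\<^sup>2 * real n)))"
    using S.walk_tail by (elim exE conjE) (rule that)
  \<comment> \<open>Inserting \<tau> \<ge> \<epsilon> / (2 A s2) and n \<ge> t c0 / \<epsilon>^2
    into c \<tau>^2 n gives c t / (4 s2).\<close>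
  define c' where "c' = c / (4 * s2)"
  have c': "c' > 0" using * s2_pos by (simp add: c'_def)
  \<comment> \<open>Fewer than \<open>n0\<close> steps are not covered by the Chernoff bound. For
    \<epsilon> \<le> 1 they occur only when t \<le> t1, and there the factor
    \<open>exp (c' * t1)\<close> makes the claimed bound at least 1.\<close>
  define t1 where "t1 = real n0 / c0"
  define r' where "r' = min (min r 1) (1 / S.\<rho>)"
  have r': "r' > 0" using * S.\<rho>_pos by (simp add: r'_def)
  have "\<forall>\<^sub>F \<epsilon> in at_right 0. \<forall>(M :: 'm measure) Z T t. tilted_noise F a \<epsilon> M Z T \<longrightarrow> t \<ge> 0 \<longrightarrow>
     measure M {\<omega>\<in>space M. scaled_T \<epsilon> T \<omega> \<ge> scaled_walk \<epsilon> Z u t \<omega>} \<le> exp (c' * t1) * exp (- c' * t)"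
    using eventually_tilt_le[OF r']
  proof (eventually_elim, intro allI impI)
    fix \<epsilon> and M :: "'m measure" and Z T and t :: real
    let ?\<tau> = "tilt F a \<epsilon>"
    assume \<epsilon>: "0 < \<epsilon> \<and> \<epsilon> < r' \<and> 0 < ?\<tau> \<and> ?\<tau> \<le> r' \<and> \<epsilon> / (2 * A * s2) \<le> ?\<tau>"
      and tn: "tilted_noise F a \<epsilon> M Z T" and t: "t \<ge> 0"
    interpret M: prob_space M by (rule tilted_noise_basic(1)[OF tn])
    have small: "?\<tau> * S.\<rho> \<le> 1" "?\<tau> \<le> r" "\<epsilon> \<le> 1"
      using \<epsilon> S.\<rho>_pos by (auto simp: r'_def pos_le_divide_eq)
    show "measure M {\<omega>\<in>space M. scaled_T \<epsilon> T \<omega> \<ge> scaled_walk \<epsilon> Z u t \<omega>} \<le> exp (c' * t1) * exp (- c' * t)"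
    proof (cases "n0 \<le> steps \<epsilon> t")
      case True
      have walk: "tilted_walk F (side_coeff a u) M ?\<tau> (side_step Z u) (side_walk a Z u)"
        using \<epsilon> small by (intro tilted_walk_side[OF tn]) auto
      have "emeasure M {\<omega>\<in>space M. scaled_T \<epsilon> T \<omega> \<ge> scaled_walk \<epsilon> Z u t \<omega>}
          \<le> (\<integral>\<^sup>+\<omega>. exp (- (\<eta> * scaled_walk \<epsilon> Z u t \<omega>)) \<partial>M)"
        using \<epsilon> by (intro M.prob_exponential_ge[OF scaled_T_exponential[OF tn] indep_T_walk[OF tn] *(1,2)]) auto
      also have "\<dots> \<le> ennreal (exp (- (c * ?\<tau>\<^sup>2 * real (steps \<epsilon> t))))"
        using tail[rule_format, OF small(2) True walk] by (simp add: scaled_walk_def coeff_sum_side)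
      finally have "measure M {\<omega>\<in>space M. scaled_T \<epsilon> T \<omega> \<ge> scaled_walk \<epsilon> Z u t \<omega>} \<le> exp (- (c * ?\<tau>\<^sup>2 * real (steps \<epsilon> t)))"
        by (simp add: M.emeasure_eq_measure)
      also have "\<dots> \<le> exp (- c' * t)"
      proof -
        have "(\<epsilon> / (2 * A * s2))\<^sup>2 \<le> ?\<tau>\<^sup>2" using \<epsilon> A_pos s2_pos by (intro power_mono) auto
        then have "c * (\<epsilon> / (2 * A * s2))\<^sup>2 * (t * c0 / \<epsilon>\<^sup>2) \<le> c * ?\<tau>\<^sup>2 * real (steps \<epsilon> t)"
          using steps_bounds(1)[of \<epsilon> t] \<epsilon> t * c0_pos by (intro mult_mono mult_nonneg_nonneg divide_nonneg_nonneg) auto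
        moreover have "c * (\<epsilon> / (2 * A * s2))\<^sup>2 * (t * c0 / \<epsilon>\<^sup>2) = c' * t"
          using \<epsilon> A_pos s2_pos by (simp add: c'_def c0_def power_divide power_mult_distrib field_simps power2_eq_square)
        ultimately show ?thesis by simp
      qed
      also have "\<dots> \<le> exp (c' * t1) * exp (- c' * t)"
        using c' c0_pos by (simp add: t1_def)
      finally show ?thesis .
    next
      case False
      then have "t * c0 / \<epsilon>\<^sup>2 \<le> real n0" using steps_bounds(1)[of \<epsilon> t] \<epsilon> t by linarith
      then have "t * c0 \<le> real n0 * \<epsilon>\<^sup>2" using \<epsilon> by (simp add: pos_divide_le_eq)
      also have "\<dots> \<le> real n0 * 1" using small \<epsilon> by (intro mult_left_mono power_le_one) auto
      finally have "t \<le> t1" using c0_pos by (simp add: t1_def pos_le_divide_eq)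
      then have "1 \<le> exp (c' * t1) * exp (- c' * t)" using c' by (simp add: exp_add[symmetric])
      then show ?thesis using M.prob_le_1 by (rule order_trans[rotated])
    qed
  qed
  from conjI[OF c' this] show ?thesis by (rule exI[of _ "exp (c' * t1)", OF exI[of _ c']])
qed

lemma scaled_walk_occupation:
  "\<exists>C c. c > 0 \<and> (\<forall>\<^sub>F \<epsilon> in at_right 0. \<forall>(M :: 'm measure) Z T. tilted_noise F a \<epsilon> M Z T \<longrightarrow>
     occupation M (scaled_T \<epsilon> T) (scaled_walk \<epsilon> Z) C c)"
proof -
  have "\<forall>u. \<exists>C c. c > 0 \<and> (\<forall>\<^sub>F \<epsilon> in at_right 0. \<forall>(M :: 'm measure) Z T t. tilted_noise F a \<epsilon> M Z T \<longrightarrow> t \<ge> 0 \<longrightarrow>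
     measure M {\<omega>\<in>space M. scaled_T \<epsilon> T \<omega> \<ge> scaled_walk \<epsilon> Z u t \<omega>} \<le> C * exp (- c * t))"
    using scaled_walk_tail by blast
  from choice[OF this] obtain C where "\<forall>u. \<exists>c. c > 0 \<and> (\<forall>\<^sub>F \<epsilon> in at_right 0. \<forall>(M :: 'm measure) Z T t. tilted_noise F a \<epsilon> M Z T \<longrightarrow> t \<ge> 0 \<longrightarrow>
     measure M {\<omega>\<in>space M. scaled_T \<epsilon> T \<omega> \<ge> scaled_walk \<epsilon> Z u t \<omega>} \<le> C u * exp (- c * t))" ..
  from choice[OF this] obtain c where cc: "\<forall>u. c u > 0 \<and> (\<forall>\<^sub>F \<epsilon> in at_right 0. \<forall>(M :: 'm measure) Z T t. tilted_noise F a \<epsilon> M Z T \<longrightarrow> t \<ge> 0 \<longrightarrow>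
     measure M {\<omega>\<in>space M. scaled_T \<epsilon> T \<omega> \<ge> scaled_walk \<epsilon> Z u t \<omega>} \<le> C u * exp (- c u * t))" ..
  have c: "c u > 0" for u using cc[rule_format, of u] by (rule conjunct1)
  note ev = cc[rule_format, THEN conjunct2]
  define C' where "C' = max 0 (max (C Minus) (C Plus))"
  define c' where "c' = min (c Minus) (c Plus)"
  have c'0: "c' > 0" using c by (simp add: c'_def)
  have cu: "c' \<le> c u" "C u \<le> C'" for u by (cases u; simp add: c'_def C'_def)+
  have C'0: "0 \<le> C'" by (simp add: C'_def)
  have "\<forall>\<^sub>F \<epsilon> in at_right 0. \<forall>(M :: 'm measure) Z T. tilted_noise F a \<epsilon> M Z T \<longrightarrow>
     occupation M (scaled_T \<epsilon> T) (scaled_walk \<epsilon> Z) C' c'"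
    using ev[of Minus] ev[of Plus]
  proof (eventually_elim, intro allI impI)
    fix \<epsilon> and M :: "'m measure" and Z T
    assume m: "\<forall>(M :: 'm measure) Z T t. tilted_noise F a \<epsilon> M Z T \<longrightarrow> t \<ge> 0 \<longrightarrow>
     measure M {\<omega>\<in>space M. scaled_T \<epsilon> T \<omega> \<ge> scaled_walk \<epsilon> Z Minus t \<omega>} \<le> C Minus * exp (- c Minus * t)"
      and p: "\<forall>(M :: 'm measure) Z T t. tilted_noise F a \<epsilon> M Z T \<longrightarrow> t \<ge> 0 \<longrightarrow>
     measure M {\<omega>\<in>space M. scaled_T \<epsilon> T \<omega> \<ge> scaled_walk \<epsilon> Z Plus t \<omega>} \<le> C Plus * exp (- c Plus * t)"
      and tn: "tilted_noise F a \<epsilon> M Z T"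
    interpret M: prob_space M by (rule tilted_noise_basic(1)[OF tn])
    show "occupation M (scaled_T \<epsilon> T) (scaled_walk \<epsilon> Z) C' c'"
    proof unfold_locales
      show "scaled_T \<epsilon> T \<in> borel_measurable M"
        using indep_T_walk[OF tn] by (simp add: independent_rvs_def)
      show "(\<lambda>x. scaled_walk \<epsilon> Z u (fst x) (snd x)) \<in> borel_measurable (borel \<Otimes>\<^sub>M M)" for u
        by (rule scaled_walk_joint[OF tilted_noise_basic(3)[OF tn]])
      fix u and t :: real assume t: "t \<ge> 0"
      have "measure M {\<omega>\<in>space M. scaled_T \<epsilon> T \<omega> \<ge> scaled_walk \<epsilon> Z u t \<omega>} \<le> C u * exp (- c u * t)"
        using m p tn t by (cases u) auto
      also have "\<dots> \<le> C' * exp (- c' * t)"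
        using cu[of u] C'0 t by (intro mult_mono) (auto intro: mult_right_mono)
      finally show "measure M {\<omega>\<in>space M. scaled_T \<epsilon> T \<omega> \<ge> scaled_walk \<epsilon> Z u t \<omega>} \<le> C' * exp (- c' * t)" .
    qed (rule c'0)
  qed
  then show ?thesis using c'0 by blast
qed

end

section \<open>Finite-dimensional limits of the rescaled walks\<close>

lemma sum_ivl_diff:
  fixes f :: "nat \<Rightarrow> real"
  assumes "m \<le> n"
  shows "sum f {m..<n} = sum f {..<n} - sum f {..<m}"
  using sum_diff_nat_ivl[of 0 m n f] assms by (simp add: atLeast0LessThan)

context tilted_coeffs
begin

lemma steps_mono: "\<epsilon> > 0 \<Longrightarrow> s \<le> t \<Longrightarrow> steps \<epsilon> s \<le> steps \<epsilon> t"
  unfolding steps_def using c0_pos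
  by (intro nat_mono ceiling_mono divide_right_mono mult_right_mono) auto

lemma steps_0 [simp]: "steps \<epsilon> 0 = 0" by (simp add: steps_def)

lemma tilt_tendsto_0: "(tilt F a \<longlongrightarrow> 0) (at_right 0)"
  using tilt_tendsto[OF A_pos] by (simp add: filterlim_at)

text \<open>Diffusive scaling: \<epsilon>^2 n tends to t c0, where rounding costs at most
  \<epsilon>^2, and (\<tau> / \<epsilon>)^2 tends to 1 / (A s2)^2.\<close>

lemma steps_limit:
  assumes t: "t \<ge> 0"
  shows "((\<lambda>\<epsilon>. (tilt F a \<epsilon>)\<^sup>2 * real (steps \<epsilon> t)) \<longlongrightarrow> t / s2) (at_right 0)"
proof -
  have pos: "\<forall>\<^sub>F \<epsilon> in at_right (0::real). \<epsilon> > 0" by (simp add: eventually_at_right_less)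
  have "((\<lambda>\<epsilon>. \<epsilon>\<^sup>2 * real (steps \<epsilon> t)) \<longlongrightarrow> t * c0) (at_right 0)"
  proof (rule tendsto_sandwich)
    show "\<forall>\<^sub>F \<epsilon> in at_right 0. t * c0 \<le> \<epsilon>\<^sup>2 * real (steps \<epsilon> t)"
      using pos by eventually_elim (use steps_bounds(1)[OF _ t] in \<open>simp add: pos_divide_le_eq mult.commute\<close>)
    show "\<forall>\<^sub>F \<epsilon> in at_right 0. \<epsilon>\<^sup>2 * real (steps \<epsilon> t) \<le> t * c0 + \<epsilon>\<^sup>2"
      using pos
    proof eventually_elim
      case (elim \<epsilon>)
      then have "\<epsilon>\<^sup>2 * real (steps \<epsilon> t) \<le> \<epsilon>\<^sup>2 * (t * c0 / \<epsilon>\<^sup>2 + 1)"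
        using steps_bounds(2)[OF _ t] by (intro mult_left_mono) auto
      also have "\<dots> = t * c0 + \<epsilon>\<^sup>2" using elim by (simp add: field_simps)
      finally show ?case .
    qed
    show "((\<lambda>\<epsilon>. t * c0 + \<epsilon>\<^sup>2) \<longlongrightarrow> t * c0) (at_right 0)"
      by (rule tendsto_eq_intros | simp)+
  qed auto
  from tendsto_mult[OF tendsto_power[OF tilt_ratio[OF A_pos], of 2] this]
  have "((\<lambda>\<epsilon>. (tilt F a \<epsilon> / \<epsilon>)\<^sup>2 * (\<epsilon>\<^sup>2 * real (steps \<epsilon> t))) \<longlongrightarrow> (1 / (A * s2))\<^sup>2 * (t * c0)) (at_right 0)" .
  moreover have "(1 / (A * s2))\<^sup>2 * (t * c0) = t / s2"
    using A_pos s2_pos by (simp add: c0_def power_divide power_mult_distrib power2_eq_square)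
  moreover have "\<forall>\<^sub>F \<epsilon> in at_right 0. (tilt F a \<epsilon> / \<epsilon>)\<^sup>2 * (\<epsilon>\<^sup>2 * real (steps \<epsilon> t)) = (tilt F a \<epsilon>)\<^sup>2 * real (steps \<epsilon> t)"
    using pos by eventually_elim (simp add: power_divide)
  ultimately show ?thesis by (auto intro: Lim_transform_eventually)
qed

text \<open>Turns error bounds \<open>e * n + C\<close> into limits: \<tau>^2 n converges, so the
  first part is of order e, and \<tau>^2 C vanishes. It is used with \<kappa> = s2 for the mean and
  with \<kappa> = 2 s2 for the variance.\<close>

lemma steps_limit_approx:
  assumes t: "t \<ge> 0"
    and h: "\<And>e. e > 0 \<Longrightarrow> \<exists>C\<ge>0. \<forall>\<^sub>F \<epsilon> in at_right 0. \<bar>h \<epsilon> - \<kappa> * (tilt F a \<epsilon>)\<^sup>2 * real (steps \<epsilon> t)\<bar>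
        \<le> (tilt F a \<epsilon>)\<^sup>2 * (e * real (steps \<epsilon> t) + C)"
  shows "(h \<longlongrightarrow> \<kappa> * (t / s2)) (at_right 0)"
proof -
  let ?n = "\<lambda>\<epsilon>. (tilt F a \<epsilon>)\<^sup>2 * real (steps \<epsilon> t)"
  have "((\<lambda>\<epsilon>. h \<epsilon> - \<kappa> * ?n \<epsilon>) \<longlongrightarrow> 0) (at_right 0)"
  proof (rule tendstoI)
    fix e :: real assume e: "e > 0"
    define D where "D = t / s2 + 1"
    define e' where "e' = e / D / 2"
    have "D > 0" using t s2_pos by (simp add: D_def add_nonneg_pos)
    then have e': "e' > 0" "e' * D = e / 2" using e by (simp_all add: e'_def)
    from h[OF e'(1)] obtain C where C: "C \<ge> 0" and ev: "\<forall>\<^sub>F \<epsilon> in at_right 0.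
        \<bar>h \<epsilon> - \<kappa> * (tilt F a \<epsilon>)\<^sup>2 * real (steps \<epsilon> t)\<bar> \<le> (tilt F a \<epsilon>)\<^sup>2 * (e' * real (steps \<epsilon> t) + C)" by blast
    have "((\<lambda>\<epsilon>. (tilt F a \<epsilon>)\<^sup>2 * C) \<longlongrightarrow> 0\<^sup>2 * C) (at_right 0)"
      by (intro tendsto_intros tilt_tendsto_0)
    then have "\<forall>\<^sub>F \<epsilon> in at_right 0. (tilt F a \<epsilon>)\<^sup>2 * C < e / 2"
      using e by (intro order_tendstoD(2)) auto
    moreover have "\<forall>\<^sub>F \<epsilon> in at_right 0. ?n \<epsilon> < D"
      unfolding D_def by (rule order_tendstoD(2)[OF steps_limit[OF t]]) simp
    ultimately show "\<forall>\<^sub>F \<epsilon> in at_right 0. dist (h \<epsilon> - \<kappa> * ?n \<epsilon>) 0 < e"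
      using ev
    proof eventually_elim
      case (elim \<epsilon>)
      have "e' * ?n \<epsilon> \<le> e / 2" unfolding e'(2)[symmetric] using elim e' by (intro mult_left_mono) auto
      moreover have "(tilt F a \<epsilon>)\<^sup>2 * (e' * real (steps \<epsilon> t) + C) = e' * ?n \<epsilon> + (tilt F a \<epsilon>)\<^sup>2 * C"
        by (simp add: algebra_simps)
      moreover have "\<bar>h \<epsilon> - \<kappa> * ?n \<epsilon>\<bar> \<le> (tilt F a \<epsilon>)\<^sup>2 * (e' * real (steps \<epsilon> t) + C)"
        using elim(3) by (simp only: mult.assoc)
      ultimately show ?case using elim(1) unfolding dist_real_def by linarith
    qed
  qed
  moreover have "((\<lambda>\<epsilon>. \<kappa> * ?n \<epsilon>) \<longlongrightarrow> \<kappa> * (t / s2)) (at_right 0)"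
    by (intro tendsto_intros steps_limit t)
  ultimately show ?thesis using tendsto_add by fastforce
qed

lemma mean_limit:
  assumes t: "t \<ge> 0"
  shows "((\<lambda>\<epsilon>. tilt F a \<epsilon> * (\<Sum>k<steps \<epsilon> t. smean (tilt F a \<epsilon>) (int k))) \<longlongrightarrow> t) (at_right 0)"
proof -
  have "((\<lambda>\<epsilon>. tilt F a \<epsilon> * (\<Sum>k<steps \<epsilon> t. smean (tilt F a \<epsilon>) (int k))) \<longlongrightarrow> s2 * (t / s2)) (at_right 0)"
  proof (rule steps_limit_approx[OF t])
    fix e :: real assume "e > 0"
    from sum_smean[OF this] obtain C r where C: "C \<ge> 0" "r > 0"
      and le: "\<And>\<tau> n. 0 < \<tau> \<Longrightarrow> \<tau> \<le> r \<Longrightarrow> \<bar>(\<Sum>k<n. smean \<tau> (int k)) - s2 * \<tau> * real n\<bar> \<le> \<tau> * (e * real n + C)" by blast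
    have "\<forall>\<^sub>F \<epsilon> in at_right 0. \<bar>tilt F a \<epsilon> * (\<Sum>k<steps \<epsilon> t. smean (tilt F a \<epsilon>) (int k)) - s2 * (tilt F a \<epsilon>)\<^sup>2 * real (steps \<epsilon> t)\<bar>
        \<le> (tilt F a \<epsilon>)\<^sup>2 * (e * real (steps \<epsilon> t) + C)"
      using eventually_tilt_le[OF C(2)]
    proof eventually_elim
      case (elim \<epsilon>)
      let ?\<tau> = "tilt F a \<epsilon>" and ?n = "steps \<epsilon> t"
      have "\<bar>?\<tau> * (\<Sum>k<?n. smean ?\<tau> (int k)) - s2 * ?\<tau>\<^sup>2 * real ?n\<bar> = ?\<tau> * \<bar>(\<Sum>k<?n. smean ?\<tau> (int k)) - s2 * ?\<tau> * real ?n\<bar>"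
        using elim by (subst abs_of_pos[of ?\<tau>, symmetric], simp, unfold abs_mult[symmetric])
           (simp add: right_diff_distrib power2_eq_square mult_ac)
      also have "\<dots> \<le> ?\<tau> * (?\<tau> * (e * real ?n + C))" using elim by (intro mult_left_mono le) auto
      finally show ?case by (simp add: power2_eq_square mult.assoc)
    qed
    then show "\<exists>C\<ge>0. \<forall>\<^sub>F \<epsilon> in at_right 0. \<bar>tilt F a \<epsilon> * (\<Sum>k<steps \<epsilon> t. smean (tilt F a \<epsilon>) (int k)) - s2 * (tilt F a \<epsilon>)\<^sup>2 * real (steps \<epsilon> t)\<bar>
        \<le> (tilt F a \<epsilon>)\<^sup>2 * (e * real (steps \<epsilon> t) + C)" using C by blast
  qed
  then show ?thesis using s2_pos by simp
qed

lemma var_limit: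
  assumes t: "t \<ge> 0"
  shows "((\<lambda>\<epsilon>. (tilt F a \<epsilon>)\<^sup>2 * (\<Sum>k<steps \<epsilon> t. svar (tilt F a \<epsilon>) (int k))) \<longlongrightarrow> 2 * t) (at_right 0)"
proof -
  have "((\<lambda>\<epsilon>. (tilt F a \<epsilon>)\<^sup>2 * (\<Sum>k<steps \<epsilon> t. svar (tilt F a \<epsilon>) (int k))) \<longlongrightarrow> 2 * s2 * (t / s2)) (at_right 0)"
  proof (rule steps_limit_approx[OF t])
    fix e :: real assume "e > 0"
    from svar_approx[OF this] obtain r where r: "r > 0"
      and le: "\<And>\<tau> k. 0 < \<tau> \<Longrightarrow> \<tau> \<le> r \<Longrightarrow> \<bar>svar \<tau> k - 2 * s2\<bar> \<le> e" by blast
    have "\<forall>\<^sub>F \<epsilon> in at_right 0. \<bar>(tilt F a \<epsilon>)\<^sup>2 * (\<Sum>k<steps \<epsilon> t. svar (tilt F a \<epsilon>) (int k)) - 2 * s2 * (tilt F a \<epsilon>)\<^sup>2 * real (steps \<epsilon> t)\<bar>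
        \<le> (tilt F a \<epsilon>)\<^sup>2 * (e * real (steps \<epsilon> t) + 0)"
      using eventually_tilt_le[OF r]
    proof eventually_elim
      case (elim \<epsilon>)
      let ?\<tau> = "tilt F a \<epsilon>" and ?n = "steps \<epsilon> t"
      have "\<bar>(\<Sum>k<?n. svar ?\<tau> (int k) - 2 * s2)\<bar> \<le> (\<Sum>k<?n. e)"
        using elim by (intro order_trans[OF sum_abs] sum_mono le) auto
      then have "?\<tau>\<^sup>2 * \<bar>(\<Sum>k<?n. svar ?\<tau> (int k) - 2 * s2)\<bar> \<le> ?\<tau>\<^sup>2 * (e * real ?n + 0)"
        by (intro mult_left_mono) (auto simp: mult.commute)
      moreover have "\<bar>?\<tau>\<^sup>2 * (\<Sum>k<?n. svar ?\<tau> (int k)) - 2 * s2 * ?\<tau>\<^sup>2 * real ?n\<bar> = ?\<tau>\<^sup>2 * \<bar>(\<Sum>k<?n. svar ?\<tau> (int k) - 2 * s2)\<bar>"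
      proof -
        have "?\<tau>\<^sup>2 * (\<Sum>k<?n. svar ?\<tau> (int k)) - 2 * s2 * ?\<tau>\<^sup>2 * real ?n = ?\<tau>\<^sup>2 * (\<Sum>k<?n. svar ?\<tau> (int k) - 2 * s2)"
          by (simp add: sum_subtractf right_diff_distrib mult_ac)
        then show ?thesis by (simp only: abs_mult abs_power2)
      qed
      ultimately show ?case by simp
    qed
    then show "\<exists>C\<ge>0. \<forall>\<^sub>F \<epsilon> in at_right 0. \<bar>(tilt F a \<epsilon>)\<^sup>2 * (\<Sum>k<steps \<epsilon> t. svar (tilt F a \<epsilon>) (int k)) - 2 * s2 * (tilt F a \<epsilon>)\<^sup>2 * real (steps \<epsilon> t)\<bar>
        \<le> (tilt F a \<epsilon>)\<^sup>2 * (e * real (steps \<epsilon> t) + C)" by blast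
  qed
  then show ?thesis using s2_pos by simp
qed

section \<open>Independent increments over the cells of a time grid\<close>

lemma tilt_side: "tilt F (side_coeff a u) \<epsilon> = tilt F a \<epsilon>"
  by (simp add: tilt_def coeff_sum_side)

lemma steps_side: "tilted_coeffs.steps F (side_coeff a u) \<epsilon> t = steps \<epsilon> t"
proof -
  interpret S: tilted_coeffs F "side_coeff a u" by (rule tilted_coeffs_side)
  show ?thesis by (simp add: S.steps_def steps_def S.c0_def c0_def coeff_sum_side)
qed

text \<open>The increment over one grid cell of the approximating walk with independent steps;
  \<open>p\<close> is the side together with the number of the cell, and \<open>n\<close> gives the
  step counts at the grid points.\<close>

definition block :: "real \<Rightarrow> (sign \<Rightarrow> int \<Rightarrow> 'a \<Rightarrow> real) \<Rightarrow> (nat \<Rightarrow> nat) \<Rightarrow> sign \<times> nat \<Rightarrow> 'a \<Rightarrow> real" where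
  "block \<tau> Z n p \<omega> = \<tau> * (\<Sum>j\<in>{n (snd p)..<n (Suc (snd p))}. side_step Z (fst p) (int j) \<omega>)"

lemma block_measurable [measurable]:
  assumes [measurable]: "\<And>v k. Z v k \<in> borel_measurable M"
  shows "block \<tau> Z n p \<in> borel_measurable M"
  unfolding block_def by measurable

lemma sum_block:
  assumes n: "mono n" "n 0 = 0"
  shows "(\<Sum>p\<in>{u} \<times> {..<\<kappa>}. block \<tau> Z n p \<omega>) = \<tau> * (\<Sum>j<n \<kappa>. side_step Z u (int j) \<omega>)"
proof -
  have "(\<Sum>p\<in>{u} \<times> {..<\<kappa>}. block \<tau> Z n p \<omega>) = (\<Sum>l<\<kappa>. block \<tau> Z n (u, l) \<omega>)"
    by (subst sum.cartesian_product[symmetric, where g="\<lambda>u l. block \<tau> Z n (u, l) \<omega>", simplified]) simp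
  also have "\<dots> = \<tau> * (\<Sum>j<n \<kappa>. side_step Z u (int j) \<omega>)"
  proof (induction \<kappa>)
    case (Suc \<kappa>)
    have "n \<kappa> \<le> n (Suc \<kappa>)" using n by (simp add: monoD)
    then show ?case using Suc
      by (simp add: block_def sum_ivl_diff[of "n \<kappa>" "n (Suc \<kappa>)"] right_diff_distrib)
  qed (simp add: n)
  finally show ?thesis .
qed

text \<open>Different blocks use disjoint sets of noise variables. On the right these sit at times j
  \<ge> 0, on the left at times -1 - j < 0; this is the origin of the independence of the two
  limiting Brownian motions.\<close>

lemma block_indep:
  assumes tn: "tilted_noise F a \<epsilon> M Z T" and n: "mono n"
  shows "prob_space.indep_vars M (\<lambda>_. borel) (block \<tau> Z n) UNIV"
proof -
  note b = tilted_noise_basic[OF tn]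
  interpret M: prob_space M by (rule b(1))
  \<comment> \<open>\<open>loc u j\<close> is the time of step j on side u before
    reflection.\<close>
  define loc :: "sign \<Rightarrow> nat \<Rightarrow> int" where "loc u j = (case u of Plus \<Rightarrow> int j | Minus \<Rightarrow> -1 - int j)" for u j
  define K :: "sign \<times> nat \<Rightarrow> (int \<times> sign) set" where "K p = loc (fst p) ` {n (snd p)..<n (Suc (snd p))} \<times> UNIV" for p
  have loc_inj: "loc u j = loc v k \<longleftrightarrow> u = v \<and> j = k" for u v j k
    by (cases u; cases v) (auto simp: loc_def)
  have n_disj: "l = l'" if "j \<in> {n l..<n (Suc l)}" "j \<in> {n l'..<n (Suc l')}" for j l l'
  proof (rule ccontr)
    assume "l \<noteq> l'"
    then consider "Suc l \<le> l'" | "Suc l' \<le> l" by linarith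
    then show False using that monoD[OF n] by cases (fastforce dest: monoD[OF n])+
  qed
  have disj: "disjoint_family_on K UNIV"
    unfolding disjoint_family_on_def
  proof (intro ballI impI)
    fix p p' :: "sign \<times> nat" assume "p \<noteq> p'"
    show "K p \<inter> K p' = {}"
    proof (rule ccontr)
      assume "K p \<inter> K p' \<noteq> {}"
      then obtain j j' where "j \<in> {n (snd p)..<n (Suc (snd p))}" "j' \<in> {n (snd p')..<n (Suc (snd p'))}"
        "loc (fst p) j = loc (fst p') j'" unfolding K_def by blast
      then show False using n_disj[of j "snd p" "snd p'"] \<open>p \<noteq> p'\<close> by (auto simp: loc_inj prod_eq_iff)
    qed
  qed
  have step: "side_step Z' u (int j) x = (if u = Plus then Z' Minus (loc u j) x - Z' Plus (loc u j) x
      else Z' Plus (loc u j) x - Z' Minus (loc u j) x)" for Z' :: "sign \<Rightarrow> int \<Rightarrow> 'b \<Rightarrow> real" and u j x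
    by (cases u) (simp_all add: side_step_def side_noise_def loc_def)
  have "M.indep_vars (\<lambda>p. PiM (K p) (\<lambda>_. borel)) (\<lambda>p \<omega>. restrict (\<lambda>i. (\<lambda>(k, u). Z u k) i \<omega>) (K p)) UNIV"
    by (rule M.indep_vars_restrict[OF b(2) _ disj]) simp
  then have "M.indep_vars (\<lambda>_. borel) (\<lambda>p \<omega>. block \<tau> (\<lambda>u k x. x (k, u)) n p (restrict (\<lambda>i. (\<lambda>(k, u). Z u k) i \<omega>) (K p))) UNIV"
  proof (rule M.indep_vars_compose2)
    fix p
    have c: "(\<lambda>x. x i) \<in> borel_measurable (PiM (K p) (\<lambda>_. borel))" if "i \<in> K p" for i
      using measurable_component_singleton[OF that, of "\<lambda>_. borel"] by simp
    have "(\<lambda>x. side_step (\<lambda>u k x. x (k, u)) (fst p) (int j) x) \<in> borel_measurable (PiM (K p) (\<lambda>_. borel))"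
      if j: "j \<in> {n (snd p)..<n (Suc (snd p))}" for j
    proof -
      have "(loc (fst p) j, v) \<in> K p" for v using j by (auto simp: K_def)
      then show ?thesis unfolding step by (cases "fst p = Plus") (auto intro!: borel_measurable_diff c)
    qed
    then show "block \<tau> (\<lambda>u k x. x (k, u)) n p \<in> borel_measurable (PiM (K p) (\<lambda>_. borel))"
      unfolding block_def by (intro borel_measurable_times borel_measurable_const borel_measurable_sum)
  qed
  moreover have "block \<tau> (\<lambda>u k x. x (k, u)) n p (restrict (\<lambda>i. (\<lambda>(k, u). Z u k) i \<omega>) (K p)) = block \<tau> Z n p \<omega>" for p \<omega>
  proof -
    have "(loc (fst p) j, v) \<in> K p" if "j \<in> {n (snd p)..<n (Suc (snd p))}" for j v using that by (auto simp: K_def)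
    then show ?thesis unfolding block_def step by (intro arg_cong2[where f="(*)"] sum.cong refl) auto
  qed
  ultimately show ?thesis by simp
qed

end

lemma (in prob_space) indep_vars_singleton:
  "X i \<in> measurable M N \<Longrightarrow> indep_vars (\<lambda>_. N) X {i}"
  unfolding indep_vars_def2
  by (intro conjI ballI indep_setsI) (auto intro: measurable_sets simp: subset_singleton_iff)

lemma (in prob_space) indep_vars_Some:
  assumes X: "indep_vars (\<lambda>_. N) X P"
  shows "indep_vars (\<lambda>_. N) (\<lambda>i. case i of None \<Rightarrow> T | Some p \<Rightarrow> X p) (Some ` P)"
proof -
  have "indep_vars (\<lambda>_. N) (\<lambda>i. X (the i)) (Some ` P)"
    by (rule indep_vars_reindex[OF X]) (auto simp: inj_on_def)
  then show ?thesis by (rule indep_vars_cong[THEN iffD1, rotated -1]) auto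
qed

context tilted_coeffs
begin

lemma T_block_indep:
  assumes tn: "tilted_noise F a \<epsilon> M Z T" and n: "mono n"
  shows "prob_space.indep_vars M (\<lambda>_. borel)
    (\<lambda>i. case i of None \<Rightarrow> scaled_T \<epsilon> T | Some p \<Rightarrow> block \<tau> Z n p) (insert None (Some ` P))"
proof -
  note b = tilted_noise_basic[OF tn]
  interpret M: prob_space M by (rule b(1))
  let ?X = "\<lambda>i. case i of None \<Rightarrow> scaled_T \<epsilon> T | Some p \<Rightarrow> block \<tau> Z n p"
  have "M.indep_vars (\<lambda>_. borel) ?X ({None} \<union> Some ` P)"
  proof (rule M.independent_rvs_imp_indep_vars)
    show "M.indep_vars (\<lambda>_. borel) ?X {None}"
      using indep_T_walk[OF tn] by (intro M.indep_vars_singleton) (simp add: independent_rvs_def)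
    show "M.indep_vars (\<lambda>_. borel) ?X (Some ` P)"
      by (intro M.indep_vars_Some M.indep_vars_subset[OF block_indep[OF tn n]]) simp
    have f: "(\<lambda>x. \<lambda>i\<in>{None :: (sign \<times> nat) option}. tilt F a \<epsilon> / A * x) \<in> measurable borel (PiM {None} (\<lambda>_. borel))"
      by (intro measurable_restrict) measurable
    have g: "(\<lambda>x. \<lambda>i\<in>Some ` P. block \<tau> (\<lambda>u k x. x (k, u)) n (the i) x) \<in> measurable (PiM UNIV (\<lambda>_. borel)) (PiM (Some ` P) (\<lambda>_. borel))"
      by (intro measurable_restrict block_measurable noise_component_measurable)
    have "independent_rvs M (PiM {None} (\<lambda>_. borel)) (\<lambda>\<omega>. (\<lambda>x. \<lambda>i\<in>{None :: (sign \<times> nat) option}. tilt F a \<epsilon> / A * x) (T \<omega>))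
       (PiM (Some ` P) (\<lambda>_. borel)) (\<lambda>\<omega>. \<lambda>i\<in>Some ` P. ?X i \<omega>)"
    proof (rule indep_T_noise_fun[OF tn f g])
      fix \<omega>
      have "block \<tau> (\<lambda>u k x. x (k, u)) n p (\<lambda>(j, u). Z u j \<omega>) = block \<tau> Z n p \<omega>" for p
        by (cases "fst p") (simp_all add: block_def side_step_def side_noise_def)
      then show "(\<lambda>i\<in>Some ` P. ?X i \<omega>) = (\<lambda>i\<in>Some ` P. block \<tau> (\<lambda>u k x. x (k, u)) n (the i) (\<lambda>(j, u). Z u j \<omega>))"
        by (auto simp: fun_eq_iff restrict_def)
    qed
    moreover have "(\<lambda>\<omega>. (\<lambda>i\<in>{None :: (sign \<times> nat) option}. tilt F a \<epsilon> / A * T \<omega>)) = (\<lambda>\<omega>. \<lambda>i\<in>{None}. ?X i \<omega>)"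
      by (auto simp: fun_eq_iff scaled_T_def restrict_def)
    ultimately show "independent_rvs M (PiM {None} (\<lambda>_. borel)) (\<lambda>\<omega>. \<lambda>i\<in>{None}. ?X i \<omega>)
       (PiM (Some ` P) (\<lambda>_. borel)) (\<lambda>\<omega>. \<lambda>i\<in>Some ` P. ?X i \<omega>)" by (simp only:)
  qed auto
  then show ?thesis by simp
qed

text \<open>\<open>triangular_clt\<close> is applied to one cell. Its mean and variance are
  differences of the quantities summed from time 0 up to the two end points, whose limits are
  \<open>mean_limit\<close> and \<open>var_limit\<close> for the coefficients of the side.\<close>

lemma block_clt:
  fixes M :: "nat \<Rightarrow> 'm measure"
  assumes tn: "\<And>k. tilted_noise F a (\<epsilon> k) (M k) (Z k) (T k)"
    and \<epsilon>: "filterlim \<epsilon> (at_right 0) sequentially" "\<And>k. \<epsilon> k > 0"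
    and \<tau>: "\<And>k. 0 < tilt F a (\<epsilon> k)" "\<And>k. tilt F a (\<epsilon> k) * tilted_coeffs.\<rho> (side_coeff a u) \<le> 1"
    and g: "0 \<le> g l" "g l < g (Suc l)"
  shows "weak_conv_m (\<lambda>k. distr (M k) borel (block (tilt F a (\<epsilon> k)) (Z k) (\<lambda>i. steps (\<epsilon> k) (g i)) (u, l)))
     (density lborel (normal_density (g (Suc l) - g l) (sqrt (2 * (g (Suc l) - g l)))))"
proof -
  interpret S: tilted_coeffs F "side_coeff a u" by (rule tilted_coeffs_side)
  have M: "prob_space (M k)" for k by (rule tilted_noise_basic(1)[OF tn])
  interpret M: prob_space "M k" for k by (rule M)
  let ?\<tau> = "\<lambda>k. tilt F a (\<epsilon> k)" and ?n = "\<lambda>k i. steps (\<epsilon> k) (g i)"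
  have walk: "tilted_walk F (side_coeff a u) (M k) (?\<tau> k) (side_step (Z k) u) (side_walk a (Z k) u)" for k
    using \<tau> by (intro tilted_walk_side[OF tn])
  have g1: "0 \<le> g (Suc l)" using g by linarith
  have nle: "?n k l \<le> ?n k (Suc l)" for k using g by (intro steps_mono \<epsilon>) simp
  have lims: "(\<lambda>k. ?\<tau> k * (\<Sum>j<?n k i. S.smean (?\<tau> k) (int j))) \<longlonglongrightarrow> g i"
    "(\<lambda>k. (?\<tau> k)\<^sup>2 * (\<Sum>j<?n k i. S.svar (?\<tau> k) (int j))) \<longlonglongrightarrow> 2 * g i"
    "(\<lambda>k. (?\<tau> k)\<^sup>2 * real (?n k i)) \<longlonglongrightarrow> g i / s2" if "g i \<ge> 0" for i
    using filterlim_compose[OF S.mean_limit[OF that] \<epsilon>(1)] filterlim_compose[OF S.var_limit[OF that] \<epsilon>(1)]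
      filterlim_compose[OF steps_limit[OF that] \<epsilon>(1)]
    by (simp_all add: tilt_side steps_side)
  \<comment> \<open>Convergence bounds \<tau>^2 n along the whole sequence, as required for the
    number of summands in the array.\<close>
  have "convergent (\<lambda>k. (?\<tau> k)\<^sup>2 * real (?n k (Suc l)))" using lims(3)[OF g1] by (rule convergentI)
  then have "Bseq (\<lambda>k. (?\<tau> k)\<^sup>2 * real (?n k (Suc l)))" by (rule convergent_imp_Bseq)
  then obtain B where B: "\<And>k. \<bar>(?\<tau> k)\<^sup>2 * real (?n k (Suc l))\<bar> \<le> B" by (auto simp: Bseq_def)
  have "weak_conv_m (\<lambda>k. distr (M k) borel (\<lambda>\<omega>. ?\<tau> k * (\<Sum>j\<in>{?n k l..<?n k (Suc l)}. side_step (Z k) u (int j) \<omega>)))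
     (density lborel (normal_density (g (Suc l) - g l) (sqrt (2 * (g (Suc l) - g l)))))"
  proof (rule triangular_clt[OF M, where C="exp_bound\<^sup>2" and B=B and Y="\<lambda>k j. side_step (Z k) u (int j)"])
    show "M.indep_vars k (\<lambda>_. borel) (\<lambda>j. side_step (Z k) u (int j)) {?n k l..<?n k (Suc l)}" for k
      by (rule M.indep_vars_reindex[OF tilted_walk.Y_indep[OF walk]]) auto
    show "integrable (M k) (\<lambda>\<omega>. exp (2 * \<bar>side_step (Z k) u (int j) \<omega>\<bar>))" for k j
      by (rule tilted_walk.Y_exp[OF walk])
    show "M.expectation k (\<lambda>\<omega>. exp (2 * \<bar>side_step (Z k) u (int j) \<omega>\<bar>)) \<le> exp_bound\<^sup>2" for k j
      by (rule tilted_walk.Y_exp_le[OF walk])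
    show "?\<tau> \<longlonglongrightarrow> 0" by (rule filterlim_compose[OF tilt_tendsto_0 \<epsilon>(1)])
    show "real (card {?n k l..<?n k (Suc l)}) * (?\<tau> k)\<^sup>2 \<le> B" for k
    proof -
      have "real (card {?n k l..<?n k (Suc l)}) * (?\<tau> k)\<^sup>2 \<le> real (?n k (Suc l)) * (?\<tau> k)\<^sup>2"
        by (intro mult_right_mono) auto
      also have "\<dots> \<le> B" using B[of k] by (simp add: mult.commute)
      finally show ?thesis .
    qed
    show "(\<lambda>k. ?\<tau> k * (\<Sum>j\<in>{?n k l..<?n k (Suc l)}. M.expectation k (side_step (Z k) u (int j)))) \<longlonglongrightarrow> g (Suc l) - g l"
      using tendsto_diff[OF lims(1)[OF g1] lims(1)[OF g(1)]]
      by (simp add: tilted_walk.Y_mean[OF walk] sum_ivl_diff[OF nle] right_diff_distrib)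
    show "(\<lambda>k. (?\<tau> k)\<^sup>2 * (\<Sum>j\<in>{?n k l..<?n k (Suc l)}. M.variance k (side_step (Z k) u (int j)))) \<longlonglongrightarrow> 2 * (g (Suc l) - g l)"
      using tendsto_diff[OF lims(2)[OF g1] lims(2)[OF g(1)]]
      by (simp add: tilted_walk.Y_var[OF walk] sum_ivl_diff[OF nle] right_diff_distrib)
  qed (use g in auto)
  then show ?thesis by (simp add: block_def[abs_def])
qed

lemma scaled_walk_approx:
  assumes e: "e > 0" and t: "t \<ge> 0"
  shows "\<forall>\<^sub>F \<epsilon> in at_right 0. \<forall>(M :: 'm measure) Z T. tilted_noise F a \<epsilon> M Z T \<longrightarrow>
    (\<integral>\<^sup>+\<omega>. ennreal \<bar>scaled_walk \<epsilon> Z u t \<omega> - tilt F a \<epsilon> * (\<Sum>j<steps \<epsilon> t. side_step Z u (int j) \<omega>)\<bar> \<partial>M) \<le> ennreal e"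
proof -
  interpret S: tilted_coeffs F "side_coeff a u" by (rule tilted_coeffs_side)
  \<comment> \<open>The extra 1 is room: \<tau>^2 n tends to t / s2, so it stays below this bound
    for small \<epsilon>.\<close>
  have R: "t / s2 + 1 \<ge> 0" using t s2_pos by simp
  from S.walk_approx[OF e R] obtain r where r: "r > 0" and
    le: "\<forall>\<tau> (M :: 'm measure) Y S n. \<tau> \<le> r \<longrightarrow> real n * \<tau>\<^sup>2 \<le> t / s2 + 1 \<longrightarrow> tilted_walk F (side_coeff a u) M \<tau> Y S \<longrightarrow>
    (\<integral>\<^sup>+\<omega>. ennreal \<bar>\<tau> / coeff_sum (side_coeff a u) * S n \<omega> - \<tau> * (\<Sum>k<n. Y (int k) \<omega>)\<bar> \<partial>M) \<le> ennreal e"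
    by (elim exE conjE) (rule that)
  have r': "min r (1 / S.\<rho>) > 0" using r S.\<rho>_pos by simp
  have "\<forall>\<^sub>F \<epsilon> in at_right 0. (tilt F a \<epsilon>)\<^sup>2 * real (steps \<epsilon> t) < t / s2 + 1"
    by (rule order_tendstoD(2)[OF steps_limit[OF t]]) simp
  then show ?thesis using eventually_tilt_le[OF r']
  proof (eventually_elim, intro allI impI)
    fix \<epsilon> and M :: "'m measure" and Z T
    assume n: "(tilt F a \<epsilon>)\<^sup>2 * real (steps \<epsilon> t) < t / s2 + 1"
      and \<epsilon>: "0 < \<epsilon> \<and> \<epsilon> < min r (1 / S.\<rho>) \<and> 0 < tilt F a \<epsilon> \<and> tilt F a \<epsilon> \<le> min r (1 / S.\<rho>) \<and> \<epsilon> / (2 * A * s2) \<le> tilt F a \<epsilon>"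
      and tn: "tilted_noise F a \<epsilon> M Z T"
    have walk: "tilted_walk F (side_coeff a u) M (tilt F a \<epsilon>) (side_step Z u) (side_walk a Z u)"
      using \<epsilon> S.\<rho>_pos by (intro tilted_walk_side[OF tn]) (auto simp: pos_le_divide_eq)
    show "(\<integral>\<^sup>+\<omega>. ennreal \<bar>scaled_walk \<epsilon> Z u t \<omega> - tilt F a \<epsilon> * (\<Sum>j<steps \<epsilon> t. side_step Z u (int j) \<omega>)\<bar> \<partial>M) \<le> ennreal e"
      using le[rule_format, OF _ _ walk, of "steps \<epsilon> t"] \<epsilon> n
      by (simp add: scaled_walk_def coeff_sum_side mult.commute)
  qed
qed

end

section \<open>Brownian motion with drift\<close>

locale brownian_pair = prob_space N for N :: "'n measure" +
  fixes T0 :: "'n \<Rightarrow> real" and Bm Bp :: "real \<Rightarrow> 'n \<Rightarrow> real"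
  assumes Bm: "standard_brownian_motion N Bm" and Bp: "standard_brownian_motion N Bp"
    and T0: "distributed N lborel T0 (exponential_density 1)"
    and indep_B: "independent_rvs N path_space (sample_path Bm) path_space (sample_path Bp)"
    and indep_T0: "independent_rvs N borel T0
           (path_space \<Otimes>\<^sub>M path_space) (\<lambda>\<omega>. (sample_path Bm \<omega>, sample_path Bp \<omega>))"
begin

definition B :: "sign \<Rightarrow> real \<Rightarrow> 'n \<Rightarrow> real" where
  "B u = (case u of Minus \<Rightarrow> Bm | Plus \<Rightarrow> Bp)"

text \<open>The maximum matters only for t < 0, where a Brownian motion is left unspecified; it
  makes the function measurable in t on the whole line.\<close>

definition drifted :: "sign \<Rightarrow> real \<Rightarrow> 'n \<Rightarrow> real" where
  "drifted u t \<omega> = sqrt 2 * B u (max 0 t) \<omega> + t"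

lemma sbm: "standard_brownian_motion N (B u)"
  using Bm Bp by (cases u) (auto simp: B_def)

lemma B_measurable: "t \<ge> 0 \<Longrightarrow> B u t \<in> borel_measurable N"
  using sbm[of u] by (simp add: standard_brownian_motion_def)

lemma B_0: "AE \<omega> in N. B u 0 \<omega> = 0"
  using sbm[of u] by (simp add: standard_brownian_motion_def)

lemma B_cont: "\<omega> \<in> space N \<Longrightarrow> continuous_on {0..} (\<lambda>t. B u t \<omega>)"
  using sbm[of u] by (simp add: standard_brownian_motion_def)

lemma B_increment: "0 \<le> s \<Longrightarrow> s < t \<Longrightarrow>
    distributed N lborel (\<lambda>\<omega>. B u t \<omega> - B u s \<omega>) (normal_density 0 (sqrt (t - s)))"
  using sbm[of u] by (simp add: standard_brownian_motion_def)

lemma B_indep_increments: "0 \<le> g (0::nat) \<Longrightarrow> (\<And>i. i < n \<Longrightarrow> g i < g (Suc i)) \<Longrightarrow>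
    indep_vars (\<lambda>_. borel) (\<lambda>i \<omega>. B u (g (Suc i)) \<omega> - B u (g i) \<omega>) {..<n}"
  using sbm[of u] by (simp add: standard_brownian_motion_def)

text \<open>Rounding t down to multiples of 1 / (m + 1) leaves countably many times, at each of
  which B is measurable. Since every path is continuous, these approximations converge at every
  point of the product space.\<close>

lemma drifted_joint: "(\<lambda>x. drifted u (fst x) (snd x)) \<in> borel_measurable (borel \<Otimes>\<^sub>M N)"
proof -
  define h where "h m t = real (nat \<lfloor>real (Suc m) * max 0 t\<rfloor>) / real (Suc m)" for m and t :: real
  have "(\<lambda>x. B u (max 0 (fst x)) (snd x)) \<in> borel_measurable (borel \<Otimes>\<^sub>M N)"
  proof (rule borel_measurable_LIMSEQ_real)
    show "(\<lambda>x. B u (h m (fst x)) (snd x)) \<in> borel_measurable (borel \<Otimes>\<^sub>M N)" for m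
      unfolding h_def
    proof (rule measurable_compose_countable[where f="\<lambda>i x. B u (real i / real (Suc m)) (snd x)"
          and g="\<lambda>x. nat \<lfloor>real (Suc m) * max 0 (fst x)\<rfloor>"])
      show "(\<lambda>x. B u (real i / real (Suc m)) (snd x)) \<in> borel_measurable (borel \<Otimes>\<^sub>M N)" for i
        by (rule measurable_compose[OF measurable_snd B_measurable]) simp
      show "(\<lambda>x. nat \<lfloor>real (Suc m) * max 0 (fst x)\<rfloor>) \<in> measurable (borel \<Otimes>\<^sub>M N) (count_space UNIV)"
        by measurable
    qed
    fix x :: "real \<times> 'n" assume "x \<in> space (borel \<Otimes>\<^sub>M N)"
    then have x: "snd x \<in> space N" by (auto simp: space_pair_measure)
    let ?t = "max 0 (fst x)"
    have lim: "(\<lambda>m. h m (fst x)) \<longlonglongrightarrow> ?t"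
    proof (rule tendsto_sandwich)
      have b: "real (Suc m) * ?t - 1 \<le> real (nat \<lfloor>real (Suc m) * ?t\<rfloor>)" "real (nat \<lfloor>real (Suc m) * ?t\<rfloor>) \<le> real (Suc m) * ?t" for m
      proof -
        have "0 \<le> real (Suc m) * ?t" by simp
        then show "real (Suc m) * ?t - 1 \<le> real (nat \<lfloor>real (Suc m) * ?t\<rfloor>)" "real (nat \<lfloor>real (Suc m) * ?t\<rfloor>) \<le> real (Suc m) * ?t"
          by linarith+
      qed
      have "?t - inverse (real (Suc m)) \<le> h m (fst x)" for m
      proof -
        have "(real (Suc m) * ?t - 1) / real (Suc m) \<le> h m (fst x)"
          unfolding h_def by (intro divide_right_mono b) simp
        then show ?thesis by (simp add: diff_divide_distrib inverse_eq_divide del: of_nat_Suc)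
      qed
      then show "\<forall>\<^sub>F m in sequentially. ?t - inverse (real (Suc m)) \<le> h m (fst x)" by simp
      have "h m (fst x) \<le> ?t" for m
      proof -
        have "h m (fst x) \<le> (real (Suc m) * ?t) / real (Suc m)"
          unfolding h_def by (intro divide_right_mono b) simp
        then show ?thesis by (simp del: of_nat_Suc)
      qed
      then show "\<forall>\<^sub>F m in sequentially. h m (fst x) \<le> ?t" by simp
      show "(\<lambda>m. ?t - inverse (real (Suc m))) \<longlonglongrightarrow> ?t"
        using tendsto_diff[OF tendsto_const LIMSEQ_inverse_real_of_nat, of ?t] by simp
    qed simp
    show "(\<lambda>m. B u (h m (fst x)) (snd x)) \<longlonglongrightarrow> B u ?t (snd x)"
      by (rule continuous_on_tendsto_compose[OF B_cont[OF x] lim]) (auto simp: h_def)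
  qed
  then show ?thesis unfolding drifted_def by measurable
qed

lemma indep_T0_path:
  assumes f: "f \<in> measurable borel N'" and g: "g \<in> measurable path_space N''"
  shows "independent_rvs N N' (\<lambda>\<omega>. f (T0 \<omega>)) N'' (\<lambda>\<omega>. g (sample_path (B u) \<omega>))"
proof (cases u)
  case Minus
  have "(\<lambda>p. g (fst p)) \<in> measurable (path_space \<Otimes>\<^sub>M path_space) N''"
    using g by measurable
  from independent_rvs_compose[OF indep_T0 f this] show ?thesis using Minus by (simp add: B_def)
next
  case Plus
  have "(\<lambda>p. g (snd p)) \<in> measurable (path_space \<Otimes>\<^sub>M path_space) N''"
    using g by measurable
  from independent_rvs_compose[OF indep_T0 f this] show ?thesis using Plus by (simp add: B_def)
qed

lemma path_component: "t \<ge> 0 \<Longrightarrow> (\<lambda>x. x t) \<in> borel_measurable path_space"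
  by (rule measurable_component_singleton) simp

lemma indep_T0_drifted: "independent_rvs N borel T0 borel (drifted u t)"
proof -
  have g: "(\<lambda>x. sqrt 2 * x (max 0 t) + t) \<in> borel_measurable path_space"
    by (intro borel_measurable_add borel_measurable_times borel_measurable_const path_component) simp
  have "independent_rvs N borel (\<lambda>\<omega>. (\<lambda>x. x) (T0 \<omega>)) borel (\<lambda>\<omega>. (\<lambda>x. sqrt 2 * x (max 0 t) + t) (sample_path (B u) \<omega>))"
    by (rule indep_T0_path[OF _ g]) simp
  then show ?thesis by (simp add: sample_path_def drifted_def[abs_def])
qed

text \<open>Completing the square: tilting a centred normal density by v moves its mean to
  \<open>\<sigma>\<^sup>2 * v\<close>.\<close>

lemma normal_mgf:
  assumes s: "\<sigma> > 0"
  shows "(\<integral>\<^sup>+x. ennreal (normal_density 0 \<sigma> x) * ennreal (exp (v * x)) \<partial>lborel) = ennreal (exp (\<sigma>\<^sup>2 * v\<^sup>2 / 2))"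
proof -
  have eq: "normal_density 0 \<sigma> x * exp (v * x) = exp (\<sigma>\<^sup>2 * v\<^sup>2 / 2) * normal_density (\<sigma>\<^sup>2 * v) \<sigma> x" for x
  proof -
    have "- (x - 0)\<^sup>2 / (2 * \<sigma>\<^sup>2) + v * x = \<sigma>\<^sup>2 * v\<^sup>2 / 2 + - (x - \<sigma>\<^sup>2 * v)\<^sup>2 / (2 * \<sigma>\<^sup>2)"
      using s by (simp add: field_simps power2_eq_square)
    then have "exp (- (x - 0)\<^sup>2 / (2 * \<sigma>\<^sup>2)) * exp (v * x) = exp (\<sigma>\<^sup>2 * v\<^sup>2 / 2) * exp (- (x - \<sigma>\<^sup>2 * v)\<^sup>2 / (2 * \<sigma>\<^sup>2))"
      by (simp only: exp_add[symmetric])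
    then have "k * (exp (- (x - 0)\<^sup>2 / (2 * \<sigma>\<^sup>2)) * exp (v * x)) = exp (\<sigma>\<^sup>2 * v\<^sup>2 / 2) * (k * exp (- (x - \<sigma>\<^sup>2 * v)\<^sup>2 / (2 * \<sigma>\<^sup>2)))" for k
      by (simp only: mult.left_commute)
    then show ?thesis unfolding normal_density_def by (simp only: mult.assoc)
  qed
  have "(\<integral>\<^sup>+x. ennreal (normal_density 0 \<sigma> x) * ennreal (exp (v * x)) \<partial>lborel)
      = (\<integral>\<^sup>+x. ennreal (exp (\<sigma>\<^sup>2 * v\<^sup>2 / 2)) * ennreal (normal_density (\<sigma>\<^sup>2 * v) \<sigma> x) \<partial>lborel)"
    by (intro nn_integral_cong) (simp add: eq ennreal_mult[symmetric])
  also have "\<dots> = ennreal (exp (\<sigma>\<^sup>2 * v\<^sup>2 / 2)) * (\<integral>\<^sup>+x. ennreal (normal_density (\<sigma>\<^sup>2 * v) \<sigma> x) \<partial>lborel)"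
    by (intro nn_integral_cmult) auto
  also have "(\<integral>\<^sup>+x. ennreal (normal_density (\<sigma>\<^sup>2 * v) \<sigma> x) \<partial>lborel) = 1"
    using prob_space.emeasure_space_1[OF prob_space_normal_density[OF s, of "\<sigma>\<^sup>2 * v"]]
    by (simp add: emeasure_density)
  finally show ?thesis by simp
qed

text \<open>At exponent -1/2 the drift contributes -t / 2 and the Brownian part, of variance 2 t,
  contributes t / 4.\<close>

lemma drifted_mgf:
  assumes t: "t \<ge> 0"
  shows "(\<integral>\<^sup>+\<omega>. exp (- (1 / 2 * drifted u t \<omega>)) \<partial>N) \<le> ennreal (exp (- (1 / 4 * t)))"
proof (cases "t = 0")
  case True
  have "(\<integral>\<^sup>+\<omega>. exp (- (1 / 2 * drifted u t \<omega>)) \<partial>N) = (\<integral>\<^sup>+\<omega>. 1 \<partial>N)"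
    using B_0[of u] by (intro nn_integral_cong_AE) (auto elim!: eventually_mono simp: drifted_def True)
  then show ?thesis using True by (simp add: emeasure_space_1)
next
  case False
  then have t0: "t > 0" using t by simp
  let ?\<sigma> = "sqrt t" and ?v = "- (sqrt 2 / 2)"
  have D: "distributed N lborel (\<lambda>\<omega>. B u t \<omega> - B u 0 \<omega>) (normal_density 0 ?\<sigma>)"
    using B_increment[of 0 t u] t0 by simp
  have "(\<integral>\<^sup>+\<omega>. exp (- (1 / 2 * drifted u t \<omega>)) \<partial>N)
      = (\<integral>\<^sup>+\<omega>. ennreal (exp (- (t / 2))) * ennreal (exp (?v * (B u t \<omega> - B u 0 \<omega>))) \<partial>N)"
    using B_0[of u]
    by (intro nn_integral_cong_AE)
       (auto elim!: eventually_mono simp: drifted_def t ennreal_mult[symmetric] exp_add[symmetric] field_simps)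
  also have "\<dots> = ennreal (exp (- (t / 2))) * (\<integral>\<^sup>+\<omega>. ennreal (exp (?v * (B u t \<omega> - B u 0 \<omega>))) \<partial>N)"
    using B_measurable[OF t, of u] B_measurable[OF order_refl, of u] by (intro nn_integral_cmult) measurable
  also have "(\<integral>\<^sup>+\<omega>. ennreal (exp (?v * (B u t \<omega> - B u 0 \<omega>))) \<partial>N)
      = (\<integral>\<^sup>+x. ennreal (normal_density 0 ?\<sigma> x) * ennreal (exp (?v * x)) \<partial>lborel)"
    by (rule distributed_nn_integral[OF D, symmetric]) measurable
  also have "\<dots> = ennreal (exp (?\<sigma>\<^sup>2 * ?v\<^sup>2 / 2))" using t0 by (intro normal_mgf) simp
  also have "ennreal (exp (- (t / 2))) * ennreal (exp (?\<sigma>\<^sup>2 * ?v\<^sup>2 / 2)) = ennreal (exp (- (1 / 4 * t)))"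
    using t0 by (simp add: ennreal_mult[symmetric] exp_add[symmetric] power_divide)
  finally show ?thesis by simp
qed

text \<open>C and c are left free within these ranges so that the limit can share the constants
  found for the walks.\<close>

lemma drifted_occupation:
  assumes "C \<ge> 1" "0 < c" "c \<le> 1 / 4"
  shows "occupation N T0 drifted C c"
proof unfold_locales
  show "T0 \<in> borel_measurable N" using T0 by (simp add: distributed_def)
  show "(\<lambda>x. drifted u (fst x) (snd x)) \<in> borel_measurable (borel \<Otimes>\<^sub>M N)" for u by (rule drifted_joint)
  fix u and t :: real assume t: "t \<ge> 0"
  have "emeasure N {\<omega>\<in>space N. T0 \<omega> \<ge> drifted u t \<omega>} \<le> (\<integral>\<^sup>+\<omega>. exp (- (1 / 2 * drifted u t \<omega>)) \<partial>N)"
    by (intro prob_exponential_ge[OF T0 indep_T0_drifted]) auto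
  also have "\<dots> \<le> ennreal (exp (- (1 / 4 * t)))" by (rule drifted_mgf[OF t])
  finally have "prob {\<omega>\<in>space N. T0 \<omega> \<ge> drifted u t \<omega>} \<le> exp (- (1 / 4 * t))"
    by (simp add: emeasure_eq_measure)
  also have "\<dots> \<le> 1 * exp (- c * t)" using assms t mult_right_mono[of c "1 / 4" t] by simp
  also have "\<dots> \<le> C * exp (- c * t)" using assms by (intro mult_right_mono) auto
  finally show "prob {\<omega>\<in>space N. T0 \<omega> \<ge> drifted u t \<omega>} \<le> C * exp (- c * t)" .
qed (use assms in auto)

definition incr :: "(nat \<Rightarrow> real) \<Rightarrow> sign \<times> nat \<Rightarrow> 'n \<Rightarrow> real" where
  "incr g p \<omega> = sqrt 2 * (B (fst p) (g (Suc (snd p))) \<omega> - B (fst p) (g (snd p)) \<omega>) + (g (Suc (snd p)) - g (snd p))"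

lemma incr_law:
  assumes g: "0 \<le> g l" "g l < g (Suc l)"
  shows "distr N borel (incr g (u, l)) = density lborel (normal_density (g (Suc l) - g l) (sqrt (2 * (g (Suc l) - g l))))"
proof -
  have "distributed N lborel (\<lambda>\<omega>. (g (Suc l) - g l) + sqrt 2 * (B u (g (Suc l)) \<omega> - B u (g l) \<omega>))
      (normal_density ((g (Suc l) - g l) + sqrt 2 * 0) (\<bar>sqrt 2\<bar> * sqrt (g (Suc l) - g l)))"
    using g by (intro normal_density_affine[OF B_increment]) auto
  then have "distr N lborel (\<lambda>\<omega>. (g (Suc l) - g l) + sqrt 2 * (B u (g (Suc l)) \<omega> - B u (g l) \<omega>))
     = density lborel (normal_density (g (Suc l) - g l) (sqrt (2 * (g (Suc l) - g l))))"
    unfolding real_sqrt_mult by (simp add: distributed_def)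
  moreover have "distr N borel (incr g (u, l)) = distr N lborel (\<lambda>\<omega>. (g (Suc l) - g l) + sqrt 2 * (B u (g (Suc l)) \<omega> - B u (g l) \<omega>))"
    by (rule distr_cong) (auto simp: incr_def)
  ultimately show ?thesis by simp
qed

lemma sum_incr: "(\<Sum>p\<in>{u} \<times> {..<\<kappa>}. incr g p \<omega>) = sqrt 2 * (B u (g \<kappa>) \<omega> - B u (g 0) \<omega>) + (g \<kappa> - g 0)"
proof -
  have "(\<Sum>p\<in>{u} \<times> {..<\<kappa>}. incr g p \<omega>) = (\<Sum>l<\<kappa>. incr g (u, l) \<omega>)"
    by (subst sum.cartesian_product[symmetric, where g="\<lambda>u l. incr g (u, l) \<omega>", simplified]) simp
  also have "\<dots> = sqrt 2 * (B u (g \<kappa>) \<omega> - B u (g 0) \<omega>) + (g \<kappa> - g 0)"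
    by (induction \<kappa>) (auto simp: incr_def algebra_simps)
  finally show ?thesis .
qed

text \<open>Within one side this is the independence of Brownian increments; across the sides the
  increments are functions of two independent sample paths.\<close>

lemma incr_indep:
  assumes g: "\<And>i. 0 \<le> g i" "\<And>i. i < r \<Longrightarrow> g i < g (Suc i)"
  shows "indep_vars (\<lambda>_. borel) (incr g) (UNIV \<times> {..<r})"
proof -
  have side: "indep_vars (\<lambda>_. borel) (incr g) ({u} \<times> {..<r})" for u
  proof -
    have "indep_vars (\<lambda>_. borel) (\<lambda>i \<omega>. (\<lambda>x. sqrt 2 * x + (g (Suc i) - g i)) (B u (g (Suc i)) \<omega> - B u (g i) \<omega>)) {..<r}"
      by (rule indep_vars_compose2[OF B_indep_increments]) (use g in auto)
    then have "indep_vars (\<lambda>_. borel) (\<lambda>i. incr g (u, i)) {..<r}" by (simp add: incr_def[abs_def])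
    then have "indep_vars (\<lambda>_. borel) (\<lambda>p. incr g (u, snd p)) ({u} \<times> {..<r})"
      by (rule indep_vars_reindex) (auto simp: inj_on_def)
    then show ?thesis by (rule indep_vars_cong[THEN iffD1, rotated -1]) auto
  qed
  define G where "G u x = (\<lambda>p\<in>{u} \<times> {..<r}. sqrt 2 * (x (g (Suc (snd p))) - x (g (snd p))) + (g (Suc (snd p)) - g (snd p)))"
    for u :: sign and x :: "real \<Rightarrow> real"
  have G: "G u \<in> measurable path_space (PiM ({u} \<times> {..<r}) (\<lambda>_. borel))" for u
    unfolding G_def
    by (intro measurable_restrict borel_measurable_add borel_measurable_times borel_measurable_diff borel_measurable_const path_component g)
  have G_path: "G u (sample_path (B u) \<omega>) = (\<lambda>p\<in>{u} \<times> {..<r}. incr g p \<omega>)" for u \<omega>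
    using g(1) by (auto simp: G_def incr_def sample_path_def fun_eq_iff)
  have "independent_rvs N path_space (sample_path (B Minus)) path_space (sample_path (B Plus))"
    using indep_B by (simp add: B_def)
  from independent_rvs_compose[OF this G[of Minus] G[of Plus]]
  have "independent_rvs N (PiM ({Minus} \<times> {..<r}) (\<lambda>_. borel)) (\<lambda>\<omega>. \<lambda>p\<in>{Minus} \<times> {..<r}. incr g p \<omega>)
     (PiM ({Plus} \<times> {..<r}) (\<lambda>_. borel)) (\<lambda>\<omega>. \<lambda>p\<in>{Plus} \<times> {..<r}. incr g p \<omega>)"
    by (simp add: G_path)
  then have "indep_vars (\<lambda>_. borel) (incr g) ({Minus} \<times> {..<r} \<union> {Plus} \<times> {..<r})"
    by (intro independent_rvs_imp_indep_vars side) auto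
  also have "{Minus} \<times> {..<r} \<union> {Plus} \<times> {..<r} = UNIV \<times> {..<r}"
    using sign.exhaust by auto
  finally show ?thesis .
qed

lemma T0_incr_indep:
  assumes g: "\<And>i. 0 \<le> g i" "\<And>i. i < r \<Longrightarrow> g i < g (Suc i)"
  shows "indep_vars (\<lambda>_. borel) (\<lambda>i. case i of None \<Rightarrow> T0 | Some p \<Rightarrow> incr g p) (insert None (Some ` (UNIV \<times> {..<r})))"
proof -
  let ?X = "\<lambda>i. case i of None \<Rightarrow> T0 | Some p \<Rightarrow> incr g p" and ?P = "UNIV \<times> {..<r} :: (sign \<times> nat) set"
  have "indep_vars (\<lambda>_. borel) ?X ({None} \<union> Some ` ?P)"
  proof (rule independent_rvs_imp_indep_vars)
    show "indep_vars (\<lambda>_. borel) ?X {None}"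
      using T0 by (intro indep_vars_singleton) (simp add: distributed_def)
    show "indep_vars (\<lambda>_. borel) ?X (Some ` ?P)"
      by (rule indep_vars_Some[OF incr_indep]) (use g in auto)
    define w where "w u x = (case u of Minus \<Rightarrow> fst x | Plus \<Rightarrow> snd x)" for u and x :: "(real \<Rightarrow> real) \<times> (real \<Rightarrow> real)"
    have w: "(\<lambda>x. w u x t) \<in> borel_measurable (path_space \<Otimes>\<^sub>M path_space)" if "t \<ge> 0" for u t
      using measurable_compose[OF measurable_fst path_component[OF that]] measurable_compose[OF measurable_snd path_component[OF that]]
      by (cases u) (simp_all add: w_def)
    have f: "(\<lambda>x. \<lambda>i\<in>{None :: (sign \<times> nat) option}. x) \<in> measurable borel (PiM {None} (\<lambda>_. borel))"
      by (intro measurable_restrict) measurable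
    have h: "(\<lambda>x. \<lambda>i\<in>Some ` ?P. sqrt 2 * (w (fst (the i)) x (g (Suc (snd (the i)))) - w (fst (the i)) x (g (snd (the i))))
        + (g (Suc (snd (the i))) - g (snd (the i)))) \<in> measurable (path_space \<Otimes>\<^sub>M path_space) (PiM (Some ` ?P) (\<lambda>_. borel))"
      by (intro measurable_restrict borel_measurable_add borel_measurable_times borel_measurable_diff borel_measurable_const w g)
    have "(\<lambda>\<omega>. \<lambda>i\<in>{None :: (sign \<times> nat) option}. T0 \<omega>) = (\<lambda>\<omega>. \<lambda>i\<in>{None}. ?X i \<omega>)"
      by (auto simp: fun_eq_iff restrict_def)
    moreover have "(\<lambda>i\<in>Some ` ?P. sqrt 2 * (w (fst (the i)) x (g (Suc (snd (the i)))) - w (fst (the i)) x (g (snd (the i))))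
        + (g (Suc (snd (the i))) - g (snd (the i)))) = (\<lambda>i\<in>Some ` ?P. ?X i \<omega>)"
      if x: "x = (sample_path Bm \<omega>, sample_path Bp \<omega>)" for x \<omega>
    proof -
      have "w u x t = B u t \<omega>" if "t \<ge> 0" for u t using that by (cases u) (simp_all add: w_def x B_def sample_path_def)
      then show ?thesis using g(1) by (auto simp: fun_eq_iff incr_def)
    qed
    ultimately show "independent_rvs N (PiM {None} (\<lambda>_. borel)) (\<lambda>\<omega>. \<lambda>i\<in>{None}. ?X i \<omega>)
       (PiM (Some ` ?P) (\<lambda>_. borel)) (\<lambda>\<omega>. \<lambda>i\<in>Some ` ?P. ?X i \<omega>)"
      using independent_rvs_compose[OF indep_T0 f h] by simp
  qed auto
  then show ?thesis by simp
qed

lemma occupation_time_eq_occ: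
  "occupation_time T0 (B u) \<omega> = occ T0 drifted {0..} u \<omega>"
  unfolding occupation_time_def occ_def by (rule set_lebesgue_integral_cong) (auto simp: drifted_def)

end

text \<open>The prescribed times and 0 are sorted without repetition and \<kappa> records their
  positions, so the times may come in any order and may coincide. Beyond r the grid is constant,
  which keeps g monotone everywhere.\<close>

lemma time_grid:
  fixes t :: "nat \<Rightarrow> real"
  assumes t: "\<And>i. i < n \<Longrightarrow> t i \<ge> 0"
  shows "\<exists>g \<kappa> r. mono g \<and> g 0 = 0 \<and> (\<forall>i<r. g i < g (Suc i)) \<and> (\<forall>i<n. \<kappa> i \<le> r \<and> t i = g (\<kappa> i))"
proof -
  define G where "G = insert 0 (t ` {..<n})"
  define xs where "xs = sorted_list_of_set G"
  define r where "r = length xs - 1"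
  define g where "g i = xs ! (min i r)" for i
  have G: "finite G" "G \<noteq> {}" "\<And>x. x \<in> G \<Longrightarrow> x \<ge> 0" using t by (auto simp: G_def)
  have xs: "set xs = G" "sorted xs" "distinct xs" using G by (auto simp: xs_def)
  have len: "length xs = Suc r"
    using G xs by (cases xs) (auto simp: r_def)
  have mono: "mono g"
    unfolding g_def by (intro monoI sorted_nth_mono xs) (auto simp: len)
  have strict: "g i < g (Suc i)" if "i < r" for i
  proof -
    have "g i \<le> g (Suc i)" using mono by (simp add: monoD)
    moreover have "g i \<noteq> g (Suc i)" using that xs(3) by (simp add: g_def len nth_eq_iff_index_eq)
    ultimately show ?thesis by simp
  qed
  have ex: "\<exists>k\<le>r. x = g k" if "x \<in> G" for x
  proof -
    from that have "x \<in> set xs" by (simp add: xs(1))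
    then obtain k where "k < length xs" "x = xs ! k" by (auto simp: in_set_conv_nth)
    then show ?thesis by (intro exI[of _ k]) (auto simp: len g_def)
  qed
  have "g 0 = 0"
  proof (rule antisym)
    obtain k where "k \<le> r" "0 = g k" using ex[of 0] by (auto simp: G_def)
    then show "g 0 \<le> 0" using monoD[OF mono, of 0 k] by simp
    have "g 0 \<in> G" unfolding xs(1)[symmetric] g_def by (simp add: len)
    then show "0 \<le> g 0" by (rule G)
  qed
  moreover have "\<forall>i. \<exists>k. i < n \<longrightarrow> k \<le> r \<and> t i = g k"
    using ex by (metis G_def imageI insertCI lessThan_iff)
  ultimately show ?thesis using mono strict by (metis (no_types, lifting))
qed

section \<open>The limit theorem\<close>

context tilted_coeffs
begin

text \<open>All times are put on one grid common to both sides. A walk at such a time is, up to a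
  small error in L1, a sum of independent blocks, and the Brownian motions split into matching
  increments, so the one-dimensional limits of single blocks suffice.\<close>

lemma exceedance_walk_limit:
  fixes M :: "nat \<Rightarrow> 'm measure" and N :: "'n measure" and s :: "nat \<Rightarrow> sign" and t :: "nat \<Rightarrow> real"
  assumes tn: "\<And>k. tilted_noise F a (\<epsilon> k) (M k) (Z k) (T k)"
    and \<epsilon>: "filterlim \<epsilon> (at_right 0) sequentially" "\<And>k. \<epsilon> k > 0"
    and \<tau>: "\<And>k. 0 < tilt F a (\<epsilon> k)" "\<And>k u. tilt F a (\<epsilon> k) * tilted_coeffs.\<rho> (side_coeff a u) \<le> 1"
    and bp: "brownian_pair N T0 Bm Bp" and t: "\<And>i. i < n \<Longrightarrow> t i \<ge> 0"
  shows "(\<lambda>k. measure (M k) {\<omega>\<in>space (M k). \<forall>i<n. scaled_T (\<epsilon> k) (T k) \<omega> \<ge> scaled_walk (\<epsilon> k) (Z k) (s i) (t i) \<omega>})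
     \<longlonglongrightarrow> measure N {\<omega>\<in>space N. \<forall>i<n. T0 \<omega> \<ge> brownian_pair.drifted Bm Bp (s i) (t i) \<omega>}"
proof -
  interpret N: brownian_pair N T0 Bm Bp by (rule bp)
  obtain g \<kappa> r where g: "mono g" "g 0 = 0" "\<And>i. i < r \<Longrightarrow> g i < g (Suc i)"
    and \<kappa>: "\<And>i. i < n \<Longrightarrow> \<kappa> i \<le> r \<and> t i = g (\<kappa> i)"
    using time_grid[of n t] t by blast
  have g0: "0 \<le> g i" for i using monoD[OF g(1), of 0 i] g(2) by simp
  define nn where "nn k i = steps (\<epsilon> k) (g i)" for k i
  have nn: "mono (nn k)" "nn k 0 = 0" for k
    unfolding nn_def using g by (auto intro!: monoI steps_mono \<epsilon> monoD[OF g(1)])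
  define P where "P = (UNIV \<times> {..<r} :: (sign \<times> nat) set)"
  have "finite (UNIV :: sign set)"
  proof -
    have "(UNIV :: sign set) = {Minus, Plus}" using sign.exhaust by auto
    then show ?thesis by (metis finite.emptyI finite.insertI)
  qed
  then have P: "finite P" by (simp add: P_def)
  define V where "V k i = (case i of None \<Rightarrow> scaled_T (\<epsilon> k) (T k) | Some p \<Rightarrow> block (tilt F a (\<epsilon> k)) (Z k) (nn k) p)" for k i
  define V' where "V' i = (case i of None \<Rightarrow> T0 | Some p \<Rightarrow> N.incr g p)" for i
  have "(\<lambda>k. measure (M k) {\<omega>\<in>space (M k). \<forall>i<n. V k None \<omega> \<ge> scaled_walk (\<epsilon> k) (Z k) (s i) (t i) \<omega>})
     \<longlonglongrightarrow> measure N {\<omega>\<in>space N. \<forall>i<n. V' None \<omega> \<ge> N.drifted (s i) (t i) \<omega>}"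
  \<comment> \<open>Indices from n on receive the empty set, because \<open>K i\<close> has to be
    finite for every i.\<close>
  proof (rule exceedance_limit[where I="insert None (Some ` P)" and K="\<lambda>i. if i < n then {s i} \<times> {..<\<kappa> i} else {}"])
    show "prob_space (M k)" for k by (rule tilted_noise_basic(1)[OF tn])
    show "prob_space N" by (rule N.prob_space_axioms)
    show "distributed (M k) lborel (V k None) (exponential_density 1)" for k
      using scaled_T_exponential[OF tn \<tau>(1)] by (simp add: V_def)
    show "distributed N lborel (V' None) (exponential_density 1)"
      using N.T0 by (simp add: V'_def)
    show "independent_rvs (M k) borel (V k None) borel (scaled_walk (\<epsilon> k) (Z k) (s i) (t i))" for k i
      using indep_T_walk[OF tn] by (simp add: V_def)
    show "independent_rvs N borel (V' None) borel (N.drifted (s i) (t i))" for i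
      using N.indep_T0_drifted by (simp add: V'_def)
    show "prob_space.indep_vars (M k) (\<lambda>_. borel) (V k) (insert None (Some ` P))" for k
      unfolding V_def[abs_def] by (rule T_block_indep[OF tn nn(1)])
    show "N.indep_vars (\<lambda>_. borel) V' (insert None (Some ` P))"
      unfolding V'_def[abs_def] P_def by (rule N.T0_incr_indep) (use g g0 in auto)
    show "Some ` (if i < n then {s i} \<times> {..<\<kappa> i} else {}) \<subseteq> insert None (Some ` P)" for i
      using \<kappa>[of i] by (auto simp: P_def)
    show "weak_conv_m (\<lambda>k. distr (M k) borel (V k (Some j))) (distr N borel (V' (Some j)))"
      if j: "Some j \<in> insert None (Some ` P)" for j
    proof -
      obtain u l where ul: "j = (u, l)" "l < r" using j by (auto simp: P_def)
      have gl: "0 \<le> g l" "g l < g (Suc l)" using g ul g0 by auto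
      show ?thesis
        using block_clt[where g=g and l=l and u=u, OF tn \<epsilon> \<tau> gl] N.incr_law[OF gl, of u]
        by (simp add: V_def V'_def ul nn_def[abs_def])
    qed
    show "\<forall>\<^sub>F k in sequentially. (\<integral>\<^sup>+\<omega>. ennreal \<bar>scaled_walk (\<epsilon> k) (Z k) (s i) (t i) \<omega>
        - (\<Sum>j\<in>(if i < n then {s i} \<times> {..<\<kappa> i} else {}). V k (Some j) \<omega>)\<bar> \<partial>M k) \<le> ennreal e"
      if i: "i < n" and e: "e > 0" for i e
    proof -
      have "\<forall>\<^sub>F k in sequentially. \<forall>(M :: 'm measure) Z T. tilted_noise F a (\<epsilon> k) M Z T \<longrightarrow>
        (\<integral>\<^sup>+\<omega>. ennreal \<bar>scaled_walk (\<epsilon> k) Z (s i) (t i) \<omega>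
          - tilt F a (\<epsilon> k) * (\<Sum>j<steps (\<epsilon> k) (t i). side_step Z (s i) (int j) \<omega>)\<bar> \<partial>M) \<le> ennreal e"
        by (rule eventually_compose_filterlim[OF scaled_walk_approx[OF e t[OF i]] \<epsilon>(1)])
      then show ?thesis
      proof eventually_elim
        case (elim k)
        from this[rule_format, OF tn] show ?case using i \<kappa>[OF i] by (simp add: V_def sum_block[OF nn] nn_def)
      qed
    qed
    show "AE \<omega> in N. N.drifted (s i) (t i) \<omega> = (\<Sum>j\<in>(if i < n then {s i} \<times> {..<\<kappa> i} else {}). V' (Some j) \<omega>)"
      if i: "i < n" for i
      using N.B_0[of "s i"]
    proof eventually_elim
      case (elim \<omega>)
      then show ?case using i \<kappa>[OF i] g0 g(2) by (simp add: V'_def N.sum_incr N.drifted_def)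
    qed
  qed (use P in auto)
  then show ?thesis by (simp add: V_def V'_def)
qed

end

section \<open>Cluster sizes as occupation times\<close>

lemma infsum_ennreal_nat: "infsum f (UNIV :: nat set) = (\<Sum>n. f n :: ennreal)"
proof -
  have "infsum f UNIV = (SUP F\<in>{F. finite F \<and> F \<subseteq> UNIV}. sum f F)"
    by (rule nonneg_infsum_complete) simp
  also have "\<dots> = (\<Sum>n. f n)"
  proof (rule antisym)
    show "(SUP F\<in>{F. finite F \<and> F \<subseteq> UNIV}. sum f F) \<le> (\<Sum>n. f n)"
      by (intro SUP_least sum_le_suminf) auto
    show "(\<Sum>n. f n) \<le> (SUP F\<in>{F. finite F \<and> F \<subseteq> UNIV}. sum f F)"
      unfolding suminf_eq_SUP by (intro SUP_mono) auto
  qed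
  finally show ?thesis .
qed

text \<open>The rounded index is n + 1 on the cell (n h, (n + 1) h]. Index 0 belongs to the single
  point t = 0, a null set, so the sum starts at \<open>f 1\<close>.\<close>

lemma nn_integral_step_function:
  fixes f :: "nat \<Rightarrow> ennreal"
  assumes h: "h > 0"
  shows "(\<integral>\<^sup>+t. indicator {0..} t * f (nat \<lceil>t / h\<rceil>) \<partial>lborel) = ennreal h * (\<Sum>n. f (Suc n))"
proof -
  define A where "A n = {real n * h<..real (Suc n) * h}" for n
  have disj: "disjoint_family A"
  proof -
    have "n = m" if "x \<in> A n" "x \<in> A m" for x n m
    proof -
      have "\<lceil>x / h\<rceil> = int n + 1" "\<lceil>x / h\<rceil> = int m + 1"
        using that h by (auto simp: A_def ceiling_eq_iff field_simps)
      then show ?thesis by simp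
    qed
    then show ?thesis by (auto simp: disjoint_family_on_def)
  qed
  have "AE t in lborel. t \<noteq> (0 :: real)" by (rule AE_lborel_singleton)
  then have "(\<integral>\<^sup>+t. indicator {0..} t * f (nat \<lceil>t / h\<rceil>) \<partial>lborel) = (\<integral>\<^sup>+t. (\<Sum>n. f (Suc n) * indicator (A n) t) \<partial>lborel)"
  proof (intro nn_integral_cong_AE, eventually_elim)
    fix t :: real assume t0: "t \<noteq> 0"
    show "indicator {0..} t * f (nat \<lceil>t / h\<rceil>) = (\<Sum>n. f (Suc n) * indicator (A n) t)"
    proof (cases "t > 0")
      case True
      define n where "n = nat (\<lceil>t / h\<rceil> - 1)"
      have c: "\<lceil>t / h\<rceil> \<ge> 1" using True h by simp
      then have n: "int n = \<lceil>t / h\<rceil> - 1" by (simp add: n_def)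
      have "real n < t / h" "t / h \<le> real n + 1" using n by linarith+
      then have "t \<in> A n" using h by (simp add: A_def pos_less_divide_eq pos_divide_le_eq add.commute)
      then have "(\<Sum>n. f (Suc n) * indicator (A n) t) = f (Suc n)"
        using disj by (intro suminf_cmult_indicator) auto
      moreover have "nat \<lceil>t / h\<rceil> = Suc n" using n by linarith
      ultimately show ?thesis using True by simp
    next
      case False
      then have t: "t < 0" using t0 by simp
      have "t \<notin> A n" for n
      proof -
        have "0 \<le> real n * h" using h by simp
        then show ?thesis using t unfolding A_def greaterThanAtMost_iff by linarith
      qed
      then show ?thesis using t by simp
    qed
  qed
  also have "\<dots> = (\<Sum>n. \<integral>\<^sup>+t. f (Suc n) * indicator (A n) t \<partial>lborel)"
    by (intro nn_integral_suminf) (auto simp: A_def)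
  also have "\<dots> = (\<Sum>n. ennreal h * f (Suc n))"
  proof (intro suminf_cong)
    fix n
    have "emeasure lborel (A n) = ennreal h"
      unfolding A_def using h by (subst emeasure_lborel_Ioc) (auto simp: algebra_simps)
    then show "(\<integral>\<^sup>+t. f (Suc n) * indicator (A n) t \<partial>lborel) = ennreal h * f (Suc n)"
      by (subst nn_integral_cmult_indicator) (auto simp: A_def mult.commute)
  qed
  also have "\<dots> = ennreal h * (\<Sum>n. f (Suc n))" by simp
  finally show ?thesis .
qed

lemma cluster_size_eq_suminf:
  "cluster_size a Z T u \<omega> = (\<Sum>n. of_bool (T \<omega> \<ge> side_walk a Z u (Suc n) \<omega>))"
proof -
  have p: "bij_betw (\<lambda>n. int n + 1) UNIV {1..}"
    by (rule bij_betwI[where g="\<lambda>j. nat (j - 1)"]) auto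
  have m: "bij_betw (\<lambda>n. - int n - 1) UNIV {..-1}"
    by (rule bij_betwI[where g="\<lambda>j. nat (- j - 1)"]) auto
  show ?thesis
  proof (cases u)
    case Plus
    have "cluster_size a Z T u \<omega> = (\<Sum>\<^sub>\<infinity>n. cluster_indicator a Z T (int n + 1) \<omega>)"
      unfolding cluster_size_def Plus sign.case by (rule infsum_reindex_bij_betw[OF p, symmetric])
    then show ?thesis unfolding infsum_ennreal_nat
      by (simp add: cluster_indicator_def Plus side_walk_Plus)
  next
    case Minus
    have "cluster_size a Z T u \<omega> = (\<Sum>\<^sub>\<infinity>n. cluster_indicator a Z T (- int n - 1) \<omega>)"
      unfolding cluster_size_def Minus sign.case by (rule infsum_reindex_bij_betw[OF m, symmetric])
    moreover have "- int n - 1 = - int (Suc n)" for n by simp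
    ultimately show ?thesis unfolding infsum_ennreal_nat
      by (simp add: cluster_indicator_def Minus side_walk_Minus)
  qed
qed

text \<open>The limit theorems above are about sequences. An eventual property P may be assumed at
  every index, where it supplies the hypotheses of those theorems.\<close>

lemma tendsto_at_right_sequentially:
  fixes f :: "real \<Rightarrow> real"
  assumes P: "\<forall>\<^sub>F x in at_right 0. P x"
    and seq: "\<And>X. filterlim X (at_right 0) sequentially \<Longrightarrow> (\<And>k. P (X k)) \<Longrightarrow> (\<lambda>k. f (X k)) \<longlonglongrightarrow> l"
  shows "(f \<longlongrightarrow> l) (at_right 0)"
proof -
  obtain b where b: "b > 0" "\<And>x. 0 < x \<Longrightarrow> x < b \<Longrightarrow> P x"
    using P by (auto simp: eventually_at_right_field)
  have "at 0 within {0<..<b} = at_right (0 :: real)"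
    by (rule at_within_nhd[where S="{..<b}"]) (use b in auto)
  moreover have "(f \<longlongrightarrow> l) (at 0 within {0<..<b})"
    unfolding tendsto_at_iff_sequentially
  proof (intro allI impI)
    fix X :: "nat \<Rightarrow> real" assume X: "\<forall>i. X i \<in> {0<..<b} - {0}" "X \<longlonglongrightarrow> 0"
    have pos: "0 < X i" for i using X(1) by simp
    have "filterlim X (at_right 0) sequentially"
      unfolding filterlim_at using X(2) pos by (auto intro!: always_eventually simp: less_imp_neq[THEN not_sym])
    then show "(f \<circ> X) \<longlonglongrightarrow> l" using X(1) b(2) unfolding o_def by (intro seq) auto
  qed
  ultimately show ?thesis by simp
qed

context tilted_coeffs
begin

lemma cluster_size_eq_occ:
  assumes \<epsilon>: "\<epsilon> > 0" and \<tau>: "tilt F a \<epsilon> > 0"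
  shows "ennreal (\<epsilon>\<^sup>2 / c0) * cluster_size a Z T u \<omega>
    = (\<integral>\<^sup>+t. indicator {0..} t * of_bool (scaled_T \<epsilon> T \<omega> \<ge> scaled_walk \<epsilon> Z u t \<omega>) \<partial>lborel)"
proof -
  have h: "\<epsilon>\<^sup>2 / c0 > 0" using \<epsilon> c0_pos by simp
  have s: "steps \<epsilon> t = nat \<lceil>t / (\<epsilon>\<^sup>2 / c0)\<rceil>" for t by (simp add: steps_def)
  have "scaled_T \<epsilon> T \<omega> \<ge> scaled_walk \<epsilon> Z u t \<omega> \<longleftrightarrow> T \<omega> \<ge> side_walk a Z u (steps \<epsilon> t) \<omega>" for t
    unfolding scaled_T_def scaled_walk_def using \<tau> A_pos by (intro mult_le_cancel_left_pos) simp
  then show ?thesis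
    using nn_integral_step_function[OF h, of "\<lambda>n. of_bool (T \<omega> \<ge> side_walk a Z u n \<omega>)"]
    by (simp add: cluster_size_eq_suminf s)
qed

lemma eventually_admissible:
  "\<forall>\<^sub>F \<epsilon> in at_right 0. 0 < \<epsilon> \<and> ereal (\<epsilon> / A) < right_endpoint F \<and> 0 < tilt F a \<epsilon> \<and>
     (\<forall>u. tilt F a \<epsilon> * tilted_coeffs.\<rho> (side_coeff a u) \<le> 1)"
proof -
  obtain x where x: "x > 0" "ereal x \<le> right_endpoint F" using right_endpoint_pos by blast
  have \<rho>: "tilted_coeffs.\<rho> (side_coeff a u) > 0" for u
    by (rule tilted_coeffs.\<rho>_pos[OF tilted_coeffs_side])
  define r where "r = min (x * A) (min (1 / tilted_coeffs.\<rho> (side_coeff a Minus)) (1 / tilted_coeffs.\<rho> (side_coeff a Plus)))"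
  have r: "r > 0" using x A_pos \<rho> by (simp add: r_def)
  have r\<rho>: "r * tilted_coeffs.\<rho> (side_coeff a u) \<le> 1" for u
  proof -
    have "r \<le> 1 / tilted_coeffs.\<rho> (side_coeff a u)" by (cases u) (simp_all add: r_def)
    then show ?thesis using \<rho>[of u] by (simp add: pos_le_divide_eq)
  qed
  show ?thesis using eventually_tilt_le[OF r]
  proof eventually_elim
    case (elim \<epsilon>)
    then have "\<epsilon> < x * A" by (simp add: r_def)
    then have "\<epsilon> / A < x" using A_pos by (simp add: pos_divide_less_eq)
    then have "ereal (\<epsilon> / A) < right_endpoint F" using x(2) by (metis ereal_less(2) less_ereal.simps(1) order_less_le_trans)
    moreover have "tilt F a \<epsilon> * tilted_coeffs.\<rho> (side_coeff a u) \<le> 1" for u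
      using mult_right_mono[of "tilt F a \<epsilon>" r "tilted_coeffs.\<rho> (side_coeff a u)"] elim \<rho>[of u] r\<rho>[of u] by linarith
    ultimately show ?case using elim by auto
  qed
qed

lemma cluster_size_limit:
  fixes M :: "real \<Rightarrow> 'm measure" and N :: "'n measure"
  assumes tn: "\<And>\<epsilon>. 0 < \<epsilon> / A \<Longrightarrow> ereal (\<epsilon> / A) < right_endpoint F \<Longrightarrow> tilted_noise F a \<epsilon> (M \<epsilon>) (ZT \<epsilon>) (T \<epsilon>)"
    and bp: "brownian_pair N T0 Bm Bp"
  shows "\<forall>\<^sub>F \<epsilon> in at_right 0. AE \<omega> in M \<epsilon>. \<forall>u. cluster_size a (ZT \<epsilon>) (T \<epsilon>) u \<omega> < \<infinity>"
    and "weakly_converges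
           (\<lambda>\<epsilon>. distr (M \<epsilon>) borel
              (\<lambda>\<omega>. (\<epsilon>\<^sup>2 * enn2real (cluster_size a (ZT \<epsilon>) (T \<epsilon>) Minus \<omega>),
                    \<epsilon>\<^sup>2 * enn2real (cluster_size a (ZT \<epsilon>) (T \<epsilon>) Plus \<omega>))))
           (distr N borel (\<lambda>\<omega>. (c0 * occupation_time T0 Bm \<omega>, c0 * occupation_time T0 Bp \<omega>)))
           (at_right 0)"
proof -
  interpret N: brownian_pair N T0 Bm Bp by (rule bp)
  obtain C c where c: "c > 0" and ev: "\<forall>\<^sub>F \<epsilon> in at_right 0. \<forall>(M :: 'm measure) Z T. tilted_noise F a \<epsilon> M Z T \<longrightarrow>
     occupation M (scaled_T \<epsilon> T) (scaled_walk \<epsilon> Z) C c"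
    using scaled_walk_occupation by (elim exE conjE) (rule that)
  \<comment> \<open>Weaker constants that still hold for the walks and lie in the ranges of
    \<open>drifted_occupation\<close>, so that prelimit and limit share them.\<close>
  define C' where "C' = max C 1"
  define c' where "c' = min c (1 / 4)"
  have weaken: "occupation L S W C c \<Longrightarrow> occupation L S W C' c'" for L :: "'m measure" and S W
  proof -
    assume "occupation L S W C c"
    then interpret L: occupation L S W C c .
    show "occupation L S W C' c'"
    proof unfold_locales
      fix u and t :: real assume t: "t \<ge> 0"
      have "L.prob {\<omega>\<in>space L. S \<omega> \<ge> W u t \<omega>} \<le> C * exp (- c * t)" by (rule L.tail[OF t])
      also have "\<dots> \<le> C' * exp (- c' * t)"
        using t by (intro mult_mono) (auto simp: C'_def c'_def intro: mult_right_mono)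
      finally show "L.prob {\<omega>\<in>space L. S \<omega> \<ge> W u t \<omega>} \<le> C' * exp (- c' * t)" .
    qed (use c in \<open>auto simp: c'_def intro: L.T_meas L.W_joint\<close>)
  qed
  \<comment> \<open>Collects everything that has to hold at every index of a sequence, not just
    eventually.\<close>
  define good where "good \<epsilon> \<longleftrightarrow> 0 < \<epsilon> \<and> 0 < tilt F a \<epsilon> \<and> (\<forall>u. tilt F a \<epsilon> * tilted_coeffs.\<rho> (side_coeff a u) \<le> 1) \<and>
      tilted_noise F a \<epsilon> (M \<epsilon>) (ZT \<epsilon>) (T \<epsilon>) \<and> occupation (M \<epsilon>) (scaled_T \<epsilon> (T \<epsilon>)) (scaled_walk \<epsilon> (ZT \<epsilon>)) C' c'" for \<epsilon>
  have good: "\<forall>\<^sub>F \<epsilon> in at_right 0. good \<epsilon>"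
    using eventually_admissible ev
  proof eventually_elim
    case (elim \<epsilon>)
    then have "tilted_noise F a \<epsilon> (M \<epsilon>) (ZT \<epsilon>) (T \<epsilon>)" using A_pos by (intro tn) auto
    then show ?case using elim weaken by (auto simp: good_def)
  qed
  show "\<forall>\<^sub>F \<epsilon> in at_right 0. AE \<omega> in M \<epsilon>. \<forall>u. cluster_size a (ZT \<epsilon>) (T \<epsilon>) u \<omega> < \<infinity>"
    using good
  proof eventually_elim
    case (elim \<epsilon>)
    then have \<epsilon>: "\<epsilon> > 0" "tilt F a \<epsilon> > 0" and oc: "occupation (M \<epsilon>) (scaled_T \<epsilon> (T \<epsilon>)) (scaled_walk \<epsilon> (ZT \<epsilon>)) C' c'"
      by (auto simp: good_def)
    interpret O: occupation "M \<epsilon>" "scaled_T \<epsilon> (T \<epsilon>)" "scaled_walk \<epsilon> (ZT \<epsilon>)" C' c' by (rule oc)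
    have "ennreal (\<epsilon>\<^sup>2 / c0) * x < \<infinity> \<Longrightarrow> x < \<infinity>" for x
      using \<epsilon> c0_pos by (auto simp: ennreal_mult_less_top)
    then have fin: "AE \<omega> in M \<epsilon>. cluster_size a (ZT \<epsilon>) (T \<epsilon>) u \<omega> < \<infinity>" for u
      using O.AE_occ_finite[of u] unfolding cluster_size_eq_occ[OF \<epsilon>, symmetric] by (auto elim: eventually_mono)
    show ?case using fin[of Minus] fin[of Plus]
    proof eventually_elim
      case (elim \<omega>)
      then show ?case by (metis sign.exhaust)
    qed
  qed
  \<comment> \<open>The identity holds at every sample point: an infinite cluster size yields 0 on
    both sides.\<close>
  have pair_eq: "(\<epsilon>\<^sup>2 * enn2real (cluster_size a (ZT \<epsilon>) (T \<epsilon>) Minus \<omega>), \<epsilon>\<^sup>2 * enn2real (cluster_size a (ZT \<epsilon>) (T \<epsilon>) Plus \<omega>))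
      = c0 *\<^sub>R occ_pair (scaled_T \<epsilon> (T \<epsilon>)) (scaled_walk \<epsilon> (ZT \<epsilon>)) {0..} \<omega>"
    if "good \<epsilon>" and \<omega>: "\<omega> \<in> space (M \<epsilon>)" for \<epsilon> \<omega>
  proof -
    have \<epsilon>: "\<epsilon> > 0" "tilt F a \<epsilon> > 0" and oc: "occupation (M \<epsilon>) (scaled_T \<epsilon> (T \<epsilon>)) (scaled_walk \<epsilon> (ZT \<epsilon>)) C' c'"
      using that by (auto simp: good_def)
    interpret O: occupation "M \<epsilon>" "scaled_T \<epsilon> (T \<epsilon>)" "scaled_walk \<epsilon> (ZT \<epsilon>)" C' c' by (rule oc)
    have "occ (scaled_T \<epsilon> (T \<epsilon>)) (scaled_walk \<epsilon> (ZT \<epsilon>)) {0..} u \<omega> = \<epsilon>\<^sup>2 / c0 * enn2real (cluster_size a (ZT \<epsilon>) (T \<epsilon>) u \<omega>)" for u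
      using O.occ_eq_nn[OF _ \<omega>, of "{0..}" u] \<epsilon> c0_pos
      unfolding cluster_size_eq_occ[OF \<epsilon>, symmetric] by (simp add: enn2real_mult)
    then show ?thesis using c0_pos by (simp add: occ_pair_def)
  qed
  have limN: "occupation N T0 N.drifted C' c'"
    by (rule N.drifted_occupation) (use c in \<open>auto simp: C'_def c'_def\<close>)
  interpret NO: occupation N T0 N.drifted C' c' by (rule limN)
  have N_eq: "(c0 * occupation_time T0 Bm \<omega>, c0 * occupation_time T0 Bp \<omega>) = c0 *\<^sub>R occ_pair T0 N.drifted {0..} \<omega>" for \<omega>
    using N.occupation_time_eq_occ[of Minus \<omega>] N.occupation_time_eq_occ[of Plus \<omega>]
    by (simp add: occ_pair_def N.B_def)
  show "weakly_converges
           (\<lambda>\<epsilon>. distr (M \<epsilon>) borel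
              (\<lambda>\<omega>. (\<epsilon>\<^sup>2 * enn2real (cluster_size a (ZT \<epsilon>) (T \<epsilon>) Minus \<omega>),
                    \<epsilon>\<^sup>2 * enn2real (cluster_size a (ZT \<epsilon>) (T \<epsilon>) Plus \<omega>))))
           (distr N borel (\<lambda>\<omega>. (c0 * occupation_time T0 Bm \<omega>, c0 * occupation_time T0 Bp \<omega>)))
           (at_right 0)"
    unfolding weakly_converges_def
  proof (intro allI impI)
    fix f :: "real \<times> real \<Rightarrow> real" assume f: "continuous_on UNIV f" and bf: "bounded (range f)"
    obtain B where B: "\<And>x. \<bar>f x\<bar> \<le> B" using bf by (auto simp: bounded_iff)
    \<comment> \<open>The factor c0 is absorbed into the test function, as
      \<open>occ_weak_limit\<close> is about unscaled occupation times.\<close>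
    define f' where "f' p = f (c0 *\<^sub>R p)" for p
    have f': "continuous_on UNIV f'" unfolding f'_def
      by (intro continuous_on_compose2[OF f]) (auto intro!: continuous_intros)
    have fm [measurable]: "f \<in> borel_measurable borel" by (rule borel_measurable_continuous_onI[OF f])
    show "((\<lambda>\<epsilon>. \<integral>x. f x \<partial>distr (M \<epsilon>) borel
              (\<lambda>\<omega>. (\<epsilon>\<^sup>2 * enn2real (cluster_size a (ZT \<epsilon>) (T \<epsilon>) Minus \<omega>),
                    \<epsilon>\<^sup>2 * enn2real (cluster_size a (ZT \<epsilon>) (T \<epsilon>) Plus \<omega>))))
        \<longlongrightarrow> (\<integral>x. f x \<partial>distr N borel (\<lambda>\<omega>. (c0 * occupation_time T0 Bm \<omega>, c0 * occupation_time T0 Bp \<omega>)))) (at_right 0)"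
    proof (rule tendsto_at_right_sequentially[OF good])
      fix \<epsilon> :: "nat \<Rightarrow> real" assume \<epsilon>: "filterlim \<epsilon> (at_right 0) sequentially" and g: "\<And>k. good (\<epsilon> k)"
      define Tk where "Tk k = scaled_T (\<epsilon> k) (T (\<epsilon> k))" for k
      define Wk where "Wk k = scaled_walk (\<epsilon> k) (ZT (\<epsilon> k))" for k
      have oc: "occupation (M (\<epsilon> k)) (Tk k) (Wk k) C' c'" for k
        using g[of k] by (simp add: good_def Tk_def Wk_def)
      interpret O: occupation "M (\<epsilon> k)" "Tk k" "Wk k" C' c' for k by (rule oc)
      have "(\<lambda>k. \<integral>\<omega>. f' (occ_pair (Tk k) (Wk k) {0..} \<omega>) \<partial>M (\<epsilon> k)) \<longlonglongrightarrow> (\<integral>\<omega>. f' (occ_pair T0 N.drifted {0..} \<omega>) \<partial>N)"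
      proof (rule occ_weak_limit[OF oc limN _ f'])
        show "\<bar>f' x\<bar> \<le> B" for x using B by (simp add: f'_def)
        fix n :: nat and s :: "nat \<Rightarrow> sign" and t :: "nat \<Rightarrow> real" assume t: "\<And>i. i < n \<Longrightarrow> t i \<ge> 0"
        show "(\<lambda>k. measure (M (\<epsilon> k)) {\<omega>\<in>space (M (\<epsilon> k)). \<forall>i<n. Tk k \<omega> \<ge> Wk k (s i) (t i) \<omega>})
          \<longlonglongrightarrow> measure N {\<omega>\<in>space N. \<forall>i<n. T0 \<omega> \<ge> N.drifted (s i) (t i) \<omega>}"
          unfolding Tk_def Wk_def
          by (rule exceedance_walk_limit[OF _ \<epsilon> _ _ _ bp t]) (use g in \<open>auto simp: good_def\<close>)
      qed
      moreover have "(\<integral>x. f x \<partial>distr (M (\<epsilon> k)) borel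
              (\<lambda>\<omega>. ((\<epsilon> k)\<^sup>2 * enn2real (cluster_size a (ZT (\<epsilon> k)) (T (\<epsilon> k)) Minus \<omega>),
                    (\<epsilon> k)\<^sup>2 * enn2real (cluster_size a (ZT (\<epsilon> k)) (T (\<epsilon> k)) Plus \<omega>))))
          = (\<integral>\<omega>. f' (occ_pair (Tk k) (Wk k) {0..} \<omega>) \<partial>M (\<epsilon> k))" for k
      proof -
        have "distr (M (\<epsilon> k)) borel
              (\<lambda>\<omega>. ((\<epsilon> k)\<^sup>2 * enn2real (cluster_size a (ZT (\<epsilon> k)) (T (\<epsilon> k)) Minus \<omega>),
                    (\<epsilon> k)\<^sup>2 * enn2real (cluster_size a (ZT (\<epsilon> k)) (T (\<epsilon> k)) Plus \<omega>)))
           = distr (M (\<epsilon> k)) borel (\<lambda>\<omega>. c0 *\<^sub>R occ_pair (Tk k) (Wk k) {0..} \<omega>)"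
          unfolding Tk_def Wk_def by (rule distr_cong) (use pair_eq[OF g] in auto)
        then show ?thesis by (simp add: integral_distr f'_def)
      qed
      moreover have "(\<integral>x. f x \<partial>distr N borel (\<lambda>\<omega>. (c0 * occupation_time T0 Bm \<omega>, c0 * occupation_time T0 Bp \<omega>)))
          = (\<integral>\<omega>. f' (occ_pair T0 N.drifted {0..} \<omega>) \<partial>N)"
        unfolding N_eq by (simp add: integral_distr f'_def)
      ultimately show "(\<lambda>k. \<integral>x. f x \<partial>distr (M (\<epsilon> k)) borel
              (\<lambda>\<omega>. ((\<epsilon> k)\<^sup>2 * enn2real (cluster_size a (ZT (\<epsilon> k)) (T (\<epsilon> k)) Minus \<omega>),
                    (\<epsilon> k)\<^sup>2 * enn2real (cluster_size a (ZT (\<epsilon> k)) (T (\<epsilon> k)) Plus \<omega>))))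
        \<longlonglongrightarrow> (\<integral>x. f x \<partial>distr N borel (\<lambda>\<omega>. (c0 * occupation_time T0 Bm \<omega>, c0 * occupation_time T0 Bp \<omega>)))"
        by simp
    qed
  qed
qed

end

theorem theorem2:
  fixes F :: "real measure" and a :: "int \<Rightarrow> real"
    and P :: "'p measure" and Z X :: "int \<Rightarrow> 'p \<Rightarrow> real"
    and M :: "real \<Rightarrow> 'm measure"
    and ZT :: "real \<Rightarrow> sign \<Rightarrow> int \<Rightarrow> 'm \<Rightarrow> real" and T :: "real \<Rightarrow> 'm \<Rightarrow> real"
    and N :: "'n measure" and T0 :: "'n \<Rightarrow> real" and Bm Bp :: "real \<Rightarrow> 'n \<Rightarrow> real"
  assumes noise: "iid_with_law P Z F"
    and nondegenerate: "\<And>c. F \<noteq> return borel c"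
    and exp_moments: "\<And>t. integrable F (\<lambda>z. exp (t * z))"
    and mean_zero: "(\<integral>z. z \<partial>F) = 0"
    and square_summable: "(\<lambda>j. (a j)\<^sup>2) summable_on UNIV"
    and X_eq: "\<And>n. X n = moving_average a Z n"
    and short: "short_memory a"
    and A_pos: "coeff_sum a > 0"
    and char_less_1: "\<And>t. t \<noteq> 0 \<Longrightarrow> cmod (char F t) < 1"
    and cluster_noise: "\<And>\<epsilon>. 0 < \<epsilon> / coeff_sum a \<Longrightarrow> ereal (\<epsilon> / coeff_sum a) < right_endpoint F \<Longrightarrow>
           tilted_noise F a \<epsilon> (M \<epsilon>) (ZT \<epsilon>) (T \<epsilon>)"
    and Bm: "standard_brownian_motion N Bm"
    and Bp: "standard_brownian_motion N Bp"
    and T0: "distributed N lborel T0 (exponential_density 1)"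
    and indep_B: "independent_rvs N path_space (sample_path Bm) path_space (sample_path Bp)"
    and indep_T0: "independent_rvs N borel T0
           (path_space \<Otimes>\<^sub>M path_space) (\<lambda>\<omega>. (sample_path Bm \<omega>, sample_path Bp \<omega>))"
  shows "(\<forall>\<^sub>F \<epsilon> in at_right 0. AE \<omega> in M \<epsilon>.
            cluster_size a (ZT \<epsilon>) (T \<epsilon>) Minus \<omega> < \<infinity> \<and> cluster_size a (ZT \<epsilon>) (T \<epsilon>) Plus \<omega> < \<infinity>) \<and>
         weakly_converges
           (\<lambda>\<epsilon>. distr (M \<epsilon>) borel
              (\<lambda>\<omega>. (\<epsilon>\<^sup>2 * enn2real (cluster_size a (ZT \<epsilon>) (T \<epsilon>) Minus \<omega>),
                    \<epsilon>\<^sup>2 * enn2real (cluster_size a (ZT \<epsilon>) (T \<epsilon>) Plus \<omega>))))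
           (distr N borel
              (\<lambda>\<omega>. ((coeff_sum a)\<^sup>2 * (\<integral>z. z\<^sup>2 \<partial>F) * occupation_time T0 Bm \<omega>,
                    (coeff_sum a)\<^sup>2 * (\<integral>z. z\<^sup>2 \<partial>F) * occupation_time T0 Bp \<omega>)))
           (at_right 0)"
proof -
  have P: "prob_space P" "prob_space.indep_vars P (\<lambda>_. borel) Z UNIV" "distr P borel (Z 0) = F"
    using noise by (auto simp: iid_with_law_def)
  have "Z 0 \<in> borel_measurable P" using P(1,2) by (simp add: prob_space.indep_vars_def)
  then have "real_distribution F" using prob_space.real_distribution_distr[OF P(1)] P(3) by metis
  then interpret F: real_distribution F .
  interpret tilted_coeffs F a
    by unfold_locales (use exp_moments mean_zero nondegenerate A_pos short in \<open>auto simp: short_memory_def\<close>)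
  have "prob_space N" using Bm by (simp add: standard_brownian_motion_def)
  then interpret N: prob_space N .
  have bp: "brownian_pair N T0 Bm Bp"
    by unfold_locales (fact Bm Bp T0 indep_B indep_T0)+
  note lim = cluster_size_limit[OF cluster_noise bp]
  have "\<forall>\<^sub>F \<epsilon> in at_right 0. AE \<omega> in M \<epsilon>.
      cluster_size a (ZT \<epsilon>) (T \<epsilon>) Minus \<omega> < \<infinity> \<and> cluster_size a (ZT \<epsilon>) (T \<epsilon>) Plus \<omega> < \<infinity>"
    using lim(1) by (rule eventually_mono) (auto elim: eventually_mono)
  then show ?thesis using lim(2) by (simp add: c0_def s2_def)
qed

end
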